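(* Let $q\in L^1_{loc}(\mathbb{R}_+)$ be real-valued and let $T>0$. Then the kernel $c^T(s,t)$ admits the representation $$c^T(s,t)=\int_{-\infty}^\infty \frac{\sin\big(\sqrt{\lambda}(T-t)\big)\,\sin\big(\sqrt{\lambda}(T-s)\big)}{\lambda}\,d\sigma(\lambda),\qquad s,t\in[0,T],$$ where the integral on the right-hand side converges uniformly on $[0,T]\times[0,T]$.
   Context: $\mathbb{R}_+=[0,\infty)$; $L^1_{loc}(\mathbb{R}_+)$ is the space of functions integrable on $[0,a]$ for every $a>0$. Spectral data. Consider $H=-\partial_x^2+q(x)$ on $L^2(\mathbb{R}_+)$ with Dirichlet boundary condition at $x=0$. Let $\varphi(x,\lambda)$ solve $-\varphi''+q\varphi=\lambda\varphi$, $x>0$, with $\varphi(0,\lambda)=0$, $\varphi'(0,\lambda)=1$. The spectral measure $d\rho(\lambda)$ of $H$ is the measure such that for all $f,g\in L^2(\mathbb{R}_+)$ one has $\int_0^\infty f g\,dx=\int_{-\infty}^\infty (Ff)(\lambda)(Fg)(\lambda)\,d\rho(\lambda)$, where $(Ff)(\lambda)=\int_0^\infty f(x)\varphi(x,\lambda)\,dx$. The regularized spectral function is $\sigma(\lambda)=\rho(\lambda)-\frac{2}{3\pi}\lambda^{3/2}$ for $\lambda\ge 0$ and $\sigma(\lambda)=\rho(\lambda)$ for $\lambda<0$. The function $\frac{\sin\sqrt\lambda x}{\sqrt\lambda}$ is understood as the entire function of $\lambda$ (so it equals $\sinh(\sqrt{|\lambda|}x)/\sqrt{|\lambda|}$ for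 $\lambda<0$ and $x$ for $\lambda=0$). Integrals $\int_{-\infty}^\infty\cdots d\sigma(\lambda)$ are understood as $\lim_{n\to\infty}\int_{-\infty}^n\cdots d\sigma(\lambda)$. Dynamical data. Let $v(\xi,\eta)$, $0\le\xi\le\eta$, be the continuous solution of $$v(\xi,\eta)=-\frac12\int_{\xi/2}^{\eta/2}q(\alpha)\,d\alpha-\frac14\int_0^\xi d\xi_1\int_\xi^\eta d\eta_1\, q\Big(\frac{\eta_1-\xi_1}{2}\Big)v(\xi_1,\eta_1),$$ and $w(x,s)=v(s-x,s+x)$ for $0\le x\le s$; thus $w$ is the (generalized) solution of the Goursat problem $w_{ss}-w_{xx}+q(x)w=0$ for $0<x<s$, $w(0,s)=0$, $w(x,x)=-\frac12\int_0^x q$. The response function is $r(t)=w_x(0,t)$, i.e. $r(t)=-\frac12 q(\frac t2)-\frac12\int_0^t q(\frac{t-\zeta}{2})v(\zeta,t)\,d\zeta$, which lies in $L^1_{loc}(\mathbb{R}_+)$. Put $p(t)=\frac12\int_0^{|t|}r(s)\,ds$ and $$c^T(t,s)=p(2T-t-s)-p(t-s),\qquad t,s\in[0,T].$$ (This is the kernel of the integral part of the operator $C^T=(W^T)^*W^T=I+\int_0^T c^T(t,s)\,\cdot\,ds$ on $L^2(0,T)$, where $(W^Tf)(x)=f(T-x)+\int_x^T w(x,\tau)f(T-\tau)\,d\tau$.) *)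

theory Defs
  imports "HOL-Analysis.Analysis"
begin

section \<open>Lebesgue--Stieltjes integrals against functions of locally bounded variation\<close>

definition distribution_function :: "(real \<Rightarrow> real) \<Rightarrow> bool" where
  "distribution_function F \<longleftrightarrow> mono F \<and> (\<forall>a. continuous (at_right a) F)"

text \<open>
  The integrator \<open>\<sigma>\<close> need not be monotone. The integral is taken with respect to any splitting
  \<open>\<sigma> = F - G\<close> into distribution functions for which both integrals exist; the value does not
  depend on the splitting (lemma \<open>has_LS_integral_unique\<close>).
\<close>

definition has_LS_integral ::
    "(real \<Rightarrow> real) \<Rightarrow> real set \<Rightarrow> (real \<Rightarrow> real) \<Rightarrow> real \<Rightarrow> bool" where
  "has_LS_integral \<sigma> A f I \<longleftrightarrow>
    (\<exists>F G. distribution_function F \<and> distribution_function G \<and> (\<forall>x. \<sigma> x = F x - G x) \<and>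
       set_integrable (interval_measure F) A f \<and> set_integrable (interval_measure G) A f \<and>
       I = (LINT x:A|interval_measure F. f x) - (LINT x:A|interval_measure G. f x))"

definition LS_integrable :: "(real \<Rightarrow> real) \<Rightarrow> real set \<Rightarrow> (real \<Rightarrow> real) \<Rightarrow> bool" where
  "LS_integrable \<sigma> A f \<longleftrightarrow> (\<exists>I. has_LS_integral \<sigma> A f I)"

definition LS_integral :: "(real \<Rightarrow> real) \<Rightarrow> real set \<Rightarrow> (real \<Rightarrow> real) \<Rightarrow> real" where
  "LS_integral \<sigma> A f = (THE I. has_LS_integral \<sigma> A f I)"

lemma emeasure_interval_measure_add:
  assumes F: "distribution_function F" and G: "distribution_function G" and A: "A \<in> sets borel"
  shows "emeasure (interval_measure (\<lambda>x. F x + G x)) A =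
    emeasure (interval_measure F) A + emeasure (interval_measure G) A"
proof -
  let ?H = "\<lambda>x. F x + G x"
  let ?\<mu> = "\<lambda>A. emeasure (interval_measure F) A + emeasure (interval_measure G) A"
  define N where "N = measure_of (UNIV :: real set) (sets borel) ?\<mu>"
  have sN: "sets N = sets borel"
    unfolding N_def by (metis sets.sets_measure_of_eq space_borel)
  have ca: "countably_additive (sets borel) ?\<mu>"
  proof (rule countably_additiveI)
    fix B :: "nat \<Rightarrow> real set"
    assume B: "range B \<subseteq> sets borel" "disjoint_family B"
    show "(\<Sum>i. ?\<mu> (B i)) = ?\<mu> (\<Union> (range B))"
      using B suminf_emeasure[of B "interval_measure F"] suminf_emeasure[of B "interval_measure G"]
      by (simp flip: suminf_add)
  qed
  have eN: "emeasure N B = ?\<mu> B" if "B \<in> sets borel" for B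
    using ca that sN by (intro emeasure_measure_of[OF N_def])
      (auto simp: positive_def)
  have mF: "\<And>x y. x \<le> y \<Longrightarrow> F x \<le> F y" and cF: "\<And>a. continuous (at_right a) F"
    and mG: "\<And>x y. x \<le> y \<Longrightarrow> G x \<le> G y" and cG: "\<And>a. continuous (at_right a) G"
    using F G by (auto simp: distribution_function_def mono_def)
  have mH: "\<And>x y. x \<le> y \<Longrightarrow> ?H x \<le> ?H y" using mF mG by (simp add: add_mono)
  have cH: "\<And>a. continuous (at_right a) ?H" using cF cG by (intro continuous_intros)
  have eq: "emeasure (interval_measure ?H) {a<..b} = emeasure N {a<..b}" for a b
    by (simp add: eN emeasure_interval_measure_Ioc_eq[OF mH cH]
        emeasure_interval_measure_Ioc_eq[OF mF cF] emeasure_interval_measure_Ioc_eq[OF mG cG]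
        ennreal_plus[symmetric] mF mG algebra_simps del: ennreal_plus)
  have "interval_measure ?H = N"
  proof (rule measure_eqI_generator_eq)
    let ?E = "range (\<lambda>(a, b). {a<..b::real})"
    show "Int_stable ?E" by (auto simp: Int_stable_def)
    show "?E \<subseteq> Pow UNIV" by simp
    show "emeasure (interval_measure ?H) X = emeasure N X" if "X \<in> ?E" for X
      using that eq by auto
    show "sets (interval_measure ?H) = sigma_sets UNIV ?E"
      by (simp add: borel_sigma_sets_Ioc image_def split: prod.split)
    show "sets N = sigma_sets UNIV ?E"
      by (simp add: sN borel_sigma_sets_Ioc image_def split: prod.split)
    show "range (\<lambda>i::nat. {- real i<..real i}) \<subseteq> ?E" by auto
    show "(\<Union>i::nat. {- real i<..real i}) = UNIV"
    proof -
      have "\<exists>i::nat. - real i < x \<and> x \<le> real i" for x :: real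
      proof -
        obtain n :: nat where "\<bar>x\<bar> < real n" using reals_Archimedean2 by blast
        then show ?thesis by (intro exI[of _ n]) auto
      qed
      then show ?thesis by auto
    qed
    show "emeasure (interval_measure ?H) {- real i<..real i} \<noteq> \<infinity>" for i :: nat
      by (simp add: emeasure_interval_measure_Ioc_eq[OF mH cH])
  qed
  then show ?thesis using eN[OF A] by simp
qed

lemma nn_integral_interval_measure_add:
  assumes F: "distribution_function F" and G: "distribution_function G"
    and f: "f \<in> borel_measurable borel"
  shows "(\<integral>\<^sup>+x. f x \<partial>interval_measure (\<lambda>x. F x + G x)) =
    (\<integral>\<^sup>+x. f x \<partial>interval_measure F) + (\<integral>\<^sup>+x. f x \<partial>interval_measure G)"
  using f
proof (induction rule: borel_measurable_induct)
  case (cong f g)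
  then show ?case by (metis space_borel ext UNIV_I)
next
  case (set A)
  then show ?case using emeasure_interval_measure_add[OF F G] by simp
next
  case (mult u c)
  then show ?case by (simp add: nn_integral_cmult distrib_left)
next
  case (add u v)
  then show ?case by (simp add: nn_integral_add algebra_simps)
next
  case (seq U)
  have eq: "(SUP i. U i) = (\<lambda>x. SUP i. U i x)" by (simp add: fun_eq_iff image_comp)
  have m: "(\<integral>\<^sup>+x. (SUP i. U i x) \<partial>interval_measure K) = (SUP i. \<integral>\<^sup>+x. U i x \<partial>interval_measure K)"
    for K using seq by (intro nn_integral_monotone_convergence_SUP) auto
  have inc: "incseq (\<lambda>i. \<integral>\<^sup>+x. U i x \<partial>interval_measure K)" for K
    using seq(3) by (auto simp: incseq_def le_fun_def intro!: nn_integral_mono)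
  show ?case
    unfolding eq m using seq inc by (simp add: ennreal_SUP_add)
qed

lemma integral_interval_measure_add:
  fixes f :: "real \<Rightarrow> real"
  assumes F: "distribution_function F" and G: "distribution_function G"
    and f: "integrable (interval_measure F) f" "integrable (interval_measure G) f"
  shows "integral\<^sup>L (interval_measure (\<lambda>x. F x + G x)) f =
    integral\<^sup>L (interval_measure F) f + integral\<^sup>L (interval_measure G) f"
proof -
  have m: "f \<in> borel_measurable borel"
    using borel_measurable_integrable[OF f(1)] by simp
  have fin: "(\<integral>\<^sup>+x. ennreal (f x) \<partial>interval_measure K) < \<infinity>"
    "(\<integral>\<^sup>+x. ennreal (- f x) \<partial>interval_measure K) < \<infinity>"
    if "integrable (interval_measure K) f" for K
    using that by (auto simp: real_integrable_def top.not_eq_extremum)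
  note nn = nn_integral_interval_measure_add[OF F G]
  have "integrable (interval_measure (\<lambda>x. F x + G x)) f"
    using fin[OF f(1)] fin[OF f(2)] m by (auto simp: real_integrable_def nn)
  then show ?thesis
    using f fin[OF f(1)] fin[OF f(2)] m
    by (simp add: real_lebesgue_integral_def nn enn2real_plus)
qed

lemma has_LS_integral_unique:
  assumes "has_LS_integral \<sigma> A f I" "has_LS_integral \<sigma> A f J"
  shows "I = J"
proof -
  obtain F G where 1: "distribution_function F" "distribution_function G" "\<And>x. \<sigma> x = F x - G x"
    "set_integrable (interval_measure F) A f" "set_integrable (interval_measure G) A f"
    "I = (LINT x:A|interval_measure F. f x) - (LINT x:A|interval_measure G. f x)"
    using assms(1) unfolding has_LS_integral_def by blast
  obtain F' G' where 2: "distribution_function F'" "distribution_function G'"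
    "\<And>x. \<sigma> x = F' x - G' x"
    "set_integrable (interval_measure F') A f" "set_integrable (interval_measure G') A f"
    "J = (LINT x:A|interval_measure F'. f x) - (LINT x:A|interval_measure G'. f x)"
    using assms(2) unfolding has_LS_integral_def by blast
  have "(\<lambda>x. F x + G' x) = (\<lambda>x. F' x + G x)"
  proof
    fix x show "F x + G' x = F' x + G x" using 1(3)[of x] 2(3)[of x] by simp
  qed
  moreover define g where "g = (\<lambda>x. indicator A x *\<^sub>R f x)"
  ultimately have "integral\<^sup>L (interval_measure F) g + integral\<^sup>L (interval_measure G') g =
      integral\<^sup>L (interval_measure F') g + integral\<^sup>L (interval_measure G) g"
    using integral_interval_measure_add[of F G' g] integral_interval_measure_add[of F' G g] 1 2
    unfolding set_integrable_def by metis
  then show ?thesis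
    using 1(6) 2(6) unfolding set_lebesgue_integral_def g_def by linarith
qed

lemma LS_integral_eqI: "has_LS_integral \<sigma> A f I \<Longrightarrow> LS_integral \<sigma> A f = I"
  unfolding LS_integral_def using has_LS_integral_unique by blast


section \<open>Spectral data\<close>

definition L1_loc :: "(real \<Rightarrow> real) \<Rightarrow> bool" where
  "L1_loc q \<longleftrightarrow> (\<forall>a>0. q absolutely_integrable_on {0..a})"

definition L2_half_line :: "(real \<Rightarrow> real) set" where
  "L2_half_line = {f. f \<in> borel_measurable (lebesgue_on {0..}) \<and>
                      integrable (lebesgue_on {0..}) (\<lambda>x. (f x)\<^sup>2)}"

text \<open>
  For locally integrable \<open>q\<close> a solution of \<open>-\<phi>'' + q \<phi> = \<mu> \<phi>\<close> is a \<open>C\<^sup>1\<close> function whose derivative is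
  locally absolutely continuous and satisfies the equation almost everywhere, i.e. whose derivative
  \<open>\<phi>'\<close> is an indefinite Lebesgue integral of \<open>(q - \<mu>) \<phi>\<close>. The initial values are
  \<open>\<phi>(0) = 0\<close>, \<open>\<phi>'(0) = 1\<close>.
\<close>

definition dirichlet_solution :: "(real \<Rightarrow> real) \<Rightarrow> (real \<Rightarrow> real \<Rightarrow> real) \<Rightarrow> bool" where
  "dirichlet_solution q \<phi> \<longleftrightarrow>
    (\<forall>\<mu>. \<phi> 0 \<mu> = 0 \<and>
      (\<exists>\<phi>'. \<phi>' 0 = 1 \<and>
        (\<forall>x\<ge>0. ((\<lambda>x. \<phi> x \<mu>) has_real_derivative \<phi>' x) (at x within {0..})) \<and>
        (\<forall>x\<ge>0. \<phi>' x = \<phi>' 0 + integral {0..x} (\<lambda>y. (q y - \<mu>) * \<phi> y \<mu>))))"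

text \<open>
  For a general \<open>f\<close> in \<open>L\<^sup>2\<close> the integral \<open>(F f)(\<mu>) = \<integral>\<^sub>0\<^sup>\<infinity> f(x) \<phi>(x,\<mu>) dx\<close> converges only in
  the mean: \<open>h\<close> represents \<open>F f\<close> if it is the limit in \<open>L\<^sup>2(M)\<close> of the integrals over \<open>[0,a]\<close>.
\<close>

definition has_transform ::
    "(real \<Rightarrow> real \<Rightarrow> real) \<Rightarrow> real measure \<Rightarrow> (real \<Rightarrow> real) \<Rightarrow> (real \<Rightarrow> real) \<Rightarrow> bool" where
  "has_transform \<phi> M f h \<longleftrightarrow>
    h \<in> borel_measurable M \<and> integrable M (\<lambda>\<mu>. (h \<mu>)\<^sup>2) \<and>
    ((\<lambda>a. \<integral>\<^sup>+\<mu>. ennreal ((integral {0..a} (\<lambda>x. f x * \<phi> x \<mu>) - h \<mu>)\<^sup>2) \<partial>M) \<longlongrightarrow> 0) at_top"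

text \<open>
  The spectral measure \<open>d\<rho>\<close> is given by its distribution function \<open>\<rho>\<close>, normalised up to an
  additive constant.
\<close>

definition spectral_function :: "(real \<Rightarrow> real \<Rightarrow> real) \<Rightarrow> (real \<Rightarrow> real) \<Rightarrow> bool" where
  "spectral_function \<phi> \<rho> \<longleftrightarrow>
    distribution_function \<rho> \<and>
    (\<forall>f\<in>L2_half_line. \<exists>h. has_transform \<phi> (interval_measure \<rho>) f h) \<and>
    (\<forall>f\<in>L2_half_line. \<forall>g\<in>L2_half_line. \<forall>h k.
       has_transform \<phi> (interval_measure \<rho>) f h \<longrightarrow> has_transform \<phi> (interval_measure \<rho>) g k \<longrightarrow>
       (LINT x|lebesgue_on {0..}. f x * g x) = (LINT \<mu>|interval_measure \<rho>. h \<mu> * k \<mu>))"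

definition regularized_spectral_function :: "(real \<Rightarrow> real) \<Rightarrow> real \<Rightarrow> real" where
  "regularized_spectral_function \<rho> \<mu> =
    (if \<mu> \<ge> 0 then \<rho> \<mu> - 2 / (3 * pi) * \<mu> powr (3/2) else \<rho> \<mu>)"

text \<open>The entire function \<open>\<mu> \<mapsto> sin(\<surd>\<mu> x) / \<surd>\<mu>\<close>, for real \<open>\<mu>\<close>.\<close>

definition sin_sqrt :: "real \<Rightarrow> real \<Rightarrow> real" where
  "sin_sqrt x \<mu> =
    (if \<mu> > 0 then sin (sqrt \<mu> * x) / sqrt \<mu>
     else if \<mu> < 0 then sinh (sqrt \<bar>\<mu>\<bar> * x) / sqrt \<bar>\<mu>\<bar>
     else x)"


section \<open>Dynamical data\<close>

definition goursat_solution :: "(real \<Rightarrow> real) \<Rightarrow> (real \<Rightarrow> real \<Rightarrow> real) \<Rightarrow> bool" where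
  "goursat_solution q v \<longleftrightarrow>
    continuous_on {(\<xi>, \<eta>). 0 \<le> \<xi> \<and> \<xi> \<le> \<eta>} (\<lambda>(\<xi>, \<eta>). v \<xi> \<eta>) \<and>
    (\<forall>\<xi> \<eta>. 0 \<le> \<xi> \<and> \<xi> \<le> \<eta> \<longrightarrow>
       v \<xi> \<eta> = - (1/2) * integral {\<xi>/2..\<eta>/2} q
         - (1/4) * integral {0..\<xi>} (\<lambda>\<xi>1. integral {\<xi>..\<eta>} (\<lambda>\<eta>1. q ((\<eta>1 - \<xi>1) / 2) * v \<xi>1 \<eta>1)))"

definition response_function ::
    "(real \<Rightarrow> real) \<Rightarrow> (real \<Rightarrow> real \<Rightarrow> real) \<Rightarrow> real \<Rightarrow> real" where
  "response_function q v t =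
    - (1/2) * q (t/2) - (1/2) * integral {0..t} (\<lambda>\<zeta>. q ((t - \<zeta>) / 2) * v \<zeta> t)"

definition response_primitive ::
    "(real \<Rightarrow> real) \<Rightarrow> (real \<Rightarrow> real \<Rightarrow> real) \<Rightarrow> real \<Rightarrow> real" where
  "response_primitive q v t = (1/2) * integral {0..\<bar>t\<bar>} (response_function q v)"

definition connecting_kernel ::
    "(real \<Rightarrow> real) \<Rightarrow> (real \<Rightarrow> real \<Rightarrow> real) \<Rightarrow> real \<Rightarrow> real \<Rightarrow> real \<Rightarrow> real" where
  "connecting_kernel q v T t s =
    response_primitive q v (2 * T - t - s) - response_primitive q v (t - s)"

end

theory Submission
  imports Defs "HOL-Probability.Sinc_Integral" "HOL-Real_Asymp.Real_Asymp"
begin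

text \<open>
  The function \<open>S(s) = sin (sqrt \<lambda> s) / sqrt \<lambda>\<close> is the image of \<open>\<phi>(x, \<lambda>)\<close> under the operator
  \<open>I + W\<close> with kernel \<open>w\<close>. Parseval's identity for \<open>\<phi>\<close> therefore becomes one for sine transforms, and
  testing it against an approximate point mass at the origin gives
  \<open>\<integral> (\<integral> G(s) S(s) ds) d\<rho> = G'(0) + \<integral> G r\<close> for test functions \<open>G\<close> of compact support.

  With \<open>E(x) = S(x / 2)\<^sup>2\<close>, the integrand of the theorem is \<open>E(2T - s - t) - E(\<bar>s - t\<bar>)\<close>. A smooth
  cutoff of \<open>E(x)\<close> at \<open>\<lambda> \<le> N\<^sup>2\<close> whose Fourier kernel is supported in \<open>[-L, L]\<close> is the sine transform of
  such a \<open>G\<close>; the integral of the cutoff minus its value for the free operator, which is explicit, tends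
  to \<open>p(x)\<close> as \<open>N \<rightarrow> \<infinity>\<close>. Replacing the smooth cutoff by the sharp one costs only \<open>O(1/L) + o(1)\<close>:
  as \<open>\<rho>\<close> is increasing, the error is controlled by the integrals of two Fejer kernels centred near \<open>N\<close>,
  which the same identity evaluates.
\<close>

section \<open>Integration along characteristics\<close>

text \<open>Test functions must have compact support: \<open>q\<close> is only locally integrable,
  so the kernel and the response function are controlled on bounded sets only. The kernel sin(N
  y)/(pi y) of the sharp cutoff is not compactly supported, and nothing is known beforehand about
  the mass of d\<rho> near \<open>N\<^sup>2\<close>; hence the window and the comparison. The window
  is parabolic because its error then decays like (L p)^-2 at distance p from the jump, as Fejer
  kernels do; a triangular window would give only (L p)^-1. Since a Fejer kernel has zeros, a copy
  shifted by pi/L fills them. \<open>L\<close> is fixed first, from the tolerance and the range of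
  x, and N tends to infinity afterwards, so constants may depend on L in any way. The negative
  spectrum needs its own argument, as cosines become cosh there: cutoffs are compared after an
  integration by parts, with exponential weights that are integrable because Parseval's identity
  holds for the weights A - b on [0, A] for every A. Null sets of \<open>q\<close> are removed by a
  Borel representative, and solutions are extended oddly to the whole line.\<close>

lemma borel_measurable_indicator_interval [measurable (raw)]:
  fixes f g h :: "'a \<Rightarrow> real"
  assumes [measurable]: "f \<in> borel_measurable M" "g \<in> borel_measurable M" "h \<in> borel_measurable M"
  shows "(\<lambda>x. indicator {f x..g x} (h x) :: real) \<in> borel_measurable M"
proof -
  have "(\<lambda>x. indicator {f x..g x} (h x) :: real) = (\<lambda>x. if f x \<le> h x \<and> h x \<le> g x then 1 else 0)"
    by (auto simp: indicator_def fun_eq_iff)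
  then show ?thesis by simp
qed

lemma integrable_indicator_mult_bounded:
  fixes f g :: "real \<Rightarrow> real"
  assumes "integrable lborel (\<lambda>x. indicator {a..b} x * f x)"
    and [measurable]: "g \<in> borel_measurable borel"
    and C: "\<And>x. x \<in> {a..b} \<Longrightarrow> \<bar>g x\<bar> \<le> C"
  shows "integrable lborel (\<lambda>x. indicator {a..b} x * (f x * g x))"
proof (rule Bochner_Integration.integrable_bound)
  show "integrable lborel (\<lambda>x. C * (indicator {a..b} x * f x))"
    using assms(1) by simp
  have "(\<lambda>x. indicator {a..b} x * f x * g x) \<in> borel_measurable lborel"
    using borel_measurable_integrable[OF assms(1)] by measurable
  then show "(\<lambda>x. indicator {a..b} x * (f x * g x)) \<in> borel_measurable lborel"
    by (simp add: mult.assoc)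
  show "AE x in lborel. norm (indicator {a..b} x * (f x * g x)) \<le> norm (C * (indicator {a..b} x * f x))"
  proof (rule AE_I2)
    fix x
    show "norm (indicator {a..b} x * (f x * g x)) \<le> norm (C * (indicator {a..b} x * f x))"
    proof (cases "x \<in> {a..b}")
      case True
      then have "\<bar>f x\<bar> * \<bar>g x\<bar> \<le> \<bar>f x\<bar> * C" using C by (intro mult_left_mono) auto
      moreover have "0 \<le> C" using C[OF True] by simp
      ultimately show ?thesis using True by (simp add: abs_mult mult.commute)
    qed simp
  qed
qed

lemma integrable_indicator_interval [simp]: "integrable lborel (\<lambda>x. indicator {a..b::real} x * (c::real))"
proof -
  have "integrable lborel (indicator {a..b} :: real \<Rightarrow> real)"
    by (rule integrable_real_indicator) (auto simp: emeasure_lborel_Icc_eq)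
  then show ?thesis by simp
qed

lemma integrable_indicator_subset:
  fixes f :: "real \<Rightarrow> real"
  assumes "integrable lborel (\<lambda>x. indicator {a..b} x * f x)" "{c..d} \<subseteq> {a..b}"
  shows "integrable lborel (\<lambda>x. indicator {c..d} x * f x)"
proof -
  have "set_integrable lborel {a..b} f" using assms(1) by (simp add: set_integrable_def)
  then have "set_integrable lborel {c..d} f" by (rule set_integrable_subset) (use assms in auto)
  then show ?thesis by (simp add: set_integrable_def)
qed

text \<open>For majorants that are not products, such as shifts
  \<open>D (\<sigma> - \<alpha>)\<close> of one integrable function: only the inner absolute
  integrals have to be dominated.\<close>

lemma lborel_Fubini_swap:
  fixes F :: "real \<Rightarrow> real \<Rightarrow> real"
  assumes F: "(\<lambda>(x, y). F x y) \<in> borel_measurable (borel \<Otimes>\<^sub>M borel)"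
    and int: "\<And>x. integrable lborel (F x)"
    and le: "\<And>x. (\<integral>y. \<bar>F x y\<bar> \<partial>lborel) \<le> a x"
    and a: "integrable lborel a"
  shows "(\<integral>x. (\<integral>y. F x y \<partial>lborel) \<partial>lborel) = (\<integral>y. (\<integral>x. F x y \<partial>lborel) \<partial>lborel)"
    and "integrable lborel (\<lambda>x. \<integral>y. F x y \<partial>lborel)"
    and "integrable lborel (\<lambda>y. \<integral>x. F x y \<partial>lborel)"
proof -
  have [measurable]: "(\<lambda>(x, y). F x y) \<in> borel_measurable (lborel \<Otimes>\<^sub>M lborel)"
    using F by (simp cong: measurable_cong_sets sets_pair_measure_cong)
  have "integrable (lborel \<Otimes>\<^sub>M lborel) (\<lambda>(x, y). F x y)"
  proof (rule lborel_pair.Fubini_integrable)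
    show "integrable lborel (\<lambda>x. \<integral>y. norm (case (x, y) of (x, y) \<Rightarrow> F x y) \<partial>lborel)"
    proof (rule Bochner_Integration.integrable_bound[OF a])
      show "AE x in lborel. norm (\<integral>y. norm (case (x, y) of (x, y) \<Rightarrow> F x y) \<partial>lborel) \<le> norm (a x)"
        using le by (intro AE_I2) (auto intro: order_trans[OF _ abs_ge_self])
    qed measurable
  qed (use int in auto)
  then show "(\<integral>x. (\<integral>y. F x y \<partial>lborel) \<partial>lborel) = (\<integral>y. (\<integral>x. F x y \<partial>lborel) \<partial>lborel)"
    "integrable lborel (\<lambda>x. \<integral>y. F x y \<partial>lborel)" "integrable lborel (\<lambda>y. \<integral>x. F x y \<partial>lborel)"
    using lborel_pair.Fubini_integral[of F] lborel_pair.integrable_fst[of F] lborel_pair.integrable_snd[of F]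
    by simp_all
qed

lemma lborel_Fubini_swap_bounded:
  fixes F :: "real \<Rightarrow> real \<Rightarrow> real"
  assumes F: "(\<lambda>(x, y). F x y) \<in> borel_measurable (borel \<Otimes>\<^sub>M borel)"
    and le: "\<And>x y. \<bar>F x y\<bar> \<le> a x * b y"
    and a: "integrable lborel a" and b: "integrable lborel b"
  shows "(\<integral>x. (\<integral>y. F x y \<partial>lborel) \<partial>lborel) = (\<integral>y. (\<integral>x. F x y \<partial>lborel) \<partial>lborel)"
    and "integrable lborel (\<lambda>x. \<integral>y. F x y \<partial>lborel)"
    and "integrable lborel (\<lambda>y. \<integral>x. F x y \<partial>lborel)"
    and "\<And>x. integrable lborel (F x)" and "\<And>y. integrable lborel (\<lambda>x. F x y)"
proof -
  note [measurable] = F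
  have m: "F x \<in> borel_measurable borel" for x
    using measurable_compose[OF measurable_Pair1' F, of x] by simp
  have m': "(\<lambda>x. F x y) \<in> borel_measurable borel" for y
    using measurable_compose[OF measurable_Pair2' F, of y] by simp
  show int: "integrable lborel (F x)" for x
    by (rule Bochner_Integration.integrable_bound[of _ "\<lambda>y. a x * b y"])
      (use m b le in \<open>auto intro!: AE_I2 intro: order_trans[OF _ abs_ge_self]\<close>)
  show "integrable lborel (\<lambda>x. F x y)" for y
    by (rule Bochner_Integration.integrable_bound[of _ "\<lambda>x. a x * b y"])
      (use m' a le in \<open>auto intro!: AE_I2 intro: order_trans[OF _ abs_ge_self]\<close>)
  have "(\<integral>y. \<bar>F x y\<bar> \<partial>lborel) \<le> a x * (\<integral>y. b y \<partial>lborel)" for x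
  proof -
    have "(\<integral>y. \<bar>F x y\<bar> \<partial>lborel) \<le> (\<integral>y. a x * b y \<partial>lborel)"
      using int b le by (intro integral_mono) auto
    then show ?thesis by simp
  qed
  from lborel_Fubini_swap[OF F int this] a
  show "(\<integral>x. (\<integral>y. F x y \<partial>lborel) \<partial>lborel) = (\<integral>y. (\<integral>x. F x y \<partial>lborel) \<partial>lborel)"
    "integrable lborel (\<lambda>x. \<integral>y. F x y \<partial>lborel)" "integrable lborel (\<lambda>y. \<integral>x. F x y \<partial>lborel)"
    by auto
qed

section \<open>Iterated integrals and averages along characteristics\<close>

definition primitive :: "(real \<Rightarrow> real) \<Rightarrow> real \<Rightarrow> real" where
  "primitive h z = (\<integral>x. indicator {0..z} x * h x \<partial>lborel)"

text \<open>Cauchy's formula for the twofold integral: the y with y'' = f and y(0) = y'(0) = 0.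
  Second-order equations are used in this integrated form, so that nothing has to be differentiated
  twice.\<close>

definition second_primitive :: "(real \<Rightarrow> real) \<Rightarrow> real \<Rightarrow> real" where
  "second_primitive f s = (\<integral>r. indicator {0..s} r * ((s - r) * f r) \<partial>lborel)"

lemma primitive_measurable [measurable]:
  assumes [measurable]: "h \<in> borel_measurable borel"
  shows "primitive h \<in> borel_measurable borel"
  unfolding primitive_def[abs_def] by measurable

text \<open>One bound for all \<open>z\<close> up to \<open>t\<close>; for negative \<open>z\<close>
  the interval is empty and the value is 0.\<close>

lemma primitive_bound:
  assumes [measurable]: "h \<in> borel_measurable borel"
    and "integrable lborel (\<lambda>x. indicator {0..t} x * h x)" and "z \<le> t"
  shows "\<bar>primitive h z\<bar> \<le> (\<integral>x. indicator {0..t} x * \<bar>h x\<bar> \<partial>lborel)"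
proof -
  have i: "integrable lborel (\<lambda>x. indicator {0..t} x * \<bar>h x\<bar>)"
    using integrable_abs[OF assms(2)] by (simp add: abs_mult)
  have "\<bar>primitive h z\<bar> \<le> (\<integral>x. \<bar>indicator {0..z} x * h x\<bar> \<partial>lborel)"
    unfolding primitive_def by (rule integral_abs_bound)
  also have "\<dots> \<le> (\<integral>x. indicator {0..t} x * \<bar>h x\<bar> \<partial>lborel)"
    using assms(3) by (intro Bochner_Integration.integral_mono i integrable_abs integrable_indicator_subset[OF assms(2)])
      (auto simp: indicator_def)
  finally show ?thesis .
qed

lemma primitive_diff:
  assumes "integrable lborel (\<lambda>x. indicator {0..t} x * h x)" "0 \<le> c" "c \<le> t"
  shows "(\<integral>x. indicator {c..t} x * h x \<partial>lborel) = primitive h t - primitive h c"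
proof -
  have i: "integrable lborel (\<lambda>x. indicator {c..t} x * h x)" "integrable lborel (\<lambda>x. indicator {0..c} x * h x)"
    using assms by (auto intro!: integrable_indicator_subset[OF assms(1)])
  have "primitive h t = (\<integral>x. indicator {0..c} x * h x + indicator {c..t} x * h x \<partial>lborel)"
    unfolding primitive_def
  proof (rule integral_cong_AE)
    show "AE x in lborel. indicator {0..t} x * h x = indicator {0..c} x * h x + indicator {c..t} x * h x"
      using AE_lborel_singleton[of c] by eventually_elim (use assms in \<open>auto simp: indicator_def\<close>)
  qed (use i assms(1) borel_measurable_integrable in auto)
  then show ?thesis using i by (simp add: primitive_def)
qed

text \<open>The condition t - x \<le> 2\<beta> \<le> t + x says that x is at least |t - 2\<beta>|.
  Integrating in x first therefore leaves a difference of two values of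
  \<open>primitive h\<close>.\<close>

lemma integral_characteristic_triangle:
  fixes h k :: "real \<Rightarrow> real"
  assumes [measurable]: "h \<in> borel_measurable borel" "k \<in> borel_measurable borel"
    and h: "integrable lborel (\<lambda>x. indicator {0..t} x * h x)"
    and k: "integrable lborel (\<lambda>x. indicator {0..t} x * k x)" and t: "0 \<le> t"
  shows "(\<integral>x. indicator {0..t} x * (h x * (\<integral>\<beta>. indicator {t - x..t + x} (2 * \<beta>) * k \<beta> \<partial>lborel)) \<partial>lborel) =
    (\<integral>\<beta>. indicator {0..t} \<beta> * (k \<beta> * (primitive h t - primitive h \<bar>t - 2 * \<beta>\<bar>)) \<partial>lborel)"
proof -
  let ?F = "\<lambda>x \<beta>. (indicator {0..t} x * h x) * (indicator {0..t} \<beta> * k \<beta>) * (indicator {t - x..t + x} (2 * \<beta>) :: real)"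
  have "(\<integral>x. indicator {0..t} x * (h x * (\<integral>\<beta>. indicator {t - x..t + x} (2 * \<beta>) * k \<beta> \<partial>lborel)) \<partial>lborel) =
    (\<integral>x. (\<integral>\<beta>. ?F x \<beta> \<partial>lborel) \<partial>lborel)"
  proof (rule Bochner_Integration.integral_cong[OF refl])
    fix x :: real
    have "(\<integral>\<beta>. ?F x \<beta> \<partial>lborel) = (\<integral>\<beta>. indicator {0..t} x * h x * (indicator {t - x..t + x} (2 * \<beta>) * k \<beta>) \<partial>lborel)"
      by (rule Bochner_Integration.integral_cong) (auto simp: indicator_def)
    then show "indicator {0..t} x * (h x * (\<integral>\<beta>. indicator {t - x..t + x} (2 * \<beta>) * k \<beta> \<partial>lborel)) =
      (\<integral>\<beta>. ?F x \<beta> \<partial>lborel)"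
      by simp
  qed
  also have "\<dots> = (\<integral>\<beta>. (\<integral>x. ?F x \<beta> \<partial>lborel) \<partial>lborel)"
  proof (rule lborel_Fubini_swap_bounded(1))
    show "integrable lborel (\<lambda>x. \<bar>indicator {0..t} x * h x\<bar>)" "integrable lborel (\<lambda>x. \<bar>indicator {0..t} x * k x\<bar>)"
      using h k by auto
    show "\<bar>?F x \<beta>\<bar> \<le> \<bar>indicator {0..t} x * h x\<bar> * \<bar>indicator {0..t} \<beta> * k \<beta>\<bar>" for x \<beta>
      by (auto simp: indicator_def abs_mult)
  qed measurable
  also have "\<dots> = (\<integral>\<beta>. indicator {0..t} \<beta> * (k \<beta> * (\<integral>x. indicator {\<bar>t - 2 * \<beta>\<bar>..t} x * h x \<partial>lborel)) \<partial>lborel)"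
  proof (rule Bochner_Integration.integral_cong[OF refl])
    fix \<beta> :: real
    have "(\<integral>x. ?F x \<beta> \<partial>lborel) = (\<integral>x. indicator {0..t} \<beta> * k \<beta> * (indicator {\<bar>t - 2 * \<beta>\<bar>..t} x * h x) \<partial>lborel)"
      by (rule Bochner_Integration.integral_cong) (auto simp: indicator_def)
    then show "(\<integral>x. ?F x \<beta> \<partial>lborel) =
      indicator {0..t} \<beta> * (k \<beta> * (\<integral>x. indicator {\<bar>t - 2 * \<beta>\<bar>..t} x * h x \<partial>lborel))"
      by simp
  qed
  also have "\<dots> = (\<integral>\<beta>. indicator {0..t} \<beta> * (k \<beta> * (primitive h t - primitive h \<bar>t - 2 * \<beta>\<bar>)) \<partial>lborel)"
  proof (intro Bochner_Integration.integral_cong refl)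
    fix \<beta> :: real
    show "indicator {0..t} \<beta> * (k \<beta> * (\<integral>x. indicator {\<bar>t - 2 * \<beta>\<bar>..t} x * h x \<partial>lborel)) =
      indicator {0..t} \<beta> * (k \<beta> * (primitive h t - primitive h \<bar>t - 2 * \<beta>\<bar>))"
      using primitive_diff[OF h, of "\<bar>t - 2 * \<beta>\<bar>"] by (cases "\<beta> \<in> {0..t}") (auto simp: abs_le_iff)
  qed
  finally show ?thesis .
qed

text \<open>By \<open>integral_characteristic_triangle\<close> this is the integral of h(x) times
  the integral of g over [(t - x)/2, (t + x)/2], the form in which the Goursat equation acts on h.
  The weight g stands for \<open>q\<close> and for \<open>q \<beta> * u \<alpha> \<beta>\<close>
  with \<alpha> fixed.\<close>

definition wave_average :: "(real \<Rightarrow> real) \<Rightarrow> (real \<Rightarrow> real) \<Rightarrow> real \<Rightarrow> real" where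
  "wave_average g h t =
    (\<integral>\<beta>. indicator {0..t} \<beta> * (g \<beta> * (primitive h t - primitive h \<bar>t - 2 * \<beta>\<bar>)) \<partial>lborel)"

text \<open>Both sides integrate (s - \<sigma>) f(\<alpha>, \<sigma> - \<alpha>) over 0 \<le>
  \<alpha> \<le> \<sigma> \<le> s: twofold integration commutes with a convolution in time. The
  majorant depends on the second argument because in one application f carries the factor q, which
  is integrable but possibly unbounded.\<close>

lemma second_primitive_convolution:
  fixes f :: "real \<Rightarrow> real \<Rightarrow> real"
  assumes f: "(\<lambda>(x, y). f x y) \<in> borel_measurable (borel \<Otimes>\<^sub>M borel)"
    and bnd: "\<And>\<alpha> \<beta>. 0 \<le> \<alpha> \<Longrightarrow> \<alpha> \<le> s \<Longrightarrow> 0 \<le> \<beta> \<Longrightarrow> \<beta> \<le> s \<Longrightarrow> \<bar>f \<alpha> \<beta>\<bar> \<le> D \<beta>"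
    and D: "integrable lborel (\<lambda>x. indicator {0..s} x * D x)" and s: "0 \<le> s"
  shows "(\<integral>\<alpha>. indicator {0..s} \<alpha> * second_primitive (f \<alpha>) (s - \<alpha>) \<partial>lborel) =
    second_primitive (\<lambda>\<sigma>. \<integral>\<alpha>. indicator {0..\<sigma>} \<alpha> * f \<alpha> (\<sigma> - \<alpha>) \<partial>lborel) s" (is ?eq)
    and "integrable lborel (\<lambda>\<alpha>. indicator {0..s} \<alpha> * second_primitive (f \<alpha>) (s - \<alpha>))" (is ?int)
proof -
  have [measurable]: "(\<lambda>x. f (g x) (k x)) \<in> borel_measurable M"
    if [measurable]: "g \<in> borel_measurable M" "k \<in> borel_measurable M" for g k and M :: "'z measure"
    using measurable_compose[OF measurable_Pair[OF that] f] by simp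
  let ?F = "\<lambda>\<alpha> \<sigma>. indicator {0..s} \<alpha> * (indicator {\<alpha>..s} \<sigma> * ((s - \<sigma>) * f \<alpha> (\<sigma> - \<alpha>)))"
  let ?D = "\<lambda>x. indicator {0..s} x * D x"
  \<comment> \<open>The majorant is a shift of one fixed integrable function, so its integral in
    \<sigma> does not depend on \<alpha>.\<close>
  have bF: "\<bar>?F \<alpha> \<sigma>\<bar> \<le> indicator {0..s} \<alpha> * (s * ?D (\<sigma> - \<alpha>))" for \<alpha> \<sigma>
  proof (cases "0 \<le> \<alpha> \<and> \<alpha> \<le> \<sigma> \<and> \<sigma> \<le> s")
    case True
    then have "\<bar>s - \<sigma>\<bar> * \<bar>f \<alpha> (\<sigma> - \<alpha>)\<bar> \<le> s * D (\<sigma> - \<alpha>)"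
      using s by (intro mult_mono bnd) auto
    then show ?thesis using True by (auto simp: indicator_def abs_mult)
  next
    case False
    have "0 \<le> D \<beta>" if "\<beta> \<in> {0..s}" for \<beta>
      using bnd[of 0 \<beta>] that s by auto
    then have "0 \<le> indicator {0..s} \<alpha> * (s * ?D (\<sigma> - \<alpha>))" using s by (auto simp: indicator_def)
    then show ?thesis using False by (auto simp: indicator_def)
  qed
  have Dsh: "integrable lborel (\<lambda>\<sigma>. ?D (\<sigma> - \<alpha>))" for \<alpha>
    using lborel_integrable_real_affine[OF D, of 1 "-\<alpha>"] by simp
  have Dsh': "(\<integral>\<sigma>. ?D (\<sigma> - \<alpha>) \<partial>lborel) = (\<integral>\<sigma>. ?D \<sigma> \<partial>lborel)" for \<alpha>
    using lborel_integral_real_affine[of 1 ?D "-\<alpha>"] by simp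
  have intF: "integrable lborel (?F \<alpha>)" for \<alpha>
    by (rule Bochner_Integration.integrable_bound[of _ "\<lambda>\<sigma>. indicator {0..s} \<alpha> * (s * ?D (\<sigma> - \<alpha>))"])
      (use Dsh bF in \<open>auto intro!: AE_I2 intro: order_trans[OF _ abs_ge_self]\<close>)
  have eqF: "indicator {0..s} \<alpha> * second_primitive (f \<alpha>) (s - \<alpha>) = (\<integral>\<sigma>. ?F \<alpha> \<sigma> \<partial>lborel)" for \<alpha>
  proof -
    have "second_primitive (f \<alpha>) (s - \<alpha>) = (\<integral>\<sigma>. indicator {0..s - \<alpha>} (-\<alpha> + \<sigma>) * ((s - \<alpha> - (-\<alpha> + \<sigma>)) * f \<alpha> (-\<alpha> + \<sigma>)) \<partial>lborel)"
      unfolding second_primitive_def by (subst lborel_integral_real_affine[of 1 _ "-\<alpha>"]) auto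
    also have "\<dots> = (\<integral>\<sigma>. indicator {\<alpha>..s} \<sigma> * ((s - \<sigma>) * f \<alpha> (\<sigma> - \<alpha>)) \<partial>lborel)"
      by (rule Bochner_Integration.integral_cong) (auto simp: indicator_def)
    finally show ?thesis by simp
  qed
  have "(\<lambda>(\<alpha>, \<sigma>). ?F \<alpha> \<sigma>) \<in> borel_measurable (borel \<Otimes>\<^sub>M borel)" by simp
  note swap = lborel_Fubini_swap[OF this intF]
  have b: "(\<integral>\<sigma>. \<bar>?F \<alpha> \<sigma>\<bar> \<partial>lborel) \<le> indicator {0..s} \<alpha> * (s * (\<integral>\<sigma>. ?D \<sigma> \<partial>lborel))" for \<alpha>
  proof -
      have "(\<integral>\<sigma>. \<bar>?F \<alpha> \<sigma>\<bar> \<partial>lborel) \<le> (\<integral>\<sigma>. indicator {0..s} \<alpha> * (s * ?D (\<sigma> - \<alpha>)) \<partial>lborel)"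
        by (intro Bochner_Integration.integral_mono integrable_abs intF bF) (use Dsh in auto)
      then show ?thesis by (simp add: Dsh')
  qed
  note swap = swap[OF b integrable_indicator_interval]
  show ?int unfolding eqF by (rule swap(2))
  have "(\<integral>\<alpha>. indicator {0..s} \<alpha> * second_primitive (f \<alpha>) (s - \<alpha>) \<partial>lborel) = (\<integral>\<sigma>. (\<integral>\<alpha>. ?F \<alpha> \<sigma> \<partial>lborel) \<partial>lborel)"
    unfolding eqF by (rule swap(1))
  also have "\<dots> = second_primitive (\<lambda>\<sigma>. \<integral>\<alpha>. indicator {0..\<sigma>} \<alpha> * f \<alpha> (\<sigma> - \<alpha>) \<partial>lborel) s"
    unfolding second_primitive_def
  proof (rule Bochner_Integration.integral_cong[OF refl])
    fix \<sigma> :: real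
    have "(\<integral>\<alpha>. ?F \<alpha> \<sigma> \<partial>lborel) = (\<integral>\<alpha>. indicator {0..s} \<sigma> * (s - \<sigma>) * (indicator {0..\<sigma>} \<alpha> * f \<alpha> (\<sigma> - \<alpha>)) \<partial>lborel)"
      by (rule Bochner_Integration.integral_cong) (auto simp: indicator_def)
    then show "(\<integral>\<alpha>. ?F \<alpha> \<sigma> \<partial>lborel) =
      indicator {0..s} \<sigma> * ((s - \<sigma>) * (\<integral>\<alpha>. indicator {0..\<sigma>} \<alpha> * f \<alpha> (\<sigma> - \<alpha>) \<partial>lborel))"
      by simp
  qed
  finally show ?eq .
qed

lemma compact_Icc_bound:
  fixes f :: "real \<Rightarrow> real"
  assumes "continuous_on {a..b} f"
  obtains C where "\<And>x. x \<in> {a..b} \<Longrightarrow> \<bar>f x\<bar> \<le> C"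
  using compact_imp_bounded[OF compact_continuous_image[OF assms compact_Icc]]
  by (auto simp: bounded_iff simp del: atLeastAtMost_iff)

lemma second_primitive_cong:
  "(\<And>r. 0 \<le> r \<Longrightarrow> r \<le> s \<Longrightarrow> f r = g r) \<Longrightarrow> second_primitive f s = second_primitive g s"
  unfolding second_primitive_def by (intro Bochner_Integration.integral_cong) (auto simp: indicator_def)

lemma integrable_second_primitive:
  fixes f :: "real \<Rightarrow> real"
  assumes "integrable lborel (\<lambda>r. indicator {0..s} r * f r)"
  shows "integrable lborel (\<lambda>r. indicator {0..s} r * ((s - r) * f r))"
  using integrable_indicator_mult_bounded[OF assms, of "\<lambda>r. s - r" s] by (simp add: mult.commute)

lemma second_primitive_linear:
  fixes f g :: "real \<Rightarrow> real"
  assumes "integrable lborel (\<lambda>r. indicator {0..s} r * f r)" "integrable lborel (\<lambda>r. indicator {0..s} r * g r)"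
  shows "second_primitive (\<lambda>r. a * f r + b * g r) s = a * second_primitive f s + b * second_primitive g s"
proof -
  have "second_primitive (\<lambda>r. a * f r + b * g r) s =
    (\<integral>r. a * (indicator {0..s} r * ((s - r) * f r)) + b * (indicator {0..s} r * ((s - r) * g r)) \<partial>lborel)"
    unfolding second_primitive_def
    by (intro Bochner_Integration.integral_cong) (auto simp: algebra_simps)
  then show ?thesis
    using assms[THEN integrable_second_primitive] by (simp add: second_primitive_def)
qed

lemma integrable_indicator_bounded:
  fixes f :: "real \<Rightarrow> real"
  assumes "f \<in> borel_measurable borel" and "\<And>x. x \<in> {a..b} \<Longrightarrow> \<bar>f x\<bar> \<le> C"
  shows "integrable lborel (\<lambda>x. indicator {a..b} x * f x)"
  using integrable_indicator_mult_bounded[OF integrable_indicator_interval[of a b 1] assms] by simp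

text \<open>In the norm sup |d(s)| exp(-K s) the map c times \<open>second_primitive\<close> at
  least halves norms, so |d| is bounded by M exp(K s)/2^n for every n.\<close>

lemma second_primitive_fixpoint_zero:
  assumes d [measurable]: "d \<in> borel_measurable borel" and M: "\<And>s. 0 \<le> s \<Longrightarrow> s \<le> B \<Longrightarrow> \<bar>d s\<bar> \<le> M"
    and eq: "\<And>s. 0 \<le> s \<Longrightarrow> s \<le> B \<Longrightarrow> d s = c * second_primitive d s"
    and s: "0 \<le> s" "s \<le> B"
  shows "d s = 0"
proof -
  \<comment> \<open>Makes |c| B / K at most 1/2; the summand 1 keeps K positive when c or B is
    0.\<close>
  define K where "K = 2 * \<bar>c\<bar> * B + 1"
  have B0: "0 \<le> B" using s by simp
  have K: "K > 0" using B0 unfolding K_def by (intro add_nonneg_pos) auto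
  have M0: "0 \<le> M" using M[OF s] by linarith
  have *: "\<forall>s. 0 \<le> s \<and> s \<le> B \<longrightarrow> \<bar>d s\<bar> \<le> (M / 2 ^ n) * exp (K * s)" for n
  proof (induction n)
    case 0
    show ?case
    proof (intro allI impI)
      fix s assume s: "0 \<le> s \<and> s \<le> B"
      have "\<bar>d s\<bar> \<le> M * 1" using M s by simp
      also have "\<dots> \<le> M * exp (K * s)" using M0 K s by (intro mult_left_mono) auto
      finally show "\<bar>d s\<bar> \<le> M / 2 ^ 0 * exp (K * s)" by simp
    qed
  next
    case (Suc n)
    show ?case
    proof (intro allI impI)
      fix s assume s: "0 \<le> s \<and> s \<le> B"
      let ?M = "M / 2 ^ n"
      have F: "has_bochner_integral lborel (\<lambda>r. exp (K * r) * indicator {0..s} r) (exp (K * s) / K - exp (K * 0) / K)"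
        using K s by (intro has_bochner_integral_FTC_Icc_real)
          (auto intro!: derivative_eq_intros continuous_intros)
      have Fi: "integrable lborel (\<lambda>r. indicator {0..s} r * exp (K * r))"
        using F by (simp add: has_bochner_integral_iff mult.commute)
      have "\<bar>second_primitive d s\<bar> \<le> (\<integral>r. \<bar>indicator {0..s} r * ((s - r) * d r)\<bar> \<partial>lborel)"
        unfolding second_primitive_def by (rule integral_abs_bound)
      also have "\<dots> \<le> (\<integral>r. B * ?M * (indicator {0..s} r * exp (K * r)) \<partial>lborel)"
      proof (rule Bochner_Integration.integral_mono)
        have "integrable lborel (\<lambda>r. indicator {0..s} r * d r)"
          by (rule integrable_indicator_bounded[where C=M]) (use s M in auto)
        then show "integrable lborel (\<lambda>r. \<bar>indicator {0..s} r * ((s - r) * d r)\<bar>)"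
          by (intro integrable_abs integrable_second_primitive)
        show "\<bar>indicator {0..s} r * ((s - r) * d r)\<bar> \<le> B * ?M * (indicator {0..s} r * exp (K * r))" for r
        proof (cases "r \<in> {0..s}")
          case True
          then have "\<bar>s - r\<bar> * \<bar>d r\<bar> \<le> B * (?M * exp (K * r))"
            using Suc s by (intro mult_mono) auto
          then show ?thesis using True by (simp add: abs_mult mult.assoc)
        qed simp
      qed (use Fi in auto)
      also have "\<dots> = B * ?M * (exp (K * s) / K - 1 / K)"
        using F by (simp add: has_bochner_integral_iff mult.commute)
      also have "\<dots> \<le> B * ?M * (exp (K * s) / K)"
        using B0 M0 K by (intro mult_left_mono) auto
      finally have 1: "\<bar>second_primitive d s\<bar> \<le> B * ?M * (exp (K * s) / K)" .
      have "\<bar>d s\<bar> = \<bar>c\<bar> * \<bar>second_primitive d s\<bar>" using eq[of s] s by (metis abs_mult)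
      also have "\<dots> \<le> \<bar>c\<bar> * (B * ?M * (exp (K * s) / K))" using 1 by (intro mult_left_mono) auto
      also have "\<dots> = (\<bar>c\<bar> * B / K) * (?M * exp (K * s))" by (simp only: divide_inverse mult_ac)
      also have "\<dots> \<le> (1 / 2) * (?M * exp (K * s))"
        using K M0 by (intro mult_right_mono) (auto simp: K_def field_simps)
      finally show "\<bar>d s\<bar> \<le> M / 2 ^ Suc n * exp (K * s)" by simp
    qed
  qed
  have "(\<lambda>n. M * exp (K * s) * (1 / 2) ^ n) \<longlonglongrightarrow> M * exp (K * s) * 0"
    by (intro tendsto_intros LIMSEQ_power_zero) simp
  then have "\<bar>d s\<bar> \<le> M * exp (K * s) * 0"
  proof (rule LIMSEQ_le_const, intro exI allI impI)
    show "\<bar>d s\<bar> \<le> M * exp (K * s) * (1 / 2) ^ n" for n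
      using *[of n] s by (simp add: power_one_over)
  qed
  then show ?thesis by simp
qed

lemma wave_average_measurable [measurable]:
  assumes [measurable]: "g \<in> borel_measurable borel" "h \<in> borel_measurable borel"
  shows "wave_average g h \<in> borel_measurable borel"
  unfolding wave_average_def[abs_def] by measurable

text \<open>The majorant D takes the place of g so that one bound serves the whole family
  \<open>q \<beta> * u \<alpha> \<beta>\<close>, uniformly in \<alpha>.\<close>

lemma wave_average_bound:
  assumes [measurable]: "h \<in> borel_measurable borel" "g \<in> borel_measurable borel"
    and h: "integrable lborel (\<lambda>x. indicator {0..s} x * h x)"
    and g: "integrable lborel (\<lambda>x. indicator {0..s} x * g x)"
    and gD: "\<And>x. 0 \<le> x \<Longrightarrow> x \<le> s \<Longrightarrow> \<bar>g x\<bar> \<le> D x" and D: "integrable lborel (\<lambda>x. indicator {0..s} x * D x)"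
    and t: "0 \<le> t" "t \<le> s"
  shows "\<bar>wave_average g h t\<bar> \<le> (\<integral>x. indicator {0..s} x * D x \<partial>lborel) * (2 * (\<integral>x. indicator {0..s} x * \<bar>h x\<bar> \<partial>lborel))"
proof -
  let ?H = "\<integral>x. indicator {0..s} x * \<bar>h x\<bar> \<partial>lborel"
  have H0: "0 \<le> ?H" by (intro integral_nonneg_AE) (auto simp: indicator_def)
  have pb: "\<bar>primitive h t - primitive h \<bar>t - 2 * \<beta>\<bar>\<bar> \<le> 2 * ?H" if "0 \<le> \<beta>" "\<beta> \<le> t" for \<beta>
  proof -
    have "\<bar>t - 2 * \<beta>\<bar> \<le> s" using t that by arith
    from primitive_bound[OF _ h this] primitive_bound[OF _ h t(2)] show ?thesis by fastforce
  qed
  have "\<bar>wave_average g h t\<bar> \<le> (\<integral>\<beta>. \<bar>indicator {0..t} \<beta> * (g \<beta> * (primitive h t - primitive h \<bar>t - 2 * \<beta>\<bar>))\<bar> \<partial>lborel)"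
    unfolding wave_average_def by (rule integral_abs_bound)
  also have "\<dots> \<le> (\<integral>\<beta>. (indicator {0..s} \<beta> * D \<beta>) * (2 * ?H) \<partial>lborel)"
  proof (rule Bochner_Integration.integral_mono)
    show "integrable lborel (\<lambda>\<beta>. \<bar>indicator {0..t} \<beta> * (g \<beta> * (primitive h t - primitive h \<bar>t - 2 * \<beta>\<bar>))\<bar>)"
      by (intro integrable_abs integrable_indicator_mult_bounded[where C="2 * ?H"] integrable_indicator_subset[OF g])
        (use t pb in auto)
    show "\<bar>indicator {0..t} \<beta> * (g \<beta> * (primitive h t - primitive h \<bar>t - 2 * \<beta>\<bar>))\<bar> \<le> (indicator {0..s} \<beta> * D \<beta>) * (2 * ?H)" for \<beta>
    proof (cases "\<beta> \<in> {0..s}")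
      case True
      then have "\<bar>g \<beta>\<bar> * \<bar>primitive h t - primitive h \<bar>t - 2 * \<beta>\<bar>\<bar> \<le> D \<beta> * (2 * ?H)" if "\<beta> \<le> t"
        using pb[of \<beta>] gD[of \<beta>] that by (intro mult_mono) auto
      moreover have "0 \<le> D \<beta> * (2 * ?H)" using gD[of \<beta>] True H0 by (intro mult_nonneg_nonneg) auto
      ultimately show ?thesis using True t by (auto simp: abs_mult indicator_def)
    qed (use t in \<open>auto simp: indicator_def\<close>)
  qed (use D in auto)
  finally show ?thesis by simp
qed

text \<open>In differential form: if \<phi> is odd and \<phi>'' = h on the positive axis, the second
  derivative of \<open>wave_average g \<phi>\<close> is 2 g \<phi> plus
  \<open>wave_average g h\<close>. Oddness enters twice. It removes the absolute value, since
  \<phi>' and the antiderivative of \<phi> are even, and it turns the boundary term \<phi>(\<beta>)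
  - \<phi>(-\<beta>) into 2 \<phi>(\<beta>).\<close>

lemma wave_average_solution:
  fixes \<phi> \<phi>' h g :: "real \<Rightarrow> real"
  assumes der: "\<And>z. (\<phi> has_real_derivative \<phi>' z) (at z)" and cont: "continuous_on UNIV \<phi>'"
    and odd: "\<And>z. \<phi> (- z) = - \<phi> z" and even: "\<And>z. \<phi>' (- z) = \<phi>' z"
    and [measurable]: "h \<in> borel_measurable borel" "g \<in> borel_measurable borel"
    and h: "integrable lborel (\<lambda>x. indicator {0..t} x * h x)"
    and prim: "\<And>z. 0 \<le> z \<Longrightarrow> \<phi>' z = \<phi>' 0 + primitive h z"
    and g: "integrable lborel (\<lambda>x. indicator {0..t} x * g x)" and t: "0 \<le> t"
  shows "wave_average g \<phi> t =
    2 * second_primitive (\<lambda>\<beta>. g \<beta> * \<phi> \<beta>) t + second_primitive (wave_average g h) t"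
proof -
  have c\<phi>: "continuous_on UNIV \<phi>" using der by (meson DERIV_isCont continuous_at_imp_continuous_on)
  note [measurable] = borel_measurable_continuous_onI[OF c\<phi>]
  obtain \<Phi> where \<Phi>: "\<And>z. (\<Phi> has_real_derivative \<phi> z) (at z)"
  proof -
    have "\<exists>F. \<forall>x::real. -\<infinity> < ereal x \<longrightarrow> ereal x < \<infinity> \<longrightarrow> (F has_vector_derivative \<phi> x) (at x)"
      by (rule einterval_antiderivative) (use c\<phi> in \<open>auto simp: continuous_on_eq_continuous_at\<close>)
    then show ?thesis using that by (auto simp: has_real_derivative_iff_has_vector_derivative)
  qed
  have \<Phi>even: "\<Phi> (- z) = \<Phi> z" for z
  proof -
    have "DERIV (\<lambda>z. \<Phi> (- z) - \<Phi> z) z :> \<phi> (- z) * (- 1) - \<phi> z" for z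
      by (rule DERIV_diff[OF DERIV_chain2[OF \<Phi>] \<Phi>]) (auto intro!: derivative_eq_intros)
    then have "\<forall>z. DERIV (\<lambda>z. \<Phi> (- z) - \<Phi> z) z :> 0"
      using odd by simp
    from DERIV_isconst_all[OF this, of z 0] show ?thesis by simp
  qed
  have prim\<phi>: "primitive \<phi> z = \<Phi> \<bar>z\<bar> - \<Phi> 0" if "0 \<le> z" for z
  proof -
    have "(\<integral>x. \<phi> x * indicator {0..z} x \<partial>lborel) = \<Phi> z - \<Phi> 0"
      using that c\<phi> \<Phi> by (intro integral_FTC_Icc_real) (auto simp: continuous_on_eq_continuous_at)
    then show ?thesis using that by (simp add: primitive_def mult.commute)
  qed
  have key: "primitive \<phi> t - primitive \<phi> \<bar>t - 2 * \<beta>\<bar> = 2 * ((t - \<beta>) * \<phi> \<beta>) +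
      (\<integral>r. indicator {\<beta>..t} r * ((t - r) * (primitive h r - primitive h \<bar>r - 2 * \<beta>\<bar>)) \<partial>lborel)"
    if \<beta>: "0 \<le> \<beta>" "\<beta> \<le> t" for \<beta>
  proof -
    have e: "\<phi>' \<bar>z\<bar> = \<phi>' z" for z using even[of z] by (auto simp: abs_if)
    \<comment> \<open>Antiderivative in r of (t - r)(\<phi>'(r) - \<phi>'(r - 2\<beta>)), found by
      parts. At the lower end r = \<beta> the shifted argument is -\<beta>.\<close>
    let ?F = "\<lambda>r. (t - r) * (\<phi> r - \<phi> (r - 2 * \<beta>)) + \<Phi> r - \<Phi> (r - 2 * \<beta>)"
    have "(\<integral>r. (t - r) * (\<phi>' r - \<phi>' (r - 2 * \<beta>)) * indicator {\<beta>..t} r \<partial>lborel) = ?F t - ?F \<beta>"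
    proof (rule integral_FTC_Icc_real[OF \<beta>(2)])
      show "DERIV ?F r :> (t - r) * (\<phi>' r - \<phi>' (r - 2 * \<beta>))" for r
      proof -
        have s: "DERIV (\<lambda>r. r - 2 * \<beta>) r :> 1" by (auto intro!: derivative_eq_intros)
        show ?thesis
          by (rule derivative_eq_intros der \<Phi> DERIV_chain2[OF der s] DERIV_chain2[OF \<Phi> s] refl)+
            (simp add: algebra_simps)
      qed
      have "continuous_on UNIV (\<lambda>r. (t - r) * (\<phi>' r - \<phi>' (r - 2 * \<beta>)))"
        by (intro continuous_intros cont continuous_on_compose2[OF cont]) auto
      then show "isCont (\<lambda>r. (t - r) * (\<phi>' r - \<phi>' (r - 2 * \<beta>))) r" for r
        by (simp add: continuous_on_eq_continuous_at)
    qed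
    also have "(\<integral>r. (t - r) * (\<phi>' r - \<phi>' (r - 2 * \<beta>)) * indicator {\<beta>..t} r \<partial>lborel) =
      (\<integral>r. indicator {\<beta>..t} r * ((t - r) * (primitive h r - primitive h \<bar>r - 2 * \<beta>\<bar>)) \<partial>lborel)"
    proof (rule Bochner_Integration.integral_cong[OF refl])
      fix r
      show "(t - r) * (\<phi>' r - \<phi>' (r - 2 * \<beta>)) * indicator {\<beta>..t} r =
        indicator {\<beta>..t} r * ((t - r) * (primitive h r - primitive h \<bar>r - 2 * \<beta>\<bar>))"
      proof (cases "r \<in> {\<beta>..t}")
        case True
        then have "primitive h r - primitive h \<bar>r - 2 * \<beta>\<bar> = \<phi>' r - \<phi>' (r - 2 * \<beta>)"
          using prim[of r] prim[of "\<bar>r - 2 * \<beta>\<bar>"] \<beta> e[of "r - 2 * \<beta>"] by simp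
        then show ?thesis by simp
      qed simp
    qed
    finally have "(\<integral>r. indicator {\<beta>..t} r * ((t - r) * (primitive h r - primitive h \<bar>r - 2 * \<beta>\<bar>)) \<partial>lborel) = ?F t - ?F \<beta>"
      by simp
    moreover have "\<Phi> \<bar>z\<bar> = \<Phi> z" for z using \<Phi>even[of z] by (simp add: abs_if)
    moreover have "\<phi> (\<beta> - 2 * \<beta>) = - \<phi> \<beta>" "\<Phi> (\<beta> - 2 * \<beta>) = \<Phi> \<beta>"
      using odd[of \<beta>] \<Phi>even[of \<beta>] by simp_all
    ultimately show ?thesis
      using prim\<phi>[of t] prim\<phi>[of "\<bar>t - 2 * \<beta>\<bar>"] t by simp
  qed
  let ?H = "\<integral>x. indicator {0..t} x * \<bar>h x\<bar> \<partial>lborel"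
  have H0: "0 \<le> ?H" by (intro integral_nonneg_AE) (auto simp: indicator_def)
  let ?F = "\<lambda>\<beta> r. (indicator {0..t} \<beta> * g \<beta>) * (indicator {\<beta>..t} r * ((t - r) * (primitive h r - primitive h \<bar>r - 2 * \<beta>\<bar>)))"
  have Fb: "\<bar>?F \<beta> r\<bar> \<le> \<bar>indicator {0..t} \<beta> * g \<beta>\<bar> * (indicator {0..t} r * (t * (2 * ?H)))" for \<beta> r
  proof (cases "0 \<le> \<beta> \<and> \<beta> \<le> r \<and> r \<le> t")
    case True
    have "\<bar>r - 2 * \<beta>\<bar> \<le> t" using True by arith
    from primitive_bound[OF _ h this] primitive_bound[OF _ h, of r] True
    have "\<bar>primitive h r - primitive h \<bar>r - 2 * \<beta>\<bar>\<bar> \<le> 2 * ?H" by fastforce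
    then have "\<bar>t - r\<bar> * \<bar>primitive h r - primitive h \<bar>r - 2 * \<beta>\<bar>\<bar> \<le> t * (2 * ?H)"
      using True by (intro mult_mono) auto
    then have "\<bar>g \<beta>\<bar> * (\<bar>t - r\<bar> * \<bar>primitive h r - primitive h \<bar>r - 2 * \<beta>\<bar>\<bar>) \<le> \<bar>g \<beta>\<bar> * (t * (2 * ?H))"
      by (rule mult_left_mono) simp
    then show ?thesis using True by (simp add: abs_mult)
  next
    case False
    have "0 \<le> \<bar>indicator {0..t} \<beta> * g \<beta>\<bar> * (indicator {0..t} r * (t * (2 * ?H)))"
      using H0 t by simp
    moreover have "?F \<beta> r = 0" using False by (auto simp: indicator_def)
    ultimately show ?thesis by (simp only: abs_zero)
  qed
  have Fm: "(\<lambda>(\<beta>, r). ?F \<beta> r) \<in> borel_measurable (borel \<Otimes>\<^sub>M borel)" by measurable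
  note swap = lborel_Fubini_swap_bounded[OF Fm Fb integrable_abs[OF g] integrable_indicator_interval]
  have i\<phi>: "integrable lborel (\<lambda>x. indicator {0..t} x * ((t - x) * (g x * \<phi> x)))"
  proof -
    obtain C where C: "\<And>x. x \<in> {0..t} \<Longrightarrow> \<bar>\<phi> x\<bar> \<le> C"
      using compact_Icc_bound[OF continuous_on_subset[OF c\<phi> subset_UNIV]] by blast
    show ?thesis
      by (intro integrable_second_primitive integrable_indicator_mult_bounded[OF g, where C=C] C) auto
  qed
  have "wave_average g \<phi> t = (\<integral>\<beta>. 2 * (indicator {0..t} \<beta> * ((t - \<beta>) * (g \<beta> * \<phi> \<beta>))) + (\<integral>r. ?F \<beta> r \<partial>lborel) \<partial>lborel)"
    unfolding wave_average_def
  proof (intro Bochner_Integration.integral_cong refl)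
    fix \<beta>
    show "indicator {0..t} \<beta> * (g \<beta> * (primitive \<phi> t - primitive \<phi> \<bar>t - 2 * \<beta>\<bar>)) =
      2 * (indicator {0..t} \<beta> * ((t - \<beta>) * (g \<beta> * \<phi> \<beta>))) + (\<integral>r. ?F \<beta> r \<partial>lborel)"
    proof (cases "\<beta> \<in> {0..t}")
      case True
      define I where "I = (\<integral>r. indicator {\<beta>..t} r * ((t - r) * (primitive h r - primitive h \<bar>r - 2 * \<beta>\<bar>)) \<partial>lborel)"
      have "(\<integral>r. ?F \<beta> r \<partial>lborel) = indicator {0..t} \<beta> * g \<beta> * I"
        unfolding I_def by simp
      moreover have "primitive \<phi> t - primitive \<phi> \<bar>t - 2 * \<beta>\<bar> = 2 * ((t - \<beta>) * \<phi> \<beta>) + I"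
        using key True unfolding I_def by simp
      ultimately show ?thesis using True by (simp only: distrib_left) simp
    qed simp
  qed
  also have "\<dots> = 2 * second_primitive (\<lambda>\<beta>. g \<beta> * \<phi> \<beta>) t + (\<integral>\<beta>. (\<integral>r. ?F \<beta> r \<partial>lborel) \<partial>lborel)"
    using i\<phi> swap(2) by (simp add: second_primitive_def)
  also have "(\<integral>\<beta>. (\<integral>r. ?F \<beta> r \<partial>lborel) \<partial>lborel) = (\<integral>r. (\<integral>\<beta>. ?F \<beta> r \<partial>lborel) \<partial>lborel)"
    by (rule swap(1))
  also have "\<dots> = second_primitive (wave_average g h) t"
    unfolding second_primitive_def wave_average_def
  proof (intro Bochner_Integration.integral_cong refl)
    fix r
    have "(\<integral>\<beta>. ?F \<beta> r \<partial>lborel) = (\<integral>\<beta>. indicator {0..t} r * (t - r) *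
      (indicator {0..r} \<beta> * (g \<beta> * (primitive h r - primitive h \<bar>r - 2 * \<beta>\<bar>))) \<partial>lborel)"
      by (rule Bochner_Integration.integral_cong) (auto simp: indicator_def)
    then show "(\<integral>\<beta>. ?F \<beta> r \<partial>lborel) = indicator {0..t} r * ((t - r) *
      (\<integral>\<beta>. indicator {0..r} \<beta> * (g \<beta> * (primitive h r - primitive h \<bar>r - 2 * \<beta>\<bar>)) \<partial>lborel))"
      by simp
  qed
  finally show ?thesis .
qed

section \<open>Transmutation\<close>

definition cos_sqrt :: "real \<Rightarrow> real \<Rightarrow> real" where
  "cos_sqrt x \<mu> = (if \<mu> > 0 then cos (sqrt \<mu> * x) else cosh (sqrt \<bar>\<mu>\<bar> * x))"

lemma DERIV_sin_sqrt: "((\<lambda>x. sin_sqrt x \<mu>) has_real_derivative cos_sqrt x \<mu>) (at x)"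
proof -
  define k where "k = sqrt \<bar>\<mu>\<bar>"
  have "((\<lambda>x. sin (k * x) / k) has_real_derivative cos (k * x) * k / k) (at x)"
    "((\<lambda>x. sinh (k * x) / k) has_real_derivative cosh (k * x) * k / k) (at x)"
    by (rule DERIV_cdivide, auto intro!: derivative_eq_intros)+
  then show ?thesis
    unfolding sin_sqrt_def cos_sqrt_def k_def
    by (cases \<mu> "0::real" rule: linorder_cases) auto
qed

lemma DERIV_cos_sqrt: "((\<lambda>x. cos_sqrt x \<mu>) has_real_derivative - \<mu> * sin_sqrt x \<mu>) (at x)"
proof -
  define k where "k = sqrt \<bar>\<mu>\<bar>"
  have k: "k * z = \<bar>\<mu>\<bar> * (z / k)" for z
  proof -
    have "\<bar>\<mu>\<bar> * (z / k) = \<bar>\<mu>\<bar> / k * z" by simp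
    also have "\<bar>\<mu>\<bar> / k = k" unfolding k_def by (rule real_div_sqrt) simp
    finally show ?thesis ..
  qed
  have "((\<lambda>x. cos (k * x)) has_real_derivative - (k * sin (k * x))) (at x)"
    "((\<lambda>x. cosh (k * x)) has_real_derivative k * sinh (k * x)) (at x)"
    by (auto intro!: derivative_eq_intros)
  then have "((\<lambda>x. cos (k * x)) has_real_derivative - (\<bar>\<mu>\<bar> * (sin (k * x) / k))) (at x)"
    "((\<lambda>x. cosh (k * x)) has_real_derivative \<bar>\<mu>\<bar> * (sinh (k * x) / k)) (at x)"
    unfolding k .
  then show ?thesis
    unfolding sin_sqrt_def cos_sqrt_def k_def
    by (cases \<mu> "0::real" rule: linorder_cases) auto
qed

lemma DERIV_sin_sqrt' [derivative_intros]:
  "(f has_real_derivative f') (at x within X) \<Longrightarrow>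
    ((\<lambda>x. sin_sqrt (f x) \<mu>) has_real_derivative cos_sqrt (f x) \<mu> * f') (at x within X)"
  using DERIV_chain2[OF DERIV_sin_sqrt] by simp

lemma DERIV_cos_sqrt' [derivative_intros]:
  "(f has_real_derivative f') (at x within X) \<Longrightarrow>
    ((\<lambda>x. cos_sqrt (f x) \<mu>) has_real_derivative (- \<mu> * sin_sqrt (f x) \<mu>) * f') (at x within X)"
  using DERIV_chain2[OF DERIV_cos_sqrt] by simp

lemma continuous_sin_sqrt [continuous_intros]:
  "continuous_on S f \<Longrightarrow> continuous_on S (\<lambda>x. sin_sqrt (f x) \<mu>)"
  by (rule continuous_on_compose2[OF DERIV_continuous_on[OF DERIV_sin_sqrt]]) auto

lemma continuous_cos_sqrt [continuous_intros]:
  "continuous_on S f \<Longrightarrow> continuous_on S (\<lambda>x. cos_sqrt (f x) \<mu>)"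
  by (rule continuous_on_compose2[OF DERIV_continuous_on[OF DERIV_cos_sqrt]]) auto

lemma sin_sqrt_measurable [measurable (raw)]:
  assumes [measurable]: "f \<in> borel_measurable M" "g \<in> borel_measurable M"
  shows "(\<lambda>x. sin_sqrt (f x) (g x)) \<in> borel_measurable M"
proof -
  have [measurable]: "(sinh :: real \<Rightarrow> real) \<in> borel_measurable borel"
    by (intro borel_measurable_continuous_onI continuous_intros)
  show ?thesis unfolding sin_sqrt_def by measurable
qed

lemma cos_sqrt_measurable [measurable (raw)]:
  assumes [measurable]: "f \<in> borel_measurable M" "g \<in> borel_measurable M"
  shows "(\<lambda>x. cos_sqrt (f x) (g x)) \<in> borel_measurable M"
proof -
  have [measurable]: "(cosh :: real \<Rightarrow> real) \<in> borel_measurable borel"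
    by (intro borel_measurable_continuous_onI continuous_intros)
  show ?thesis unfolding cos_sqrt_def by measurable
qed

lemma sin_sqrt_0 [simp]: "sin_sqrt 0 \<mu> = 0" and cos_sqrt_0 [simp]: "cos_sqrt 0 \<mu> = 1"
  and sin_sqrt_minus [simp]: "sin_sqrt (- x) \<mu> = - sin_sqrt x \<mu>"
  and cos_sqrt_minus [simp]: "cos_sqrt (- x) \<mu> = cos_sqrt x \<mu>"
  by (auto simp: sin_sqrt_def cos_sqrt_def)

text \<open>S'' = -\<mu> S with S(0) = 0 and S'(0) = 1, integrated twice. Solutions are compared in
  this form, and lower bounds for transforms are read off from it.\<close>

lemma sin_sqrt_fixpoint:
  assumes "0 \<le> s"
  shows "sin_sqrt s \<mu> = s - \<mu> * second_primitive (\<lambda>r. sin_sqrt r \<mu>) s"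
proof -
  let ?F = "\<lambda>r. (s - r) * cos_sqrt r \<mu> + sin_sqrt r \<mu>"
  have "(\<integral>r. (s - r) * (- \<mu> * sin_sqrt r \<mu>) * indicator {0..s} r \<partial>lborel) = ?F s - ?F 0"
  proof (rule integral_FTC_Icc_real[OF assms])
    show "DERIV ?F r :> (s - r) * (- \<mu> * sin_sqrt r \<mu>)" for r
      by (auto intro!: derivative_eq_intros)
    have "continuous_on UNIV (\<lambda>r. (s - r) * (- \<mu> * sin_sqrt r \<mu>))" by (intro continuous_intros)
    then show "isCont (\<lambda>r. (s - r) * (- \<mu> * sin_sqrt r \<mu>)) r" for r
      by (simp add: continuous_on_eq_continuous_at)
  qed
  moreover have "(\<integral>r. (s - r) * (- \<mu> * sin_sqrt r \<mu>) * indicator {0..s} r \<partial>lborel) =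
    - \<mu> * second_primitive (\<lambda>r. sin_sqrt r \<mu>) s"
    unfolding second_primitive_def
    by (subst integral_mult_right_zero[symmetric]) (simp add: mult_ac)
  ultimately show ?thesis by simp
qed

lemma integral_diff_scaled:
  fixes f g :: "'a \<Rightarrow> real"
  assumes "integrable M f" "integrable M g"
  shows "(\<integral>x. a * f x - b * g x \<partial>M) = a * integral\<^sup>L M f - b * integral\<^sup>L M g"
  using assms by simp

text \<open>The kernel is used in the coordinates \<open>u \<xi> y = v(\<xi>, \<xi> + 2 y)\<close>, so that \<open>w(x,s) = u (s - x) x\<close>; in
  them the Goursat domain is a quadrant and integrals of \<open>q\<close> run along the second coordinate.\<close>

locale goursat_kernel =
  fixes q :: "real \<Rightarrow> real" and u :: "real \<Rightarrow> real \<Rightarrow> real"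
  assumes q_measurable [measurable]: "q \<in> borel_measurable borel"
    and q_integrable: "\<And>t. integrable lborel (\<lambda>x. indicator {0..t} x * q x)"
    and u_continuous: "continuous_on UNIV (\<lambda>p. u (fst p) (snd p))"
    and u_eq: "\<And>\<xi> y. 0 \<le> \<xi> \<Longrightarrow> 0 \<le> y \<Longrightarrow> u \<xi> y =
      - (1/2) * (\<integral>\<beta>. indicator {\<xi>..\<xi> + 2 * y} (2 * \<beta>) * q \<beta> \<partial>lborel)
      - (1/2) * (\<integral>\<alpha>. indicator {0..\<xi>} \<alpha> *
          (\<integral>\<beta>. indicator {\<xi> - \<alpha>..\<xi> - \<alpha> + 2 * y} (2 * \<beta>) * (q \<beta> * u \<alpha> \<beta>) \<partial>lborel) \<partial>lborel)"
begin

lemma u_measurable [measurable (raw)]: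
  assumes [measurable]: "f \<in> borel_measurable M" "g \<in> borel_measurable M"
  shows "(\<lambda>x. u (f x) (g x)) \<in> borel_measurable M"
proof -
  have "(\<lambda>p. u (fst p) (snd p)) \<in> borel_measurable (borel \<Otimes>\<^sub>M borel)"
    using borel_measurable_continuous_onI[OF u_continuous] by (simp add: borel_prod)
  from measurable_compose[OF measurable_Pair[OF assms] this] show ?thesis by simp
qed

lemma u_bound:
  obtains C where "0 \<le> C" "\<And>\<alpha> \<beta>. \<alpha> \<in> {0..s} \<Longrightarrow> \<beta> \<in> {0..s} \<Longrightarrow> \<bar>u \<alpha> \<beta>\<bar> \<le> C"
proof -
  have "compact ((\<lambda>p. u (fst p) (snd p)) ` ({0..s} \<times> {0..s}))"
    by (intro compact_continuous_image compact_Times continuous_on_subset[OF u_continuous]) auto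
  then obtain C where "\<forall>x\<in>(\<lambda>p. u (fst p) (snd p)) ` ({0..s} \<times> {0..s}). norm x \<le> C"
    using compact_imp_bounded bounded_iff by metis
  then have C: "\<bar>u \<alpha> \<beta>\<bar> \<le> C" if "\<alpha> \<in> {0..s}" "\<beta> \<in> {0..s}" for \<alpha> \<beta>
    using that by fastforce
  show ?thesis
    by (rule that[of "max 0 C"]) (use C in \<open>auto intro: max.coboundedI2\<close>)
qed

lemma qu_integrable: "integrable lborel (\<lambda>x. indicator {0..t} x * (q x * u \<alpha> x))"
proof -
  have c: "continuous_on {0..t} (\<lambda>x. (\<lambda>p. u (fst p) (snd p)) (\<alpha>, x))"
    by (rule continuous_on_compose2[OF u_continuous]) (auto intro!: continuous_intros)
  from compact_Icc_bound[OF c] obtain C where "\<And>x. x \<in> {0..t} \<Longrightarrow> \<bar>u \<alpha> x\<bar> \<le> C" by auto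
  then show ?thesis by (intro integrable_indicator_mult_bounded[OF q_integrable]) auto
qed

text \<open>The operator W in S = (I + W) \<phi>, since w(x, s) =
  \<open>u (s - x) x\<close>.\<close>

definition transmute :: "(real \<Rightarrow> real) \<Rightarrow> real \<Rightarrow> real" where
  "transmute h s = (\<integral>x. indicator {0..s} x * (u (s - x) x * h x) \<partial>lborel)"

lemma transmute_measurable [measurable]:
  assumes [measurable]: "h \<in> borel_measurable borel"
  shows "transmute h \<in> borel_measurable borel"
  unfolding transmute_def[abs_def] by measurable

lemma transmute_bound:
  assumes [measurable]: "h \<in> borel_measurable borel"
    and h: "integrable lborel (\<lambda>x. indicator {0..s} x * h x)"
  obtains C where "\<And>r. 0 \<le> r \<Longrightarrow> r \<le> s \<Longrightarrow> \<bar>transmute h r\<bar> \<le> C"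
proof -
  obtain C where C: "0 \<le> C" "\<And>\<alpha> \<beta>. \<alpha> \<in> {0..s} \<Longrightarrow> \<beta> \<in> {0..s} \<Longrightarrow> \<bar>u \<alpha> \<beta>\<bar> \<le> C"
    using u_bound by blast
  have "\<bar>transmute h r\<bar> \<le> (\<integral>x. \<bar>indicator {0..s} x * h x\<bar> * C \<partial>lborel)" if r: "0 \<le> r" "r \<le> s" for r
  proof -
    have "integrable lborel (\<lambda>x. indicator {0..r} x * (h x * u (r - x) x))"
      by (intro integrable_indicator_mult_bounded[where C=C] integrable_indicator_subset[OF h]) (use r C in auto)
    then have i: "integrable lborel (\<lambda>x. indicator {0..r} x * (u (r - x) x * h x))"
      by (simp add: mult_ac)
    have "\<bar>transmute h r\<bar> \<le> (\<integral>x. \<bar>indicator {0..r} x * (u (r - x) x * h x)\<bar> \<partial>lborel)"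
      unfolding transmute_def by (rule integral_abs_bound)
    also have "\<dots> \<le> (\<integral>x. \<bar>indicator {0..s} x * h x\<bar> * C \<partial>lborel)"
    proof (intro Bochner_Integration.integral_mono integrable_abs integrable_mult_left i h)
      show "\<bar>indicator {0..r} x * (u (r - x) x * h x)\<bar> \<le> \<bar>indicator {0..s} x * h x\<bar> * C" for x
        using r C(1) C(2)[of "r - x" x] by (auto simp: indicator_def abs_mult mult.commute[of _ C] intro!: mult_right_mono)
    qed
    finally show ?thesis .
  qed
  then show ?thesis by (rule that)
qed

lemma integrable_transmute:
  assumes [measurable]: "h \<in> borel_measurable borel"
    and h: "integrable lborel (\<lambda>x. indicator {0..s} x * h x)"
  shows "integrable lborel (\<lambda>r. indicator {0..s} r * transmute h r)"
proof -
  obtain C where "\<And>r. 0 \<le> r \<Longrightarrow> r \<le> s \<Longrightarrow> \<bar>transmute h r\<bar> \<le> C"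
    by (rule transmute_bound[OF assms]) blast
  then show ?thesis by (intro integrable_indicator_bounded[where C=C]) auto
qed

text \<open>Insert the Goursat equation for \<open>u (s - x) x\<close> and exchange integrations.
  The inhomogeneous term becomes an average with weight q at time s; the term with parameter
  \<alpha> becomes an average with weight \<open>q \<beta> * u \<alpha> \<beta>\<close> at the
  earlier time s - \<alpha>.\<close>

lemma transmute_expand:
  assumes [measurable]: "h \<in> borel_measurable borel"
    and h: "integrable lborel (\<lambda>x. indicator {0..s} x * h x)" and s: "0 \<le> s"
  shows "transmute h s = - (1/2) * wave_average q h s
    - (1/2) * (\<integral>\<alpha>. indicator {0..s} \<alpha> * wave_average (\<lambda>\<beta>. q \<beta> * u \<alpha> \<beta>) h (s - \<alpha>) \<partial>lborel)"
proof -
  let ?A = "\<lambda>x. \<integral>\<beta>. indicator {s - x..s + x} (2 * \<beta>) * q \<beta> \<partial>lborel"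
  let ?P = "\<lambda>\<alpha> x. \<integral>\<beta>. indicator {s - \<alpha> - x..s - \<alpha> + x} (2 * \<beta>) * (q \<beta> * u \<alpha> \<beta>) \<partial>lborel"
  obtain C where C: "0 \<le> C" "\<And>\<alpha> \<beta>. \<alpha> \<in> {0..s} \<Longrightarrow> \<beta> \<in> {0..s} \<Longrightarrow> \<bar>u \<alpha> \<beta>\<bar> \<le> C"
    using u_bound by blast
  let ?Q = "\<integral>x. \<bar>indicator {0..s} x * q x\<bar> \<partial>lborel"
  have Q: "integrable lborel (\<lambda>x. \<bar>indicator {0..s} x * q x\<bar>)" using q_integrable by auto
  have Q0: "0 \<le> ?Q" by simp
  have Pb: "\<bar>?P \<alpha> x\<bar> \<le> ?Q * C" if ax: "0 \<le> \<alpha>" "0 \<le> x" "\<alpha> + x \<le> s" for \<alpha> x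
  proof -
    have "\<bar>?P \<alpha> x\<bar> \<le> (\<integral>\<beta>. \<bar>indicator {s - \<alpha> - x..s - \<alpha> + x} (2 * \<beta>) * (q \<beta> * u \<alpha> \<beta>)\<bar> \<partial>lborel)"
      by (rule integral_abs_bound)
    also have "\<dots> \<le> (\<integral>\<beta>. \<bar>indicator {0..s} \<beta> * q \<beta>\<bar> * C \<partial>lborel)"
      using ax C Q by (intro integral_mono' integrable_mult_left)
        (auto simp: indicator_def abs_mult intro!: mult_left_mono)
    finally show ?thesis by simp
  qed
  have P0b: "\<bar>?A x\<bar> \<le> ?Q" if ax: "0 \<le> x" "x \<le> s" for x
  proof -
    have "\<bar>?A x\<bar> \<le> (\<integral>\<beta>. \<bar>indicator {s - x..s + x} (2 * \<beta>) * q \<beta>\<bar> \<partial>lborel)"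
      by (rule integral_abs_bound)
    also have "\<dots> \<le> ?Q"
      using ax Q by (intro integral_mono') (auto simp: indicator_def abs_mult)
    finally show ?thesis by simp
  qed
  let ?F = "\<lambda>x \<alpha>. indicator {0..s} x * h x * (indicator {0..s - x} \<alpha> * ?P \<alpha> x)"
  have Fb: "\<bar>?F x \<alpha>\<bar> \<le> \<bar>indicator {0..s} x * h x\<bar> * (indicator {0..s} \<alpha> * (?Q * C))" for x \<alpha>
  proof (cases "0 \<le> x \<and> x \<le> s \<and> 0 \<le> \<alpha> \<and> \<alpha> \<le> s - x")
    case True
    then show ?thesis using Pb[of \<alpha> x] by (auto simp: abs_mult intro!: mult_left_mono)
  next
    case False
    then have "?F x \<alpha> = 0" by (auto simp: indicator_def)
    moreover have "0 \<le> \<bar>indicator {0..s} x * h x\<bar> * (indicator {0..s} \<alpha> * (?Q * C))"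
      using Q0 C by simp
    ultimately show ?thesis by (simp only: abs_zero)
  qed
  have Fm: "(\<lambda>(x, \<alpha>). ?F x \<alpha>) \<in> borel_measurable (borel \<Otimes>\<^sub>M borel)" by measurable
  note swap = lborel_Fubini_swap_bounded[OF Fm Fb integrable_abs[OF h] integrable_indicator_interval]
  have i0: "integrable lborel (\<lambda>x. indicator {0..s} x * (h x * ?A x))"
    by (rule integrable_indicator_mult_bounded[OF h, where C="?Q"]) (use P0b in auto)
  have "transmute h s = (\<integral>x. - (1/2) * (indicator {0..s} x * (h x * ?A x)) - (1/2) * (\<integral>\<alpha>. ?F x \<alpha> \<partial>lborel) \<partial>lborel)"
    unfolding transmute_def
  proof (intro Bochner_Integration.integral_cong refl)
    fix x
    have F: "(\<integral>\<alpha>. ?F x \<alpha> \<partial>lborel) = indicator {0..s} x * h x * (\<integral>\<alpha>. indicator {0..s - x} \<alpha> * ?P \<alpha> x \<partial>lborel)"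
      by simp
    show "indicator {0..s} x * (u (s - x) x * h x) =
      - (1/2) * (indicator {0..s} x * (h x * ?A x)) - (1/2) * (\<integral>\<alpha>. ?F x \<alpha> \<partial>lborel)"
    proof (cases "x \<in> {0..s}")
      case True
      then have one: "indicator {0..s} x = (1::real)" by simp
      have e: "s - x + 2 * x = s + x" "\<And>\<alpha>. s - x - \<alpha> = s - \<alpha> - x" "\<And>\<alpha>. s - \<alpha> - x + 2 * x = s - \<alpha> + x" by auto
      have ue: "u (s - x) x = - (1/2) * ?A x - (1/2) * (\<integral>\<alpha>. indicator {0..s - x} \<alpha> * ?P \<alpha> x \<partial>lborel)"
        using True by (subst u_eq) (auto simp only: e atLeastAtMost_iff diff_ge_0_iff_ge)
      have ring: "(- (1/2) * a - (1/2) * b) * c = - (1/2) * (c * a) - (1/2) * (c * b)" for a b c :: real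
        by (simp add: algebra_simps)
      show ?thesis unfolding F unfolding ue one by (simp only: ring mult_1_left)
    qed simp
  qed
  also have "\<dots> = - (1/2) * (\<integral>x. indicator {0..s} x * (h x * ?A x) \<partial>lborel) - (1/2) * (\<integral>x. (\<integral>\<alpha>. ?F x \<alpha> \<partial>lborel) \<partial>lborel)"
    by (rule integral_diff_scaled[OF i0 swap(2)])
  also have "(\<integral>x. (\<integral>\<alpha>. ?F x \<alpha> \<partial>lborel) \<partial>lborel) = (\<integral>\<alpha>. (\<integral>x. ?F x \<alpha> \<partial>lborel) \<partial>lborel)" by (rule swap(1))
  also have "\<dots> = (\<integral>\<alpha>. indicator {0..s} \<alpha> * wave_average (\<lambda>\<beta>. q \<beta> * u \<alpha> \<beta>) h (s - \<alpha>) \<partial>lborel)"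
  proof (intro Bochner_Integration.integral_cong refl)
    fix \<alpha>
    have "(\<integral>x. ?F x \<alpha> \<partial>lborel) = (\<integral>x. indicator {0..s} \<alpha> * (indicator {0..s - \<alpha>} x * (h x * ?P \<alpha> x)) \<partial>lborel)"
      by (rule Bochner_Integration.integral_cong) (auto simp: indicator_def)
    also have "\<dots> = indicator {0..s} \<alpha> * (\<integral>x. indicator {0..s - \<alpha>} x * (h x * ?P \<alpha> x) \<partial>lborel)" by simp
    also have "\<dots> = indicator {0..s} \<alpha> * wave_average (\<lambda>\<beta>. q \<beta> * u \<alpha> \<beta>) h (s - \<alpha>)"
    proof (cases "\<alpha> \<in> {0..s}")
      case True
      then have "integrable lborel (\<lambda>x. indicator {0..s - \<alpha>} x * h x)"
        by (intro integrable_indicator_subset[OF h]) auto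
      then show ?thesis using True qu_integrable unfolding wave_average_def
        by (subst integral_characteristic_triangle) auto
    qed simp
    finally show "(\<integral>x. ?F x \<alpha> \<partial>lborel) = indicator {0..s} \<alpha> * wave_average (\<lambda>\<beta>. q \<beta> * u \<alpha> \<beta>) h (s - \<alpha>)" .
  qed
  also have "(\<integral>x. indicator {0..s} x * (h x * ?A x) \<partial>lborel) = wave_average q h s"
    unfolding wave_average_def by (rule integral_characteristic_triangle) (use h q_integrable s in auto)
  finally show ?thesis .
qed

end

lemma integrable_indicator_Icc [simp]: "integrable lborel (indicator {a..b::real} :: real \<Rightarrow> real)"
  by (rule integrable_real_indicator) (auto simp: emeasure_lborel_Icc_eq)

section \<open>The transmutation identity\<close>

context goursat_kernel
begin

text \<open>In differential form (W \<phi>)'' = -q \<phi> - W(q \<phi>) + W \<phi>'' with \<phi>'' =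
  h: the wave equation of the kernel and its values on the diagonal, tested against \<phi>. As q is
  merely integrable, the kernel is never differentiated; instead both averages of
  \<open>transmute_expand\<close> are rewritten by \<open>wave_average_solution\<close>, and the
  averages of h recombine to W h.\<close>

lemma transmute_solution_eq:
  fixes \<phi> \<phi>' h :: "real \<Rightarrow> real"
  assumes der: "\<And>z. (\<phi> has_real_derivative \<phi>' z) (at z)" and cont: "continuous_on UNIV \<phi>'"
    and odd: "\<And>z. \<phi> (- z) = - \<phi> z" and even: "\<And>z. \<phi>' (- z) = \<phi>' z"
    and hm [measurable]: "h \<in> borel_measurable borel"
    and h: "integrable lborel (\<lambda>x. indicator {0..s} x * h x)"
    and prim: "\<And>z. 0 \<le> z \<Longrightarrow> \<phi>' z = \<phi>' 0 + primitive h z" and s: "0 \<le> s"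
  shows "transmute \<phi> s = - second_primitive (\<lambda>x. q x * \<phi> x) s
    - second_primitive (transmute (\<lambda>x. q x * \<phi> x)) s + second_primitive (transmute h) s"
proof -
  have c\<phi>: "continuous_on UNIV \<phi>" using der by (meson DERIV_isCont continuous_at_imp_continuous_on)
  note [measurable] = borel_measurable_continuous_onI[OF c\<phi>]
  obtain C\<phi> where C\<phi>: "\<And>x. x \<in> {0..s} \<Longrightarrow> \<bar>\<phi> x\<bar> \<le> C\<phi>"
    using compact_Icc_bound[OF continuous_on_subset[OF c\<phi> subset_UNIV]] by blast
  obtain C where C: "0 \<le> C" "\<And>\<alpha> \<beta>. \<alpha> \<in> {0..s} \<Longrightarrow> \<beta> \<in> {0..s} \<Longrightarrow> \<bar>u \<alpha> \<beta>\<bar> \<le> C"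
    using u_bound by blast
  have i\<phi>: "integrable lborel (\<lambda>x. indicator {0..t} x * \<phi> x)" if "t \<le> s" for t
    using C\<phi> that by (intro integrable_indicator_bounded[where C=C\<phi>]) auto
  have q\<phi>: "integrable lborel (\<lambda>x. indicator {0..t} x * (q x * \<phi> x))" if "t \<le> s" for t
    using C\<phi> that by (intro integrable_indicator_mult_bounded[OF q_integrable, where C=C\<phi>]) auto
  have ih: "integrable lborel (\<lambda>x. indicator {0..t} x * h x)" if "t \<le> s" for t
    by (rule integrable_indicator_subset[OF h]) (use that in auto)
  have Dq: "integrable lborel (\<lambda>x. indicator {0..s} x * (\<bar>q x\<bar> * c))" for c
  proof -
    have "integrable lborel (\<lambda>x. \<bar>indicator {0..s} x * q x\<bar> * c)"
      by (intro integrable_mult_left integrable_abs q_integrable)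
    then show ?thesis by (simp add: abs_mult mult.assoc)
  qed
  have W: "wave_average g \<phi> t = 2 * second_primitive (\<lambda>\<beta>. g \<beta> * \<phi> \<beta>) t + second_primitive (wave_average g h) t"
    if "g \<in> borel_measurable borel" "integrable lborel (\<lambda>x. indicator {0..t} x * g x)" "0 \<le> t" "t \<le> s" for g t
    by (rule wave_average_solution[OF der cont odd even hm that(1) ih[OF that(4)] prim that(2,3)])
  let ?f = "\<lambda>\<alpha> \<beta>. q \<beta> * u \<alpha> \<beta> * \<phi> \<beta>"
  let ?g = "\<lambda>\<alpha>. wave_average (\<lambda>\<beta>. q \<beta> * u \<alpha> \<beta>) h"
  have fm: "(\<lambda>(\<alpha>, \<beta>). ?f \<alpha> \<beta>) \<in> borel_measurable (borel \<Otimes>\<^sub>M borel)" by measurable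
  have gm: "(\<lambda>(\<alpha>, \<beta>). ?g \<alpha> \<beta>) \<in> borel_measurable (borel \<Otimes>\<^sub>M borel)"
    unfolding wave_average_def by measurable
  have fb: "\<bar>?f \<alpha> \<beta>\<bar> \<le> \<bar>q \<beta>\<bar> * (C * C\<phi>)" if "0 \<le> \<alpha>" "\<alpha> \<le> s" "0 \<le> \<beta>" "\<beta> \<le> s" for \<alpha> \<beta>
  proof -
    have "\<bar>u \<alpha> \<beta>\<bar> * \<bar>\<phi> \<beta>\<bar> \<le> C * C\<phi>" using C(1) C(2)[of \<alpha> \<beta>] C\<phi>[of \<beta>] that by (intro mult_mono) auto
    then show ?thesis by (simp add: abs_mult mult.assoc mult_left_mono)
  qed
  have gb: "\<bar>?g \<alpha> \<beta>\<bar> \<le> (\<integral>x. indicator {0..s} x * (\<bar>q x\<bar> * C) \<partial>lborel) * (2 * (\<integral>x. indicator {0..s} x * \<bar>h x\<bar> \<partial>lborel))"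
    if "0 \<le> \<alpha>" "\<alpha> \<le> s" "0 \<le> \<beta>" "\<beta> \<le> s" for \<alpha> \<beta>
    by (rule wave_average_bound[OF _ _ h qu_integrable _ Dq])
      (use that C in \<open>auto simp: abs_mult intro!: mult_left_mono\<close>)
  have convf: "(\<integral>\<alpha>. indicator {0..s} \<alpha> * second_primitive (?f \<alpha>) (s - \<alpha>) \<partial>lborel) =
      second_primitive (\<lambda>\<sigma>. \<integral>\<alpha>. indicator {0..\<sigma>} \<alpha> * ?f \<alpha> (\<sigma> - \<alpha>) \<partial>lborel) s"
    "integrable lborel (\<lambda>\<alpha>. indicator {0..s} \<alpha> * second_primitive (?f \<alpha>) (s - \<alpha>))"
    by (rule second_primitive_convolution[OF fm _ Dq s], erule (3) fb)+
  have convg: "(\<integral>\<alpha>. indicator {0..s} \<alpha> * second_primitive (?g \<alpha>) (s - \<alpha>) \<partial>lborel) =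
      second_primitive (\<lambda>\<sigma>. \<integral>\<alpha>. indicator {0..\<sigma>} \<alpha> * ?g \<alpha> (\<sigma> - \<alpha>) \<partial>lborel) s"
    "integrable lborel (\<lambda>\<alpha>. indicator {0..s} \<alpha> * second_primitive (?g \<alpha>) (s - \<alpha>))"
    by (rule second_primitive_convolution[OF gm _ integrable_indicator_interval s], erule (3) gb)+
  \<comment> \<open>The substitution \<alpha> = \<sigma> - x turns the convolution in \<alpha> into
    W applied to q \<phi>.\<close>
  have I1: "(\<integral>\<alpha>. indicator {0..s} \<alpha> * second_primitive (?f \<alpha>) (s - \<alpha>) \<partial>lborel) =
    second_primitive (transmute (\<lambda>x. q x * \<phi> x)) s"
  proof (rule trans[OF convf(1)], rule second_primitive_cong)
    fix \<sigma> :: real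
    have "(\<integral>\<alpha>. indicator {0..\<sigma>} \<alpha> * ?f \<alpha> (\<sigma> - \<alpha>) \<partial>lborel) =
      (\<integral>x. indicator {0..\<sigma>} (\<sigma> + (-1) * x) * ?f (\<sigma> + (-1) * x) (\<sigma> - (\<sigma> + (-1) * x)) \<partial>lborel)"
      by (subst lborel_integral_real_affine[of "-1" _ \<sigma>]) auto
    also have "\<dots> = transmute (\<lambda>x. q x * \<phi> x) \<sigma>"
      unfolding transmute_def by (intro Bochner_Integration.integral_cong) (auto simp: indicator_def)
    finally show "(\<integral>\<alpha>. indicator {0..\<sigma>} \<alpha> * ?f \<alpha> (\<sigma> - \<alpha>) \<partial>lborel) = transmute (\<lambda>x. q x * \<phi> x) \<sigma>" .
  qed
  have i_wave: "integrable lborel (\<lambda>r. indicator {0..s} r * wave_average q h r)"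
  proof (rule integrable_indicator_bounded)
    show "\<bar>wave_average q h r\<bar> \<le> (\<integral>x. indicator {0..s} x * (\<bar>q x\<bar> * 1) \<partial>lborel) * (2 * (\<integral>x. indicator {0..s} x * \<bar>h x\<bar> \<partial>lborel))"
      if "r \<in> {0..s}" for r
      by (rule wave_average_bound[OF _ _ h q_integrable _ Dq]) (use that in auto)
  qed measurable
  \<comment> \<open>This is \<open>transmute_expand\<close> for h, read backwards; its term
    \<open>wave_average q h\<close> cancels against the one coming from
    \<open>wave_average q \<phi>\<close>.\<close>
  have I2: "(\<integral>\<alpha>. indicator {0..s} \<alpha> * second_primitive (?g \<alpha>) (s - \<alpha>) \<partial>lborel) =
    (- 2) * second_primitive (transmute h) s + (- 1) * second_primitive (wave_average q h) s"
  proof -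
    have "(\<integral>\<alpha>. indicator {0..s} \<alpha> * second_primitive (?g \<alpha>) (s - \<alpha>) \<partial>lborel) =
      second_primitive (\<lambda>\<sigma>. (- 2) * transmute h \<sigma> + (- 1) * wave_average q h \<sigma>) s"
    proof (rule trans[OF convg(1)], rule second_primitive_cong)
      fix \<sigma> assume "0 \<le> \<sigma>" "\<sigma> \<le> s"
      then show "(\<integral>\<alpha>. indicator {0..\<sigma>} \<alpha> * ?g \<alpha> (\<sigma> - \<alpha>) \<partial>lborel) = (- 2) * transmute h \<sigma> + (- 1) * wave_average q h \<sigma>"
        using transmute_expand[OF hm ih, of \<sigma>] by simp
    qed
    also have "\<dots> = (- 2) * second_primitive (transmute h) s + (- 1) * second_primitive (wave_average q h) s"
      by (rule second_primitive_linear[OF integrable_transmute[OF hm h] i_wave])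
    finally show ?thesis .
  qed
  have "(\<integral>\<alpha>. indicator {0..s} \<alpha> * wave_average (\<lambda>\<beta>. q \<beta> * u \<alpha> \<beta>) \<phi> (s - \<alpha>) \<partial>lborel) =
    (\<integral>\<alpha>. 2 * (indicator {0..s} \<alpha> * second_primitive (?f \<alpha>) (s - \<alpha>)) +
      indicator {0..s} \<alpha> * second_primitive (?g \<alpha>) (s - \<alpha>) \<partial>lborel)"
  proof (intro Bochner_Integration.integral_cong refl)
    fix \<alpha>
    have "wave_average (\<lambda>\<beta>. q \<beta> * u \<alpha> \<beta>) \<phi> (s - \<alpha>) =
      2 * second_primitive (?f \<alpha>) (s - \<alpha>) + second_primitive (?g \<alpha>) (s - \<alpha>)" if "\<alpha> \<in> {0..s}"
      using that by (intro W qu_integrable) auto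
    then show "indicator {0..s} \<alpha> * wave_average (\<lambda>\<beta>. q \<beta> * u \<alpha> \<beta>) \<phi> (s - \<alpha>) =
      2 * (indicator {0..s} \<alpha> * second_primitive (?f \<alpha>) (s - \<alpha>)) +
      indicator {0..s} \<alpha> * second_primitive (?g \<alpha>) (s - \<alpha>)"
      by (cases "\<alpha> \<in> {0..s}") auto
  qed
  also have "\<dots> = 2 * (\<integral>\<alpha>. indicator {0..s} \<alpha> * second_primitive (?f \<alpha>) (s - \<alpha>) \<partial>lborel) +
    (\<integral>\<alpha>. indicator {0..s} \<alpha> * second_primitive (?g \<alpha>) (s - \<alpha>) \<partial>lborel)"
    using convf(2) convg(2) by simp
  finally have I: "(\<integral>\<alpha>. indicator {0..s} \<alpha> * wave_average (\<lambda>\<beta>. q \<beta> * u \<alpha> \<beta>) \<phi> (s - \<alpha>) \<partial>lborel) =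
    2 * second_primitive (transmute (\<lambda>x. q x * \<phi> x)) s +
    ((- 2) * second_primitive (transmute h) s + (- 1) * second_primitive (wave_average q h) s)"
    unfolding I1 I2 .
  have "transmute \<phi> s = - (1/2) * wave_average q \<phi> s
    - (1/2) * (\<integral>\<alpha>. indicator {0..s} \<alpha> * wave_average (\<lambda>\<beta>. q \<beta> * u \<alpha> \<beta>) \<phi> (s - \<alpha>) \<partial>lborel)"
    by (rule transmute_expand[OF _ i\<phi> s]) auto
  moreover have "wave_average q \<phi> s = 2 * second_primitive (\<lambda>x. q x * \<phi> x) s + second_primitive (wave_average q h) s"
    by (rule W) (use q_integrable s in auto)
  ultimately show ?thesis unfolding I by (simp add: field_simps)
qed

text \<open>The right-hand side \<open>Y\<close> solves \<open>Y'' = - \<mu> Y\<close> in integrated form.\<close>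

theorem sin_sqrt_eq_transmute:
  fixes \<phi> \<phi>' :: "real \<Rightarrow> real"
  assumes der: "\<And>z. (\<phi> has_real_derivative \<phi>' z) (at z)" and cont: "continuous_on UNIV \<phi>'"
    and odd: "\<And>z. \<phi> (- z) = - \<phi> z" and even: "\<And>z. \<phi>' (- z) = \<phi>' z" and one: "\<phi>' 0 = 1"
    and prim: "\<And>z. 0 \<le> z \<Longrightarrow> \<phi>' z = \<phi>' 0 + primitive (\<lambda>x. (q x - \<mu>) * \<phi> x) z" and s: "0 \<le> s"
  shows "sin_sqrt s \<mu> = \<phi> s + transmute \<phi> s"
proof -
  have c\<phi>: "continuous_on UNIV \<phi>" using der by (meson DERIV_isCont continuous_at_imp_continuous_on)
  note [measurable] = borel_measurable_continuous_onI[OF c\<phi>]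
  let ?h = "\<lambda>x. (q x - \<mu>) * \<phi> x"
  obtain C\<phi> where C\<phi>: "\<And>x. x \<in> {0..s} \<Longrightarrow> \<bar>\<phi> x\<bar> \<le> C\<phi>"
    using compact_Icc_bound[OF continuous_on_subset[OF c\<phi> subset_UNIV]] by blast
  have i\<phi>: "integrable lborel (\<lambda>x. indicator {0..t} x * \<phi> x)" if "t \<le> s" for t
    using C\<phi> that by (intro integrable_indicator_bounded[where C=C\<phi>]) auto
  have q\<phi>: "integrable lborel (\<lambda>x. indicator {0..t} x * (q x * \<phi> x))" if "t \<le> s" for t
    using C\<phi> that by (intro integrable_indicator_mult_bounded[OF q_integrable, where C=C\<phi>]) auto
  have ih: "integrable lborel (\<lambda>x. indicator {0..t} x * ?h x)" if "t \<le> s" for t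
  proof -
    have "integrable lborel (\<lambda>x. indicator {0..t} x * (q x * \<phi> x) - \<mu> * (indicator {0..t} x * \<phi> x))"
      using i\<phi> q\<phi> that by simp
    then show ?thesis by (simp add: algebra_simps)
  qed
  have iT: "integrable lborel (\<lambda>x. indicator {0..t} x * transmute \<phi> x)"
    "integrable lborel (\<lambda>x. indicator {0..t} x * transmute (\<lambda>x. q x * \<phi> x) x)" if "t \<le> s" for t
    using i\<phi> q\<phi> that by (auto intro!: integrable_transmute)
  define Y where "Y = (\<lambda>s. \<phi> s + transmute \<phi> s)"
  have [measurable]: "Y \<in> borel_measurable borel" unfolding Y_def by simp
  have Y: "Y t = t - \<mu> * second_primitive Y t" if t: "0 \<le> t" "t \<le> s" for t
  proof -
    have Th: "transmute ?h r = 1 * transmute (\<lambda>x. q x * \<phi> x) r + (- \<mu>) * transmute \<phi> r" if r: "0 \<le> r" "r \<le> t" for r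
    proof -
      obtain C where C: "0 \<le> C" "\<And>\<alpha> \<beta>. \<alpha> \<in> {0..r} \<Longrightarrow> \<beta> \<in> {0..r} \<Longrightarrow> \<bar>u \<alpha> \<beta>\<bar> \<le> C"
        using u_bound by blast
      have "integrable lborel (\<lambda>x. indicator {0..r} x * (f x * u (r - x) x))"
        if "integrable lborel (\<lambda>x. indicator {0..r} x * f x)" for f
        using C by (intro integrable_indicator_mult_bounded[OF that, where C=C]) auto
      from this[OF i\<phi>] this[OF q\<phi>] r t
      have "integrable lborel (\<lambda>x. indicator {0..r} x * (u (r - x) x * \<phi> x))"
        "integrable lborel (\<lambda>x. indicator {0..r} x * (u (r - x) x * (q x * \<phi> x)))"
        by (simp_all add: mult_ac)
      moreover have "transmute ?h r = (\<integral>x. indicator {0..r} x * (u (r - x) x * (q x * \<phi> x)) -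
          \<mu> * (indicator {0..r} x * (u (r - x) x * \<phi> x)) \<partial>lborel)"
        unfolding transmute_def by (intro Bochner_Integration.integral_cong) (auto simp: algebra_simps)
      ultimately show ?thesis by (simp add: transmute_def)
    qed
    have "second_primitive (transmute ?h) t =
      1 * second_primitive (transmute (\<lambda>x. q x * \<phi> x)) t + (- \<mu>) * second_primitive (transmute \<phi>) t"
      using second_primitive_linear[OF iT(2) iT(1), of t 1 "- \<mu>"] t
      by (subst second_primitive_cong[OF Th]) auto
    moreover have "transmute \<phi> t = - second_primitive (\<lambda>x. q x * \<phi> x) t
      - second_primitive (transmute (\<lambda>x. q x * \<phi> x)) t + second_primitive (transmute ?h) t"
      by (rule transmute_solution_eq[OF der cont odd even _ ih prim]) (use t in auto)
    \<comment> \<open>Taylor's formula with integral remainder, from \<phi>(0) = 0 and \<phi>'(0) =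
      1.\<close>
    moreover have "\<phi> t = t + second_primitive ?h t"
    proof -
      let ?F = "\<lambda>r. (t - r) * (primitive ?h r)"
      have "\<phi> t - \<phi> 0 = (\<integral>r. \<phi>' r * indicator {0..t} r \<partial>lborel)"
        using der cont t by (subst integral_FTC_Icc_real[where F=\<phi>]) (auto simp: continuous_on_eq_continuous_at)
      also have "\<dots> = (\<integral>r. indicator {0..t} r * 1 + indicator {0..t} r * primitive ?h r \<partial>lborel)"
        by (intro Bochner_Integration.integral_cong) (auto simp: indicator_def prim one)
      also have "\<dots> = t + (\<integral>r. indicator {0..t} r * primitive ?h r \<partial>lborel)"
      proof -
        have "integrable lborel (\<lambda>r. indicator {0..t} r * primitive ?h r)"
          using primitive_bound[OF _ ih[OF t(2)]]
          by (intro integrable_indicator_bounded) auto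
        then show ?thesis
          using t integrable_indicator_interval[of 0 t 1] by (subst Bochner_Integration.integral_add) auto
      qed
      also have "(\<integral>r. indicator {0..t} r * primitive ?h r \<partial>lborel) =
        (\<integral>r. (\<integral>x. indicator {0..t} r * (indicator {0..t} x * ?h x) * indicator {x..t} r \<partial>lborel) \<partial>lborel)"
      proof (intro Bochner_Integration.integral_cong refl)
        fix r
        have "(\<integral>x. indicator {0..t} r * (indicator {0..t} x * ?h x) * indicator {x..t} r \<partial>lborel) =
          (\<integral>x. indicator {0..t} r * (indicator {0..r} x * ?h x) \<partial>lborel)"
          by (intro Bochner_Integration.integral_cong) (auto simp: indicator_def)
        then show "indicator {0..t} r * primitive ?h r =
          (\<integral>x. indicator {0..t} r * (indicator {0..t} x * ?h x) * indicator {x..t} r \<partial>lborel)"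
          by (simp add: primitive_def)
      qed
      also have "\<dots> = (\<integral>x. (\<integral>r. indicator {0..t} r * (indicator {0..t} x * ?h x) * indicator {x..t} r \<partial>lborel) \<partial>lborel)"
      proof (rule lborel_Fubini_swap_bounded(1))
        show "integrable lborel (\<lambda>x. indicator {0..t} x * (1::real))" by simp
        show "integrable lborel (\<lambda>x. \<bar>indicator {0..t} x * ?h x\<bar>)" using ih t by auto
        show "\<bar>indicator {0..t} r * (indicator {0..t} x * ?h x) * indicator {x..t} r\<bar>
          \<le> indicator {0..t} r * 1 * \<bar>indicator {0..t} x * ?h x\<bar>" for r x
          by (auto simp: indicator_def abs_mult)
      qed measurable
      also have "\<dots> = second_primitive ?h t"
        unfolding second_primitive_def
      proof (intro Bochner_Integration.integral_cong refl)
        fix x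
        have "(\<integral>r. indicator {0..t} r * (indicator {0..t} x * ?h x) * indicator {x..t} r \<partial>lborel) =
          (\<integral>r. (indicator {0..t} x * ?h x) * (indicator {x..t} r * 1) \<partial>lborel)"
          by (intro Bochner_Integration.integral_cong) (auto simp: indicator_def)
        also have "\<dots> = indicator {0..t} x * ((t - x) * ?h x)"
          by (cases "x \<in> {0..t}") simp_all
        finally show "(\<integral>r. indicator {0..t} r * (indicator {0..t} x * ?h x) * indicator {x..t} r \<partial>lborel) =
          indicator {0..t} x * ((t - x) * ?h x)" .
      qed
      finally show ?thesis using odd[of 0] by simp
    qed
    moreover have "second_primitive ?h t = 1 * second_primitive (\<lambda>x. q x * \<phi> x) t + (- \<mu>) * second_primitive \<phi> t"
      using second_primitive_linear[OF q\<phi> i\<phi>, of t 1 "- \<mu>"] t by (simp add: algebra_simps)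
    moreover have "second_primitive Y t = 1 * second_primitive \<phi> t + 1 * second_primitive (transmute \<phi>) t"
      using second_primitive_linear[OF i\<phi> iT(1), of t 1 1] t by (simp add: Y_def)
    \<comment> \<open>All terms containing q cancel; what remains is -\<mu> times the second
      primitive of Y.\<close>
    ultimately show ?thesis unfolding Y_def by (simp add: algebra_simps)
  qed
  let ?S = "\<lambda>r. sin_sqrt r \<mu>"
  obtain CS where CS: "\<And>x. x \<in> {0..s} \<Longrightarrow> \<bar>?S x\<bar> \<le> CS"
    using compact_Icc_bound[of 0 s ?S] continuous_sin_sqrt[OF continuous_on_id] by blast
  have iS: "integrable lborel (\<lambda>x. indicator {0..t} x * ?S x)" if "t \<le> s" for t
    using CS that by (intro integrable_indicator_bounded[where C=CS]) auto
  have iY: "integrable lborel (\<lambda>x. indicator {0..t} x * Y x)" if "t \<le> s" for t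
  proof -
    have "integrable lborel (\<lambda>x. indicator {0..t} x * \<phi> x + indicator {0..t} x * transmute \<phi> x)"
      using i\<phi> iT that by simp
    then show ?thesis by (simp add: Y_def algebra_simps)
  qed
  obtain CT where CT: "\<And>r. 0 \<le> r \<Longrightarrow> r \<le> s \<Longrightarrow> \<bar>transmute \<phi> r\<bar> \<le> CT"
    by (rule transmute_bound[OF _ i\<phi>]) auto
  \<comment> \<open>The difference is written as a linear combination to match
    \<open>second_primitive_linear\<close>.\<close>
  have "1 * Y s + (- 1) * ?S s = 0"
  proof (rule second_primitive_fixpoint_zero[where c="- \<mu>" and d="\<lambda>s. 1 * Y s + (- 1) * ?S s" and B=s and M="C\<phi> + CT + CS"])
    fix t assume t: "0 \<le> t" "t \<le> s"
    show "\<bar>1 * Y t + (- 1) * ?S t\<bar> \<le> C\<phi> + CT + CS"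
      using C\<phi>[of t] CT[of t] CS[of t] t by (auto simp: Y_def)
    show "1 * Y t + (- 1) * ?S t = - \<mu> * second_primitive (\<lambda>s. 1 * Y s + (- 1) * ?S s) t"
      unfolding second_primitive_linear[OF iY iS, OF t(2) t(2)]
      using Y[OF t] sin_sqrt_fixpoint[OF t(1), of \<mu>] by (simp add: algebra_simps)
  qed (use s in auto)
  then show ?thesis by (simp add: Y_def)
qed

end

section \<open>The dual transmutation at the axis\<close>

lemma interval_average_tendsto:
  fixes G :: "real \<Rightarrow> real"
  assumes G: "continuous_on UNIV G"
  shows "((\<lambda>x. (1 / (2 * x)) * (\<integral>s. indicator {z - x..z + x} s * G s \<partial>lborel)) \<longlongrightarrow> G z) (at_right 0)"
proof (rule tendstoI)
  fix e :: real assume e: "e > 0"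
  have "isCont G z" using G by (simp add: continuous_on_eq_continuous_at)
  then obtain d where d: "d > 0" "\<And>s. \<bar>s - z\<bar> < d \<Longrightarrow> \<bar>G s - G z\<bar> < e / 2"
    using e unfolding continuous_at_eps_delta dist_real_def by (metis half_gt_zero)
  show "eventually (\<lambda>x. dist ((1 / (2 * x)) * (\<integral>s. indicator {z - x..z + x} s * G s \<partial>lborel)) (G z) < e) (at_right 0)"
    unfolding eventually_at_right_field
  proof (intro exI[of _ d] conjI allI impI d(1))
    fix x assume x: "0 < x" "x < d"
    note [measurable] = borel_measurable_continuous_onI[OF G]
    obtain C where C: "\<And>s. s \<in> {z - x..z + x} \<Longrightarrow> \<bar>G s\<bar> \<le> C"
      using compact_Icc_bound[OF continuous_on_subset[OF G subset_UNIV]] by blast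
    have i: "integrable lborel (\<lambda>s. indicator {z - x..z + x} s * G s)"
      by (rule integrable_indicator_bounded[where C=C]) (use C in auto)
    have eq: "(\<integral>s. indicator {z - x..z + x} s * G s \<partial>lborel) - 2 * x * G z =
      (\<integral>s. indicator {z - x..z + x} s * G s - indicator {z - x..z + x} s * G z \<partial>lborel)"
      using i x by simp
    have "\<bar>(\<integral>s. indicator {z - x..z + x} s * G s \<partial>lborel) - 2 * x * G z\<bar> \<le>
      (\<integral>s. indicator {z - x..z + x} s * (e / 2) \<partial>lborel)"
      unfolding eq
    proof (rule order_trans[OF integral_abs_bound], rule Bochner_Integration.integral_mono)
      show "\<bar>indicator {z - x..z + x} s * G s - indicator {z - x..z + x} s * G z\<bar> \<le> indicator {z - x..z + x} s * (e / 2)" for s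
      proof (cases "s \<in> {z - x..z + x}")
        case True
        then have "\<bar>s - z\<bar> < d" using x by (auto simp: abs_less_iff)
        from d(2)[OF this] True show ?thesis by simp
      qed simp
    qed (use i in auto)
    also have "\<dots> = x * e" using x by simp
    finally have "\<bar>(1 / (2 * x)) * ((\<integral>s. indicator {z - x..z + x} s * G s \<partial>lborel) - 2 * x * G z)\<bar> \<le> (1 / (2 * x)) * (x * e)"
      using x unfolding abs_mult by (intro mult_mono) auto
    also have "\<dots> < e" using x e by simp
    finally show "dist ((1 / (2 * x)) * (\<integral>s. indicator {z - x..z + x} s * G s \<partial>lborel)) (G z) < e"
      using x by (simp add: dist_real_def right_diff_distrib)
  qed
qed

context goursat_kernel
begin

text \<open>With x and \<alpha> fixed, the strip is read as a condition on s: s lies within x of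
  \<alpha> + 2\<beta>. The inner integral runs over a window of length 2x, which is the source of
  the factor x and of the averages of G in the limit at the axis.\<close>

lemma integral_characteristic_triangle_dual:
  fixes G k :: "real \<Rightarrow> real"
  assumes [measurable]: "G \<in> borel_measurable borel" "k \<in> borel_measurable borel"
    and G: "\<And>s. \<bar>G s\<bar> \<le> C"
    and k: "integrable lborel (\<lambda>x. indicator {0..B} x * k x)" and x: "0 \<le> x" "x \<le> B" and \<alpha>: "0 \<le> \<alpha>"
  shows "(\<integral>s. indicator {\<alpha> + x..B} s * (G s * (\<integral>\<beta>. indicator {s - \<alpha> - x..s - \<alpha> + x} (2 * \<beta>) * k \<beta> \<partial>lborel)) \<partial>lborel) =
    (\<integral>\<beta>. indicator {0..B} \<beta> * (k \<beta> * (\<integral>s. indicator {\<alpha> + x..B} s * (indicator {\<alpha> + 2 * \<beta> - x..\<alpha> + 2 * \<beta> + x} s * G s) \<partial>lborel)) \<partial>lborel)"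
proof -
  let ?F = "\<lambda>s \<beta>. (indicator {\<alpha> + x..B} s * G s) * (indicator {0..B} \<beta> * k \<beta>) * (indicator {s - \<alpha> - x..s - \<alpha> + x} (2 * \<beta>) :: real)"
  have "(\<integral>s. indicator {\<alpha> + x..B} s * (G s * (\<integral>\<beta>. indicator {s - \<alpha> - x..s - \<alpha> + x} (2 * \<beta>) * k \<beta> \<partial>lborel)) \<partial>lborel) =
    (\<integral>s. (\<integral>\<beta>. ?F s \<beta> \<partial>lborel) \<partial>lborel)"
  proof (rule Bochner_Integration.integral_cong[OF refl])
    fix s :: real
    have "(\<integral>\<beta>. ?F s \<beta> \<partial>lborel) = (\<integral>\<beta>. indicator {\<alpha> + x..B} s * G s * (indicator {s - \<alpha> - x..s - \<alpha> + x} (2 * \<beta>) * k \<beta>) \<partial>lborel)"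
      using x \<alpha> by (intro Bochner_Integration.integral_cong) (auto simp: indicator_def)
    then show "indicator {\<alpha> + x..B} s * (G s * (\<integral>\<beta>. indicator {s - \<alpha> - x..s - \<alpha> + x} (2 * \<beta>) * k \<beta> \<partial>lborel)) =
      (\<integral>\<beta>. ?F s \<beta> \<partial>lborel)"
      by simp
  qed
  also have "\<dots> = (\<integral>\<beta>. (\<integral>s. ?F s \<beta> \<partial>lborel) \<partial>lborel)"
  proof (rule lborel_Fubini_swap_bounded(1))
    show "integrable lborel (\<lambda>s. indicator {\<alpha> + x..B} s * C)" by simp
    show "integrable lborel (\<lambda>x. \<bar>indicator {0..B} x * k x\<bar>)" using k by auto
    show "\<bar>?F s \<beta>\<bar> \<le> (indicator {\<alpha> + x..B} s * C) * \<bar>indicator {0..B} \<beta> * k \<beta>\<bar>" for s \<beta>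
      using G[of s] order_trans[OF abs_ge_zero G[of s]]
      by (auto simp: indicator_def abs_mult intro!: mult_right_mono mult_nonneg_nonneg)
  qed measurable
  also have "\<dots> = (\<integral>\<beta>. indicator {0..B} \<beta> * (k \<beta> * (\<integral>s. indicator {\<alpha> + x..B} s * (indicator {\<alpha> + 2 * \<beta> - x..\<alpha> + 2 * \<beta> + x} s * G s) \<partial>lborel)) \<partial>lborel)"
  proof (rule Bochner_Integration.integral_cong[OF refl])
    fix \<beta> :: real
    have "(\<integral>s. ?F s \<beta> \<partial>lborel) = (\<integral>s. indicator {0..B} \<beta> * k \<beta> * (indicator {\<alpha> + x..B} s * (indicator {\<alpha> + 2 * \<beta> - x..\<alpha> + 2 * \<beta> + x} s * G s)) \<partial>lborel)"
      by (rule Bochner_Integration.integral_cong) (auto simp: indicator_def)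
    then show "(\<integral>s. ?F s \<beta> \<partial>lborel) =
      indicator {0..B} \<beta> * (k \<beta> * (\<integral>s. indicator {\<alpha> + x..B} s * (indicator {\<alpha> + 2 * \<beta> - x..\<alpha> + 2 * \<beta> + x} s * G s) \<partial>lborel))"
      by simp
  qed
  finally show ?thesis .
qed

text \<open>The adjoint of I + W on [0, B].\<close>

definition transmute_dual :: "real \<Rightarrow> (real \<Rightarrow> real) \<Rightarrow> real \<Rightarrow> real" where
  "transmute_dual B g x = g x + (\<integral>s. indicator {x..B} s * (u (s - x) x * g s) \<partial>lborel)"

text \<open>The limit, as x tends to 0, of 1/x times the integral of w(x, s) G(s). It becomes the
  pairing of G with the response function after t = \<alpha> + 2\<beta> is substituted, see
  \<open>response_pairing_eq\<close>.\<close>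

definition response_pairing :: "real \<Rightarrow> (real \<Rightarrow> real) \<Rightarrow> real" where
  "response_pairing B G = - (\<integral>\<beta>. indicator {0..B} \<beta> * (q \<beta> * G (2 * \<beta>)) \<partial>lborel)
    - (\<integral>\<alpha>. indicator {0..B} \<alpha> * (\<integral>\<beta>. indicator {0..B} \<beta> * (q \<beta> * u \<alpha> \<beta> * G (\<alpha> + 2 * \<beta>)) \<partial>lborel) \<partial>lborel)"

lemma transmute_dual_measurable [measurable]:
  assumes [measurable]: "g \<in> borel_measurable borel"
  shows "transmute_dual B g \<in> borel_measurable borel"
  unfolding transmute_dual_def[abs_def] by measurable

text \<open>The factor B - x is kept because for functions living on a short interval [0, a] it
  makes the kernel term O(a).\<close>

lemma integral_kernel_bound:
  assumes [measurable]: "g \<in> borel_measurable borel" and g: "\<And>x. \<bar>g x\<bar> \<le> c"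
    and C: "0 \<le> C" "\<And>\<alpha> \<beta>. \<alpha> \<in> {0..B} \<Longrightarrow> \<beta> \<in> {0..B} \<Longrightarrow> \<bar>u \<alpha> \<beta>\<bar> \<le> C"
    and x: "0 \<le> x" "x \<le> B"
  shows "\<bar>\<integral>s. indicator {x..B} s * (u (s - x) x * g s) \<partial>lborel\<bar> \<le> (B - x) * (C * c)"
proof -
  have c: "0 \<le> c" using g[of 0] by linarith
  have b: "\<bar>u (s - x) x * g s\<bar> \<le> C * c" if "s \<in> {x..B}" for s
    unfolding abs_mult using that x C g[of s] c by (intro mult_mono) auto
  have "\<bar>\<integral>s. indicator {x..B} s * (u (s - x) x * g s) \<partial>lborel\<bar> \<le> (\<integral>s. indicator {x..B} s * (C * c) \<partial>lborel)"
  proof (rule order_trans[OF integral_abs_bound], rule Bochner_Integration.integral_mono)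
    show "integrable lborel (\<lambda>s. \<bar>indicator {x..B} s * (u (s - x) x * g s)\<bar>)"
      using b by (intro integrable_abs integrable_indicator_bounded) auto
    show "\<bar>indicator {x..B} s * (u (s - x) x * g s)\<bar> \<le> indicator {x..B} s * (C * c)" for s
      using b[of s] by (auto simp: indicator_def)
  qed simp
  then show ?thesis using x by simp
qed

lemma transmute_dual_bound:
  assumes [measurable]: "g \<in> borel_measurable borel" and g: "\<And>x. \<bar>g x\<bar> \<le> c"
  obtains C where "\<And>x. x \<in> {0..B} \<Longrightarrow> \<bar>transmute_dual B g x\<bar> \<le> C"
proof -
  have c: "0 \<le> c" using g[of 0] by linarith
  obtain C where C: "0 \<le> C" "\<And>\<alpha> \<beta>. \<alpha> \<in> {0..B} \<Longrightarrow> \<beta> \<in> {0..B} \<Longrightarrow> \<bar>u \<alpha> \<beta>\<bar> \<le> C"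
    using u_bound by blast
  have "\<bar>transmute_dual B g x\<bar> \<le> c + B * (C * c)" if x: "x \<in> {0..B}" for x
  proof -
    have "(B - x) * (C * c) \<le> B * (C * c)" using x c C by (intro mult_right_mono) auto
    moreover have "\<bar>\<integral>s. indicator {x..B} s * (u (s - x) x * g s) \<partial>lborel\<bar> \<le> (B - x) * (C * c)"
      by (rule integral_kernel_bound[OF _ g C]) (use x in auto)
    ultimately show ?thesis
      unfolding transmute_dual_def using g[of x] by linarith
  qed
  then show ?thesis by (rule that)
qed

text \<open>At the axis the kernel \<open>w(x,s) = u (s - x) x\<close> vanishes, and \<open>w(x,s) / x\<close> converges weakly to the
  response function.\<close>

lemma transmute_dual_axis:
  fixes G :: "real \<Rightarrow> real"
  assumes G: "continuous_on UNIV G" and supp: "\<And>b. b \<ge> B \<Longrightarrow> G b = 0" and bnd: "\<And>s. \<bar>G s\<bar> \<le> c"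
    and lim: "((\<lambda>x. G x / x) \<longlongrightarrow> G1) (at_right 0)" and B: "0 < B"
  shows "((\<lambda>x. transmute_dual B G x / x) \<longlongrightarrow> G1 + response_pairing B G) (at_right 0)"
proof -
  note Gm [measurable] = borel_measurable_continuous_onI[OF G]
  obtain C where C: "0 \<le> C" "\<And>\<alpha> \<beta>. \<alpha> \<in> {0..B} \<Longrightarrow> \<beta> \<in> {0..B} \<Longrightarrow> \<bar>u \<alpha> \<beta>\<bar> \<le> C"
    using u_bound by blast
  have c: "0 \<le> c" using bnd[of 0] by linarith
  \<comment> \<open>The average of G over the window of radius x about \<alpha> + 2\<beta>, except
    that the window is cut at \<alpha> + x and at B.\<close>
  define m where "m x \<alpha> \<beta> = (1 / (2 * x)) *
    (\<integral>s. indicator {\<alpha> + x..B} s * (indicator {\<alpha> + 2 * \<beta> - x..\<alpha> + 2 * \<beta> + x} s * G s) \<partial>lborel)" for x \<alpha> \<beta>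
  have [measurable]: "(\<lambda>y. m x (f y) (g y)) \<in> borel_measurable N"
    if [measurable]: "f \<in> borel_measurable N" "g \<in> borel_measurable N" for f g x and N :: "'z measure"
    unfolding m_def by measurable
  have m_bound: "\<bar>m x \<alpha> \<beta>\<bar> \<le> c" if x: "0 < x" for x \<alpha> \<beta>
  proof -
    have "\<bar>\<integral>s. indicator {\<alpha> + x..B} s * (indicator {\<alpha> + 2 * \<beta> - x..\<alpha> + 2 * \<beta> + x} s * G s) \<partial>lborel\<bar> \<le>
      (\<integral>s. indicator {\<alpha> + 2 * \<beta> - x..\<alpha> + 2 * \<beta> + x} s * c \<partial>lborel)"
    proof (rule order_trans[OF integral_abs_bound], rule integral_mono')
      show "\<bar>indicator {\<alpha> + x..B} s * (indicator {\<alpha> + 2 * \<beta> - x..\<alpha> + 2 * \<beta> + x} s * G s)\<bar> \<le>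
        indicator {\<alpha> + 2 * \<beta> - x..\<alpha> + 2 * \<beta> + x} s * c" for s
        using bnd[of s] c by (auto simp: indicator_def)
    qed (use c in auto)
    also have "\<dots> = 2 * x * c" using x by simp
    finally have "\<bar>m x \<alpha> \<beta>\<bar> \<le> (1 / (2 * x)) * (2 * x * c)"
      using x unfolding m_def abs_mult by (intro mult_mono) auto
    then show ?thesis using x by simp
  qed
  \<comment> \<open>For x < \<beta> the lower cut is inactive, and the upper cut changes nothing
    because G vanishes beyond B.\<close>
  have m_lim: "((\<lambda>x. m x \<alpha> \<beta>) \<longlongrightarrow> G (\<alpha> + 2 * \<beta>)) (at_right 0)" if \<beta>: "0 < \<beta>" for \<alpha> \<beta>
  proof (rule Lim_transform_eventually[OF interval_average_tendsto[OF G]])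
    show "\<forall>\<^sub>F x in at_right 0. 1 / (2 * x) * (\<integral>s. indicator {\<alpha> + 2 * \<beta> - x..\<alpha> + 2 * \<beta> + x} s * G s \<partial>lborel) = m x \<alpha> \<beta>"
      unfolding eventually_at_right_field
    proof (intro exI[of _ \<beta>] conjI allI impI \<beta>)
      fix x assume "0 < x" "x < \<beta>"
      then have "indicator {\<alpha> + 2 * \<beta> - x..\<alpha> + 2 * \<beta> + x} s * G s =
        indicator {\<alpha> + x..B} s * (indicator {\<alpha> + 2 * \<beta> - x..\<alpha> + 2 * \<beta> + x} s * G s)" for s
        using supp[of s] by (cases "s \<le> B") (auto simp: indicator_def)
      from arg_cong[OF ext[OF this], of "\<lambda>h. 1 / (2 * x) * integral\<^sup>L lborel h"] show "1 / (2 * x) * (\<integral>s. indicator {\<alpha> + 2 * \<beta> - x..\<alpha> + 2 * \<beta> + x} s * G s \<partial>lborel) = m x \<alpha> \<beta>"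
        unfolding m_def .
    qed
  qed
  define P where "P x = (\<integral>\<beta>. indicator {0..B} \<beta> * (q \<beta> * m x 0 \<beta>) \<partial>lborel)" for x
  define Q where "Q x \<alpha> = (\<integral>\<beta>. indicator {0..B} \<beta> * (q \<beta> * u \<alpha> \<beta> * m x \<alpha> \<beta>) \<partial>lborel)" for x \<alpha>
  let ?q = "\<integral>\<beta>. \<bar>indicator {0..B} \<beta> * q \<beta>\<bar> \<partial>lborel"
  have q': "integrable lborel (\<lambda>\<beta>. \<bar>indicator {0..B} \<beta> * q \<beta>\<bar> * d)" for d
    using q_integrable by auto
  \<comment> \<open>The factor 1/2 of the Goursat equation against the window length 2x leaves
    exactly x in front of both terms.\<close>
  have dual_eq: "transmute_dual B G x = G x - x * P x - x * (\<integral>\<alpha>. indicator {0..B} \<alpha> * Q x \<alpha> \<partial>lborel)"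
    if x: "0 < x" "x < B" for x
  proof -
    let ?A = "\<lambda>s. \<integral>\<beta>. indicator {s - 0 - x..s - 0 + x} (2 * \<beta>) * q \<beta> \<partial>lborel"
    let ?P = "\<lambda>\<alpha> s. \<integral>\<beta>. indicator {s - \<alpha> - x..s - \<alpha> + x} (2 * \<beta>) * (q \<beta> * u \<alpha> \<beta>) \<partial>lborel"
    have Ab: "\<bar>?A s\<bar> \<le> ?q" if "x \<le> s" "s \<le> B" for s
      by (rule order_trans[OF integral_abs_bound], rule integral_mono')
        (use x that q_integrable in \<open>auto simp: indicator_def\<close>)
    have Pb: "\<bar>?P \<alpha> s\<bar> \<le> ?q * C" if "0 \<le> \<alpha>" "\<alpha> \<le> s - x" "s \<le> B" for \<alpha> s
    proof -
      have "\<bar>?P \<alpha> s\<bar> \<le> (\<integral>\<beta>. \<bar>indicator {0..B} \<beta> * q \<beta>\<bar> * C \<partial>lborel)"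
        by (rule order_trans[OF integral_abs_bound], rule integral_mono'[OF q'])
          (use x that C in \<open>auto simp: indicator_def abs_mult intro!: mult_left_mono\<close>)
      then show ?thesis by simp
    qed
    let ?F = "\<lambda>s \<alpha>. indicator {x..B} s * G s * (indicator {0..s - x} \<alpha> * ?P \<alpha> s)"
    have Fb: "\<bar>?F s \<alpha>\<bar> \<le> (indicator {x..B} s * c) * (indicator {0..B} \<alpha> * (?q * C))" for s \<alpha>
    proof (cases "x \<le> s \<and> s \<le> B \<and> 0 \<le> \<alpha> \<and> \<alpha> \<le> s - x")
      case True
      then have "\<bar>G s\<bar> * \<bar>?P \<alpha> s\<bar> \<le> c * (?q * C)" using Pb[of \<alpha> s] bnd c by (intro mult_mono) auto
      then show ?thesis using True x by (auto simp: abs_mult indicator_def)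
    next
      case False
      then have "?F s \<alpha> = 0" by (auto simp: indicator_def)
      moreover have "0 \<le> (indicator {x..B} s * c) * (indicator {0..B} \<alpha> * (?q * C))"
        using C c by simp
      ultimately show ?thesis by (simp only: abs_zero)
    qed
    have Fm: "(\<lambda>(s, \<alpha>). ?F s \<alpha>) \<in> borel_measurable (borel \<Otimes>\<^sub>M borel)" by measurable
    note swap = lborel_Fubini_swap_bounded[OF Fm Fb integrable_indicator_interval integrable_indicator_interval]
    have i0: "integrable lborel (\<lambda>s. indicator {x..B} s * (G s * ?A s))"
    proof (rule integrable_indicator_bounded[where C="c * ?q"])
      show "\<bar>G s * ?A s\<bar> \<le> c * ?q" if "s \<in> {x..B}" for s
      proof -
        have "\<bar>?A s\<bar> \<le> ?q" by (rule Ab) (use that in auto)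
        from mult_mono[OF bnd this c abs_ge_zero] show ?thesis by (simp only: abs_mult)
      qed
    qed measurable
    have "(\<integral>s. indicator {x..B} s * (u (s - x) x * G s) \<partial>lborel) =
      (\<integral>s. - (1/2) * (indicator {x..B} s * (G s * ?A s)) - (1/2) * (\<integral>\<alpha>. ?F s \<alpha> \<partial>lborel) \<partial>lborel)"
    proof (intro Bochner_Integration.integral_cong refl)
      fix s
      have F: "(\<integral>\<alpha>. ?F s \<alpha> \<partial>lborel) = indicator {x..B} s * G s * (\<integral>\<alpha>. indicator {0..s - x} \<alpha> * ?P \<alpha> s \<partial>lborel)"
        by simp
      show "indicator {x..B} s * (u (s - x) x * G s) =
        - (1/2) * (indicator {x..B} s * (G s * ?A s)) - (1/2) * (\<integral>\<alpha>. ?F s \<alpha> \<partial>lborel)"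
      proof (cases "s \<in> {x..B}")
        case True
        then have one: "indicator {x..B} s = (1::real)" by simp
        have e: "s - x + 2 * x = s - 0 + x" "s - 0 - x = s - x" "\<And>\<alpha>. s - x - \<alpha> = s - \<alpha> - x" "\<And>\<alpha>. s - \<alpha> - x + 2 * x = s - \<alpha> + x" by auto
        have ue: "u (s - x) x = - (1/2) * ?A s - (1/2) * (\<integral>\<alpha>. indicator {0..s - x} \<alpha> * ?P \<alpha> s \<partial>lborel)"
          using True x by (subst u_eq) (auto simp only: e atLeastAtMost_iff diff_ge_0_iff_ge)
        have ring: "(- (1/2) * a - (1/2) * b) * c = - (1/2) * (c * a) - (1/2) * (c * b)" for a b c :: real
          by (simp add: algebra_simps)
        show ?thesis unfolding F unfolding ue one by (simp only: ring mult_1_left)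
      qed simp
    qed
    also have "\<dots> = - (1/2) * (\<integral>s. indicator {x..B} s * (G s * ?A s) \<partial>lborel) - (1/2) * (\<integral>s. (\<integral>\<alpha>. ?F s \<alpha> \<partial>lborel) \<partial>lborel)"
      by (rule integral_diff_scaled[OF i0 swap(2)])
    also have "(\<integral>s. indicator {x..B} s * (G s * ?A s) \<partial>lborel) = 2 * x * P x"
    proof -
      have "(\<integral>s. indicator {x..B} s * (G s * ?A s) \<partial>lborel) =
        (\<integral>\<beta>. indicator {0..B} \<beta> * (q \<beta> * (\<integral>s. indicator {0 + x..B} s * (indicator {0 + 2 * \<beta> - x..0 + 2 * \<beta> + x} s * G s) \<partial>lborel)) \<partial>lborel)"
        using integral_characteristic_triangle_dual[OF Gm q_measurable bnd q_integrable, of x B 0] x by simp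
      also have "\<dots> = (\<integral>\<beta>. 2 * x * (indicator {0..B} \<beta> * (q \<beta> * m x 0 \<beta>)) \<partial>lborel)"
        using x by (intro Bochner_Integration.integral_cong refl) (simp add: m_def)
      finally show ?thesis by (simp add: P_def)
    qed
    also have "(\<integral>s. (\<integral>\<alpha>. ?F s \<alpha> \<partial>lborel) \<partial>lborel) = (\<integral>\<alpha>. (\<integral>s. ?F s \<alpha> \<partial>lborel) \<partial>lborel)" by (rule swap(1))
    also have "\<dots> = (\<integral>\<alpha>. 2 * x * (indicator {0..B} \<alpha> * Q x \<alpha>) \<partial>lborel)"
    proof (intro Bochner_Integration.integral_cong refl)
      fix \<alpha>
      have "(\<integral>s. ?F s \<alpha> \<partial>lborel) = (\<integral>s. indicator {0..B} \<alpha> * (indicator {\<alpha> + x..B} s * (G s * ?P \<alpha> s)) \<partial>lborel)"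
        using x by (intro Bochner_Integration.integral_cong) (auto simp: indicator_def)
      also have "\<dots> = indicator {0..B} \<alpha> * (\<integral>s. indicator {\<alpha> + x..B} s * (G s * ?P \<alpha> s) \<partial>lborel)" by simp
      also have "\<dots> = indicator {0..B} \<alpha> * (\<integral>\<beta>. indicator {0..B} \<beta> * (q \<beta> * u \<alpha> \<beta> *
        (\<integral>s. indicator {\<alpha> + x..B} s * (indicator {\<alpha> + 2 * \<beta> - x..\<alpha> + 2 * \<beta> + x} s * G s) \<partial>lborel)) \<partial>lborel)"
      proof (cases "\<alpha> \<in> {0..B}")
        case True
        then show ?thesis
          using x by (subst integral_characteristic_triangle_dual[OF Gm _ bnd qu_integrable]) auto
      qed simp
      also have "\<dots> = indicator {0..B} \<alpha> * (\<integral>\<beta>. 2 * x * (indicator {0..B} \<beta> * (q \<beta> * u \<alpha> \<beta> * m x \<alpha> \<beta>)) \<partial>lborel)"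
      proof -
        have "(\<integral>s. indicator {\<alpha> + x..B} s * (indicator {\<alpha> + 2 * \<beta> - x..\<alpha> + 2 * \<beta> + x} s * G s) \<partial>lborel) =
          2 * x * m x \<alpha> \<beta>" for \<beta>
          using x by (simp add: m_def)
        then show ?thesis by (simp only: mult.left_commute mult.assoc)
      qed
      also have "\<dots> = 2 * x * (indicator {0..B} \<alpha> * Q x \<alpha>)" by (simp add: Q_def)
      finally show "(\<integral>s. ?F s \<alpha> \<partial>lborel) = 2 * x * (indicator {0..B} \<alpha> * Q x \<alpha>)" .
    qed
    finally show ?thesis unfolding transmute_dual_def by (simp add: algebra_simps)
  qed
  have Qb: "\<bar>Q x \<alpha>\<bar> \<le> ?q * (C * c)" if "0 < x" "\<alpha> \<in> {0..B}" for x \<alpha>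
  proof -
    have "\<bar>Q x \<alpha>\<bar> \<le> (\<integral>\<beta>. \<bar>indicator {0..B} \<beta> * q \<beta>\<bar> * (C * c) \<partial>lborel)"
      unfolding Q_def
    proof (rule order_trans[OF integral_abs_bound], rule integral_mono'[OF q'])
      show "\<bar>indicator {0..B} \<beta> * (q \<beta> * u \<alpha> \<beta> * m x \<alpha> \<beta>)\<bar> \<le> \<bar>indicator {0..B} \<beta> * q \<beta>\<bar> * (C * c)" for \<beta>
      proof (cases "\<beta> \<in> {0..B}")
        case True
        then have "\<bar>u \<alpha> \<beta>\<bar> * \<bar>m x \<alpha> \<beta>\<bar> \<le> C * c" using that C m_bound by (intro mult_mono) auto
        then show ?thesis using True by (simp add: abs_mult mult.assoc mult_left_mono)
      qed simp
    qed (use C c in auto)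
    then show ?thesis by simp
  qed
  have P_lim: "(\<lambda>n. P (X n)) \<longlonglongrightarrow> (\<integral>\<beta>. indicator {0..B} \<beta> * (q \<beta> * G (2 * \<beta>)) \<partial>lborel)"
    if X: "\<And>n. 0 < X n" "filterlim X (at_right 0) sequentially" for X
    unfolding P_def
  proof (rule integral_dominated_convergence[where w="\<lambda>\<beta>. \<bar>indicator {0..B} \<beta> * q \<beta>\<bar> * c"])
    \<comment> \<open>The pointwise limit is available for \<beta> > 0; the point 0 is a null
      set.\<close>
    show "AE \<beta> in lborel. (\<lambda>n. indicator {0..B} \<beta> * (q \<beta> * m (X n) 0 \<beta>)) \<longlonglongrightarrow> indicator {0..B} \<beta> * (q \<beta> * G (2 * \<beta>))"
      using AE_lborel_singleton[of 0]
    proof eventually_elim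
      case (elim \<beta>)
      then show ?case
        using filterlim_compose[OF m_lim X(2), of \<beta> 0]
        by (cases "\<beta> \<in> {0..B}") (auto intro!: tendsto_intros)
    qed
    show "AE \<beta> in lborel. norm (indicator {0..B} \<beta> * (q \<beta> * m (X n) 0 \<beta>)) \<le> \<bar>indicator {0..B} \<beta> * q \<beta>\<bar> * c" for n
      using m_bound[OF X(1)] by (intro AE_I2) (auto simp: abs_mult indicator_def intro!: mult_left_mono)
  qed (use q' in auto)
  have Q_lim: "(\<lambda>n. Q (X n) \<alpha>) \<longlonglongrightarrow> (\<integral>\<beta>. indicator {0..B} \<beta> * (q \<beta> * u \<alpha> \<beta> * G (\<alpha> + 2 * \<beta>)) \<partial>lborel)"
    if X: "\<And>n. 0 < X n" "filterlim X (at_right 0) sequentially" and \<alpha>: "\<alpha> \<in> {0..B}" for X \<alpha>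
    unfolding Q_def
  proof (rule integral_dominated_convergence[where w="\<lambda>\<beta>. \<bar>indicator {0..B} \<beta> * q \<beta>\<bar> * (C * c)"])
    show "AE \<beta> in lborel. (\<lambda>n. indicator {0..B} \<beta> * (q \<beta> * u \<alpha> \<beta> * m (X n) \<alpha> \<beta>)) \<longlonglongrightarrow> indicator {0..B} \<beta> * (q \<beta> * u \<alpha> \<beta> * G (\<alpha> + 2 * \<beta>))"
      using AE_lborel_singleton[of 0]
    proof eventually_elim
      case (elim \<beta>)
      then show ?case
        using filterlim_compose[OF m_lim X(2), of \<beta> \<alpha>]
        by (cases "\<beta> \<in> {0..B}") (auto intro!: tendsto_intros)
    qed
    show "AE \<beta> in lborel. norm (indicator {0..B} \<beta> * (q \<beta> * u \<alpha> \<beta> * m (X n) \<alpha> \<beta>)) \<le> \<bar>indicator {0..B} \<beta> * q \<beta>\<bar> * (C * c)" for n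
    proof (rule AE_I2)
      fix \<beta>
      show "norm (indicator {0..B} \<beta> * (q \<beta> * u \<alpha> \<beta> * m (X n) \<alpha> \<beta>)) \<le> \<bar>indicator {0..B} \<beta> * q \<beta>\<bar> * (C * c)"
      proof (cases "\<beta> \<in> {0..B}")
        case True
        then have "\<bar>u \<alpha> \<beta>\<bar> * \<bar>m (X n) \<alpha> \<beta>\<bar> \<le> C * c" using \<alpha> C m_bound[OF X(1)] by (intro mult_mono) auto
        then show ?thesis using True by (simp add: abs_mult mult.assoc mult_left_mono)
      qed simp
    qed
  qed (use q' in auto)
  show ?thesis
  proof (rule tendsto_at_right_sequentially[OF B])
    fix X :: "nat \<Rightarrow> real"
    assume X: "\<And>n. 0 < X n" "\<And>n. X n < B" "decseq X" "X \<longlonglongrightarrow> 0"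
    have Xf: "filterlim X (at_right 0) sequentially"
      using X(1,4) unfolding filterlim_at by (auto intro!: always_eventually simp: less_le)
    have Q2: "(\<lambda>n. \<integral>\<alpha>. indicator {0..B} \<alpha> * Q (X n) \<alpha> \<partial>lborel) \<longlonglongrightarrow>
      (\<integral>\<alpha>. indicator {0..B} \<alpha> * (\<integral>\<beta>. indicator {0..B} \<beta> * (q \<beta> * u \<alpha> \<beta> * G (\<alpha> + 2 * \<beta>)) \<partial>lborel) \<partial>lborel)"
    proof (rule integral_dominated_convergence[where w="\<lambda>\<alpha>. indicator {0..B} \<alpha> * (?q * (C * c))"])
      show "AE \<alpha> in lborel. (\<lambda>n. indicator {0..B} \<alpha> * Q (X n) \<alpha>) \<longlonglongrightarrow>
        indicator {0..B} \<alpha> * (\<integral>\<beta>. indicator {0..B} \<beta> * (q \<beta> * u \<alpha> \<beta> * G (\<alpha> + 2 * \<beta>)) \<partial>lborel)"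
      proof (rule AE_I2)
        fix \<alpha> show "(\<lambda>n. indicator {0..B} \<alpha> * Q (X n) \<alpha>) \<longlonglongrightarrow>
        indicator {0..B} \<alpha> * (\<integral>\<beta>. indicator {0..B} \<beta> * (q \<beta> * u \<alpha> \<beta> * G (\<alpha> + 2 * \<beta>)) \<partial>lborel)"
          using Q_lim[OF X(1) Xf, of \<alpha>] by (cases "\<alpha> \<in> {0..B}") auto
      qed
      show "AE \<alpha> in lborel. norm (indicator {0..B} \<alpha> * Q (X n) \<alpha>) \<le> indicator {0..B} \<alpha> * (?q * (C * c))" for n
        using Qb[OF X(1)] by (intro AE_I2) (auto simp: indicator_def)
      show "(\<lambda>\<alpha>. indicator {0..B} \<alpha> * Q (X n) \<alpha>) \<in> borel_measurable lborel" for n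
        unfolding Q_def by measurable
    qed (simp_all, measurable)
    have "(\<lambda>n. G (X n) / X n) \<longlonglongrightarrow> G1" using filterlim_compose[OF lim Xf] .
    from tendsto_diff[OF tendsto_diff[OF this P_lim[OF X(1) Xf]] Q2]
    have "(\<lambda>n. G (X n) / X n - P (X n) - (\<integral>\<alpha>. indicator {0..B} \<alpha> * Q (X n) \<alpha> \<partial>lborel)) \<longlonglongrightarrow> G1 + response_pairing B G"
      unfolding response_pairing_def by (simp add: add_diff_eq)
    then show "(\<lambda>n. transmute_dual B G (X n) / X n) \<longlonglongrightarrow> G1 + response_pairing B G"
    proof (rule Lim_transform_eventually[OF _ always_eventually], intro allI)
      fix n
      show "G (X n) / X n - P (X n) - (\<integral>\<alpha>. indicator {0..B} \<alpha> * Q (X n) \<alpha> \<partial>lborel) = transmute_dual B G (X n) / X n"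
        using dual_eq[OF X(1,2), of n] X(1)[of n] by (simp add: field_simps)
    qed
  qed
qed

end

section \<open>Parseval's identity for sine transforms\<close>

lemma sin_sqrt_add: "sin_sqrt (a + b) \<mu> = sin_sqrt a \<mu> * cos_sqrt b \<mu> + cos_sqrt a \<mu> * sin_sqrt b \<mu>"
  by (cases \<mu> "0::real" rule: linorder_cases)
    (auto simp: sin_sqrt_def cos_sqrt_def distrib_left sin_add sinh_add add_divide_distrib)

lemma abs_sin_sqrt_le: "0 \<le> \<mu> \<Longrightarrow> \<bar>sin_sqrt b \<mu>\<bar> \<le> \<bar>b\<bar>"
  using abs_sin_x_le_abs_x[of "sqrt \<mu> * b"]
  by (cases "\<mu> = 0") (auto simp: sin_sqrt_def abs_mult field_simps)

lemma abs_sin_sqrt_mult_sqrt_le: "0 \<le> \<mu> \<Longrightarrow> \<bar>sin_sqrt b \<mu>\<bar> * sqrt \<mu> \<le> 1"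
  using abs_sin_le_one[of "sqrt \<mu> * b"] by (cases "\<mu> = 0") (auto simp: sin_sqrt_def abs_mult)

lemma cos_sqrt_ge_1: "\<mu> \<le> 0 \<Longrightarrow> 1 \<le> cos_sqrt b \<mu>"
  by (simp add: cos_sqrt_def cosh_real_ge_1)

lemma sin_sqrt_mono: "\<mu> \<le> 0 \<Longrightarrow> a \<le> b \<Longrightarrow> sin_sqrt a \<mu> \<le> sin_sqrt b \<mu>"
  by (rule DERIV_nonneg_imp_nondecreasing[of a b "\<lambda>x. sin_sqrt x \<mu>"])
    (auto intro!: DERIV_sin_sqrt order_trans[OF zero_le_one cos_sqrt_ge_1])

lemma sin_sqrt_nonneg: "\<mu> \<le> 0 \<Longrightarrow> 0 \<le> b \<Longrightarrow> 0 \<le> sin_sqrt b \<mu>"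
  using sin_sqrt_mono[of \<mu> 0 b] by simp

lemma cos_sqrt_mono: "\<mu> \<le> 0 \<Longrightarrow> 0 \<le> a \<Longrightarrow> a \<le> b \<Longrightarrow> cos_sqrt a \<mu> \<le> cos_sqrt b \<mu>"
  by (rule DERIV_nonneg_imp_nondecreasing[of a b "\<lambda>x. cos_sqrt x \<mu>"])
    (auto intro!: exI DERIV_cos_sqrt mult_nonneg_nonneg sin_sqrt_nonneg)

lemma le_sin_sqrt: "\<mu> \<le> 0 \<Longrightarrow> 0 \<le> b \<Longrightarrow> b \<le> sin_sqrt b \<mu>"
  using DERIV_nonneg_imp_nondecreasing[of 0 b "\<lambda>x. sin_sqrt x \<mu> - x"] cos_sqrt_ge_1
  by (force intro!: derivative_eq_intros)

lemma sin_sqrt_le: "\<mu> \<le> 0 \<Longrightarrow> 0 \<le> b \<Longrightarrow> sin_sqrt b \<mu> \<le> b * cos_sqrt b \<mu>"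
proof -
  assume \<mu>: "\<mu> \<le> 0" and b: "0 \<le> b"
  have "0 * cos_sqrt 0 \<mu> - sin_sqrt 0 \<mu> \<le> b * cos_sqrt b \<mu> - sin_sqrt b \<mu>"
  proof (rule DERIV_nonneg_imp_nondecreasing[OF b])
    fix x assume x: "0 \<le> x" "x \<le> b"
    have "DERIV (\<lambda>x. x * cos_sqrt x \<mu> - sin_sqrt x \<mu>) x :> x * (- \<mu> * sin_sqrt x \<mu>)"
      by (auto intro!: derivative_eq_intros)
    moreover have "0 \<le> x * (- \<mu> * sin_sqrt x \<mu>)"
      using \<mu> x by (intro mult_nonneg_nonneg sin_sqrt_nonneg) auto
    ultimately show "\<exists>y. DERIV (\<lambda>x. x * cos_sqrt x \<mu> - sin_sqrt x \<mu>) x :> y \<and> 0 \<le> y" by blast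
  qed
  then show ?thesis by simp
qed

text \<open>Absorbs a factor cosh: exponential growth is paid for by a larger argument of
  \<open>sin_sqrt\<close>. The dropped part of the addition theorem is nonnegative.\<close>

lemma cos_sqrt_mult_sin_sqrt_le:
  assumes "\<mu> \<le> 0" "0 \<le> a"
  shows "cos_sqrt a \<mu> * sin_sqrt b \<mu> \<le> sin_sqrt (a + b) \<mu>"
  using sin_sqrt_nonneg[of \<mu> a] cos_sqrt_ge_1[of \<mu> b] assms by (simp add: sin_sqrt_add)

section \<open>Sine transforms, and lower bounds for the transform of A - b\<close>

definition sine_transform :: "real \<Rightarrow> (real \<Rightarrow> real) \<Rightarrow> real \<Rightarrow> real" where
  "sine_transform B g \<mu> = (\<integral>b. indicator {0..B} b * (g b * sin_sqrt b \<mu>) \<partial>lborel)"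

lemma sine_transform_measurable [measurable]:
  assumes [measurable]: "g \<in> borel_measurable borel"
  shows "sine_transform B g \<in> borel_measurable borel"
  unfolding sine_transform_def[abs_def] by measurable

lemma integrable_bounded_mult_sin_sqrt:
  assumes [measurable]: "g \<in> borel_measurable borel" and g: "\<And>x. \<bar>g x\<bar> \<le> c"
  shows "integrable lborel (\<lambda>b. indicator {a..B} b * (g b * sin_sqrt b \<mu>))"
proof -
  obtain C where C: "\<And>x. x \<in> {a..B} \<Longrightarrow> \<bar>sin_sqrt x \<mu>\<bar> \<le> C"
    using compact_Icc_bound[of a B "\<lambda>x. sin_sqrt x \<mu>"] continuous_sin_sqrt[OF continuous_on_id] by blast
  have "\<bar>g b * sin_sqrt b \<mu>\<bar> \<le> c * C" if "b \<in> {a..B}" for b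
    using g[of b] C[OF that] unfolding abs_mult
    by (intro mult_mono) (auto intro: order_trans[OF abs_ge_zero])
  then show ?thesis by (intro integrable_indicator_bounded) auto
qed

lemma sine_transform_linear_weight: "sine_transform A (\<lambda>b. A - b) \<mu> = second_primitive (\<lambda>r. sin_sqrt r \<mu>) A"
  by (simp add: sine_transform_def second_primitive_def)

text \<open>The length 2 is large enough for 2 - S(2) \<ge> 1 when \<mu> > 1, because |S(2)| \<le>
  1/sqrt(\<mu>); the fixed point equation then gives at least 1/\<mu>. It is small enough for S(b)
  \<ge> b/3 on [0, 2] when \<mu> \<le> 1. The bound converts Parseval's identity into a growth bound
  for the spectral measure.\<close>

lemma sine_transform_weight_lower_nonneg:
  assumes \<mu>: "0 \<le> \<mu>"
  shows "1 / (3 * (1 + \<mu>)) \<le> second_primitive (\<lambda>r. sin_sqrt r \<mu>) 2"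
proof (cases "\<mu> \<le> 1")
  case False
  have "sqrt \<mu> \<ge> 1" using False by simp
  then have "\<bar>sin_sqrt 2 \<mu>\<bar> * 1 \<le> \<bar>sin_sqrt 2 \<mu>\<bar> * sqrt \<mu>" by (intro mult_left_mono) auto
  then have "sin_sqrt 2 \<mu> \<le> 1" using abs_sin_sqrt_mult_sqrt_le[OF \<mu>, of 2] by linarith
  then have "1 \<le> \<mu> * second_primitive (\<lambda>r. sin_sqrt r \<mu>) 2"
    using sin_sqrt_fixpoint[of 2 \<mu>] by simp
  then have "1 / \<mu> \<le> second_primitive (\<lambda>r. sin_sqrt r \<mu>) 2"
    using False by (simp add: field_simps)
  moreover have "1 / (3 * (1 + \<mu>)) \<le> 1 / \<mu>" using False by (simp add: field_simps)
  ultimately show ?thesis by linarith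
next
  case True
  have i: "integrable lborel (\<lambda>r. indicator {0..b} r * sin_sqrt r \<mu>)" for b
    using integrable_bounded_mult_sin_sqrt[of "\<lambda>_. 1" 1 0 b \<mu>] by simp
  have FTC: "(\<integral>r. indicator {0..b} r * ((b - r) * r) \<partial>lborel) = b ^ 3 / 6" if "0 \<le> b" for b :: real
  proof -
    have "(\<integral>r. ((b - r) * r) * indicator {0..b} r \<partial>lborel) = (b * b ^ 2 / 2 - b ^ 3 / 3) - (b * 0 ^ 2 / 2 - 0 ^ 3 / 3)"
      by (rule integral_FTC_Icc_real[OF that]) (auto intro!: derivative_eq_intros continuous_intros simp: power2_eq_square algebra_simps)
    then show ?thesis by (simp add: mult.commute power3_eq_cube power2_eq_square)
  qed
  \<comment> \<open>The Taylor bound S(b) \<ge> b - b^3/6, from S(r) \<le> r in the fixed point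
    equation, combined with b^3 \<le> 4 b.\<close>
  have low: "b / 3 \<le> sin_sqrt b \<mu>" if b: "0 \<le> b" "b \<le> 2" for b
  proof -
    have "second_primitive (\<lambda>r. sin_sqrt r \<mu>) b \<le> (\<integral>r. indicator {0..b} r * ((b - r) * r) \<partial>lborel)"
      unfolding second_primitive_def
    proof (rule Bochner_Integration.integral_mono)
      show "integrable lborel (\<lambda>r. indicator {0..b} r * ((b - r) * sin_sqrt r \<mu>))"
        by (rule integrable_second_primitive[OF i])
      show "integrable lborel (\<lambda>r. indicator {0..b} r * ((b - r) * r))"
        by (rule integrable_second_primitive, rule integrable_indicator_bounded[where C=b]) auto
      show "indicator {0..b} r * ((b - r) * sin_sqrt r \<mu>) \<le> indicator {0..b} r * ((b - r) * r)" for r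
        using abs_sin_sqrt_le[OF \<mu>, of r] by (cases "r \<in> {0..b}") (auto intro!: mult_left_mono)
    qed
    then have *: "second_primitive (\<lambda>r. sin_sqrt r \<mu>) b \<le> b ^ 3 / 6" using FTC[OF b(1)] by simp
    have "\<mu> * second_primitive (\<lambda>r. sin_sqrt r \<mu>) b \<le> b ^ 3 / 6"
    proof (cases "second_primitive (\<lambda>r. sin_sqrt r \<mu>) b \<le> 0")
      case True
      have "\<mu> * second_primitive (\<lambda>r. sin_sqrt r \<mu>) b \<le> 0" using \<mu> True by (rule mult_nonneg_nonpos)
      also have "0 \<le> b ^ 3 / 6" using b by simp
      finally show ?thesis .
    next
      case False
      then have "\<mu> * second_primitive (\<lambda>r. sin_sqrt r \<mu>) b \<le> 1 * second_primitive (\<lambda>r. sin_sqrt r \<mu>) b"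
        using \<open>\<mu> \<le> 1\<close> by (intro mult_right_mono) auto
      then show ?thesis using * by simp
    qed
    then have "b - b ^ 3 / 6 \<le> sin_sqrt b \<mu>" using sin_sqrt_fixpoint[OF b(1), of \<mu>] by linarith
    moreover have "b ^ 3 \<le> b * 2 ^ 2"
      using b mult_left_mono[OF power_mono[of b 2 2], of b] by (simp add: power3_eq_cube power2_eq_square)
    ultimately show ?thesis by simp
  qed
  have "(1/3) * (\<integral>r. indicator {0..2::real} r * ((2 - r) * r) \<partial>lborel) \<le> second_primitive (\<lambda>r. sin_sqrt r \<mu>) 2"
    unfolding second_primitive_def integral_mult_right_zero[symmetric]
  proof (rule Bochner_Integration.integral_mono)
    show "integrable lborel (\<lambda>r. indicator {0..2} r * ((2 - r) * sin_sqrt r \<mu>))"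
      by (rule integrable_second_primitive[OF i])
    show "integrable lborel (\<lambda>r. (1/3) * (indicator {0..2::real} r * ((2 - r) * r)))"
      by (intro integrable_mult_right integrable_second_primitive, rule integrable_indicator_bounded[where C=2]) auto
    show "(1/3) * (indicator {0..2::real} r * ((2 - r) * r)) \<le> indicator {0..2} r * ((2 - r) * sin_sqrt r \<mu>)" for r
    proof (cases "r \<in> {0..2}")
      case True
      then have "(2 - r) * (r / 3) \<le> (2 - r) * sin_sqrt r \<mu>" using low[of r] by (intro mult_left_mono) auto
      then show ?thesis using True by simp
    qed simp
  qed
  moreover have "1 / (3 * (1 + \<mu>)) \<le> (1/3::real)" using \<mu> by (simp add: field_simps)
  ultimately show ?thesis using FTC[of 2] by simp
qed

text \<open>The integrand is nonnegative, so only r in [A/4, A/2] is kept, where A - r \<ge> A/2 and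
  S(r) \<ge> S(A/4).\<close>

lemma sine_transform_weight_lower_nonpos:
  assumes \<mu>: "\<mu> \<le> 0" and A: "0 < A"
  shows "A ^ 2 / 8 * sin_sqrt (A / 4) \<mu> \<le> second_primitive (\<lambda>r. sin_sqrt r \<mu>) A"
proof -
  have i: "integrable lborel (\<lambda>r. indicator {0..b} r * sin_sqrt r \<mu>)" for b
    using integrable_bounded_mult_sin_sqrt[of "\<lambda>_. 1" 1 0 b \<mu>] by simp
  have "(\<integral>r. indicator {A/4..A/2} r * (A / 2 * sin_sqrt (A / 4) \<mu>) \<partial>lborel) \<le> second_primitive (\<lambda>r. sin_sqrt r \<mu>) A"
    unfolding second_primitive_def
  proof (rule Bochner_Integration.integral_mono)
    show "integrable lborel (\<lambda>r. indicator {0..A} r * ((A - r) * sin_sqrt r \<mu>))"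
      by (rule integrable_second_primitive[OF i])
    show "indicator {A/4..A/2} r * (A / 2 * sin_sqrt (A / 4) \<mu>) \<le> indicator {0..A} r * ((A - r) * sin_sqrt r \<mu>)" for r
    proof (cases "r \<in> {A/4..A/2}")
      case True
      then have "A / 2 * sin_sqrt (A / 4) \<mu> \<le> (A - r) * sin_sqrt r \<mu>"
        using A \<mu> by (intro mult_mono sin_sqrt_mono sin_sqrt_nonneg) auto
      then show ?thesis using True A by simp
    next
      case False
      then show ?thesis using sin_sqrt_nonneg[OF \<mu>, of r] by (auto simp: indicator_def)
    qed
  qed simp
  then show ?thesis using A by (simp add: power2_eq_square)
qed

text \<open>Parseval's identity enters for bounded functions on bounded intervals, whose transforms
  are ordinary integrals. The transforms are given as measurable functions F and G, which avoids any
  discussion of measurability of \<phi> in \<mu>: for the transforms used here it is inherited from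
  \<open>sin_sqrt\<close>.\<close>

locale spectral_data = goursat_kernel q u for q u +
  fixes \<phi> :: "real \<Rightarrow> real \<Rightarrow> real" and M :: "real measure"
  assumes sets_M [measurable_cong, simp]: "sets M = sets borel"
    and \<phi>_continuous: "\<And>\<mu>. continuous_on UNIV (\<lambda>x. \<phi> x \<mu>)"
    and sin_sqrt_transmute: "\<And>s \<mu>. 0 \<le> s \<Longrightarrow> sin_sqrt s \<mu> = \<phi> s \<mu> + transmute (\<lambda>x. \<phi> x \<mu>) s"
    and parseval: "\<And>A C f g F G. 0 < A \<Longrightarrow> f \<in> borel_measurable borel \<Longrightarrow> g \<in> borel_measurable borel \<Longrightarrow>
      (\<And>x. \<bar>f x\<bar> \<le> C) \<Longrightarrow> (\<And>x. \<bar>g x\<bar> \<le> C) \<Longrightarrow>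
      F \<in> borel_measurable borel \<Longrightarrow> G \<in> borel_measurable borel \<Longrightarrow>
      (\<And>\<mu>. F \<mu> = (\<integral>x. indicator {0..A} x * (f x * \<phi> x \<mu>) \<partial>lborel)) \<Longrightarrow>
      (\<And>\<mu>. G \<mu> = (\<integral>x. indicator {0..A} x * (g x * \<phi> x \<mu>) \<partial>lborel)) \<Longrightarrow>
      integrable M (\<lambda>\<mu>. F \<mu> * G \<mu>) \<and>
      (\<integral>\<mu>. F \<mu> * G \<mu> \<partial>M) = (\<integral>x. indicator {0..A} x * (f x * g x) \<partial>lborel)"
begin

text \<open>Insert S = (I + W) \<phi> and exchange integrations; I + W passes to its
  adjoint.\<close>

lemma sine_transform_dual:
  assumes [measurable]: "g \<in> borel_measurable borel" and g: "\<And>x. \<bar>g x\<bar> \<le> c"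
  shows "sine_transform B g \<mu> = (\<integral>x. indicator {0..B} x * (transmute_dual B g x * \<phi> x \<mu>) \<partial>lborel)"
proof -
  note [measurable] = borel_measurable_continuous_onI[OF \<phi>_continuous]
  have c: "0 \<le> c" using g[of 0] by linarith
  obtain C where C: "0 \<le> C" "\<And>\<alpha> \<beta>. \<alpha> \<in> {0..B} \<Longrightarrow> \<beta> \<in> {0..B} \<Longrightarrow> \<bar>u \<alpha> \<beta>\<bar> \<le> C"
    using u_bound by blast
  obtain D where D: "\<And>x. x \<in> {0..B} \<Longrightarrow> \<bar>\<phi> x \<mu>\<bar> \<le> D"
    using compact_Icc_bound[OF continuous_on_subset[OF \<phi>_continuous subset_UNIV]] by blast
  let ?F = "\<lambda>b x. (indicator {0..B} b * g b) * (indicator {0..b} x * (u (b - x) x * \<phi> x \<mu>))"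
  have Fb: "\<bar>?F b x\<bar> \<le> (indicator {0..B} b * c) * (indicator {0..B} x * (C * D))" for b x
  proof (cases "0 \<le> x \<and> x \<le> b \<and> b \<le> B")
    case True
    then have "\<bar>g b\<bar> * (\<bar>u (b - x) x\<bar> * \<bar>\<phi> x \<mu>\<bar>) \<le> c * (C * D)"
      using g C D[of x] c by (intro mult_mono) auto
    then show ?thesis using True by (simp add: abs_mult)
  next
    case False
    have "0 \<le> D" if "x \<in> {0..B}" using D[OF that] by linarith
    then have "0 \<le> (indicator {0..B} b * c) * (indicator {0..B} x * (C * D))"
      using C c by (auto simp: indicator_def)
    moreover have "?F b x = 0" using False by (auto simp: indicator_def)
    ultimately show ?thesis by (simp only: abs_zero)
  qed
  have Fm: "(\<lambda>(b, x). ?F b x) \<in> borel_measurable (borel \<Otimes>\<^sub>M borel)" by measurable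
  note swap = lborel_Fubini_swap_bounded[OF Fm Fb integrable_indicator_interval integrable_indicator_interval]
  have i: "integrable lborel (\<lambda>b. indicator {0..B} b * (g b * \<phi> b \<mu>))"
  proof (rule integrable_indicator_bounded[where C="c * D"])
    show "\<bar>g x * \<phi> x \<mu>\<bar> \<le> c * D" if "x \<in> {0..B}" for x
      unfolding abs_mult using g[of x] D[OF that] c by (intro mult_mono) auto
  qed measurable
  have "sine_transform B g \<mu> = (\<integral>b. indicator {0..B} b * (g b * \<phi> b \<mu>) + (\<integral>x. ?F b x \<partial>lborel) \<partial>lborel)"
    unfolding sine_transform_def
  proof (intro Bochner_Integration.integral_cong refl)
    fix b
    show "indicator {0..B} b * (g b * sin_sqrt b \<mu>) = indicator {0..B} b * (g b * \<phi> b \<mu>) + (\<integral>x. ?F b x \<partial>lborel)"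
    proof (cases "b \<in> {0..B}")
      case True
      have F: "(\<integral>x. ?F b x \<partial>lborel) = indicator {0..B} b * g b * transmute (\<lambda>x. \<phi> x \<mu>) b"
        by (simp add: transmute_def)
      show ?thesis unfolding F using True by (simp add: sin_sqrt_transmute distrib_left)
    qed simp
  qed
  also have "\<dots> = (\<integral>b. indicator {0..B} b * (g b * \<phi> b \<mu>) \<partial>lborel) + (\<integral>b. (\<integral>x. ?F b x \<partial>lborel) \<partial>lborel)"
    by (rule Bochner_Integration.integral_add[OF i swap(2)])
  also have "(\<integral>b. (\<integral>x. ?F b x \<partial>lborel) \<partial>lborel) = (\<integral>x. (\<integral>b. ?F b x \<partial>lborel) \<partial>lborel)" by (rule swap(1))
  also have "(\<integral>b. indicator {0..B} b * (g b * \<phi> b \<mu>) \<partial>lborel) + \<dots> =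
    (\<integral>x. indicator {0..B} x * (g x * \<phi> x \<mu>) + (\<integral>b. ?F b x \<partial>lborel) \<partial>lborel)"
    by (rule Bochner_Integration.integral_add[OF i swap(3), symmetric])
  also have "\<dots> = (\<integral>x. indicator {0..B} x * (transmute_dual B g x * \<phi> x \<mu>) \<partial>lborel)"
  proof (intro Bochner_Integration.integral_cong refl)
    fix x
    have "(\<integral>b. ?F b x \<partial>lborel) = (\<integral>b. indicator {0..B} x * \<phi> x \<mu> * (indicator {x..B} b * (u (b - x) x * g b)) \<partial>lborel)"
      by (intro Bochner_Integration.integral_cong) (auto simp: indicator_def)
    also have "\<dots> = indicator {0..B} x * \<phi> x \<mu> * (transmute_dual B g x - g x)"
      by (simp add: transmute_dual_def)
    finally show "indicator {0..B} x * (g x * \<phi> x \<mu>) + (\<integral>b. ?F b x \<partial>lborel) =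
      indicator {0..B} x * (transmute_dual B g x * \<phi> x \<mu>)"
      by (simp only: algebra_simps)
  qed
  finally show ?thesis .
qed

lemma parseval_sine:
  assumes [measurable]: "g \<in> borel_measurable borel" "h \<in> borel_measurable borel"
    and g: "\<And>x. \<bar>g x\<bar> \<le> c" and h: "\<And>x. \<bar>h x\<bar> \<le> d" and B: "0 < B"
  shows "integrable M (\<lambda>\<mu>. sine_transform B g \<mu> * sine_transform B h \<mu>)"
    and "(\<integral>\<mu>. sine_transform B g \<mu> * sine_transform B h \<mu> \<partial>M) =
      (\<integral>x. indicator {0..B} x * (transmute_dual B g x * transmute_dual B h x) \<partial>lborel)"
proof -
  obtain C where C: "\<And>x. x \<in> {0..B} \<Longrightarrow> \<bar>transmute_dual B g x\<bar> \<le> C"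
    by (rule transmute_dual_bound[OF assms(1) g]) blast
  obtain D where D: "\<And>x. x \<in> {0..B} \<Longrightarrow> \<bar>transmute_dual B h x\<bar> \<le> D"
    by (rule transmute_dual_bound[OF assms(2) h]) blast
  \<comment> \<open>Truncated to [0, B], since the bounds for the dual hold there and
    \<open>parseval\<close> asks for global ones.\<close>
  let ?f = "\<lambda>x. indicator {0..B} x * transmute_dual B g x"
  let ?k = "\<lambda>x. indicator {0..B} x * transmute_dual B h x"
  let ?F = "sine_transform B g" and ?G = "sine_transform B h"
  have "integrable M (\<lambda>\<mu>. ?F \<mu> * ?G \<mu>) \<and> (\<integral>\<mu>. ?F \<mu> * ?G \<mu> \<partial>M) = (\<integral>x. indicator {0..B} x * (?f x * ?k x) \<partial>lborel)"
  proof (rule parseval[OF B, where C="max \<bar>C\<bar> \<bar>D\<bar>"])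
    show "\<bar>?f x\<bar> \<le> max \<bar>C\<bar> \<bar>D\<bar>" "\<bar>?k x\<bar> \<le> max \<bar>C\<bar> \<bar>D\<bar>" for x
      using C[of x] D[of x] by (auto simp: indicator_def)
    show "?F \<mu> = (\<integral>x. indicator {0..B} x * (?f x * \<phi> x \<mu>) \<partial>lborel)" for \<mu>
      unfolding sine_transform_dual[OF assms(1) g]
      by (intro Bochner_Integration.integral_cong) (auto simp: indicator_def)
    show "?G \<mu> = (\<integral>x. indicator {0..B} x * (?k x * \<phi> x \<mu>) \<partial>lborel)" for \<mu>
      unfolding sine_transform_dual[OF assms(2) h]
      by (intro Bochner_Integration.integral_cong) (auto simp: indicator_def)
  qed measurable
  moreover have "(\<integral>x. indicator {0..B} x * (?f x * ?k x) \<partial>lborel) =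
    (\<integral>x. indicator {0..B} x * (transmute_dual B g x * transmute_dual B h x) \<partial>lborel)"
    by (intro Bochner_Integration.integral_cong) (auto simp: indicator_def)
  ultimately show "integrable M (\<lambda>\<mu>. ?F \<mu> * ?G \<mu>)" "(\<integral>\<mu>. ?F \<mu> * ?G \<mu> \<partial>M) =
      (\<integral>x. indicator {0..B} x * (transmute_dual B g x * transmute_dual B h x) \<partial>lborel)"
    by auto
qed

text \<open>Parseval's identity with both factors equal to the transform of the weight A - b on
  [0, A]. The lower bounds for this transform then limit the spectral measure at both ends.\<close>

lemma integrable_second_primitive_sin_sqrt:
  assumes A: "0 < A"
  shows "integrable M (\<lambda>\<mu>. (second_primitive (\<lambda>r. sin_sqrt r \<mu>) A)\<^sup>2)"
proof -
  let ?g = "\<lambda>b. indicator {0..A} b * (A - b)"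
  have "sine_transform A ?g \<mu> = second_primitive (\<lambda>r. sin_sqrt r \<mu>) A" for \<mu>
    unfolding sine_transform_linear_weight[symmetric] sine_transform_def
    by (intro Bochner_Integration.integral_cong) (auto simp: indicator_def)
  moreover have "integrable M (\<lambda>\<mu>. sine_transform A ?g \<mu> * sine_transform A ?g \<mu>)"
    by (rule parseval_sine[where c=A and d=A]) (use A in \<open>auto simp: indicator_def\<close>)
  ultimately show ?thesis by (simp add: power2_eq_square)
qed

text \<open>This growth bound is why test functions are asked to have sine transforms of order (1 +
  \<mu>)^-2.\<close>

lemma integrable_weight_nonneg: "integrable M (\<lambda>\<mu>. indicator {0..} \<mu> * (1 / (1 + \<mu>)\<^sup>2))"
proof (rule Bochner_Integration.integrable_bound)
  show "integrable M (\<lambda>\<mu>. 9 * (second_primitive (\<lambda>r. sin_sqrt r \<mu>) 2)\<^sup>2)"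
    using integrable_second_primitive_sin_sqrt[of 2] by simp
  show "AE \<mu> in M. norm (indicator {0..} \<mu> * (1 / (1 + \<mu>)\<^sup>2)) \<le> norm (9 * (second_primitive (\<lambda>r. sin_sqrt r \<mu>) 2)\<^sup>2)"
  proof (rule AE_I2)
    fix \<mu>
    show "norm (indicator {0..} \<mu> * (1 / (1 + \<mu>)\<^sup>2)) \<le> norm (9 * (second_primitive (\<lambda>r. sin_sqrt r \<mu>) 2)\<^sup>2)"
    proof (cases "0 \<le> \<mu>")
      case True
      have "(1 / (1 + \<mu>))\<^sup>2 \<le> (3 * second_primitive (\<lambda>r. sin_sqrt r \<mu>) 2)\<^sup>2"
        using sine_transform_weight_lower_nonneg[OF True] True by (intro power_mono) (auto simp: field_simps)
      then show ?thesis using True by (simp add: power_divide power_mult_distrib)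
    qed simp
  qed
qed measurable

text \<open>As A is arbitrary, exp(c sqrt|\<mu>|) is integrable on the negative spectrum for every
  c; this licenses all exponential weights below. The transform is taken on [0, 4 A] because its
  lower bound involves a quarter of the length.\<close>

lemma integrable_weight_neg:
  assumes A: "0 < A"
  shows "integrable M (\<lambda>\<mu>. indicator {..<0} \<mu> * (sin_sqrt A \<mu>)\<^sup>2)"
proof (rule Bochner_Integration.integrable_bound)
  show "integrable M (\<lambda>\<mu>. (1 / (2 * A ^ 2))\<^sup>2 * (second_primitive (\<lambda>r. sin_sqrt r \<mu>) (4 * A))\<^sup>2)"
    using integrable_second_primitive_sin_sqrt[of "4 * A"] A by simp
  show "AE \<mu> in M. norm (indicator {..<0} \<mu> * (sin_sqrt A \<mu>)\<^sup>2) \<le> norm ((1 / (2 * A ^ 2))\<^sup>2 * (second_primitive (\<lambda>r. sin_sqrt r \<mu>) (4 * A))\<^sup>2)"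
  proof (rule AE_I2)
    fix \<mu>
    show "norm (indicator {..<0} \<mu> * (sin_sqrt A \<mu>)\<^sup>2) \<le> norm ((1 / (2 * A ^ 2))\<^sup>2 * (second_primitive (\<lambda>r. sin_sqrt r \<mu>) (4 * A))\<^sup>2)"
    proof (cases "\<mu> < 0")
      case True
      have "sin_sqrt A \<mu> \<le> (1 / (2 * A ^ 2)) * second_primitive (\<lambda>r. sin_sqrt r \<mu>) (4 * A)"
        using sine_transform_weight_lower_nonpos[of \<mu> "4 * A"] True A by (simp add: field_simps)
      then have "(sin_sqrt A \<mu>)\<^sup>2 \<le> ((1 / (2 * A ^ 2)) * second_primitive (\<lambda>r. sin_sqrt r \<mu>) (4 * A))\<^sup>2"
        using True A sin_sqrt_nonneg[of \<mu> A] by (intro power_mono) auto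
      then have "(sin_sqrt A \<mu>)\<^sup>2 \<le> (1 / (2 * A ^ 2))\<^sup>2 * (second_primitive (\<lambda>r. sin_sqrt r \<mu>) (4 * A))\<^sup>2"
        by (simp only: power_mult_distrib)
      then show ?thesis using True by simp
    qed simp
  qed
qed measurable

end

text \<open>The weight 2 x / a^2 on [0, a] has total mass 1, so this is an average of
  f(x)/x.\<close>

lemma quadratic_average_tendsto:
  fixes f :: "real \<Rightarrow> real"
  assumes [measurable]: "f \<in> borel_measurable borel"
    and lim: "((\<lambda>x. f x / x) \<longlongrightarrow> c) (at_right 0)"
  shows "((\<lambda>a. (2 / a\<^sup>2) * (\<integral>x. indicator {0..a} x * f x \<partial>lborel)) \<longlongrightarrow> c) (at_right 0)"
proof (rule tendstoI)
  fix e :: real assume e: "e > 0"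
  then have "eventually (\<lambda>x. dist (f x / x) c < e / 2) (at_right 0)"
    by (intro tendstoD[OF lim]) simp
  then obtain d where d: "d > 0" "\<And>x. 0 < x \<Longrightarrow> x < d \<Longrightarrow> \<bar>f x / x - c\<bar> < e / 2"
    unfolding eventually_at_right_field dist_real_def by blast
  have d': "\<bar>f x - c * x\<bar> \<le> e / 2 * x" if "0 < x" "x < d" for x
  proof -
    have "\<bar>f x - c * x\<bar> = \<bar>f x / x - c\<bar> * x" using that by (simp add: abs_mult[symmetric] field_simps flip: abs_of_pos)
    also have "\<dots> \<le> e / 2 * x" using d(2)[OF that] that by (intro mult_right_mono) auto
    finally show ?thesis .
  qed
  show "eventually (\<lambda>a. dist ((2 / a\<^sup>2) * (\<integral>x. indicator {0..a} x * f x \<partial>lborel)) c < e) (at_right 0)"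
    unfolding eventually_at_right_field
  proof (intro exI[of _ d] conjI allI impI d(1))
    fix a assume a: "0 < a" "a < d"
    have lin: "integrable lborel (\<lambda>x. indicator {0..a} x * x)"
      by (rule integrable_indicator_bounded[where C=a]) auto
    have I: "(\<integral>x. indicator {0..a} x * x \<partial>lborel) = a\<^sup>2 / 2"
    proof -
      have "(\<integral>x. x * indicator {0..a} x \<partial>lborel) = a\<^sup>2 / 2 - 0\<^sup>2 / 2"
        using a by (intro integral_FTC_Icc_real) (auto intro!: derivative_eq_intros)
      then show ?thesis by (simp add: mult.commute)
    qed
    have diff: "integrable lborel (\<lambda>x. indicator {0..a} x * (f x - c * x))"
    proof (rule Bochner_Integration.integrable_bound)
      show "integrable lborel (\<lambda>x. e / 2 * (indicator {0..a} x * x))" using lin by simp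
      show "AE x in lborel. norm (indicator {0..a} x * (f x - c * x)) \<le> norm (e / 2 * (indicator {0..a} x * x))"
        using AE_lborel_singleton[of 0]
      proof eventually_elim
        case (elim x)
        show ?case
        proof (cases "x \<in> {0..a}")
          case True
          then have "\<bar>f x - c * x\<bar> \<le> e / 2 * x" using elim a by (intro d') auto
          then show ?thesis using True by simp
        qed simp
      qed
    qed measurable
    have "integrable lborel (\<lambda>x. indicator {0..a} x * (f x - c * x) + c * (indicator {0..a} x * x))"
      using diff lin by simp
    then have fi: "integrable lborel (\<lambda>x. indicator {0..a} x * f x)" by (simp add: algebra_simps)
    have eq: "(\<integral>x. indicator {0..a} x * f x \<partial>lborel) - c * (a\<^sup>2 / 2) = (\<integral>x. indicator {0..a} x * (f x - c * x) \<partial>lborel)"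
    proof -
      have "(\<integral>x. indicator {0..a} x * (f x - c * x) \<partial>lborel) = (\<integral>x. 1 * (indicator {0..a} x * f x) - c * (indicator {0..a} x * x) \<partial>lborel)"
        by (intro Bochner_Integration.integral_cong) (auto simp: algebra_simps)
      then show ?thesis unfolding integral_diff_scaled[OF fi lin] I by simp
    qed
    have "\<bar>\<integral>x. indicator {0..a} x * (f x - c * x) \<partial>lborel\<bar> \<le> (\<integral>x. e / 2 * (indicator {0..a} x * x) \<partial>lborel)"
    proof (rule order_trans[OF integral_abs_bound], rule integral_mono_AE)
      show "AE x in lborel. \<bar>indicator {0..a} x * (f x - c * x)\<bar> \<le> e / 2 * (indicator {0..a} x * x)"
        using AE_lborel_singleton[of 0]
      proof eventually_elim
        case (elim x)
        show ?case
        proof (cases "x \<in> {0..a}")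
          case True
          then have "\<bar>f x - c * x\<bar> \<le> e / 2 * x" using elim a by (intro d') auto
          then show ?thesis using True by simp
        qed simp
      qed
    qed (use diff lin in auto)
    also have "\<dots> = e * a\<^sup>2 / 4" by (simp add: I)
    finally have "\<bar>(2 / a\<^sup>2) * ((\<integral>x. indicator {0..a} x * f x \<partial>lborel) - c * (a\<^sup>2 / 2))\<bar> \<le> (2 / a\<^sup>2) * (e * a\<^sup>2 / 4)"
      unfolding eq abs_mult using a by (intro mult_mono) auto
    also have "\<dots> < e" using a e by simp
    finally show "dist ((2 / a\<^sup>2) * (\<integral>x. indicator {0..a} x * f x \<partial>lborel)) c < e"
      using a by (simp add: dist_real_def right_diff_distrib)
  qed
qed

section \<open>Integrals of sine transforms against the spectral measure\<close>

context spectral_data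
begin

text \<open>The second factor in Parseval's identity is 2/a^2 on [0, a] with a tending to 0. Its
  first moment is normalised, not its mass: as S(b) is close to b, its sine transform tends to 1,
  while the space side tends to the limit of (dual of G)(x)/x supplied by
  \<open>transmute_dual_axis\<close>.\<close>

lemma integral_sine_transform:
  fixes G :: "real \<Rightarrow> real"
  assumes G: "continuous_on UNIV G" and supp: "\<And>b. b \<ge> B \<Longrightarrow> G b = 0" and bnd: "\<And>s. \<bar>G s\<bar> \<le> c"
    and lim: "((\<lambda>x. G x / x) \<longlongrightarrow> G1) (at_right 0)" and B: "0 < B"
    and decay: "\<And>\<mu>. 0 \<le> \<mu> \<Longrightarrow> \<bar>sine_transform B G \<mu>\<bar> \<le> K / (1 + \<mu>)\<^sup>2"
  shows "integrable M (sine_transform B G)"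
    and "(\<integral>\<mu>. sine_transform B G \<mu> \<partial>M) = G1 + response_pairing B G"
proof -
  note [measurable] = borel_measurable_continuous_onI[OF G]
  have c: "0 \<le> c" using bnd[of 0] by linarith
  \<comment> \<open>Bounds |S(b)|/b for 0 < b \<le> 1 and hence all transforms of the approximating
    functions.\<close>
  define \<omega> where "\<omega> \<mu> = (if \<mu> < 0 then cos_sqrt 1 \<mu> else 1)" for \<mu>
  have [measurable]: "\<omega> \<in> borel_measurable borel" unfolding \<omega>_def by measurable
  have \<omega>1: "1 \<le> \<omega> \<mu>" for \<mu> unfolding \<omega>_def using cos_sqrt_ge_1[of \<mu> 1] by auto
  have S_le: "\<bar>sin_sqrt b \<mu>\<bar> \<le> b * \<omega> \<mu>" if b: "0 \<le> b" "b \<le> 1" for b \<mu>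
  proof (cases "\<mu> < 0")
    case True
    have "sin_sqrt b \<mu> \<le> b * cos_sqrt b \<mu>" using True b by (intro sin_sqrt_le) auto
    also have "\<dots> \<le> b * cos_sqrt 1 \<mu>" using True b by (intro mult_left_mono cos_sqrt_mono) auto
    finally show ?thesis using True b sin_sqrt_nonneg[of \<mu> b] by (simp add: \<omega>_def)
  next
    case False
    then show ?thesis using abs_sin_sqrt_le[of \<mu> b] b by (simp add: \<omega>_def)
  qed
  \<comment> \<open>Majorant for the limit. On \<mu> \<ge> 0 it comes from \<open>decay\<close>; on
    \<mu> < 0 the product of cosh and S(B) is at most S(1 + B), which is at least 1 and may be
    squared to fit \<open>integrable_weight_neg\<close>.\<close>
  have D: "integrable M (\<lambda>\<mu>. \<bar>sine_transform B G \<mu>\<bar> * \<omega> \<mu>)"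
  proof (rule Bochner_Integration.integrable_bound)
    show "integrable M (\<lambda>\<mu>. \<bar>K\<bar> * (indicator {0..} \<mu> * (1 / (1 + \<mu>)\<^sup>2)) + c * B * (indicator {..<0} \<mu> * (sin_sqrt (1 + B) \<mu>)\<^sup>2))"
      by (intro Bochner_Integration.integrable_add integrable_mult_right integrable_weight_nonneg integrable_weight_neg)
        (use B in simp)
    show "AE \<mu> in M. norm (\<bar>sine_transform B G \<mu>\<bar> * \<omega> \<mu>) \<le> norm (\<bar>K\<bar> * (indicator {0..} \<mu> * (1 / (1 + \<mu>)\<^sup>2)) + c * B * (indicator {..<0} \<mu> * (sin_sqrt (1 + B) \<mu>)\<^sup>2))"
    proof (rule AE_I2)
      fix \<mu>
      show "norm (\<bar>sine_transform B G \<mu>\<bar> * \<omega> \<mu>) \<le> norm (\<bar>K\<bar> * (indicator {0..} \<mu> * (1 / (1 + \<mu>)\<^sup>2)) + c * B * (indicator {..<0} \<mu> * (sin_sqrt (1 + B) \<mu>)\<^sup>2))"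
      proof (cases "\<mu> < 0")
        case True
        have "\<bar>sine_transform B G \<mu>\<bar> \<le> (\<integral>b. indicator {0..B} b * (c * sin_sqrt B \<mu>) \<partial>lborel)"
          unfolding sine_transform_def
        proof (rule order_trans[OF integral_abs_bound], rule Bochner_Integration.integral_mono)
          show "integrable lborel (\<lambda>b. \<bar>indicator {0..B} b * (G b * sin_sqrt b \<mu>)\<bar>)"
            by (intro integrable_abs integrable_bounded_mult_sin_sqrt[OF _ bnd]) measurable
          show "\<bar>indicator {0..B} b * (G b * sin_sqrt b \<mu>)\<bar> \<le> indicator {0..B} b * (c * sin_sqrt B \<mu>)" for b
          proof (cases "b \<in> {0..B}")
            case b: True
            have "\<bar>G b\<bar> * \<bar>sin_sqrt b \<mu>\<bar> \<le> c * sin_sqrt B \<mu>"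
              using b True bnd c sin_sqrt_nonneg[of \<mu> b] sin_sqrt_mono[of \<mu> b B] by (intro mult_mono) auto
            then show ?thesis using b by (simp add: abs_mult)
          qed simp
        qed simp
        also have "\<dots> = B * (c * sin_sqrt B \<mu>)" using B by simp
        finally have "\<bar>sine_transform B G \<mu>\<bar> * cos_sqrt 1 \<mu> \<le> B * (c * sin_sqrt B \<mu>) * cos_sqrt 1 \<mu>"
          using cos_sqrt_ge_1[of \<mu> 1] True by (intro mult_right_mono) auto
        also have "\<dots> = c * B * (cos_sqrt 1 \<mu> * sin_sqrt B \<mu>)" by simp
        also have "\<dots> \<le> c * B * (sin_sqrt (1 + B) \<mu>)\<^sup>2"
        proof (rule mult_left_mono)
          have "cos_sqrt 1 \<mu> * sin_sqrt B \<mu> \<le> sin_sqrt (1 + B) \<mu> * 1"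
            using cos_sqrt_mult_sin_sqrt_le[of \<mu> 1 B] True by simp
          also have "\<dots> \<le> sin_sqrt (1 + B) \<mu> * sin_sqrt (1 + B) \<mu>"
            using le_sin_sqrt[of \<mu> "1 + B"] True B by (intro mult_left_mono) auto
          finally show "cos_sqrt 1 \<mu> * sin_sqrt B \<mu> \<le> (sin_sqrt (1 + B) \<mu>)\<^sup>2" by (simp add: power2_eq_square)
        qed (use c B in simp)
        finally show ?thesis using True c B cos_sqrt_ge_1[of \<mu> 1] by (simp add: \<omega>_def)
      next
        case False
        then have "\<bar>sine_transform B G \<mu>\<bar> \<le> \<bar>K\<bar> / (1 + \<mu>)\<^sup>2"
          using decay[of \<mu>] by (auto intro: order_trans[OF _ divide_right_mono])
        then show ?thesis using False by (simp add: \<omega>_def)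
      qed
    qed
  qed measurable
  show int: "integrable M (sine_transform B G)"
  proof (rule Bochner_Integration.integrable_bound[OF D])
    show "AE \<mu> in M. norm (sine_transform B G \<mu>) \<le> norm (\<bar>sine_transform B G \<mu>\<bar> * \<omega> \<mu>)"
    proof (rule AE_I2)
      fix \<mu>
      have "\<bar>sine_transform B G \<mu>\<bar> * 1 \<le> \<bar>sine_transform B G \<mu>\<bar> * \<omega> \<mu>" by (intro mult_left_mono \<omega>1) auto
      then show "norm (sine_transform B G \<mu>) \<le> norm (\<bar>sine_transform B G \<mu>\<bar> * \<omega> \<mu>)" by simp
    qed
  qed measurable
  \<comment> \<open>At most 1 for the bound by \<omega>, at most B so that the approximating
    functions live on [0, B].\<close>
  define b0 where "b0 = min 1 B"
  define X where "X n = b0 / (2 + real n)" for n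
  have b0: "0 < b0" "b0 \<le> 1" "b0 \<le> B" using B by (auto simp: b0_def)
  have X: "0 < X n" "X n \<le> 1" "X n \<le> B" for n
  proof -
    show "0 < X n" using b0 by (simp add: X_def)
    have "X n \<le> b0" using b0 by (simp add: X_def field_simps)
    then show "X n \<le> 1" "X n \<le> B" using b0 by auto
  qed
  have "X \<longlonglongrightarrow> 0" unfolding X_def by real_asymp
  then have Xf: "filterlim X (at_right 0) sequentially"
    using X(1) unfolding filterlim_at by (auto intro!: always_eventually simp: less_le)
  define h where "h n b = indicator {0..X n} b * (2 / (X n)\<^sup>2)" for n and b :: real
  have [measurable]: "h n \<in> borel_measurable borel" for n unfolding h_def by measurable
  have hb: "\<bar>h n b\<bar> \<le> 2 / (X n)\<^sup>2" for n b by (auto simp: h_def indicator_def)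
  have h_ST: "sine_transform B (h n) \<mu> = (2 / (X n)\<^sup>2) * (\<integral>b. indicator {0..X n} b * sin_sqrt b \<mu> \<partial>lborel)" for n \<mu>
    unfolding sine_transform_def integral_mult_right_zero[symmetric]
    using X[of n] by (intro Bochner_Integration.integral_cong) (auto simp: h_def indicator_def)
  have h_ST_bound: "\<bar>sine_transform B (h n) \<mu>\<bar> \<le> \<omega> \<mu>" for n \<mu>
  proof -
    have lin: "integrable lborel (\<lambda>x. indicator {0..X n} x * x)"
      by (rule integrable_indicator_bounded[where C="X n"]) auto
    have I: "(\<integral>x. indicator {0..X n} x * x \<partial>lborel) = (X n)\<^sup>2 / 2"
    proof -
      have "(\<integral>x. x * indicator {0..X n} x \<partial>lborel) = (X n)\<^sup>2 / 2 - 0\<^sup>2 / 2"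
        using X(1)[of n] by (intro integral_FTC_Icc_real) (auto intro!: derivative_eq_intros)
      then show ?thesis by (simp add: mult.commute)
    qed
    have "\<bar>\<integral>b. indicator {0..X n} b * sin_sqrt b \<mu> \<partial>lborel\<bar> \<le> (\<integral>b. \<omega> \<mu> * (indicator {0..X n} b * b) \<partial>lborel)"
    proof (rule order_trans[OF integral_abs_bound], rule Bochner_Integration.integral_mono)
      show "integrable lborel (\<lambda>b. \<bar>indicator {0..X n} b * sin_sqrt b \<mu>\<bar>)"
        using integrable_bounded_mult_sin_sqrt[of "\<lambda>_. 1" 1 0 "X n" \<mu>] by auto
      show "\<bar>indicator {0..X n} b * sin_sqrt b \<mu>\<bar> \<le> \<omega> \<mu> * (indicator {0..X n} b * b)" for b
        using S_le[of b \<mu>] X(2)[of n] by (auto simp: indicator_def mult.commute)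
    qed (use lin in auto)
    also have "\<dots> = \<omega> \<mu> * ((X n)\<^sup>2 / 2)" by (simp add: I)
    finally have "\<bar>sine_transform B (h n) \<mu>\<bar> \<le> (2 / (X n)\<^sup>2) * (\<omega> \<mu> * ((X n)\<^sup>2 / 2))"
      unfolding h_ST abs_mult by (intro mult_mono) auto
    then show ?thesis using X(1)[of n] by simp
  qed
  have h_ST_lim: "(\<lambda>n. sine_transform B (h n) \<mu>) \<longlonglongrightarrow> 1" for \<mu>
  proof -
    have "((\<lambda>x. (sin_sqrt x \<mu> - sin_sqrt 0 \<mu>) / (x - 0)) \<longlongrightarrow> cos_sqrt 0 \<mu>) (at 0)"
      using DERIV_sin_sqrt[of \<mu> 0] by (simp add: has_field_derivative_iff)
    then have "((\<lambda>x. sin_sqrt x \<mu> / x) \<longlongrightarrow> 1) (at_right 0)"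
      by (simp add: filterlim_at_split)
    from quadratic_average_tendsto[OF _ this] have
      "((\<lambda>a. (2 / a\<^sup>2) * (\<integral>x. indicator {0..a} x * sin_sqrt x \<mu> \<partial>lborel)) \<longlongrightarrow> 1) (at_right 0)"
      by simp
    from filterlim_compose[OF this Xf] show ?thesis unfolding h_ST .
  qed
  \<comment> \<open>Spectral side of Parseval's identity, by dominated convergence.\<close>
  have L: "(\<lambda>n. \<integral>\<mu>. sine_transform B G \<mu> * sine_transform B (h n) \<mu> \<partial>M) \<longlonglongrightarrow> (\<integral>\<mu>. sine_transform B G \<mu> \<partial>M)"
  proof (rule integral_dominated_convergence[OF _ _ D])
    show "AE \<mu> in M. (\<lambda>n. sine_transform B G \<mu> * sine_transform B (h n) \<mu>) \<longlonglongrightarrow> sine_transform B G \<mu>"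
      using tendsto_mult[OF tendsto_const h_ST_lim] by (intro AE_I2) auto
    show "AE \<mu> in M. norm (sine_transform B G \<mu> * sine_transform B (h n) \<mu>) \<le> \<bar>sine_transform B G \<mu>\<bar> * \<omega> \<mu>" for n
      using h_ST_bound by (intro AE_I2) (auto simp: abs_mult intro!: mult_left_mono)
  qed measurable
  obtain C where C: "0 \<le> C" "\<And>\<alpha> \<beta>. \<alpha> \<in> {0..B} \<Longrightarrow> \<beta> \<in> {0..B} \<Longrightarrow> \<bar>u \<alpha> \<beta>\<bar> \<le> C"
    using u_bound by blast
  define W where "W = transmute_dual B G"
  have [measurable]: "W \<in> borel_measurable borel" unfolding W_def by measurable
  obtain CW where CW: "\<And>x. x \<in> {0..B} \<Longrightarrow> \<bar>W x\<bar> \<le> CW"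
    unfolding W_def by (rule transmute_dual_bound[OF borel_measurable_continuous_onI[OF G] bnd]) blast
  let ?c = "G1 + response_pairing B G"
  have W_lim: "((\<lambda>x. W x / x) \<longlongrightarrow> ?c) (at_right 0)"
    unfolding W_def by (rule transmute_dual_axis[OF G supp bnd lim B])
  \<comment> \<open>Shows that the averages of |W| converge, so the kernel correction, which carries
    a further factor \<open>X n\<close>, tends to 0.\<close>
  have W_abs_lim: "((\<lambda>x. \<bar>W x\<bar> / x) \<longlongrightarrow> \<bar>?c\<bar>) (at_right 0)"
  proof (rule Lim_transform_eventually[OF tendsto_rabs[OF W_lim]])
    show "\<forall>\<^sub>F x in at_right 0. \<bar>W x / x\<bar> = \<bar>W x\<bar> / x"
      unfolding eventually_at_right_field by (auto intro!: exI[of _ 1])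
  qed
  \<comment> \<open>The kernel part of the dual of \<open>h n\<close>, up to the factor
    \<open>2 / (X n)\<^sup>2\<close>; it is O(\<open>X n\<close>).\<close>
  define e where "e n x = (\<integral>s. indicator {x..X n} s * (u (s - x) x * 1) \<partial>lborel)" for n x
  have [measurable]: "e n \<in> borel_measurable borel" for n unfolding e_def by measurable
  have eb: "\<bar>e n x\<bar> \<le> C * X n" if "x \<in> {0..X n}" for n x
  proof -
    have "\<bar>e n x\<bar> \<le> (X n - x) * (C * 1)"
      unfolding e_def by (rule integral_kernel_bound) (use that C X[of n] in auto)
    also have "\<dots> \<le> C * X n" using that C by (simp add: mult.commute mult_left_mono)
    finally show ?thesis .
  qed
  have Wh: "indicator {0..B} x * (W x * transmute_dual B (h n) x) =
    (2 / (X n)\<^sup>2) * (indicator {0..X n} x * W x) + (2 / (X n)\<^sup>2) * (indicator {0..X n} x * (W x * e n x))" for n x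
  proof (cases "x \<in> {0..X n}")
    case True
    have "(\<integral>s. indicator {x..B} s * (u (s - x) x * h n s) \<partial>lborel) = (\<integral>s. (2 / (X n)\<^sup>2) * (indicator {x..X n} s * (u (s - x) x * 1)) \<partial>lborel)"
      using True X[of n] by (intro Bochner_Integration.integral_cong) (auto simp: h_def indicator_def)
    also have "\<dots> = (2 / (X n)\<^sup>2) * e n x" by (simp add: e_def)
    finally have "transmute_dual B (h n) x = (2 / (X n)\<^sup>2) * (1 + e n x)"
      using True by (simp add: transmute_dual_def h_def distrib_left)
    then show ?thesis using True X[of n] by (simp add: algebra_simps add_divide_distrib)
  next
    case False
    show ?thesis
    proof (cases "x \<in> {0..B}")
      case True
      have "(\<integral>s. indicator {x..B} s * (u (s - x) x * h n s) \<partial>lborel) = (\<integral>s. 0 \<partial>(lborel :: real measure))"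
        using True False by (intro Bochner_Integration.integral_cong) (auto simp: h_def indicator_def)
      then show ?thesis using False by (simp add: transmute_dual_def h_def)
    qed (use False X[of n] in \<open>auto simp: indicator_def\<close>)
  qed
  have iW: "integrable lborel (\<lambda>x. indicator {0..X n} x * W x)" for n
    by (rule integrable_indicator_bounded[where C=CW]) (use CW X(3)[of n] in auto)
  have iWe: "integrable lborel (\<lambda>x. indicator {0..X n} x * (W x * e n x))" for n
    by (rule integrable_indicator_mult_bounded[OF iW _ eb]) auto
  have R: "(\<lambda>n. \<integral>\<mu>. sine_transform B G \<mu> * sine_transform B (h n) \<mu> \<partial>M) \<longlonglongrightarrow> ?c + 0"
  proof -
    have eq: "(\<integral>\<mu>. sine_transform B G \<mu> * sine_transform B (h n) \<mu> \<partial>M) =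
      (2 / (X n)\<^sup>2) * (\<integral>x. indicator {0..X n} x * W x \<partial>lborel) +
      (2 / (X n)\<^sup>2) * (\<integral>x. indicator {0..X n} x * (W x * e n x) \<partial>lborel)" for n
    proof -
      have "(\<integral>\<mu>. sine_transform B G \<mu> * sine_transform B (h n) \<mu> \<partial>M) =
        (\<integral>x. indicator {0..B} x * (W x * transmute_dual B (h n) x) \<partial>lborel)"
        unfolding W_def by (rule parseval_sine(2)[OF _ _ bnd hb B]) auto
      also have "\<dots> = (\<integral>x. (2 / (X n)\<^sup>2) * (indicator {0..X n} x * W x) + (2 / (X n)\<^sup>2) * (indicator {0..X n} x * (W x * e n x)) \<partial>lborel)"
        unfolding Wh ..
      finally show ?thesis using iW iWe by simp
    qed
    have "(\<lambda>n. (2 / (X n)\<^sup>2) * (\<integral>x. indicator {0..X n} x * W x \<partial>lborel)) \<longlonglongrightarrow> ?c"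
      by (rule filterlim_compose[OF quadratic_average_tendsto[OF _ W_lim] Xf]) auto
    moreover have "(\<lambda>n. (2 / (X n)\<^sup>2) * (\<integral>x. indicator {0..X n} x * (W x * e n x) \<partial>lborel)) \<longlonglongrightarrow> 0"
    proof (rule Lim_null_comparison[OF always_eventually], rule allI)
      fix n
      have "\<bar>\<integral>x. indicator {0..X n} x * (W x * e n x) \<partial>lborel\<bar> \<le> (\<integral>x. C * X n * (indicator {0..X n} x * \<bar>W x\<bar>) \<partial>lborel)"
      proof (rule order_trans[OF integral_abs_bound], rule Bochner_Integration.integral_mono)
        show "integrable lborel (\<lambda>x. \<bar>indicator {0..X n} x * (W x * e n x)\<bar>)" using iWe by auto
        show "integrable lborel (\<lambda>x. C * X n * (indicator {0..X n} x * \<bar>W x\<bar>))"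
          using integrable_abs[OF iW[of n]] by (simp add: abs_mult)
        show "\<bar>indicator {0..X n} x * (W x * e n x)\<bar> \<le> C * X n * (indicator {0..X n} x * \<bar>W x\<bar>)" for x
          using eb[of x n] by (auto simp: indicator_def abs_mult mult.commute[of "\<bar>W x\<bar>"] intro!: mult_right_mono)
      qed
      then have "norm ((2 / (X n)\<^sup>2) * (\<integral>x. indicator {0..X n} x * (W x * e n x) \<partial>lborel)) \<le>
        (2 / (X n)\<^sup>2) * (C * X n * (\<integral>x. indicator {0..X n} x * \<bar>W x\<bar> \<partial>lborel))"
        unfolding real_norm_def abs_mult by (intro mult_mono) auto
      then show "norm ((2 / (X n)\<^sup>2) * (\<integral>x. indicator {0..X n} x * (W x * e n x) \<partial>lborel)) \<le>
        C * X n * ((2 / (X n)\<^sup>2) * (\<integral>x. indicator {0..X n} x * \<bar>W x\<bar> \<partial>lborel))"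
        by (simp add: mult_ac)
    next
      have "(\<lambda>n. (2 / (X n)\<^sup>2) * (\<integral>x. indicator {0..X n} x * \<bar>W x\<bar> \<partial>lborel)) \<longlonglongrightarrow> \<bar>?c\<bar>"
        by (rule filterlim_compose[OF quadratic_average_tendsto[OF _ W_abs_lim] Xf]) auto
      from tendsto_mult[OF tendsto_mult[OF tendsto_const \<open>X \<longlonglongrightarrow> 0\<close>] this]
      show "(\<lambda>n. C * X n * ((2 / (X n)\<^sup>2) * (\<integral>x. indicator {0..X n} x * \<bar>W x\<bar> \<partial>lborel))) \<longlonglongrightarrow> 0" by simp
    qed
    ultimately show ?thesis unfolding eq by (rule tendsto_add)
  qed
  show "(\<integral>\<mu>. sine_transform B G \<mu> \<partial>M) = ?c"
    using LIMSEQ_unique[OF L R] by simp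
qed

end

section \<open>Smooth cutoffs\<close>

context goursat_kernel
begin

text \<open>The response function in quadrant coordinates, where v(\<zeta>, t) =
  \<open>u \<zeta> ((t - \<zeta>) / 2)\<close>.\<close>

definition response :: "real \<Rightarrow> real" where
  "response t = - (1/2) * q (t / 2) - (1/2) * (\<integral>\<zeta>. indicator {0..t} \<zeta> * (q ((t - \<zeta>) / 2) * u \<zeta> ((t - \<zeta>) / 2)) \<partial>lborel)"

lemma response_measurable [measurable]: "response \<in> borel_measurable borel"
  unfolding response_def[abs_def] by measurable

text \<open>Substitute t = 2\<beta> and t = \<alpha> + 2\<beta>. The Jacobian gives the factors 1/2
  of the response function, and the vanishing of G beyond B cuts the square in (\<alpha>, \<beta>)
  down to \<alpha> \<le> t \<le> B. The same exchange of integrals yields local integrability of the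
  response function.\<close>

lemma
  assumes [measurable]: "G \<in> borel_measurable borel" and bnd: "\<And>s. \<bar>G s\<bar> \<le> c" and supp: "\<And>b. b > B \<Longrightarrow> G b = 0"
  shows response_pairing_eq: "response_pairing B G = (\<integral>t. indicator {0..B} t * (G t * response t) \<partial>lborel)" (is ?eq)
    and integrable_mult_response: "integrable lborel (\<lambda>t. indicator {0..B} t * (G t * response t))" (is ?int)
proof -
  have c: "0 \<le> c" using bnd[of 0] by linarith
  obtain C where C: "0 \<le> C" "\<And>\<alpha> \<beta>. \<alpha> \<in> {0..B} \<Longrightarrow> \<beta> \<in> {0..B} \<Longrightarrow> \<bar>u \<alpha> \<beta>\<bar> \<le> C"
    using u_bound by blast
  have half: "(\<integral>\<beta>. f \<beta> \<partial>lborel) = (1/2) * (\<integral>t. f ((t - \<alpha>) / 2) \<partial>lborel)" for f :: "real \<Rightarrow> real" and \<alpha>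
    using lborel_integral_real_affine[of "1/2" f "- \<alpha> / 2"] by (simp add: diff_divide_distrib)
  have half_int: "integrable lborel (\<lambda>t. f ((t - \<alpha>) / 2))" if "integrable lborel f" for f :: "real \<Rightarrow> real" and \<alpha>
    using lborel_integrable_real_affine[OF that, of "1/2" "- \<alpha> / 2"] by (simp add: diff_divide_distrib)
  let ?Q = "\<lambda>\<beta>. \<bar>indicator {0..B} \<beta> * q \<beta>\<bar> * (C * c)"
  have Q: "integrable lborel ?Q" using q_integrable by auto
  let ?F = "\<lambda>\<alpha> t. indicator {0..B} \<alpha> * (indicator {\<alpha>..B} t * (q ((t - \<alpha>) / 2) * u \<alpha> ((t - \<alpha>) / 2) * G t))"
  have Fb: "\<bar>?F \<alpha> t\<bar> \<le> indicator {0..B} \<alpha> * ?Q ((t - \<alpha>) / 2)" for \<alpha> t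
  proof (cases "0 \<le> \<alpha> \<and> \<alpha> \<le> t \<and> t \<le> B")
    case True
    then have "\<bar>u \<alpha> ((t - \<alpha>) / 2)\<bar> * \<bar>G t\<bar> \<le> C * c"
      using C c bnd by (intro mult_mono) auto
    then show ?thesis using True by (simp add: abs_mult mult.assoc mult_left_mono)
  next
    case False
    then have "?F \<alpha> t = 0" by (auto simp: indicator_def)
    moreover have "0 \<le> indicator {0..B} \<alpha> * ?Q ((t - \<alpha>) / 2)" using C c by simp
    ultimately show ?thesis by (simp only: abs_zero)
  qed
  have Fi: "integrable lborel (?F \<alpha>)" for \<alpha>
    by (rule Bochner_Integration.integrable_bound[of _ "\<lambda>t. indicator {0..B} \<alpha> * ?Q ((t - \<alpha>) / 2)"])
      (use half_int[OF Q] Fb in \<open>auto intro!: AE_I2 intro: order_trans[OF _ abs_ge_self]\<close>)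
  have Fl: "(\<integral>t. \<bar>?F \<alpha> t\<bar> \<partial>lborel) \<le> indicator {0..B} \<alpha> * (2 * (\<integral>\<beta>. ?Q \<beta> \<partial>lborel))" for \<alpha>
  proof -
    have "(\<integral>t. \<bar>?F \<alpha> t\<bar> \<partial>lborel) \<le> (\<integral>t. indicator {0..B} \<alpha> * ?Q ((t - \<alpha>) / 2) \<partial>lborel)"
      by (intro Bochner_Integration.integral_mono integrable_abs Fi Fb integrable_mult_right half_int[OF Q])
    also have "\<dots> = indicator {0..B} \<alpha> * (2 * (\<integral>\<beta>. ?Q \<beta> \<partial>lborel))"
      unfolding half[of ?Q \<alpha>] by simp
    finally show ?thesis .
  qed
  have Fm: "(\<lambda>(\<alpha>, t). ?F \<alpha> t) \<in> borel_measurable (borel \<Otimes>\<^sub>M borel)" by measurable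
  note swap = lborel_Fubini_swap[OF Fm Fi Fl integrable_indicator_interval]
  have A_eq: "(\<integral>\<alpha>. ?F \<alpha> t \<partial>lborel) =
    indicator {0..B} t * (G t * (\<integral>\<zeta>. indicator {0..t} \<zeta> * (q ((t - \<zeta>) / 2) * u \<zeta> ((t - \<zeta>) / 2)) \<partial>lborel))" for t
  proof -
    have "(\<integral>\<alpha>. ?F \<alpha> t \<partial>lborel) = (\<integral>\<zeta>. indicator {0..B} t * G t * (indicator {0..t} \<zeta> * (q ((t - \<zeta>) / 2) * u \<zeta> ((t - \<zeta>) / 2))) \<partial>lborel)"
      by (intro Bochner_Integration.integral_cong) (auto simp: indicator_def)
    then show ?thesis by simp
  qed
  have i1: "integrable lborel (\<lambda>t. indicator {0..B} t * (q (t / 2) * G t))"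
  proof -
    have i: "integrable lborel (\<lambda>t. indicator {0..B} (t / 2) * q (t / 2))"
      using half_int[OF q_integrable, of B 0] by simp
    show ?thesis
    proof (rule Bochner_Integration.integrable_bound)
      show "integrable lborel (\<lambda>t. \<bar>indicator {0..B} (t / 2) * q (t / 2)\<bar> * c)" using i by auto
      show "AE t in lborel. norm (indicator {0..B} t * (q (t / 2) * G t)) \<le> norm (\<bar>indicator {0..B} (t / 2) * q (t / 2)\<bar> * c)"
        using bnd c by (intro AE_I2) (auto simp: indicator_def abs_mult intro!: mult_left_mono)
    qed measurable
  qed
  have split: "indicator {0..B} t * (G t * response t) = - (1/2) * (indicator {0..B} t * (q (t / 2) * G t)) - (1/2) * (\<integral>\<alpha>. ?F \<alpha> t \<partial>lborel)" for t
    unfolding A_eq response_def by (simp only: algebra_simps)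
  show ?int unfolding split by (intro Bochner_Integration.integrable_diff integrable_mult_right i1 swap(3))
  have "(\<integral>\<beta>. indicator {0..B} \<beta> * (q \<beta> * G (2 * \<beta>)) \<partial>lborel) = (1/2) * (\<integral>t. indicator {0..B} t * (q (t / 2) * G t) \<partial>lborel)"
  proof -
    have "indicator {0..B} ((t - 0) / 2) * (q ((t - 0) / 2) * G (2 * ((t - 0) / 2))) = indicator {0..B} t * (q (t / 2) * G t)" for t
      using supp[of t] by (auto simp: indicator_def)
    from arg_cong[OF ext[OF this], of "\<lambda>h. (1/2) * integral\<^sup>L lborel h"]
    show ?thesis by (subst half[of _ 0])
  qed
  moreover have "(\<integral>\<beta>. indicator {0..B} \<beta> * (q \<beta> * u \<alpha> \<beta> * G (\<alpha> + 2 * \<beta>)) \<partial>lborel) =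
    (1/2) * (\<integral>t. indicator {\<alpha>..B} t * (q ((t - \<alpha>) / 2) * u \<alpha> ((t - \<alpha>) / 2) * G t) \<partial>lborel)" if \<alpha>: "\<alpha> \<in> {0..B}" for \<alpha>
  proof -
    have "indicator {0..B} ((t - \<alpha>) / 2) * (q ((t - \<alpha>) / 2) * u \<alpha> ((t - \<alpha>) / 2) * G (\<alpha> + 2 * ((t - \<alpha>) / 2))) =
      indicator {\<alpha>..B} t * (q ((t - \<alpha>) / 2) * u \<alpha> ((t - \<alpha>) / 2) * G t)" for t
      using supp[of t] \<alpha> by (auto simp: indicator_def field_simps)
    from arg_cong[OF ext[OF this], of "\<lambda>h. (1/2) * integral\<^sup>L lborel h"]
    show ?thesis by (subst half[of _ \<alpha>])
  qed
  then have inner: "indicator {0..B} \<alpha> * (\<integral>\<beta>. indicator {0..B} \<beta> * (q \<beta> * u \<alpha> \<beta> * G (\<alpha> + 2 * \<beta>)) \<partial>lborel) =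
    (1/2) * (\<integral>t. ?F \<alpha> t \<partial>lborel)" for \<alpha>
    by (cases "\<alpha> \<in> {0..B}") simp_all
  have "(\<integral>\<alpha>. indicator {0..B} \<alpha> * (\<integral>\<beta>. indicator {0..B} \<beta> * (q \<beta> * u \<alpha> \<beta> * G (\<alpha> + 2 * \<beta>)) \<partial>lborel) \<partial>lborel) =
    (1/2) * (\<integral>t. (\<integral>\<alpha>. ?F \<alpha> t \<partial>lborel) \<partial>lborel)"
    unfolding inner swap(1)[symmetric] by simp
  ultimately show ?eq
    unfolding response_pairing_def split integral_diff_scaled[OF i1 swap(3)] by simp
qed

lemma response_integrable: "integrable lborel (\<lambda>t. indicator {0..B} t * response t)"
proof -
  have "integrable lborel (\<lambda>t. indicator {0..B} t * (indicator {0..B} t * response t))"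
    by (rule integrable_mult_response[where c=1]) (auto simp: indicator_def)
  also have "(\<lambda>t. indicator {0..B} t * (indicator {0..B} t * response t)) = (\<lambda>t. indicator {0..B} t * response t)"
    by (auto simp: indicator_def)
  finally show ?thesis .
qed

end

section \<open>Cutoff kernels and the test functions built from them\<close>

definition cut :: "(real \<Rightarrow> real) \<Rightarrow> real \<Rightarrow> real" where
  "cut \<kappa> \<mu> = (\<integral>y. \<kappa> y * cos_sqrt y \<mu> \<partial>lborel)"

lemma cut_measurable [measurable]:
  assumes [measurable]: "\<kappa> \<in> borel_measurable borel"
  shows "cut \<kappa> \<in> borel_measurable borel"
  unfolding cut_def[abs_def] by measurable

text \<open>The primitive K is carried along with \<kappa> because test functions and smallness
  estimates are expressed by it: it is odd and constant beyond L.\<close>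

locale cutoff =
  fixes \<kappa> K :: "real \<Rightarrow> real" and L :: real
  assumes L: "0 < L" and \<kappa>_continuous: "continuous_on UNIV \<kappa>"
    and \<kappa>_even: "\<And>y. \<kappa> (- y) = \<kappa> y" and \<kappa>_support: "\<And>y. L \<le> \<bar>y\<bar> \<Longrightarrow> \<kappa> y = 0"
    and K_deriv: "\<And>y. (K has_real_derivative \<kappa> y) (at y)" and K_0 [simp]: "K 0 = 0"
begin

lemma \<kappa>_measurable [measurable]: "\<kappa> \<in> borel_measurable borel"
  by (rule borel_measurable_continuous_onI[OF \<kappa>_continuous])

lemma K_continuous: "continuous_on UNIV K"
  using K_deriv by (meson DERIV_isCont continuous_at_imp_continuous_on)

lemma K_odd: "K (- z) = - K z"
proof -
  have "DERIV (\<lambda>z. K (- z) + K z) z :> \<kappa> (- z) * (- 1) + \<kappa> z" for z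
    by (rule DERIV_add[OF DERIV_chain2[OF K_deriv] K_deriv]) (auto intro!: derivative_eq_intros)
  then have "\<forall>z. DERIV (\<lambda>z. K (- z) + K z) z :> 0"
    using \<kappa>_even by simp
  from DERIV_isconst_all[OF this, of z 0] show ?thesis by simp
qed

lemma K_const: "L \<le> z \<Longrightarrow> K z = K L"
proof (cases "z = L")
  case False
  assume "L \<le> z"
  with False have "L < z" by simp
  moreover have "DERIV K y :> 0" if "L < y" "y < z" for y
    using K_deriv[of y] \<kappa>_support[of y] that by simp
  ultimately show ?thesis
    by (intro DERIV_isconst_end) (auto intro: continuous_on_subset[OF K_continuous])
qed simp

lemma integrable_\<kappa>_mult:
  assumes f: "continuous_on UNIV f"
  shows "integrable lborel (\<lambda>y. \<kappa> y * f y)"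
proof -
  have c: "continuous_on UNIV (\<lambda>y. \<kappa> y * f y)" by (intro continuous_intros \<kappa>_continuous f)
  obtain C where C: "\<And>y. y \<in> {-L..L} \<Longrightarrow> \<bar>\<kappa> y * f y\<bar> \<le> C"
    using compact_Icc_bound[OF continuous_on_subset[OF c subset_UNIV]] by blast
  have "integrable lborel (\<lambda>y. indicator {-L..L} y * (\<kappa> y * f y))"
    by (rule integrable_indicator_bounded[OF borel_measurable_continuous_onI[OF c] C])
  also have "(\<lambda>y. indicator {-L..L} y * (\<kappa> y * f y)) = (\<lambda>y. \<kappa> y * f y)"
  proof
    fix y show "indicator {-L..L} y * (\<kappa> y * f y) = \<kappa> y * f y"
      using \<kappa>_support[of y] by (cases "y \<in> {-L..L}") (auto simp: abs_if)
  qed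
  finally show ?thesis .
qed

text \<open>Half the convolution of \<kappa> with the odd extension of the indicator of [0, x],
  evaluated by means of K. Convolution with \<kappa> multiplies sine transforms by
  \<open>cut \<kappa>\<close>, and S(x/2)^2 is half the integral of S over [0, x].\<close>

definition profile :: "real \<Rightarrow> real \<Rightarrow> real" where
  "profile x b = K b + (K (x - b) - K (x + b)) / 2"

lemma profile_continuous: "continuous_on UNIV (profile x)"
  unfolding profile_def
  by (intro continuous_intros K_continuous continuous_on_compose2[OF K_continuous]) auto

text \<open>All three values of K then have size K(L), with weights 1, -1/2 and -1/2.\<close>

lemma profile_support: "0 \<le> x \<Longrightarrow> x + L \<le> b \<Longrightarrow> profile x b = 0"
  using K_odd[of "b - x"] K_const[of b] K_const[of "b - x"] K_const[of "x + b"] L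
  by (simp add: profile_def)

lemma profile_bound:
  assumes "\<And>z. \<bar>K z\<bar> \<le> c"
  shows "\<bar>profile x b\<bar> \<le> 2 * c"
  using assms[of b] assms[of "x - b"] assms[of "x + b"] unfolding profile_def by (auto simp: abs_le_iff field_simps)

lemma K_bounded: obtains c where "\<And>z. \<bar>K z\<bar> \<le> c"
proof -
  obtain c where c: "\<And>z. z \<in> {0..L} \<Longrightarrow> \<bar>K z\<bar> \<le> c"
    using compact_Icc_bound[OF continuous_on_subset[OF K_continuous subset_UNIV]] by blast
  have "\<bar>K z\<bar> \<le> c" if "0 \<le> z" for z
    using c[of z] c[of L] K_const[of z] L that by (cases "z \<le> L") auto
  then have "\<bar>K z\<bar> \<le> c" for z using K_odd[of z] by (cases "0 \<le> z") (metis abs_minus_cancel, metis abs_minus_cancel neg_0_le_iff_le linear)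
  then show ?thesis by (rule that)
qed

text \<open>This slope supplies the boundary term G'(0); for the Dirichlet kernel it is the part, of
  order N, that the free operator cancels.\<close>

lemma profile_axis: "((\<lambda>b. profile x b / b) \<longlongrightarrow> \<kappa> 0 - \<kappa> x) (at_right 0)"
proof -
  have "((\<lambda>b. profile x b) has_real_derivative \<kappa> 0 + (\<kappa> (x - 0) * (- 1) - \<kappa> (x + 0) * 1) / 2) (at 0)"
    unfolding profile_def
    by (intro DERIV_add DERIV_diff DERIV_cdivide DERIV_chain2[OF K_deriv] K_deriv) (auto intro!: derivative_eq_intros)
  then have "((\<lambda>b. (profile x b - profile x 0) / (b - 0)) \<longlongrightarrow> \<kappa> 0 - \<kappa> x) (at 0)"
    by (simp add: has_field_derivative_iff)
  moreover have "profile x 0 = 0" by (simp add: profile_def)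
  ultimately show ?thesis by (simp add: filterlim_at_split)
qed

text \<open>Duplication formula: S(y) = 2 S(y/2) C(y/2), with C for \<open>cos_sqrt\<close>, is the
  derivative of 2 S(y/2)^2.\<close>

lemma sin_sqrt_half_squared: "0 \<le> x \<Longrightarrow> (\<integral>y. indicator {0..x} y * sin_sqrt y \<mu> \<partial>lborel) = 2 * (sin_sqrt (x / 2) \<mu>)\<^sup>2"
proof -
  assume x: "0 \<le> x"
  have "(\<integral>y. sin_sqrt y \<mu> * indicator {0..x} y \<partial>lborel) = 2 * (sin_sqrt (x / 2) \<mu>)\<^sup>2 - 2 * (sin_sqrt (0 / 2) \<mu>)\<^sup>2"
  proof (rule integral_FTC_Icc_real[OF x])
    show "DERIV (\<lambda>x. 2 * (sin_sqrt (x / 2) \<mu>)\<^sup>2) y :> sin_sqrt y \<mu>" for y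
      using sin_sqrt_add[of "y/2" "y/2" \<mu>] by (auto intro!: derivative_eq_intros)
    show "isCont (\<lambda>y. sin_sqrt y \<mu>) y" for y by (rule DERIV_isCont[OF DERIV_sin_sqrt])
  qed
  then show ?thesis by (simp add: mult.commute)
qed

text \<open>The term with \<kappa>(b + y) is the reflection in b of the one with \<kappa>(b - y), so
  both together form an integral over the whole line; [0, x + L] is long enough for the supports. A
  shift by y and the addition theorem leave S(y) times the cosine transform of \<kappa>, the sine
  part vanishing by parity.\<close>

lemma sine_transform_profile:
  assumes x: "0 \<le> x"
  shows "sine_transform (x + L) (profile x) \<mu> = (sin_sqrt (x / 2) \<mu>)\<^sup>2 * cut \<kappa> \<mu>"
proof -
  let ?B = "x + L"
  let ?S = "\<lambda>y. sin_sqrt y \<mu>"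
  have cS: "continuous_on UNIV ?S" by (intro continuous_intros)
  have cC: "continuous_on UNIV (\<lambda>y. cos_sqrt y \<mu>)" by (intro continuous_intros)
  have prof: "profile x b = (1/2) * (\<integral>y. indicator {0..x} y * (\<kappa> (b - y) - \<kappa> (b + y)) \<partial>lborel)" for b
  proof -
    have "(\<integral>y. (\<kappa> (b - y) - \<kappa> (b + y)) * indicator {0..x} y \<partial>lborel) = (- K (b - x) - K (b + x)) - (- K (b - 0) - K (b + 0))"
    proof (rule integral_FTC_Icc_real[OF x])
      have 1: "DERIV (\<lambda>y. b - y) y :> - 1" "DERIV (\<lambda>y. b + y) y :> 1" for y by (auto intro!: derivative_eq_intros)
      show "DERIV (\<lambda>y. - K (b - y) - K (b + y)) y :> \<kappa> (b - y) - \<kappa> (b + y)" for y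
        using DERIV_diff[OF DERIV_minus[OF DERIV_chain2[OF K_deriv 1(1)]] DERIV_chain2[OF K_deriv 1(2)], of y] by simp
      have "continuous_on UNIV (\<lambda>y. \<kappa> (b - y) - \<kappa> (b + y))"
        by (intro continuous_intros continuous_on_compose2[OF \<kappa>_continuous]) auto
      then show "isCont (\<lambda>y. \<kappa> (b - y) - \<kappa> (b + y)) y" for y by (simp add: continuous_on_eq_continuous_at)
    qed
    then show ?thesis using K_odd[of "x - b"] by (simp add: profile_def mult.commute add.commute)
  qed
  obtain k where k: "\<And>y. y \<in> {-L..L} \<Longrightarrow> \<bar>\<kappa> y\<bar> \<le> k"
    using compact_Icc_bound[OF continuous_on_subset[OF \<kappa>_continuous subset_UNIV]] by blast
  have k0: "0 \<le> k" using k[of 0] L by auto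
  have k: "\<bar>\<kappa> y\<bar> \<le> k" for y
  proof (cases "y \<in> {-L..L}")
    case False
    then have "L \<le> \<bar>y\<bar>" by (auto simp: abs_if)
    then show ?thesis using \<kappa>_support k0 by simp
  qed (rule k)
  obtain s where s: "\<And>y. y \<in> {0..?B} \<Longrightarrow> \<bar>?S y\<bar> \<le> s"
    using compact_Icc_bound[OF continuous_on_subset[OF cS subset_UNIV]] by blast
  have s0: "0 \<le> s" using s[of 0] x L by auto
  let ?F = "\<lambda>b y. indicator {0..?B} b * ?S b * (indicator {0..x} y * (\<kappa> (b - y) - \<kappa> (b + y)))"
  have Fb: "\<bar>?F b y\<bar> \<le> (indicator {0..?B} b * s) * (indicator {0..x} y * (2 * k))" for b y
  proof -
    have "\<bar>\<kappa> (b - y) - \<kappa> (b + y)\<bar> \<le> 2 * k" using k[of "b - y"] k[of "b + y"] by linarith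
    then have "\<bar>?S b\<bar> * \<bar>\<kappa> (b - y) - \<kappa> (b + y)\<bar> \<le> s * (2 * k)" if "b \<in> {0..?B}"
      using s[OF that] s0 by (intro mult_mono) auto
    then show ?thesis by (auto simp: abs_mult indicator_def)
  qed
  have Fm: "(\<lambda>(b, y). ?F b y) \<in> borel_measurable (borel \<Otimes>\<^sub>M borel)" by measurable
  note swap = lborel_Fubini_swap_bounded[OF Fm Fb integrable_indicator_interval integrable_indicator_interval]
  have inner: "(\<integral>b. ?F b y \<partial>lborel) = indicator {0..x} y * (?S y * cut \<kappa> \<mu>)" for y
  proof (cases "y \<in> {0..x}")
    case y: True
    have shift_int: "integrable lborel (\<lambda>b. \<kappa> (b - y) * ?S b)"
    proof -
      have "integrable lborel (\<lambda>z. \<kappa> z * ?S (z + y))"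
        by (rule integrable_\<kappa>_mult) (intro continuous_intros)
      from lborel_integrable_real_affine[OF this, of 1 "- y"] show ?thesis by simp
    qed
    have pos: "integrable lborel (\<lambda>b. indicator {0..?B} b * (\<kappa> (b - y) * ?S b))"
      "integrable lborel (\<lambda>b. indicator {-?B..0} b * (\<kappa> (b - y) * ?S b))"
      by (rule Bochner_Integration.integrable_bound[OF shift_int]; auto simp: indicator_def)+
    have reflect: "(\<integral>b. indicator {-?B..0} b * (\<kappa> (b - y) * ?S b) \<partial>lborel) = (\<integral>b. indicator {0..?B} b * (- \<kappa> (b + y) * ?S b) \<partial>lborel)"
    proof -
      have "(\<integral>b. indicator {-?B..0} b * (\<kappa> (b - y) * ?S b) \<partial>lborel) =
        (\<integral>b. indicator {-?B..0} (0 + (-1) * b) * (\<kappa> (0 + (-1) * b - y) * ?S (0 + (-1) * b)) \<partial>lborel)"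
        by (subst lborel_integral_real_affine[of "-1" _ 0]) auto
      also have "\<dots> = (\<integral>b. indicator {0..?B} b * (- \<kappa> (b + y) * ?S b) \<partial>lborel)"
      proof (intro Bochner_Integration.integral_cong refl)
        fix b
        show "indicator {-?B..0} (0 + (-1) * b) * (\<kappa> (0 + (-1) * b - y) * ?S (0 + (-1) * b)) = indicator {0..?B} b * (- \<kappa> (b + y) * ?S b)"
          using \<kappa>_even[of "b + y"] by (auto simp: indicator_def)
      qed
      finally show ?thesis .
    qed
    have reflect_int: "integrable lborel (\<lambda>b. indicator {0..?B} b * (- \<kappa> (b + y) * ?S b))"
    proof -
      have "integrable lborel (\<lambda>b. indicator {-?B..0} (0 + (-1) * b) * (\<kappa> (0 + (-1) * b - y) * ?S (0 + (-1) * b)))"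
        by (rule lborel_integrable_real_affine[OF pos(2), of "-1" 0]) simp
      also have "(\<lambda>b. indicator {-?B..0} (0 + (-1) * b) * (\<kappa> (0 + (-1) * b - y) * ?S (0 + (-1) * b))) = (\<lambda>b. indicator {0..?B} b * (- \<kappa> (b + y) * ?S b))"
      proof
        fix b
        show "indicator {-?B..0} (0 + (-1) * b) * (\<kappa> (0 + (-1) * b - y) * ?S (0 + (-1) * b)) = indicator {0..?B} b * (- \<kappa> (b + y) * ?S b)"
          using \<kappa>_even[of "b + y"] by (auto simp: indicator_def)
      qed
      finally show ?thesis .
    qed
    have "(\<integral>b. ?F b y \<partial>lborel) = (\<integral>b. indicator {0..?B} b * (\<kappa> (b - y) * ?S b) + indicator {0..?B} b * (- \<kappa> (b + y) * ?S b) \<partial>lborel)"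
    proof (intro Bochner_Integration.integral_cong refl)
      fix b
      have one: "indicator {0..x} y = (1::real)" using y by simp
      show "?F b y = indicator {0..?B} b * (\<kappa> (b - y) * ?S b) + indicator {0..?B} b * (- \<kappa> (b + y) * ?S b)"
        unfolding one by (simp only: algebra_simps)
    qed
    also have "\<dots> = (\<integral>b. indicator {0..?B} b * (\<kappa> (b - y) * ?S b) \<partial>lborel) + (\<integral>b. indicator {-?B..0} b * (\<kappa> (b - y) * ?S b) \<partial>lborel)"
      unfolding reflect by (rule Bochner_Integration.integral_add[OF pos(1) reflect_int])
    also have "\<dots> = (\<integral>b. indicator {0..?B} b * (\<kappa> (b - y) * ?S b) + indicator {-?B..0} b * (\<kappa> (b - y) * ?S b) \<partial>lborel)"
      by (rule Bochner_Integration.integral_add[OF pos, symmetric])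
    also have "\<dots> = (\<integral>b. \<kappa> (b - y) * ?S b \<partial>lborel)"
    proof (rule Bochner_Integration.integral_cong[OF refl])
      fix b
      show "indicator {0..?B} b * (\<kappa> (b - y) * ?S b) + indicator {-?B..0} b * (\<kappa> (b - y) * ?S b) = \<kappa> (b - y) * ?S b"
      proof (cases "\<bar>b\<bar> \<le> ?B")
        case True
        then show ?thesis by (cases "b = 0") (auto simp: indicator_def abs_if split: if_splits)
      next
        case False
        then have "L \<le> \<bar>b - y\<bar>" using y by (auto simp: abs_if split: if_splits)
        then show ?thesis using \<kappa>_support by simp
      qed
    qed
    also have "\<dots> = (\<integral>z. \<kappa> z * ?S (z + y) \<partial>lborel)"
      by (subst lborel_integral_real_affine[of 1 _ y]) (auto simp: add.commute)
    also have "\<dots> = (\<integral>z. ?S y * (\<kappa> z * cos_sqrt z \<mu>) + cos_sqrt y \<mu> * (\<kappa> z * ?S z) \<partial>lborel)"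
      by (intro Bochner_Integration.integral_cong refl) (simp add: sin_sqrt_add algebra_simps)
    also have "\<dots> = ?S y * cut \<kappa> \<mu> + cos_sqrt y \<mu> * (\<integral>z. \<kappa> z * ?S z \<partial>lborel)"
      using integrable_\<kappa>_mult[OF cC] integrable_\<kappa>_mult[OF cS] by (simp add: cut_def)
    also have "(\<integral>z. \<kappa> z * ?S z \<partial>lborel) = 0"
    proof -
      have "(\<integral>z. \<kappa> z * ?S z \<partial>lborel) = (\<integral>z. - (\<kappa> z * ?S z) \<partial>lborel)"
        by (subst lborel_integral_real_affine[of "-1" _ 0]) (auto simp: \<kappa>_even)
      then show ?thesis by simp
    qed
    finally show ?thesis using y by simp
  qed simp
  have "sine_transform ?B (profile x) \<mu> = (\<integral>b. (1/2) * (\<integral>y. ?F b y \<partial>lborel) \<partial>lborel)"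
    unfolding sine_transform_def by (intro Bochner_Integration.integral_cong refl) (simp add: prof)
  also have "\<dots> = (1/2) * (\<integral>y. (\<integral>b. ?F b y \<partial>lborel) \<partial>lborel)"
    unfolding swap(1)[symmetric] by simp
  also have "\<dots> = (1/2) * (\<integral>y. (indicator {0..x} y * ?S y) * cut \<kappa> \<mu> \<partial>lborel)"
    unfolding inner by (simp add: mult.assoc)
  also have "\<dots> = (sin_sqrt (x / 2) \<mu>)\<^sup>2 * cut \<kappa> \<mu>"
    using sin_sqrt_half_squared[OF x, of \<mu>] by simp
  finally show ?thesis .
qed

end

locale spectral_cutoff = spectral_data q u \<phi> M + cutoff \<kappa> K L for q u \<phi> M \<kappa> K L
begin

text \<open>Decay 1/(1 + \<mu>) of the cutoff suffices, because S(x/2)^2 is bounded both by (x/2)^2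
  and by 1/\<mu> and so supplies the second factor 1/(1 + \<mu>).\<close>

lemma cutoff_integral:
  assumes x: "0 \<le> x" and decay: "\<And>\<mu>. 0 \<le> \<mu> \<Longrightarrow> \<bar>cut \<kappa> \<mu>\<bar> \<le> D / (1 + \<mu>)"
  shows "integrable M (\<lambda>\<mu>. (sin_sqrt (x / 2) \<mu>)\<^sup>2 * cut \<kappa> \<mu>)"
    and "(\<integral>\<mu>. (sin_sqrt (x / 2) \<mu>)\<^sup>2 * cut \<kappa> \<mu> \<partial>M) =
      \<kappa> 0 - \<kappa> x + (\<integral>b. indicator {0..x + L} b * (profile x b * response b) \<partial>lborel)"
proof -
  obtain c where c: "\<And>z. \<bar>K z\<bar> \<le> c" using K_bounded by blast
  have B: "0 < x + L" using x L by simp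
  have D: "0 \<le> D" using decay[of 0] by simp
  have dec: "\<bar>sine_transform (x + L) (profile x) \<mu>\<bar> \<le> ((x / 2)\<^sup>2 + 1) * D / (1 + \<mu>)\<^sup>2" if \<mu>: "0 \<le> \<mu>" for \<mu>
  proof -
    have 1: "(sin_sqrt (x / 2) \<mu>)\<^sup>2 \<le> (x / 2)\<^sup>2"
      using abs_sin_sqrt_le[OF \<mu>, of "x / 2"] by (rule abs_le_square_iff[THEN iffD1])
    have "(sin_sqrt (x / 2) \<mu> * sqrt \<mu>)\<^sup>2 \<le> 1\<^sup>2"
      using abs_sin_sqrt_mult_sqrt_le[OF \<mu>, of "x / 2"] \<mu> by (intro abs_le_square_iff[THEN iffD1]) (simp add: abs_mult)
    then have "(sin_sqrt (x / 2) \<mu>)\<^sup>2 * \<mu> \<le> 1" using \<mu> by (simp add: power_mult_distrib)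
    with 1 have "(sin_sqrt (x / 2) \<mu>)\<^sup>2 * (1 + \<mu>) \<le> (x / 2)\<^sup>2 + 1" by (simp add: algebra_simps)
    then have "(sin_sqrt (x / 2) \<mu>)\<^sup>2 \<le> ((x / 2)\<^sup>2 + 1) / (1 + \<mu>)" using \<mu> by (simp add: pos_le_divide_eq)
    then have "(sin_sqrt (x / 2) \<mu>)\<^sup>2 * \<bar>cut \<kappa> \<mu>\<bar> \<le> ((x / 2)\<^sup>2 + 1) / (1 + \<mu>) * (D / (1 + \<mu>))"
      using decay[OF \<mu>] \<mu> by (intro mult_mono) auto
    then show ?thesis unfolding sine_transform_profile[OF x] by (simp add: abs_mult power2_eq_square)
  qed
  note L_lemma = integral_sine_transform[OF profile_continuous profile_support[OF x] profile_bound[OF c] profile_axis B dec]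
  show "integrable M (\<lambda>\<mu>. (sin_sqrt (x / 2) \<mu>)\<^sup>2 * cut \<kappa> \<mu>)"
    using L_lemma(1) unfolding sine_transform_profile[OF x, abs_def] by simp
  have "response_pairing (x + L) (profile x) = (\<integral>b. indicator {0..x + L} b * (profile x b * response b) \<partial>lborel)"
    by (rule response_pairing_eq[OF borel_measurable_continuous_onI[OF profile_continuous] profile_bound[OF c]])
      (use profile_support[OF x] in auto)
  then show "(\<integral>\<mu>. (sin_sqrt (x / 2) \<mu>)\<^sup>2 * cut \<kappa> \<mu> \<partial>M) =
      \<kappa> 0 - \<kappa> x + (\<integral>b. indicator {0..x + L} b * (profile x b * response b) \<partial>lborel)"
    using L_lemma(2) by (simp add: sine_transform_profile[OF x])
qed

end

section \<open>Dirichlet and Fejer kernels\<close>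

text \<open>The derivative of Si m + cos m / m + sin m / m^2 is -2 sin m / m^3. Adding 1/m^2 to the
  function makes it nonincreasing, subtracting 1/m^2 makes it nondecreasing, and both tend to
  pi/2.\<close>

lemma Si_asymp_bound:
  assumes m: "0 < m"
  shows "\<bar>Si m + cos m / m + sin m / m\<^sup>2 - pi / 2\<bar> \<le> 1 / m\<^sup>2"
proof -
  let ?h = "\<lambda>m. Si m + cos m / m + sin m / m\<^sup>2"
  have d: "((\<lambda>m. ?h m + c / m\<^sup>2) has_real_derivative - 2 * (sin x + c) / x ^ 3) (at x)" if x: "0 < x" for x c
  proof -
    have "((\<lambda>m. Si m + cos m / m + sin m / m\<^sup>2 + c / m\<^sup>2) has_real_derivative
      sinc x + (- sin x * x - cos x * 1) / (x * x) + (cos x * x\<^sup>2 - sin x * (2 * x)) / (x\<^sup>2 * x\<^sup>2) + (0 * x\<^sup>2 - c * (2 * x)) / (x\<^sup>2 * x\<^sup>2)) (at x)"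
      using x by (intro DERIV_add DERIV_divide DERIV_Si) (auto intro!: derivative_eq_intros)
    also have "sinc x + (- sin x * x - cos x * 1) / (x * x) + (cos x * x\<^sup>2 - sin x * (2 * x)) / (x\<^sup>2 * x\<^sup>2) + (0 * x\<^sup>2 - c * (2 * x)) / (x\<^sup>2 * x\<^sup>2) = - 2 * (sin x + c) / x ^ 3"
      using x by (simp add: field_simps power2_eq_square power3_eq_cube)
    finally show ?thesis .
  qed
  have lim: "((\<lambda>m. ?h m + c / m\<^sup>2) \<longlongrightarrow> pi / 2) at_top" for c
  proof -
    have 1: "((\<lambda>m::real. cos m / m) \<longlongrightarrow> 0) at_top" by real_asymp
    have 2: "((\<lambda>m::real. sin m / m\<^sup>2) \<longlongrightarrow> 0) at_top" by real_asymp
    have 3: "((\<lambda>m::real. c / m\<^sup>2) \<longlongrightarrow> 0) at_top" by real_asymp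
    show ?thesis using tendsto_add[OF tendsto_add[OF tendsto_add[OF Si_at_top 1] 2] 3] by simp
  qed
  have "pi / 2 \<le> ?h m + 1 / m\<^sup>2"
  proof (rule tendsto_upperbound[OF lim[of 1]])
    show "\<forall>\<^sub>F x in at_top. ?h x + 1 / x\<^sup>2 \<le> ?h m + 1 / m\<^sup>2"
      using eventually_ge_at_top[of m]
    proof eventually_elim
      case (elim x)
      show ?case
      proof (rule DERIV_nonpos_imp_nonincreasing[OF elim])
        fix y assume y: "m \<le> y" "y \<le> x"
        have "- 2 * (sin y + 1) / y ^ 3 \<le> 0"
        proof -
          have "0 \<le> sin y + 1" using sin_ge_minus_one[of y] by linarith
          then show ?thesis using y m by (intro divide_nonpos_pos mult_nonpos_nonneg) auto
        qed
        then show "\<exists>z. DERIV (\<lambda>m. ?h m + 1 / m\<^sup>2) y :> z \<and> z \<le> 0"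
          using d[of y 1] y m by (intro exI[of _ "- 2 * (sin y + 1) / y ^ 3"]) auto
      qed
    qed
  qed simp
  moreover have "?h m + (- 1) / m\<^sup>2 \<le> pi / 2"
  proof (rule tendsto_lowerbound[OF lim[of "-1"]])
    show "\<forall>\<^sub>F x in at_top. ?h m + (- 1) / m\<^sup>2 \<le> ?h x + (- 1) / x\<^sup>2"
      using eventually_ge_at_top[of m]
    proof eventually_elim
      case (elim x)
      show ?case
      proof (rule DERIV_nonneg_imp_nondecreasing[OF elim])
        fix y assume y: "m \<le> y" "y \<le> x"
        have "0 \<le> - 2 * (sin y + (- 1)) / y ^ 3"
          using y m by (intro divide_nonneg_pos mult_nonpos_nonpos) auto
        then show "\<exists>z. DERIV (\<lambda>m. ?h m + (- 1) / m\<^sup>2) y :> z \<and> 0 \<le> z"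
          using d[of y "- 1"] y m by (intro exI[of _ "- 2 * (sin y + (- 1)) / y ^ 3"]) auto
      qed
    qed
  qed simp
  moreover have "(- 1) / m\<^sup>2 = - (1 / m\<^sup>2)" by simp
  ultimately show ?thesis unfolding abs_le_iff by linarith
qed

section \<open>Antiderivatives normalised at 0\<close>

lemma antiderivative_exists:
  fixes f :: "real \<Rightarrow> real"
  assumes "continuous_on UNIV f"
  shows "\<exists>F. (\<forall>y. (F has_real_derivative f y) (at y)) \<and> F 0 = 0"
proof -
  have "\<exists>F. \<forall>x::real. -\<infinity> < ereal x \<longrightarrow> ereal x < \<infinity> \<longrightarrow> (F has_vector_derivative f x) (at x)"
    by (rule einterval_antiderivative) (use assms in \<open>auto simp: continuous_on_eq_continuous_at\<close>)
  then obtain F where F: "\<And>x. (F has_real_derivative f x) (at x)"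
    by (auto simp: has_real_derivative_iff_has_vector_derivative)
  have "((\<lambda>x. F x - F 0) has_real_derivative f y) (at y)" for y
    using DERIV_diff[OF F DERIV_const] by simp
  then show ?thesis by (intro exI[of _ "\<lambda>x. F x - F 0"]) auto
qed

definition antiderivative :: "(real \<Rightarrow> real) \<Rightarrow> real \<Rightarrow> real" where
  "antiderivative f = (SOME F. (\<forall>y. (F has_real_derivative f y) (at y)) \<and> F 0 = 0)"

lemma
  assumes "continuous_on UNIV f"
  shows DERIV_antiderivative: "(antiderivative f has_real_derivative f y) (at y)"
    and antiderivative_0: "antiderivative f 0 = 0"
  using someI_ex[OF antiderivative_exists[OF assms]] unfolding antiderivative_def by auto

text \<open>The comparison is local to [0, z], since the closed forms used later hold only where the
  windows of the kernels are positive.\<close>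

lemma antiderivative_eqI:
  assumes f: "continuous_on UNIV f" and F: "\<And>y. 0 \<le> y \<Longrightarrow> y \<le> z \<Longrightarrow> (F has_real_derivative f y) (at y)"
    and "F 0 = 0" and z: "0 \<le> z"
  shows "antiderivative f z = F z"
proof (cases "z = 0")
  case False
  have d: "((\<lambda>y. antiderivative f y - F y) has_real_derivative 0) (at y)" if "0 \<le> y" "y \<le> z" for y
    using DERIV_diff[OF DERIV_antiderivative[OF f] F[OF that]] by simp
  have "antiderivative f z - F z = antiderivative f 0 - F 0"
  proof (rule DERIV_isconst_end[where f="\<lambda>y. antiderivative f y - F y"])
    show "continuous_on {0..z} (\<lambda>y. antiderivative f y - F y)"
      using d by (intro continuous_at_imp_continuous_on) (auto intro!: DERIV_isCont)
  qed (use z False d in auto)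
  then show ?thesis using assms(3) antiderivative_0[OF f] by simp
qed (use assms antiderivative_0[OF f] in simp)

section \<open>Cutoffs on the negative spectrum\<close>

context cutoff
begin

lemma cut_eq: "cut \<kappa> \<mu> = 2 * (\<integral>y. indicator {0..L} y * (\<kappa> y * cos_sqrt y \<mu>) \<partial>lborel)"
proof -
  let ?f = "\<lambda>y. \<kappa> y * cos_sqrt y \<mu>"
  have i: "integrable lborel ?f" by (rule integrable_\<kappa>_mult) (intro continuous_intros)
  have i1: "integrable lborel (\<lambda>y. indicator {0..L} y * ?f y)"
    by (rule Bochner_Integration.integrable_bound[OF i]) (auto simp: indicator_def)
  have i2: "integrable lborel (\<lambda>y. indicator {0..L} (0 + (-1) * y) * ?f (0 + (-1) * y))"
    by (rule lborel_integrable_real_affine[OF i1]) simp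
  have "cut \<kappa> \<mu> = (\<integral>y. indicator {0..L} y * ?f y + indicator {0..L} (0 + (-1) * y) * ?f (0 + (-1) * y) \<partial>lborel)"
    unfolding cut_def
  proof (rule integral_cong_AE)
    show "AE y in lborel. ?f y = indicator {0..L} y * ?f y + indicator {0..L} (0 + (-1) * y) * ?f (0 + (-1) * y)"
      using AE_lborel_singleton[of 0]
    proof eventually_elim
      case (elim y)
      show ?case
      proof (cases "\<bar>y\<bar> \<le> L")
        case True
        then show ?thesis using elim by (cases "0 < y") (auto simp: indicator_def \<kappa>_even)
      next
        case False
        then show ?thesis using \<kappa>_support[of y] by (simp add: \<kappa>_even)
      qed
    qed
  qed measurable
  also have "\<dots> = (\<integral>y. indicator {0..L} y * ?f y \<partial>lborel) + (\<integral>y. indicator {0..L} (0 + (-1) * y) * ?f (0 + (-1) * y) \<partial>lborel)"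
    by (rule Bochner_Integration.integral_add[OF i1 i2])
  also have "(\<integral>y. indicator {0..L} (0 + (-1) * y) * ?f (0 + (-1) * y) \<partial>lborel) = (\<integral>y. indicator {0..L} y * ?f y \<partial>lborel)"
    using lborel_integral_real_affine[of "-1" "\<lambda>y. indicator {0..L} y * ?f y" 0] by simp
  finally show ?thesis by simp
qed

text \<open>Integrate by parts with the primitive K - t: the boundary term at 0 gives t, and the
  rest is controlled by the distance of K from t at L and in the mean over [0, L]. For the two
  kernels below K approaches t = 1/2 and t = 0, so their cutoffs approach 1 and 0, up to an
  exponential weight.\<close>

lemma cut_nonpos_bound:
  assumes \<mu>: "\<mu> \<le> 0"
  shows "\<bar>cut \<kappa> \<mu> - 2 * t\<bar> \<le> 2 * (\<bar>K L - t\<bar> + (\<integral>y. indicator {0..L} y * \<bar>K y - t\<bar> \<partial>lborel)) * cos_sqrt (L + 1) \<mu>"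
proof -
  note [measurable] = borel_measurable_continuous_onI[OF K_continuous]
  let ?c = "\<lambda>y. cos_sqrt y \<mu>" and ?S = "\<lambda>y. sin_sqrt y \<mu>"
  have cK: "continuous_on UNIV (\<lambda>y. \<bar>K y - t\<bar>)" by (intro continuous_intros K_continuous)
  obtain CK where CK: "\<And>y. y \<in> {0..L} \<Longrightarrow> \<bar>\<bar>K y - t\<bar>\<bar> \<le> CK"
    using compact_Icc_bound[OF continuous_on_subset[OF cK subset_UNIV]] by blast
  have iK: "integrable lborel (\<lambda>y. indicator {0..L} y * \<bar>K y - t\<bar>)"
    by (rule integrable_indicator_bounded[OF _ CK]) measurable
  have i\<kappa>: "integrable lborel (\<lambda>y. indicator {0..L} y * (\<kappa> y * ?c y))"
  proof -
    have i: "integrable lborel (\<lambda>y. \<kappa> y * ?c y)" by (rule integrable_\<kappa>_mult) (intro continuous_intros)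
    show ?thesis by (rule Bochner_Integration.integrable_bound[OF i]) (auto simp: indicator_def)
  qed
  have iKS: "integrable lborel (\<lambda>y. indicator {0..L} y * ((K y - t) * (- \<mu> * ?S y)))"
  proof -
    have "integrable lborel (\<lambda>y. indicator {0..L} y * (K y - t))"
      by (rule integrable_indicator_bounded[where C=CK]) (use CK in auto)
    moreover have c: "continuous_on UNIV (\<lambda>y. - \<mu> * ?S y)" by (intro continuous_intros)
    moreover obtain C where "\<And>y. y \<in> {0..L} \<Longrightarrow> \<bar>- \<mu> * ?S y\<bar> \<le> C"
      using compact_Icc_bound[OF continuous_on_subset[OF c subset_UNIV]] by blast
    ultimately show ?thesis by (intro integrable_indicator_mult_bounded) auto
  qed
  have "(\<integral>y. (\<kappa> y * ?c y + (K y - t) * (- \<mu> * ?S y)) * indicator {0..L} y \<partial>lborel) = (K L - t) * ?c L - (K 0 - t) * ?c 0"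
  proof (rule integral_FTC_Icc_real)
    show "0 \<le> L" using L by simp
    show "DERIV (\<lambda>y. (K y - t) * ?c y) y :> \<kappa> y * ?c y + (K y - t) * (- \<mu> * ?S y)" for y
      by (auto intro!: derivative_eq_intros K_deriv)
    have "continuous_on UNIV (\<lambda>y. \<kappa> y * ?c y + (K y - t) * (- \<mu> * ?S y))"
      by (intro continuous_intros \<kappa>_continuous K_continuous)
    then show "isCont (\<lambda>y. \<kappa> y * ?c y + (K y - t) * (- \<mu> * ?S y)) y" for y
      by (simp add: continuous_on_eq_continuous_at)
  qed
  moreover have "(\<integral>y. (\<kappa> y * ?c y + (K y - t) * (- \<mu> * ?S y)) * indicator {0..L} y \<partial>lborel) =
    (\<integral>y. indicator {0..L} y * (\<kappa> y * ?c y) + indicator {0..L} y * ((K y - t) * (- \<mu> * ?S y)) \<partial>lborel)"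
    by (rule Bochner_Integration.integral_cong[OF refl]) (simp only: algebra_simps)
  moreover have "\<dots> = (\<integral>y. indicator {0..L} y * (\<kappa> y * ?c y) \<partial>lborel) + (\<integral>y. indicator {0..L} y * ((K y - t) * (- \<mu> * ?S y)) \<partial>lborel)"
    by (rule Bochner_Integration.integral_add[OF i\<kappa> iKS])
  ultimately have eq: "cut \<kappa> \<mu> - 2 * t = 2 * ((K L - t) * ?c L - (\<integral>y. indicator {0..L} y * ((K y - t) * (- \<mu> * ?S y)) \<partial>lborel))"
    unfolding cut_eq by simp
  \<comment> \<open>The derivative of cosh is absorbed by one more unit of length, through S(1)
    \<ge> 1 and the addition theorem for cosh.\<close>
  have S1: "- \<mu> * ?S y \<le> ?c (L + 1)" if "y \<in> {0..L}" for y
  proof -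
    have "- \<mu> * ?S y \<le> - \<mu> * ?S L" using \<mu> that by (intro mult_left_mono sin_sqrt_mono) auto
    also have "\<dots> \<le> - \<mu> * ?S L * ?S 1"
      using mult_left_mono[of 1 "?S 1" "- \<mu> * ?S L"] le_sin_sqrt[OF \<mu>, of 1] \<mu> L sin_sqrt_nonneg[OF \<mu>, of L]
      by (simp add: mult_nonpos_nonneg)
    also have "\<dots> \<le> ?c L * ?c 1 + - \<mu> * ?S L * ?S 1"
      using cos_sqrt_ge_1[OF \<mu>, of L] cos_sqrt_ge_1[OF \<mu>, of 1] by simp
    also have "\<dots> = ?c (L + 1)" using \<mu>
      by (cases "\<mu> = 0") (auto simp: cos_sqrt_def sin_sqrt_def distrib_left cosh_add)
    finally show ?thesis .
  qed
  have "\<bar>\<integral>y. indicator {0..L} y * ((K y - t) * (- \<mu> * ?S y)) \<partial>lborel\<bar> \<le> (\<integral>y. (indicator {0..L} y * \<bar>K y - t\<bar>) * ?c (L + 1) \<partial>lborel)"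
  proof (rule order_trans[OF integral_abs_bound], rule Bochner_Integration.integral_mono)
    show "\<bar>indicator {0..L} y * ((K y - t) * (- \<mu> * ?S y))\<bar> \<le> (indicator {0..L} y * \<bar>K y - t\<bar>) * ?c (L + 1)" for y
    proof (cases "y \<in> {0..L}")
      case True
      have "0 \<le> - \<mu> * ?S y" using True \<mu> sin_sqrt_nonneg[OF \<mu>, of y] by (intro mult_nonneg_nonneg) auto
      then have "\<bar>- \<mu> * ?S y\<bar> \<le> ?c (L + 1)" using S1[OF True] by linarith
      then show ?thesis using True by (simp only: abs_mult indicator_simps mult_1_left abs_one) (rule mult_left_mono, auto)
    qed simp
  qed (use iKS iK in auto)
  then have "\<bar>\<integral>y. indicator {0..L} y * ((K y - t) * (- \<mu> * ?S y)) \<partial>lborel\<bar> \<le> (\<integral>y. indicator {0..L} y * \<bar>K y - t\<bar> \<partial>lborel) * ?c (L + 1)"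
    by simp
  moreover have "\<bar>(K L - t) * ?c L\<bar> \<le> \<bar>K L - t\<bar> * ?c (L + 1)"
    using cos_sqrt_mono[OF \<mu>, of L "L + 1"] cos_sqrt_ge_1[OF \<mu>, of L] L by (simp add: abs_mult mult_left_mono)
  moreover have "\<bar>2 * (a - i)\<bar> \<le> 2 * (k + J) * c" if "\<bar>i\<bar> \<le> J * c" "\<bar>a\<bar> \<le> k * c" for a i J k c :: real
  proof -
    have "\<bar>2 * (a - i)\<bar> \<le> 2 * (\<bar>a\<bar> + \<bar>i\<bar>)"
      unfolding abs_mult by (intro mult_mono abs_triangle_ineq4) auto
    also have "\<dots> \<le> 2 * (k * c + J * c)" using that by (intro mult_left_mono add_mono) auto
    also have "\<dots> = 2 * (k + J) * c" by (simp add: algebra_simps)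
    finally show ?thesis .
  qed
  ultimately show ?thesis unfolding eq by blast
qed

end

text \<open>\<open>N / pi * sinc (N * y)\<close> is sin(N y)/(pi y), the kernel of the sharp cutoff
  at frequency N. The window is smooth at 0, and its part (y/L)^2 cancels the leading error of the
  truncation at L; see \<open>dirichlet_mass_bound\<close>.\<close>

definition dirichlet_kernel :: "real \<Rightarrow> real \<Rightarrow> real \<Rightarrow> real" where
  "dirichlet_kernel N L y = N / pi * sinc (N * y) * max 0 (1 - (y / L)\<^sup>2)"

text \<open>A triangular window modulated to the frequency M; the factor 2/L makes
  \<open>fejer_mass L 0\<close> equal to 1.\<close>

definition fejer_kernel :: "real \<Rightarrow> real \<Rightarrow> real \<Rightarrow> real" where
  "fejer_kernel M L y = 2 / L * max 0 (1 - \<bar>y\<bar> / L) * cos (M * y)"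

lemma cutoff_dirichlet: "0 < L \<Longrightarrow> cutoff (dirichlet_kernel N L) (antiderivative (dirichlet_kernel N L)) L"
proof -
  assume L: "0 < L"
  have c: "continuous_on UNIV (dirichlet_kernel N L)"
    unfolding dirichlet_kernel_def[abs_def] using L by (intro continuous_intros) auto
  have "dirichlet_kernel N L y = 0" if "L \<le> \<bar>y\<bar>" for y
  proof -
    have "1 \<le> (\<bar>y\<bar> / L)\<^sup>2" using that L by (intro one_le_power) auto
    then show ?thesis by (simp add: dirichlet_kernel_def power_divide)
  qed
  then show ?thesis
    using L c DERIV_antiderivative[OF c] antiderivative_0[OF c]
    by unfold_locales (auto simp: dirichlet_kernel_def)
qed

lemma cutoff_fejer: "0 < L \<Longrightarrow> cutoff (fejer_kernel M L) (antiderivative (fejer_kernel M L)) L"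
proof -
  assume L: "0 < L"
  have c: "continuous_on UNIV (fejer_kernel M L)"
    unfolding fejer_kernel_def[abs_def] using L by (intro continuous_intros) auto
  show ?thesis
    using L c DERIV_antiderivative[OF c] antiderivative_0[OF c]
    by unfold_locales (auto simp: fejer_kernel_def)
qed

text \<open>A smoothed sign(p)/2, odd in p. The cutoff at N is the sum of its values at N + k and N
  - k.\<close>

definition dirichlet_mass :: "real \<Rightarrow> real \<Rightarrow> real" where
  "dirichlet_mass L p = (\<integral>y. indicator {0..L} y * (p / pi * sinc (p * y) * (1 - (y / L)\<^sup>2)) \<partial>lborel)"

text \<open>The Fejer kernel in the frequency p, with zeros at the nonzero multiples of 2
  pi/L.\<close>

definition fejer_mass :: "real \<Rightarrow> real \<Rightarrow> real" where
  "fejer_mass L p = (\<integral>y. indicator {0..L} y * (2 / L * (1 - y / L) * cos (p * y)) \<partial>lborel)"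

lemma integrable_continuous_indicator:
  fixes f :: "real \<Rightarrow> real"
  assumes "continuous_on UNIV f"
  shows "integrable lborel (\<lambda>y. indicator {a..b} y * f y)"
proof -
  obtain C where "\<And>y. y \<in> {a..b} \<Longrightarrow> \<bar>f y\<bar> \<le> C"
    using compact_Icc_bound[OF continuous_on_subset[OF assms subset_UNIV]] by blast
  then show ?thesis by (intro integrable_indicator_bounded[OF borel_measurable_continuous_onI[OF assms]])
qed

lemma dirichlet_mass_minus: "dirichlet_mass L (- p) = - dirichlet_mass L p"
proof -
  have "- p / pi * sinc (- p * y) * w = - (p / pi * sinc (p * y) * w)" for y w by simp
  then show ?thesis unfolding dirichlet_mass_def by (simp only: mult_minus_right Bochner_Integration.integral_minus)
qed

lemma dirichlet_antiderivative:
  assumes L: "0 < L" and N: "N \<noteq> 0" and z: "0 \<le> z" "z \<le> L"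
  shows "antiderivative (dirichlet_kernel N L) z =
    (Si (N * z) - (sin (N * z) / N\<^sup>2 - z * cos (N * z) / N) / L\<^sup>2) / pi"
proof (rule antiderivative_eqI)
  show "continuous_on UNIV (dirichlet_kernel N L)"
    by (rule cutoff.\<kappa>_continuous[OF cutoff_dirichlet[OF L]])
  fix y assume y: "0 \<le> y" "y \<le> z"
  have "(y / L)\<^sup>2 \<le> 1" using y z L by (simp add: power_le_one)
  then have k: "dirichlet_kernel N L y = (sinc (N * y) * N - ((cos (N * y) * N) / N\<^sup>2 - (cos (N * y) - y * (sin (N * y) * N)) / N) / L\<^sup>2) / pi"
    using N L by (simp add: dirichlet_kernel_def field_simps power2_eq_square)
  have l: "((\<lambda>z. N * z) has_real_derivative N) (at y)" by (auto intro!: derivative_eq_intros)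
  have D: "((\<lambda>z. sin (N * z) / N\<^sup>2) has_real_derivative (cos (N * y) * N) / N\<^sup>2) (at y)"
    "((\<lambda>z. z * cos (N * z) / N) has_real_derivative (cos (N * y) - y * (sin (N * y) * N)) / N) (at y)"
    by (rule DERIV_cdivide, (auto intro!: derivative_eq_intros)[1])+
  show "((\<lambda>z. (Si (N * z) - (sin (N * z) / N\<^sup>2 - z * cos (N * z) / N) / L\<^sup>2) / pi) has_real_derivative dirichlet_kernel N L y) (at y)"
    unfolding k by (rule DERIV_cdivide[OF DERIV_diff[OF DERIV_chain2[OF DERIV_Si l] DERIV_cdivide[OF DERIV_diff[OF D]]]])
qed (use z Si_neg[of 0] in auto)

lemma dirichlet_mass_eq_antiderivative:
  assumes L: "0 < L"
  shows "dirichlet_mass L p = antiderivative (dirichlet_kernel p L) L"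
proof -
  interpret cutoff "dirichlet_kernel p L" "antiderivative (dirichlet_kernel p L)" L by (rule cutoff_dirichlet[OF L])
  have "(\<integral>y. dirichlet_kernel p L y * indicator {0..L} y \<partial>lborel) = antiderivative (dirichlet_kernel p L) L - antiderivative (dirichlet_kernel p L) 0"
    using L K_deriv \<kappa>_continuous by (intro integral_FTC_Icc_real) (auto simp: continuous_on_eq_continuous_at)
  also have "(\<integral>y. dirichlet_kernel p L y * indicator {0..L} y \<partial>lborel) = dirichlet_mass L p"
    unfolding dirichlet_mass_def
  proof (rule Bochner_Integration.integral_cong[OF refl])
    fix y
    have "(y / L)\<^sup>2 \<le> 1" if "y \<in> {0..L}" using that L by (simp add: power_le_one)
    then show "dirichlet_kernel p L y * indicator {0..L} y = indicator {0..L} y * (p / pi * sinc (p * y) * (1 - (y / L)\<^sup>2))"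
      by (cases "y \<in> {0..L}") (simp_all add: dirichlet_kernel_def)
  qed
  finally show ?thesis by simp
qed

text \<open>Let m = L p. For m \<le> 1 the mass has size at most 1 while the right-hand side is at
  least 3/2. For m > 1 the window adds cos m / m - sin m / m^2 to Si m, which is the correction in
  \<open>Si_asymp_bound\<close> up to terms of size 1/m^2.\<close>

lemma dirichlet_mass_bound:
  assumes L: "0 < L" and p: "0 < p"
  shows "\<bar>dirichlet_mass L p - 1 / 2\<bar> \<le> 3 / (1 + (L * p)\<^sup>2)"
proof (cases "L * p \<le> 1")
  case True
  have c: "continuous_on UNIV (\<lambda>y. p / pi * sinc (p * y) * (1 - (y / L)\<^sup>2))"
    using L by (intro continuous_intros) auto
  have "\<bar>dirichlet_mass L p\<bar> \<le> (\<integral>y. indicator {0..L} y * (p / pi) \<partial>lborel)"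
    unfolding dirichlet_mass_def
  proof (rule order_trans[OF integral_abs_bound], rule Bochner_Integration.integral_mono)
    show "integrable lborel (\<lambda>y. \<bar>indicator {0..L} y * (p / pi * sinc (p * y) * (1 - (y / L)\<^sup>2))\<bar>)"
      by (intro integrable_abs integrable_continuous_indicator c)
    show "\<bar>indicator {0..L} y * (p / pi * sinc (p * y) * (1 - (y / L)\<^sup>2))\<bar> \<le> indicator {0..L} y * (p / pi)" for y
    proof (cases "y \<in> {0..L}")
      case True
      have s: "\<bar>sinc (p * y)\<bar> \<le> 1"
        using abs_sin_x_le_abs_x[of "p * y"] by (auto simp: divide_simps)
      have "(y / L)\<^sup>2 \<le> 1" using True L by (simp add: power_le_one)
      then have "\<bar>1 - (y / L)\<^sup>2\<bar> \<le> 1" by simp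
      with s have "\<bar>sinc (p * y)\<bar> * \<bar>1 - (y / L)\<^sup>2\<bar> \<le> 1 * 1" by (intro mult_mono) auto
      then have "p / pi * (\<bar>sinc (p * y)\<bar> * \<bar>1 - (y / L)\<^sup>2\<bar>) \<le> p / pi * 1" using p by (intro mult_left_mono) auto
      then show ?thesis using True p by (simp only: abs_mult indicator_simps) (simp add: mult.assoc)
    qed simp
  qed simp
  also have "\<dots> = L * p / pi" using L by simp
  also have "\<dots> \<le> 1 / pi" using True by (intro divide_right_mono) auto
  also have "\<dots> \<le> 1" using pi_gt3 by simp
  finally have "\<bar>dirichlet_mass L p\<bar> \<le> 1" .
  then have "\<bar>dirichlet_mass L p - 1 / 2\<bar> \<le> 3 / 2" by linarith
  also have "\<dots> \<le> 3 / (1 + (L * p)\<^sup>2)"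
    using True L p power_le_one[of "L * p" 2] by (simp add: field_simps add_pos_nonneg)
  finally show ?thesis .
next
  case False
  let ?m = "L * p"
  have m: "1 < ?m" "0 < ?m" using False by auto
  have "dirichlet_mass L p = (Si ?m - (sin ?m / p\<^sup>2 - L * cos ?m / p) / L\<^sup>2) / pi"
    unfolding dirichlet_mass_eq_antiderivative[OF L]
    using L p by (subst dirichlet_antiderivative) (auto simp: mult.commute)
  also have "(sin ?m / p\<^sup>2 - L * cos ?m / p) / L\<^sup>2 = sin ?m / ?m\<^sup>2 - cos ?m / ?m"
    using L p by (simp add: field_simps power2_eq_square)
  finally have D: "dirichlet_mass L p - 1 / 2 = ((Si ?m + cos ?m / ?m + sin ?m / ?m\<^sup>2 - pi / 2) - 2 * (sin ?m / ?m\<^sup>2)) / pi"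
    by (simp add: diff_divide_distrib add_divide_distrib)
  have "\<bar>sin ?m / ?m\<^sup>2\<bar> \<le> 1 / ?m\<^sup>2" by (simp add: abs_divide divide_right_mono)
  with Si_asymp_bound[OF m(2)]
  have "\<bar>(Si ?m + cos ?m / ?m + sin ?m / ?m\<^sup>2 - pi / 2) - 2 * (sin ?m / ?m\<^sup>2)\<bar> \<le> 3 / ?m\<^sup>2" by linarith
  then have "\<bar>dirichlet_mass L p - 1 / 2\<bar> \<le> 3 / ?m\<^sup>2 / pi"
    unfolding D abs_divide abs_of_pos[OF pi_gt_zero] by (rule divide_right_mono) simp
  also have "\<dots> \<le> 3 / ?m\<^sup>2 / 2" using pi_gt3 m by (intro divide_left_mono) auto
  also have "\<dots> \<le> 3 / (1 + ?m\<^sup>2)"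
  proof -
    have "1 \<le> ?m\<^sup>2" using m by simp
    then have "1 + ?m\<^sup>2 \<le> 2 * ?m\<^sup>2" "0 < ?m\<^sup>2" by auto
    then show ?thesis by (simp add: divide_simps add_pos_nonneg)
  qed
  finally show ?thesis .
qed

lemma fejer_mass_0: "0 < L \<Longrightarrow> fejer_mass L 0 = 1"
proof -
  assume L: "0 < L"
  have "(\<integral>y. (2 / L * (1 - y / L)) * indicator {0..L} y \<partial>lborel) = 2 / L * (L - L\<^sup>2 / 2 / L) - 2 / L * (0 - 0\<^sup>2 / 2 / L)"
    using L by (intro integral_FTC_Icc_real) (auto intro!: derivative_eq_intros)
  then show ?thesis using L by (simp add: fejer_mass_def mult.commute power2_eq_square)
qed

lemma fejer_mass_eq:
  assumes L: "0 < L" and p: "p \<noteq> 0"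
  shows "fejer_mass L p = 2 * (1 - cos (L * p)) / (L * p)\<^sup>2"
proof -
  let ?F = "\<lambda>y. 2 / L * ((1 - y / L) * (sin (p * y) / p) - cos (p * y) / (L * p\<^sup>2))"
  have "(\<integral>y. (2 / L * (1 - y / L) * cos (p * y)) * indicator {0..L} y \<partial>lborel) = ?F L - ?F 0"
  proof (rule integral_FTC_Icc_real)
    fix y
    have 1: "((\<lambda>y. sin (p * y) / p) has_real_derivative cos (p * y) * p / p) (at y)"
      "((\<lambda>y. cos (p * y) / (L * p\<^sup>2)) has_real_derivative - sin (p * y) * p / (L * p\<^sup>2)) (at y)"
      "((\<lambda>y. 1 - y / L) has_real_derivative - 1 / L) (at y)"
      by (rule DERIV_cdivide, (auto intro!: derivative_eq_intros)[1])+
        (use L in \<open>auto intro!: derivative_eq_intros\<close>)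
    show "DERIV ?F y :> 2 / L * (1 - y / L) * cos (p * y)"
      by (rule DERIV_cong[OF DERIV_cmult[OF DERIV_diff[OF DERIV_mult[OF 1(3) 1(1)] 1(2)]]])
        (use L p in \<open>simp add: field_simps power2_eq_square\<close>)
  qed (use L in \<open>auto intro!: continuous_intros\<close>)
  then show ?thesis using L p by (simp add: fejer_mass_def mult.commute field_simps power2_eq_square)
qed

lemma fejer_mass_nonneg: "0 < L \<Longrightarrow> 0 \<le> fejer_mass L p"
  by (cases "p = 0") (auto simp: fejer_mass_0 fejer_mass_eq)

lemma fejer_mass_upper: "0 < L \<Longrightarrow> fejer_mass L p \<le> 8 / (1 + (L * p)\<^sup>2)"
proof (cases "\<bar>L * p\<bar> \<le> 1")
  case True
  assume L: "0 < L"
  have "fejer_mass L p \<le> fejer_mass L 0"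
    unfolding fejer_mass_def
  proof (rule Bochner_Integration.integral_mono)
    show "integrable lborel (\<lambda>y. indicator {0..L} y * (2 / L * (1 - y / L) * cos (p * y)))"
      "integrable lborel (\<lambda>y. indicator {0..L} y * (2 / L * (1 - y / L) * cos (0 * y)))"
      using L by (intro integrable_continuous_indicator continuous_intros; simp)+
    show "indicator {0..L} y * (2 / L * (1 - y / L) * cos (p * y)) \<le> indicator {0..L} y * (2 / L * (1 - y / L) * cos (0 * y))" for y
    proof (cases "y \<in> {0..L}")
      case True
      then have "2 / L * (1 - y / L) * cos (p * y) \<le> 2 / L * (1 - y / L) * 1"
        using L by (intro mult_left_mono mult_nonneg_nonneg) auto
      then show ?thesis using True by simp
    qed simp
  qed
  also have "\<dots> = 1" using L by (rule fejer_mass_0)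
  also have "1 \<le> 8 / (1 + (L * p)\<^sup>2)"
  proof -
    have "(L * p)\<^sup>2 \<le> 1" using True by (simp add: abs_square_le_1)
    then show ?thesis by (simp add: field_simps add_pos_nonneg)
  qed
  finally show ?thesis .
next
  case False
  assume L: "0 < L"
  have p: "p \<noteq> 0" using False by auto
  have m: "1 \<le> (L * p)\<^sup>2" using False by (meson abs_square_le_1 linear)
  have "1 - cos (L * p) \<le> 2" using cos_ge_minus_one[of "L * p"] by linarith
  from mult_left_mono[OF this, of 2] have "2 * (1 - cos (L * p)) \<le> 4" by simp
  then have "fejer_mass L p \<le> 4 / (L * p)\<^sup>2" unfolding fejer_mass_eq[OF L p] by (intro divide_right_mono) auto
  also have "\<dots> \<le> 8 / (1 + (L * p)\<^sup>2)" using m by (simp add: divide_simps add_pos_nonneg)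
  finally show ?thesis .
qed

text \<open>The shift by pi/L advances L p by pi and turns 1 - cos into 1 + cos; over a common
  denominator the numerators add up to a constant.\<close>

lemma fejer_mass_lower:
  assumes L: "0 < L"
  shows "1 / (1 + (L * p)\<^sup>2) \<le> pi\<^sup>2 / 2 * (fejer_mass L p + fejer_mass L (p + pi / L))"
proof -
  let ?m = "L * p"
  have m': "L * (p + pi / L) = ?m + pi" using L by (simp add: distrib_left)
  have pi2: "2 \<le> pi\<^sup>2 / 2" using power_mono[of 3 pi 2] pi_gt3 by simp
  have le1: "1 / (1 + ?m\<^sup>2) \<le> 1" by (simp add: divide_le_eq_1 add_pos_nonneg)
  \<comment> \<open>At a centre the closed form reads 0/0; there the corresponding mass is
    1.\<close>
  consider "p = 0" | "p + pi / L = 0" | "p \<noteq> 0" "p + pi / L \<noteq> 0" by blast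
  then show ?thesis
  proof cases
    case 1
    then have "1 \<le> fejer_mass L p + fejer_mass L (p + pi / L)"
      using fejer_mass_0[OF L] fejer_mass_nonneg[OF L] by simp
    then have "1 * 1 \<le> pi\<^sup>2 / 2 * (fejer_mass L p + fejer_mass L (p + pi / L))" using pi2 by (intro mult_mono) auto
    then show ?thesis using le1 by simp
  next
    case 2
    then have "1 \<le> fejer_mass L p + fejer_mass L (p + pi / L)"
      using fejer_mass_0[OF L] fejer_mass_nonneg[OF L] by simp
    then have "1 * 1 \<le> pi\<^sup>2 / 2 * (fejer_mass L p + fejer_mass L (p + pi / L))" using pi2 by (intro mult_mono) auto
    then show ?thesis using le1 by simp
  next
    case 3
    have nz: "?m \<noteq> 0" "?m + pi \<noteq> 0" using 3 L m' by auto
    \<comment> \<open>Dominates both m^2 and (m + pi)^2, and is the multiple of 1 + m^2 that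
      produces the constant pi^2/2.\<close>
    define D where "D = 2 * pi\<^sup>2 * (1 + ?m\<^sup>2)"
    have D0: "0 < D" unfolding D_def by (intro mult_pos_pos add_pos_nonneg) auto
    have "?m\<^sup>2 * 1 \<le> ?m\<^sup>2 * (2 * pi\<^sup>2)" using pi2 by (intro mult_left_mono) auto
    then have D1: "?m\<^sup>2 \<le> D" unfolding D_def by (simp add: algebra_simps add_increasing)
    have "(?m + pi)\<^sup>2 \<le> 2 * ?m\<^sup>2 + 2 * pi\<^sup>2"
      using zero_le_power2[of "?m - pi"] by (simp add: power2_eq_square algebra_simps)
    also have "\<dots> \<le> D"
    proof -
      have "2 * ?m\<^sup>2 \<le> (2 * pi\<^sup>2) * ?m\<^sup>2" using pi2 by (intro mult_right_mono) auto
      then show ?thesis unfolding D_def by (simp add: algebra_simps)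
    qed
    finally have D2: "(?m + pi)\<^sup>2 \<le> D" .
    have "2 * (1 - cos ?m) / D \<le> fejer_mass L p"
      unfolding fejer_mass_eq[OF L 3(1)] using D1 nz D0 by (intro divide_left_mono) auto
    moreover have "2 * (1 + cos ?m) / D \<le> fejer_mass L (p + pi / L)"
    proof -
      have "0 \<le> 2 * (1 + cos ?m)" using cos_ge_minus_one[of ?m] by (intro mult_nonneg_nonneg) linarith+
      then have "2 * (1 + cos ?m) / D \<le> 2 * (1 + cos ?m) / (?m + pi)\<^sup>2"
        using nz D0 by (intro divide_left_mono[OF D2] mult_pos_pos) auto
      then show ?thesis unfolding fejer_mass_eq[OF L 3(2)] m' by simp
    qed
    ultimately have "2 * (1 - cos ?m) / D + 2 * (1 + cos ?m) / D \<le> fejer_mass L p + fejer_mass L (p + pi / L)" by linarith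
    moreover have "2 * (1 - cos ?m) / D + 2 * (1 + cos ?m) / D = 4 / D"
      by (simp add: add_divide_distrib[symmetric])
    ultimately have "pi\<^sup>2 / 2 * (4 / D) \<le> pi\<^sup>2 / 2 * (fejer_mass L p + fejer_mass L (p + pi / L))"
      by (intro mult_left_mono) auto
    moreover have "pi\<^sup>2 / 2 * (4 / D) = 1 / (1 + ?m\<^sup>2)" unfolding D_def by simp
    ultimately show ?thesis by simp
  qed
qed

section \<open>Smooth cutoffs as sums of masses, and their distance from the sharp cutoff\<close>

lemma cut_dirichlet:
  assumes L: "0 < L" and k: "0 \<le> k"
  shows "cut (dirichlet_kernel N L) (k\<^sup>2) = dirichlet_mass L (N + k) + dirichlet_mass L (N - k)"
proof -
  have c: "continuous_on UNIV (\<lambda>y. p / pi * sinc (p * y) * (1 - (y / L)\<^sup>2))" for p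
    using L by (intro continuous_intros) auto
  have cs: "cos_sqrt y (k\<^sup>2) = cos (k * y)" for y using k by (cases "k = 0") (auto simp: cos_sqrt_def)
  have "cut (dirichlet_kernel N L) (k\<^sup>2) = (\<integral>y. 2 * (indicator {0..L} y * (dirichlet_kernel N L y * cos (k * y))) \<partial>lborel)"
    unfolding cutoff.cut_eq[OF cutoff_dirichlet[OF L]] cs by simp
  also have "\<dots> = (\<integral>y. indicator {0..L} y * ((N + k) / pi * sinc ((N + k) * y) * (1 - (y / L)\<^sup>2)) +
      indicator {0..L} y * ((N - k) / pi * sinc ((N - k) * y) * (1 - (y / L)\<^sup>2)) \<partial>lborel)"
  proof (rule Bochner_Integration.integral_cong[OF refl])
    fix y
    show "2 * (indicator {0..L} y * (dirichlet_kernel N L y * cos (k * y))) =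
      indicator {0..L} y * ((N + k) / pi * sinc ((N + k) * y) * (1 - (y / L)\<^sup>2)) +
      indicator {0..L} y * ((N - k) / pi * sinc ((N - k) * y) * (1 - (y / L)\<^sup>2))"
    proof (cases "y \<in> {0..L}")
      case True
      then have "(y / L)\<^sup>2 \<le> 1" using L by (simp add: power_le_one)
      then have w: "max 0 (1 - (y / L)\<^sup>2) = 1 - (y / L)\<^sup>2" by simp
      have s: "2 * (N * sinc (N * y) * cos (k * y)) = (N + k) * sinc ((N + k) * y) + (N - k) * sinc ((N - k) * y)"
      proof (cases "y = 0")
        case False
        have e: "p * sinc (p * y) = sin (p * y) / y" for p using False by simp
        have "2 * (sin (N * y) * cos (k * y)) = sin ((N + k) * y) + sin ((N - k) * y)"
          by (simp add: distrib_right left_diff_distrib sin_add sin_diff)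
        then show ?thesis unfolding e using False by (simp add: field_simps)
      qed simp
      have "2 * (dirichlet_kernel N L y * cos (k * y)) = (2 * (N * sinc (N * y) * cos (k * y))) * (1 - (y / L)\<^sup>2) / pi"
        unfolding dirichlet_kernel_def w by simp
      also have "\<dots> = (N + k) / pi * sinc ((N + k) * y) * (1 - (y / L)\<^sup>2) + (N - k) / pi * sinc ((N - k) * y) * (1 - (y / L)\<^sup>2)"
        unfolding s by (simp only: distrib_right add_divide_distrib) simp
      finally show ?thesis using True by (simp only: indicator_simps mult_1_left)
    qed simp
  qed
  also have "\<dots> = dirichlet_mass L (N + k) + dirichlet_mass L (N - k)"
    unfolding dirichlet_mass_def by (intro Bochner_Integration.integral_add integrable_continuous_indicator c)
  finally show ?thesis .
qed

lemma cut_fejer: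
  assumes L: "0 < L" and k: "0 \<le> k"
  shows "cut (fejer_kernel M L) (k\<^sup>2) = fejer_mass L (M + k) + fejer_mass L (M - k)"
proof -
  have c: "continuous_on UNIV (\<lambda>y. 2 / L * (1 - y / L) * cos (p * y))" for p
    using L by (intro continuous_intros) auto
  have cs: "cos_sqrt y (k\<^sup>2) = cos (k * y)" for y using k by (cases "k = 0") (auto simp: cos_sqrt_def)
  have "cut (fejer_kernel M L) (k\<^sup>2) = (\<integral>y. 2 * (indicator {0..L} y * (fejer_kernel M L y * cos (k * y))) \<partial>lborel)"
    unfolding cutoff.cut_eq[OF cutoff_fejer[OF L]] cs by simp
  also have "\<dots> = (\<integral>y. indicator {0..L} y * (2 / L * (1 - y / L) * cos ((M + k) * y)) +
      indicator {0..L} y * (2 / L * (1 - y / L) * cos ((M - k) * y)) \<partial>lborel)"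
  proof (rule Bochner_Integration.integral_cong[OF refl])
    fix y
    show "2 * (indicator {0..L} y * (fejer_kernel M L y * cos (k * y))) =
      indicator {0..L} y * (2 / L * (1 - y / L) * cos ((M + k) * y)) +
      indicator {0..L} y * (2 / L * (1 - y / L) * cos ((M - k) * y))"
    proof (cases "y \<in> {0..L}")
      case True
      then have w: "max 0 (1 - \<bar>y\<bar> / L) = 1 - y / L" using L by auto
      have s: "2 * (cos (M * y) * cos (k * y)) = cos ((M + k) * y) + cos ((M - k) * y)"
        by (simp add: distrib_right left_diff_distrib cos_add cos_diff)
      have "2 * (fejer_kernel M L y * cos (k * y)) = 2 / L * (1 - y / L) * (2 * (cos (M * y) * cos (k * y)))"
        unfolding fejer_kernel_def w by simp
      then show ?thesis unfolding s using True by (simp only: indicator_simps mult_1_left distrib_left)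
    qed simp
  qed
  also have "\<dots> = fejer_mass L (M + k) + fejer_mass L (M - k)"
    unfolding fejer_mass_def by (intro Bochner_Integration.integral_add integrable_continuous_indicator c)
  finally show ?thesis .
qed

text \<open>From k^2 \<le> 2 N^2 + 2 (N - k)^2. It moves the centre from N to 0 at the price of a
  constant; only the finiteness of that constant matters, for the decay hypothesis of
  \<open>cutoff_integral\<close>.\<close>

lemma lorentz_shift:
  fixes k N L :: real
  assumes L: "0 < L"
  shows "1 / (1 + (L * (N - k))\<^sup>2) \<le> (1 + 2 * N\<^sup>2 + 2 / L\<^sup>2) / (1 + k\<^sup>2)"
proof -
  have "k\<^sup>2 \<le> 2 * N\<^sup>2 + 2 * (N - k)\<^sup>2"
    using zero_le_power2[of "2 * N - k"] by (simp add: power2_eq_square algebra_simps)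
  then have "1 + k\<^sup>2 \<le> (1 + 2 * N\<^sup>2) * 1 + 2 / L\<^sup>2 * (L * (N - k))\<^sup>2"
    using L by (simp add: power_mult_distrib)
  also have "\<dots> \<le> (1 + 2 * N\<^sup>2) * (1 + (L * (N - k))\<^sup>2) + 2 / L\<^sup>2 * (1 + (L * (N - k))\<^sup>2)"
    by (intro add_mono mult_left_mono) auto
  also have "\<dots> = (1 + 2 * N\<^sup>2 + 2 / L\<^sup>2) * (1 + (L * (N - k))\<^sup>2)" by (simp only: distrib_right)
  finally show ?thesis by (simp add: divide_simps add_pos_nonneg mult.commute)
qed

lemma lorentz_sum_le:
  fixes k N L :: real
  assumes "0 < L" "0 \<le> N" "0 \<le> k"
  shows "1 / (1 + (L * (N + k))\<^sup>2) \<le> 1 / (1 + (L * (N - k))\<^sup>2)"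
proof -
  have "\<bar>L * (N - k)\<bar> \<le> \<bar>L * (N + k)\<bar>" using assms by (simp add: abs_mult mult_left_mono)
  then have "(L * (N - k))\<^sup>2 \<le> (L * (N + k))\<^sup>2" by (rule abs_le_square_iff[THEN iffD1])
  then show ?thesis by (intro divide_left_mono) (auto intro!: mult_pos_pos add_pos_nonneg)
qed

text \<open>Up to three times the weight, the mass at N + k is 1/2 and the mass at N - k is 1/2 or
  -1/2, according to the sign of N - k.\<close>

lemma cut_dirichlet_sharp:
  assumes L: "0 < L" and N: "0 < N" and k: "0 \<le> k"
  shows "\<bar>(if k \<le> N then 1 else 0) - cut (dirichlet_kernel N L) (k\<^sup>2)\<bar> \<le> 6 * (1 / (1 + (L * (N - k))\<^sup>2))"
proof -
  let ?w = "1 / (1 + (L * (N - k))\<^sup>2)"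
  have 1: "\<bar>dirichlet_mass L (N + k) - 1 / 2\<bar> \<le> 3 * ?w"
    using dirichlet_mass_bound[OF L, of "N + k"] lorentz_sum_le[OF L, of N k] N k by simp
  consider "k < N" | "k = N" | "N < k" by linarith
  then show ?thesis
  proof cases
    case 1
    then have "\<bar>dirichlet_mass L (N - k) - 1 / 2\<bar> \<le> 3 * ?w" using dirichlet_mass_bound[OF L, of "N - k"] by simp
    then show ?thesis using \<open>\<bar>dirichlet_mass L (N + k) - 1 / 2\<bar> \<le> 3 * ?w\<close> 1 unfolding cut_dirichlet[OF L k]
      by (auto simp: abs_le_iff)
  next
    \<comment> \<open>At the jump the second mass is 0 and the weight is 1, which leaves room for
      the defect 1/2.\<close>
    case 2
    then have "dirichlet_mass L (N - k) = 0" using dirichlet_mass_minus[of L 0] by simp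
    then show ?thesis using 1 2 unfolding cut_dirichlet[OF L k] by (auto simp: abs_le_iff)
  next
    case 3
    have e: "(L * (k - N))\<^sup>2 = (L * (N - k))\<^sup>2" by (simp add: power2_eq_square algebra_simps)
    have "\<bar>dirichlet_mass L (k - N) - 1 / 2\<bar> \<le> 3 * ?w"
      using dirichlet_mass_bound[OF L, of "k - N"] 3 unfolding e by simp
    moreover have "dirichlet_mass L (N - k) = - dirichlet_mass L (k - N)" using dirichlet_mass_minus[of L "k - N"] by simp
    ultimately show ?thesis using 1 3 unfolding cut_dirichlet[OF L k] by (auto simp: abs_le_iff)
  qed
qed

text \<open>The sharp indicator is O(1/(1 + k^2)), and the error is a Lorentzian about N that
  \<open>lorentz_shift\<close> recentres.\<close>

lemma cut_dirichlet_decay: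
  assumes L: "0 < L" and N: "0 < N"
  obtains D where "\<And>\<mu>. 0 \<le> \<mu> \<Longrightarrow> \<bar>cut (dirichlet_kernel N L) \<mu>\<bar> \<le> D / (1 + \<mu>)"
proof
  fix \<mu> :: real assume \<mu>: "0 \<le> \<mu>"
  define k where "k = sqrt \<mu>"
  have k: "0 \<le> k" "k\<^sup>2 = \<mu>" using \<mu> by (auto simp: k_def)
  have "(if k \<le> N then 1 else 0) \<le> (1 + N\<^sup>2) / (1 + k\<^sup>2)"
  proof (cases "k \<le> N")
    case True
    have "0 < 1 + k\<^sup>2" by (intro add_pos_nonneg) auto
    moreover have "k\<^sup>2 \<le> N\<^sup>2" by (rule power_mono[OF True k(1)])
    ultimately show ?thesis using True by (simp add: pos_le_divide_eq)
  qed simp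
  moreover have "6 * (1 / (1 + (L * (N - k))\<^sup>2)) \<le> 6 * ((1 + 2 * N\<^sup>2 + 2 / L\<^sup>2) / (1 + k\<^sup>2))"
    by (intro mult_left_mono lorentz_shift[OF L]) auto
  moreover have "0 \<le> (if k \<le> N then 1 else (0::real))" by simp
  ultimately have "\<bar>cut (dirichlet_kernel N L) (k\<^sup>2)\<bar> \<le> (1 + N\<^sup>2) / (1 + k\<^sup>2) + 6 * ((1 + 2 * N\<^sup>2 + 2 / L\<^sup>2) / (1 + k\<^sup>2))"
    using cut_dirichlet_sharp[OF L N k(1)] by linarith
  also have "\<dots> = ((1 + N\<^sup>2) + 6 * (1 + 2 * N\<^sup>2 + 2 / L\<^sup>2)) / (1 + k\<^sup>2)" by (subst add_divide_distrib[of "1 + N\<^sup>2" "6 * (1 + 2 * N\<^sup>2 + 2 / L\<^sup>2)"]) simp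
  finally show "\<bar>cut (dirichlet_kernel N L) \<mu>\<bar> \<le> ((1 + N\<^sup>2) + 6 * (1 + 2 * N\<^sup>2 + 2 / L\<^sup>2)) / (1 + \<mu>)" unfolding k(2) .
qed

lemma cut_fejer_nonneg: "0 < L \<Longrightarrow> 0 \<le> \<mu> \<Longrightarrow> 0 \<le> cut (fejer_kernel M L) \<mu>"
  using cut_fejer[of L "sqrt \<mu>" M] fejer_mass_nonneg[of L] by simp

lemma cut_fejer_decay:
  assumes L: "0 < L" and M: "0 \<le> M"
  obtains D where "\<And>\<mu>. 0 \<le> \<mu> \<Longrightarrow> \<bar>cut (fejer_kernel M L) \<mu>\<bar> \<le> D / (1 + \<mu>)"
proof
  fix \<mu> :: real assume \<mu>: "0 \<le> \<mu>"
  define k where "k = sqrt \<mu>"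
  have k: "0 \<le> k" "k\<^sup>2 = \<mu>" using \<mu> by (auto simp: k_def)
  let ?w = "1 / (1 + (L * (M - k))\<^sup>2)"
  have "cut (fejer_kernel M L) (k\<^sup>2) \<le> 8 / (1 + (L * (M + k))\<^sup>2) + 8 * ?w"
    unfolding cut_fejer[OF L k(1)] using fejer_mass_upper[OF L, of "M + k"] fejer_mass_upper[OF L, of "M - k"] by simp
  also have "\<dots> \<le> 16 * ?w" using lorentz_sum_le[OF L M k(1)] by simp
  also have "\<dots> \<le> 16 * ((1 + 2 * M\<^sup>2 + 2 / L\<^sup>2) / (1 + k\<^sup>2))"
    by (intro mult_left_mono lorentz_shift[OF L]) auto
  finally show "\<bar>cut (fejer_kernel M L) \<mu>\<bar> \<le> (16 * (1 + 2 * M\<^sup>2 + 2 / L\<^sup>2)) / (1 + \<mu>)"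
    using cut_fejer_nonneg[OF L \<mu>, of M] unfolding k(2) by simp
qed

text \<open>The error of the smooth cutoff is dominated by two translated Fejer kernels, since their zeros
  interlace.\<close>

lemma cut_dirichlet_fejer:
  assumes L: "0 < L" and N: "0 < N" and \<mu>: "0 \<le> \<mu>"
  shows "\<bar>indicator {..N\<^sup>2} \<mu> - cut (dirichlet_kernel N L) \<mu>\<bar> \<le>
    3 * pi\<^sup>2 * (cut (fejer_kernel N L) \<mu> + cut (fejer_kernel (N + pi / L) L) \<mu>)"
proof -
  define k where "k = sqrt \<mu>"
  have k: "0 \<le> k" "k\<^sup>2 = \<mu>" using \<mu> by (auto simp: k_def)
  have i: "indicator {..N\<^sup>2} \<mu> = (if k \<le> N then 1 else (0::real))"
    using N k abs_le_square_iff[of k N] by (auto simp: indicator_def)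
  \<comment> \<open>The constant is 6 times pi^2/2; the shift by pi/L in the mass is a shift of the
    centre of the Fejer kernel.\<close>
  have "6 * (1 / (1 + (L * (N - k))\<^sup>2)) \<le> 6 * (pi\<^sup>2 / 2 * (fejer_mass L (N - k) + fejer_mass L (N - k + pi / L)))"
    by (intro mult_left_mono fejer_mass_lower[OF L]) auto
  also have "\<dots> = 3 * pi\<^sup>2 * (fejer_mass L (N - k) + fejer_mass L (N + pi / L - k))"
    by (simp add: algebra_simps)
  also have "\<dots> \<le> 3 * pi\<^sup>2 * (cut (fejer_kernel N L) (k\<^sup>2) + cut (fejer_kernel (N + pi / L) L) (k\<^sup>2))"
    unfolding cut_fejer[OF L k(1)] using fejer_mass_nonneg[OF L] by (intro mult_left_mono add_mono) auto
  finally show ?thesis using cut_dirichlet_sharp[OF L N k(1)] unfolding i k(2) by linarith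
qed

text \<open>Oscillation makes the primitive O(1/M) for fixed L. It controls both the response term
  and the negative spectrum in a Fejer integral.\<close>

lemma fejer_antiderivative_bound:
  assumes L: "0 < L" and M: "0 < M"
  shows "\<bar>antiderivative (fejer_kernel M L) z\<bar> \<le> 2 / L * (1 / M + 2 / (L * M\<^sup>2))"
proof -
  interpret cutoff "fejer_kernel M L" "antiderivative (fejer_kernel M L)" L by (rule cutoff_fejer[OF L])
  let ?K = "antiderivative (fejer_kernel M L)"
  have 1: "\<bar>?K z\<bar> \<le> 2 / L * (1 / M + 2 / (L * M\<^sup>2))" if z: "0 \<le> z" "z \<le> L" for z
  proof -
    have "?K z = 2 / L * ((1 - z / L) * (sin (M * z) / M) + (1 - cos (M * z)) / (L * M\<^sup>2))"
    proof (rule antiderivative_eqI[OF \<kappa>_continuous])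
      fix y assume y: "0 \<le> y" "y \<le> z"
      have k: "fejer_kernel M L y = 2 / L * (1 - y / L) * cos (M * y)"
        using y z L by (simp add: fejer_kernel_def)
      have d1: "((\<lambda>y. 1 - y / L) has_real_derivative - 1 / L) (at y)" using L by (auto intro!: derivative_eq_intros)
      have d2: "((\<lambda>y. sin (M * y) / M) has_real_derivative cos (M * y) * M / M) (at y)"
        by (rule DERIV_cdivide) (auto intro!: derivative_eq_intros)
      have d3: "((\<lambda>y. (1 - cos (M * y)) / (L * M\<^sup>2)) has_real_derivative sin (M * y) * M / (L * M\<^sup>2)) (at y)"
        by (rule DERIV_cdivide) (auto intro!: derivative_eq_intros)
      show "((\<lambda>z. 2 / L * ((1 - z / L) * (sin (M * z) / M) + (1 - cos (M * z)) / (L * M\<^sup>2))) has_real_derivative fejer_kernel M L y) (at y)"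
        unfolding k
        by (rule DERIV_cong[OF DERIV_cmult[OF DERIV_add[OF DERIV_mult[OF d1 d2] d3]]])
          (use L M in \<open>simp add: field_simps power2_eq_square\<close>)
    qed (use z in auto)
    moreover have "\<bar>(1 - z / L) * (sin (M * z) / M)\<bar> \<le> 1 * (1 / M)"
      unfolding abs_mult using z L M by (intro mult_mono) (auto simp: divide_right_mono)
    moreover have "\<bar>(1 - cos (M * z)) / (L * M\<^sup>2)\<bar> \<le> 2 / (L * M\<^sup>2)"
    proof -
      have "\<bar>1 - cos (M * z)\<bar> \<le> 2" using cos_ge_minus_one[of "M * z"] cos_le_one[of "M * z"] by linarith
      then show ?thesis using L M by (simp add: divide_right_mono)
    qed
    moreover have "\<bar>k * (a + b)\<bar> \<le> \<bar>k\<bar> * (c + d)" if "\<bar>a\<bar> \<le> 1 * c" "\<bar>b\<bar> \<le> d" for a b c d k :: real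
      unfolding abs_mult using that by (intro mult_left_mono) auto
    ultimately have "\<bar>?K z\<bar> \<le> \<bar>2 / L\<bar> * (1 / M + 2 / (L * M\<^sup>2))"
      by presburger
    then show ?thesis using L by simp
  qed
  have 2: "\<bar>?K z\<bar> \<le> 2 / L * (1 / M + 2 / (L * M\<^sup>2))" if "0 \<le> z" for z
    using 1[of z] 1[of L] K_const[of z] L that by (cases "z \<le> L") auto
  show ?thesis
    using 2[of z] 2[of "- z"] K_odd[of z] by (cases "0 \<le> z") auto
qed

text \<open>\<open>min z L\<close> appears because the primitive is constant beyond L; the last two
  terms bound what the window adds to Si.\<close>

lemma dirichlet_antiderivative_bound:
  assumes L: "0 < L" and N: "0 < N" and z: "0 \<le> z"
  shows "\<bar>antiderivative (dirichlet_kernel N L) z - 1 / 2\<bar> \<le> \<bar>Si (N * min z L) - pi / 2\<bar> + 1 / (L * N)\<^sup>2 + 1 / (L * N)"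
proof -
  interpret cutoff "dirichlet_kernel N L" "antiderivative (dirichlet_kernel N L)" L by (rule cutoff_dirichlet[OF L])
  define y where "y = min z L"
  have y: "0 \<le> y" "y \<le> L" using z L by (auto simp: y_def)
  have Ky: "antiderivative (dirichlet_kernel N L) z = antiderivative (dirichlet_kernel N L) y"
    using K_const[of z] by (auto simp: y_def min_def)
  have 1: "\<bar>sin (N * y) / N\<^sup>2 / L\<^sup>2\<bar> \<le> 1 / (L * N)\<^sup>2"
    using L N by (simp add: abs_mult divide_simps power_mult_distrib mult_ac)
  have 2: "\<bar>y * cos (N * y) / N / L\<^sup>2\<bar> \<le> 1 / (L * N)"
  proof -
    have "\<bar>y\<bar> * \<bar>cos (N * y)\<bar> \<le> L * 1" using y by (intro mult_mono) auto
    then have "\<bar>y * cos (N * y)\<bar> / N / L\<^sup>2 \<le> L / N / L\<^sup>2"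
      using L N unfolding abs_mult by (intro divide_right_mono) auto
    also have "\<dots> = 1 / (L * N)" using L N by (simp add: field_simps power2_eq_square)
    finally show ?thesis using L N by (simp add: abs_mult)
  qed
  have eq: "antiderivative (dirichlet_kernel N L) y - 1 / 2 =
    ((Si (N * y) - pi / 2) - sin (N * y) / N\<^sup>2 / L\<^sup>2 + y * cos (N * y) / N / L\<^sup>2) / pi"
    using dirichlet_antiderivative[OF L _ y, of N] N by (simp add: diff_divide_distrib add_divide_distrib)
  have num: "\<bar>(Si (N * y) - pi / 2) - sin (N * y) / N\<^sup>2 / L\<^sup>2 + y * cos (N * y) / N / L\<^sup>2\<bar> \<le>
    \<bar>Si (N * y) - pi / 2\<bar> + 1 / (L * N)\<^sup>2 + 1 / (L * N)"
    using 1 2 by linarith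
  have "\<bar>antiderivative (dirichlet_kernel N L) y - 1 / 2\<bar> \<le> (\<bar>Si (N * y) - pi / 2\<bar> + 1 / (L * N)\<^sup>2 + 1 / (L * N)) / 1"
    unfolding eq abs_divide using pi_gt3 by (intro frac_le num order_trans[OF abs_ge_zero num]) auto
  then show ?thesis unfolding Ky y_def[symmetric] by simp
qed

text \<open>Complements \<open>dirichlet_antiderivative_eventually\<close>: convergence to 1/2 is
  not uniform near 0, where N z need not be large, and there a bound independent of N takes
  over.\<close>

lemma dirichlet_antiderivative_bounded:
  assumes L: "0 < L"
  obtains C where "0 < C" "\<And>N z. 1 \<le> N \<Longrightarrow> 0 \<le> z \<Longrightarrow> \<bar>antiderivative (dirichlet_kernel N L) z - 1 / 2\<bar> \<le> C"
proof -
  obtain S where S: "\<And>t. \<bar>Si t\<bar> \<le> S" using bounded_Si by blast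
  have S0: "0 \<le> S" using S[of 0] by linarith
  let ?C = "S + pi / 2 + 1 / L\<^sup>2 + 1 / L"
  have "0 < ?C" using S0 L pi_gt_zero by (intro add_nonneg_pos add_nonneg_nonneg) auto
  moreover have "\<bar>antiderivative (dirichlet_kernel N L) z - 1 / 2\<bar> \<le> ?C" if N: "1 \<le> N" and z: "0 \<le> z" for N z
  proof -
    have "L \<le> L * N" using L N by simp
    then have "1 / (L * N) \<le> 1 / L" "1 / (L * N)\<^sup>2 \<le> 1 / L\<^sup>2"
      using L N by (intro divide_left_mono power_mono mult_pos_pos zero_less_power; simp)+
    moreover have "\<bar>Si (N * min z L) - pi / 2\<bar> \<le> S + pi / 2"
      using abs_triangle_ineq4[of "Si (N * min z L)" "pi / 2"] S[of "N * min z L"] by simp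
    moreover have "0 < N" using N by simp
    ultimately show ?thesis using dirichlet_antiderivative_bound[OF L _ z, of N] by linarith
  qed
  ultimately show ?thesis by (rule that)
qed

lemma dirichlet_antiderivative_eventually:
  assumes L: "0 < L" and \<delta>: "0 < \<delta>" and \<eta>: "0 < \<eta>"
  shows "eventually (\<lambda>N. \<forall>z\<ge>\<delta>. \<bar>antiderivative (dirichlet_kernel N L) z - 1 / 2\<bar> \<le> \<eta>) at_top"
proof -
  have "eventually (\<lambda>m. dist (Si m) (pi / 2) < \<eta> / 3) at_top"
    using \<eta> by (intro tendstoD[OF Si_at_top]) simp
  then obtain m0 where m0: "\<And>m. m0 \<le> m \<Longrightarrow> \<bar>Si m - pi / 2\<bar> < \<eta> / 3"
    unfolding eventually_at_top_linorder dist_real_def by blast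
  have l1: "((\<lambda>N. 1 / (L * N)) \<longlongrightarrow> 0) at_top" "((\<lambda>N. 1 / (L * N)\<^sup>2) \<longlongrightarrow> 0) at_top"
    using L by real_asymp+
  have e1: "eventually (\<lambda>N. 1 / (L * N) < \<eta> / 3) at_top" "eventually (\<lambda>N. 1 / (L * N)\<^sup>2 < \<eta> / 3) at_top"
    using \<eta> order_tendstoD(2)[OF l1(1), of "\<eta> / 3"] order_tendstoD(2)[OF l1(2), of "\<eta> / 3"] by auto
  have "eventually (\<lambda>N. m0 / min \<delta> L \<le> N) at_top" "eventually (\<lambda>N::real. 0 < N) at_top"
    by (rule eventually_ge_at_top, rule eventually_gt_at_top)
  with e1 show ?thesis
  proof eventually_elim
    case (elim N)
    show ?case
    proof (intro allI impI)
      fix z assume z: "\<delta> \<le> z"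
      have "m0 \<le> N * min \<delta> L" using elim(3) L \<delta> by (simp add: pos_divide_le_eq)
      also have "\<dots> \<le> N * min z L" using z elim by (intro mult_left_mono) auto
      finally have "\<bar>Si (N * min z L) - pi / 2\<bar> < \<eta> / 3" by (rule m0)
      moreover have "\<bar>antiderivative (dirichlet_kernel N L) z - 1 / 2\<bar> \<le> \<bar>Si (N * min z L) - pi / 2\<bar> + 1 / (L * N)\<^sup>2 + 1 / (L * N)"
        using z \<delta> elim by (intro dirichlet_antiderivative_bound[OF L]) auto
      ultimately show "\<bar>antiderivative (dirichlet_kernel N L) z - 1 / 2\<bar> \<le> \<eta>" using elim by linarith
    qed
  qed
qed

text \<open>Truncate |f| at a height n beyond which the excess has integral below e/2; the truncated
  part contributes at most n times the length, wherever the interval lies.\<close>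

lemma integral_small_interval:
  fixes f :: "real \<Rightarrow> real"
  assumes f: "integrable lborel f" and e: "0 < e"
  obtains d where "0 < d" "\<And>a b. \<bar>b - a\<bar> \<le> d \<Longrightarrow> (\<integral>x. indicator {a..b} x * \<bar>f x\<bar> \<partial>lborel) \<le> e"
proof -
  note [measurable] = borel_measurable_integrable[OF f]
  let ?g = "\<lambda>n::nat. \<lambda>x. max 0 (\<bar>f x\<bar> - real n)"
  have "(\<lambda>n. \<integral>x. ?g n x \<partial>lborel) \<longlonglongrightarrow> (\<integral>x. 0 \<partial>(lborel :: real measure))"
  proof (rule integral_dominated_convergence[where w="\<lambda>x. \<bar>f x\<bar>"])
    show "AE x in lborel. (\<lambda>n. ?g n x) \<longlonglongrightarrow> 0"
    proof (rule AE_I2)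
      fix x
      obtain n0 :: nat where "\<bar>f x\<bar> \<le> real n0" using real_arch_simple by blast
      then have "eventually (\<lambda>n. ?g n x = 0) sequentially"
        by (intro eventually_sequentiallyI[of n0]) auto
      then show "(\<lambda>n. ?g n x) \<longlonglongrightarrow> 0" by (rule tendsto_eventually)
    qed
  qed (use f in auto)
  then have "eventually (\<lambda>n. (\<integral>x. ?g n x \<partial>lborel) < e / 2) sequentially"
    using e by (intro order_tendstoD(2)) auto
  then obtain n where n: "(\<integral>x. ?g n x \<partial>lborel) < e / 2" by (auto simp: eventually_sequentially)
  have gi: "integrable lborel (?g n)"
    by (rule Bochner_Integration.integrable_bound[OF integrable_abs[OF f]]) auto
  define d where "d = e / (2 * (real n + 1))"
  have d: "0 < d" using e by (simp add: d_def)
  have "(\<integral>x. indicator {a..b} x * \<bar>f x\<bar> \<partial>lborel) \<le> e" if ab: "\<bar>b - a\<bar> \<le> d" for a b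
  proof -
    have "(\<integral>x. indicator {a..b} x * \<bar>f x\<bar> \<partial>lborel) \<le> (\<integral>x. ?g n x + indicator {a..b} x * real n \<partial>lborel)"
    proof (rule Bochner_Integration.integral_mono)
      show "integrable lborel (\<lambda>x. indicator {a..b} x * \<bar>f x\<bar>)"
        by (rule Bochner_Integration.integrable_bound[OF integrable_abs[OF f]]) (auto simp: indicator_def)
      show "integrable lborel (\<lambda>x. ?g n x + indicator {a..b} x * real n)"
        by (intro Bochner_Integration.integrable_add gi integrable_indicator_interval)
    qed (auto simp: indicator_def)
    also have "\<dots> = (\<integral>x. ?g n x \<partial>lborel) + (\<integral>x. indicator {a..b} x * real n \<partial>lborel)"
      by (rule Bochner_Integration.integral_add[OF gi integrable_indicator_interval])
    also have "(\<integral>x. indicator {a..b} x * real n \<partial>lborel) \<le> d * real n"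
      using ab d by (cases "a \<le> b") (auto intro!: mult_right_mono)
    also have "d * real n \<le> e / 2" using e by (simp add: d_def field_simps)
    finally show ?thesis using n by simp
  qed
  with d show ?thesis by (rule that)
qed

section \<open>Sharp cutoffs\<close>

context spectral_data
begin

definition energy :: "real \<Rightarrow> real \<Rightarrow> real" where
  "energy x \<mu> = (sin_sqrt (x / 2) \<mu>)\<^sup>2"

lemma energy_measurable [measurable]: "energy x \<in> borel_measurable borel"
  unfolding energy_def[abs_def] by measurable

lemma energy_nonneg: "0 \<le> energy x \<mu>" by (simp add: energy_def)

lemma integrable_energy_cut:
  assumes L: "0 < L" and x: "0 \<le> x"
  shows "0 < N \<Longrightarrow> integrable M (\<lambda>\<mu>. energy x \<mu> * cut (dirichlet_kernel N L) \<mu>)"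
    and "0 \<le> N \<Longrightarrow> integrable M (\<lambda>\<mu>. energy x \<mu> * cut (fejer_kernel N L) \<mu>)"
proof -
  assume N: "0 < N"
  obtain D where D: "\<And>\<mu>. 0 \<le> \<mu> \<Longrightarrow> \<bar>cut (dirichlet_kernel N L) \<mu>\<bar> \<le> D / (1 + \<mu>)" by (rule cut_dirichlet_decay[OF L N]) blast
  interpret spectral_cutoff q u \<phi> M "dirichlet_kernel N L" "antiderivative (dirichlet_kernel N L)" L
    by (intro spectral_cutoff.intro cutoff_dirichlet[OF L]) unfold_locales
  show "integrable M (\<lambda>\<mu>. energy x \<mu> * cut (dirichlet_kernel N L) \<mu>)"
    unfolding energy_def by (rule cutoff_integral(1)[OF x D])
next
  assume N: "0 \<le> N"
  obtain D where D: "\<And>\<mu>. 0 \<le> \<mu> \<Longrightarrow> \<bar>cut (fejer_kernel N L) \<mu>\<bar> \<le> D / (1 + \<mu>)" by (rule cut_fejer_decay[OF L N]) blast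
  interpret spectral_cutoff q u \<phi> M "fejer_kernel N L" "antiderivative (fejer_kernel N L)" L
    by (intro spectral_cutoff.intro cutoff_fejer[OF L]) unfold_locales
  show "integrable M (\<lambda>\<mu>. energy x \<mu> * cut (fejer_kernel N L) \<mu>)"
    unfolding energy_def by (rule cutoff_integral(1)[OF x D])
qed

lemma integral_energy_cut:
  assumes L: "0 < L" and x: "0 \<le> x"
  shows "0 < N \<Longrightarrow> (\<integral>\<mu>. energy x \<mu> * cut (dirichlet_kernel N L) \<mu> \<partial>M) =
      dirichlet_kernel N L 0 - dirichlet_kernel N L x +
      (\<integral>b. indicator {0..x + L} b * (cutoff.profile (antiderivative (dirichlet_kernel N L)) x b * response b) \<partial>lborel)"
    and "0 \<le> N \<Longrightarrow> (\<integral>\<mu>. energy x \<mu> * cut (fejer_kernel N L) \<mu> \<partial>M) =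
      fejer_kernel N L 0 - fejer_kernel N L x +
      (\<integral>b. indicator {0..x + L} b * (cutoff.profile (antiderivative (fejer_kernel N L)) x b * response b) \<partial>lborel)"
proof -
  assume N: "0 < N"
  obtain D where D: "\<And>\<mu>. 0 \<le> \<mu> \<Longrightarrow> \<bar>cut (dirichlet_kernel N L) \<mu>\<bar> \<le> D / (1 + \<mu>)" by (rule cut_dirichlet_decay[OF L N]) blast
  interpret spectral_cutoff q u \<phi> M "dirichlet_kernel N L" "antiderivative (dirichlet_kernel N L)" L
    by (intro spectral_cutoff.intro cutoff_dirichlet[OF L]) unfold_locales
  show "(\<integral>\<mu>. energy x \<mu> * cut (dirichlet_kernel N L) \<mu> \<partial>M) =
      dirichlet_kernel N L 0 - dirichlet_kernel N L x +
      (\<integral>b. indicator {0..x + L} b * (cutoff.profile (antiderivative (dirichlet_kernel N L)) x b * response b) \<partial>lborel)"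
    unfolding energy_def by (rule cutoff_integral(2)[OF x D])
next
  assume N: "0 \<le> N"
  obtain D where D: "\<And>\<mu>. 0 \<le> \<mu> \<Longrightarrow> \<bar>cut (fejer_kernel N L) \<mu>\<bar> \<le> D / (1 + \<mu>)" by (rule cut_fejer_decay[OF L N]) blast
  interpret spectral_cutoff q u \<phi> M "fejer_kernel N L" "antiderivative (fejer_kernel N L)" L
    by (intro spectral_cutoff.intro cutoff_fejer[OF L]) unfold_locales
  show "(\<integral>\<mu>. energy x \<mu> * cut (fejer_kernel N L) \<mu> \<partial>M) =
      fejer_kernel N L 0 - fejer_kernel N L x +
      (\<integral>b. indicator {0..x + L} b * (cutoff.profile (antiderivative (fejer_kernel N L)) x b * response b) \<partial>lborel)"
    unfolding energy_def by (rule cutoff_integral(2)[OF x D])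
qed

text \<open>The exponential weights cover \<mu> < 0, and on [0, n] the weight (1 + \<mu>)^-2 is
  bounded below.\<close>

lemma integrable_energy_atMost:
  assumes x: "0 \<le> x"
  shows "integrable M (\<lambda>\<mu>. indicator {..n} \<mu> * energy x \<mu>)"
proof (rule Bochner_Integration.integrable_bound)
  let ?K = "(x / 2)\<^sup>2 * (1 + \<bar>n\<bar>)\<^sup>2"
  show "integrable M (\<lambda>\<mu>. indicator {..<0} \<mu> * (sin_sqrt (x / 2 + 1) \<mu>)\<^sup>2 + ?K * (indicator {0..} \<mu> * (1 / (1 + \<mu>)\<^sup>2)))"
    by (intro Bochner_Integration.integrable_add integrable_mult_right integrable_weight_nonneg integrable_weight_neg) (use x in simp)
  show "AE \<mu> in M. norm (indicator {..n} \<mu> * energy x \<mu>) \<le> norm (indicator {..<0} \<mu> * (sin_sqrt (x / 2 + 1) \<mu>)\<^sup>2 + ?K * (indicator {0..} \<mu> * (1 / (1 + \<mu>)\<^sup>2)))"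
  proof (rule AE_I2)
    fix \<mu>
    show "norm (indicator {..n} \<mu> * energy x \<mu>) \<le> norm (indicator {..<0} \<mu> * (sin_sqrt (x / 2 + 1) \<mu>)\<^sup>2 + ?K * (indicator {0..} \<mu> * (1 / (1 + \<mu>)\<^sup>2)))"
    proof (cases "\<mu> < 0")
      case True
      have "(sin_sqrt (x / 2) \<mu>)\<^sup>2 \<le> (sin_sqrt (x / 2 + 1) \<mu>)\<^sup>2"
        using True x by (intro power_mono sin_sqrt_mono sin_sqrt_nonneg) auto
      then show ?thesis using True by (auto simp: energy_def indicator_def)
    next
      case False
      have "(sin_sqrt (x / 2) \<mu>)\<^sup>2 \<le> ?K * (1 / (1 + \<mu>)\<^sup>2)" if "\<mu> \<le> n"
      proof -
        have "(sin_sqrt (x / 2) \<mu>)\<^sup>2 \<le> (x / 2)\<^sup>2"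
          using abs_sin_sqrt_le[of \<mu> "x / 2"] False by (intro abs_le_square_iff[THEN iffD1]) auto
        also have "\<dots> = (x / 2)\<^sup>2 * ((1 + \<mu>)\<^sup>2 * (1 / (1 + \<mu>)\<^sup>2))" using False by simp
        also have "\<dots> \<le> (x / 2)\<^sup>2 * ((1 + \<bar>n\<bar>)\<^sup>2 * (1 / (1 + \<mu>)\<^sup>2))"
          using False that by (intro mult_left_mono mult_right_mono power_mono) auto
        finally show ?thesis by simp
      qed
      then show ?thesis using False by (auto simp: energy_def indicator_def)
    qed
  qed
qed measurable

text \<open>One majorant of the negative spectrum for all x in [0, R], which keeps the later bounds
  uniform in x.\<close>

definition neg_weight :: "real \<Rightarrow> real \<Rightarrow> real" where
  "neg_weight R L = (\<integral>\<mu>. indicator {..<0} \<mu> * (sin_sqrt (R / 2 + (L + 1)) \<mu>)\<^sup>2 \<partial>M)"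

text \<open>One factor S(x/2) is enlarged to the full argument; the other absorbs the cosh by
  \<open>cos_sqrt_mult_sin_sqrt_le\<close>.\<close>

lemma energy_neg_bound:
  assumes \<mu>: "\<mu> < 0" and x: "0 \<le> x" "x \<le> R" and L: "0 < L"
  shows "energy x \<mu> * cos_sqrt (L + 1) \<mu> \<le> (sin_sqrt (R / 2 + (L + 1)) \<mu>)\<^sup>2"
proof -
  have A: "sin_sqrt (x / 2) \<mu> \<le> sin_sqrt (R / 2) \<mu>" "sin_sqrt (R / 2) \<mu> \<le> sin_sqrt (R / 2 + (L + 1)) \<mu>"
    "0 \<le> sin_sqrt (x / 2) \<mu>" "0 \<le> sin_sqrt (R / 2 + (L + 1)) \<mu>"
    using \<mu> x L by (intro sin_sqrt_mono sin_sqrt_nonneg; simp)+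
  have B: "cos_sqrt (L + 1) \<mu> * sin_sqrt (R / 2) \<mu> \<le> sin_sqrt (R / 2 + (L + 1)) \<mu>"
    using cos_sqrt_mult_sin_sqrt_le[of \<mu> "L + 1" "R / 2"] \<mu> L by (simp add: add.commute)
  have "energy x \<mu> * cos_sqrt (L + 1) \<mu> = sin_sqrt (x / 2) \<mu> * (cos_sqrt (L + 1) \<mu> * sin_sqrt (x / 2) \<mu>)"
    by (simp add: energy_def power2_eq_square)
  also have "\<dots> \<le> sin_sqrt (R / 2 + (L + 1)) \<mu> * (cos_sqrt (L + 1) \<mu> * sin_sqrt (R / 2) \<mu>)"
    using A \<mu> cos_sqrt_ge_1[of \<mu> "L + 1"] by (intro mult_mono mult_nonneg_nonneg) auto
  also have "\<dots> \<le> sin_sqrt (R / 2 + (L + 1)) \<mu> * sin_sqrt (R / 2 + (L + 1)) \<mu>"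
    using A B by (intro mult_left_mono)
  finally show ?thesis by (simp add: power2_eq_square)
qed

text \<open>Applied to the Fejer cutoff itself and to the defect of the Dirichlet cutoff from
  1.\<close>

lemma neg_energy_integral:
  assumes L: "0 < L" and x: "0 \<le> x" "x \<le> R" and [measurable]: "f \<in> borel_measurable borel"
    and f: "\<And>\<mu>. \<mu> < 0 \<Longrightarrow> \<bar>f \<mu>\<bar> \<le> c * cos_sqrt (L + 1) \<mu>" and c: "0 \<le> c"
  shows "integrable M (\<lambda>\<mu>. indicator {..<0} \<mu> * (energy x \<mu> * f \<mu>))"
    and "(\<integral>\<mu>. \<bar>indicator {..<0} \<mu> * (energy x \<mu> * f \<mu>)\<bar> \<partial>M) \<le> c * neg_weight R L"
proof -
  let ?w = "\<lambda>\<mu>. indicator {..<0} \<mu> * (sin_sqrt (R / 2 + (L + 1)) \<mu>)\<^sup>2"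
  have w: "integrable M ?w" by (rule integrable_weight_neg) (use L x in simp)
  have b: "\<bar>indicator {..<0} \<mu> * (energy x \<mu> * f \<mu>)\<bar> \<le> c * ?w \<mu>" for \<mu>
  proof (cases "\<mu> < 0")
    case True
    have "energy x \<mu> * \<bar>f \<mu>\<bar> \<le> energy x \<mu> * (c * cos_sqrt (L + 1) \<mu>)"
      using f[OF True] energy_nonneg by (intro mult_left_mono) auto
    also have "\<dots> = c * (energy x \<mu> * cos_sqrt (L + 1) \<mu>)" by simp
    also have "\<dots> \<le> c * (sin_sqrt (R / 2 + (L + 1)) \<mu>)\<^sup>2"
      by (rule mult_left_mono[OF energy_neg_bound[OF True x L] c])
    finally show ?thesis using True energy_nonneg[of x \<mu>] by (simp add: abs_mult)
  qed (use c in simp)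
  show i: "integrable M (\<lambda>\<mu>. indicator {..<0} \<mu> * (energy x \<mu> * f \<mu>))"
    by (rule Bochner_Integration.integrable_bound[of _ "\<lambda>\<mu>. c * ?w \<mu>"])
      (use w b in \<open>auto intro!: AE_I2 intro: order_trans[OF _ abs_ge_self]\<close>)
  have "(\<integral>\<mu>. \<bar>indicator {..<0} \<mu> * (energy x \<mu> * f \<mu>)\<bar> \<partial>M) \<le> (\<integral>\<mu>. c * ?w \<mu> \<partial>M)"
    by (intro Bochner_Integration.integral_mono integrable_abs i integrable_mult_right w b)
  then show "(\<integral>\<mu>. \<bar>indicator {..<0} \<mu> * (energy x \<mu> * f \<mu>)\<bar> \<partial>M) \<le> c * neg_weight R L"
    by (simp add: neg_weight_def)
qed

definition response_mass :: "real \<Rightarrow> real" where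
  "response_mass B = (\<integral>t. indicator {0..B} t * \<bar>response t\<bar> \<partial>lborel)"

lemma response_abs_integrable: "integrable lborel (\<lambda>t. indicator {0..B} t * \<bar>response t\<bar>)"
  using integrable_abs[OF response_integrable[of B]] by (simp add: abs_mult)

lemma response_mass_nonneg: "0 \<le> response_mass B"
  unfolding response_mass_def by (intro integral_nonneg_AE) auto

definition fejer_rate :: "real \<Rightarrow> real \<Rightarrow> real" where
  "fejer_rate L N = 2 / L * (1 / N + 2 / (L * N\<^sup>2))"

lemma fejer_rate_nonneg: "0 < L \<Longrightarrow> 0 < N \<Longrightarrow> 0 \<le> fejer_rate L N"
  by (simp add: fejer_rate_def)

lemma fejer_positive_part_bound:
  assumes L: "0 < L" and x: "0 \<le> x" "x \<le> R" and N: "0 < N"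
  shows "integrable M (\<lambda>\<mu>. indicator {0..} \<mu> * (energy x \<mu> * cut (fejer_kernel N L) \<mu>))"
    and "(\<integral>\<mu>. indicator {0..} \<mu> * (energy x \<mu> * cut (fejer_kernel N L) \<mu>) \<partial>M) \<le>
      4 / L + fejer_rate L N * (2 * response_mass (R + L) + 2 * (1 + L) * neg_weight R L)"
proof -
  interpret cutoff "fejer_kernel N L" "antiderivative (fejer_kernel N L)" L by (rule cutoff_fejer[OF L])
  let ?K = "antiderivative (fejer_kernel N L)" and ?J = "cut (fejer_kernel N L)"
  have r0: "0 \<le> fejer_rate L N" by (rule fejer_rate_nonneg[OF L N])
  have Kb: "\<bar>?K z\<bar> \<le> fejer_rate L N" for z
    unfolding fejer_rate_def by (rule fejer_antiderivative_bound[OF L N])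
  \<comment> \<open>The case t = 0 of \<open>cut_nonpos_bound\<close>.\<close>
  have neg: "\<bar>?J \<mu>\<bar> \<le> (2 * (1 + L) * fejer_rate L N) * cos_sqrt (L + 1) \<mu>" if \<mu>: "\<mu> < 0" for \<mu>
  proof -
    have "(\<integral>y. indicator {0..L} y * \<bar>?K y - 0\<bar> \<partial>lborel) \<le> (\<integral>y. indicator {0..L} y * fejer_rate L N \<partial>lborel)"
    proof (rule Bochner_Integration.integral_mono)
      show "integrable lborel (\<lambda>y. indicator {0..L} y * \<bar>?K y - 0\<bar>)"
        by (intro integrable_continuous_indicator continuous_intros K_continuous)
      show "indicator {0..L} y * \<bar>?K y - 0\<bar> \<le> indicator {0..L} y * fejer_rate L N" for y
        using Kb[of y] by (auto simp: indicator_def)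
    qed simp
    also have "\<dots> = L * fejer_rate L N" using L by simp
    finally have "\<bar>?K L - 0\<bar> + (\<integral>y. indicator {0..L} y * \<bar>?K y - 0\<bar> \<partial>lborel) \<le> (1 + L) * fejer_rate L N"
      using Kb[of L] by (simp add: distrib_right)
    then have "2 * (\<bar>?K L - 0\<bar> + (\<integral>y. indicator {0..L} y * \<bar>?K y - 0\<bar> \<partial>lborel)) * cos_sqrt (L + 1) \<mu> \<le>
      2 * ((1 + L) * fejer_rate L N) * cos_sqrt (L + 1) \<mu>"
      using cos_sqrt_ge_1[of \<mu> "L + 1"] \<mu> by (intro mult_right_mono mult_left_mono) auto
    with cut_nonpos_bound[of \<mu> 0] \<mu> have "\<bar>?J \<mu> - 2 * 0\<bar> \<le> 2 * ((1 + L) * fejer_rate L N) * cos_sqrt (L + 1) \<mu>"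
      by (meson order_trans less_imp_le)
    then show ?thesis by (simp only: mult.assoc mult_zero_right diff_zero)
  qed
  have c0: "0 \<le> 2 * (1 + L) * fejer_rate L N" using r0 L by simp
  note ni = neg_energy_integral[OF L x cut_measurable[OF \<kappa>_measurable] neg c0]
  have i: "integrable M (\<lambda>\<mu>. energy x \<mu> * ?J \<mu>)" by (rule integrable_energy_cut(2)[OF L x(1)]) (use N in simp)
  have split: "indicator {0..} \<mu> * (energy x \<mu> * ?J \<mu>) = energy x \<mu> * ?J \<mu> - indicator {..<0} \<mu> * (energy x \<mu> * ?J \<mu>)" for \<mu>
    by (auto simp: indicator_def)
  show "integrable M (\<lambda>\<mu>. indicator {0..} \<mu> * (energy x \<mu> * ?J \<mu>))"
    unfolding split by (intro Bochner_Integration.integrable_diff i ni(1))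
  have "(\<integral>\<mu>. indicator {0..} \<mu> * (energy x \<mu> * ?J \<mu>) \<partial>M) =
    (\<integral>\<mu>. energy x \<mu> * ?J \<mu> \<partial>M) - (\<integral>\<mu>. indicator {..<0} \<mu> * (energy x \<mu> * ?J \<mu>) \<partial>M)"
    unfolding split by (rule Bochner_Integration.integral_diff[OF i ni(1)])
  moreover have "- (\<integral>\<mu>. indicator {..<0} \<mu> * (energy x \<mu> * ?J \<mu>) \<partial>M) \<le> 2 * (1 + L) * fejer_rate L N * neg_weight R L"
    using order_trans[OF integral_abs_bound ni(2)] by linarith
  moreover have "(\<integral>\<mu>. energy x \<mu> * ?J \<mu> \<partial>M) \<le> 4 / L + 2 * fejer_rate L N * response_mass (R + L)"
  proof -
    have "\<bar>\<integral>b. indicator {0..x + L} b * (profile x b * response b) \<partial>lborel\<bar> \<le> (\<integral>b. 2 * fejer_rate L N * (indicator {0..R + L} b * \<bar>response b\<bar>) \<partial>lborel)"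
    proof (rule order_trans[OF integral_abs_bound], rule integral_mono')
      show "integrable lborel (\<lambda>b. 2 * fejer_rate L N * (indicator {0..R + L} b * \<bar>response b\<bar>))"
        using response_abs_integrable by simp
      show "\<bar>indicator {0..x + L} b * (profile x b * response b)\<bar> \<le> 2 * fejer_rate L N * (indicator {0..R + L} b * \<bar>response b\<bar>)" for b
        using profile_bound[OF Kb, of x b] x r0 by (auto simp: indicator_def abs_mult intro!: mult_right_mono)
    qed (use r0 in simp)
    then have "\<bar>\<integral>b. indicator {0..x + L} b * (profile x b * response b) \<partial>lborel\<bar> \<le> 2 * fejer_rate L N * response_mass (R + L)"
      by (simp add: response_mass_def)
    moreover have "\<bar>fejer_kernel N L y\<bar> \<le> 2 / L" for y
    proof -
      have "\<bar>max 0 (1 - \<bar>y\<bar> / L) * cos (N * y)\<bar> \<le> 1 * 1"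
        unfolding abs_mult using L by (intro mult_mono) auto
      then have "2 / L * \<bar>max 0 (1 - \<bar>y\<bar> / L) * cos (N * y)\<bar> \<le> 2 / L * 1" using L by (intro mult_left_mono) auto
      then show ?thesis using L by (simp add: fejer_kernel_def abs_mult mult.assoc)
    qed
    then have "fejer_kernel N L 0 \<le> 2 / L" "- fejer_kernel N L x \<le> 2 / L" by (meson abs_le_D1, meson abs_le_D2)
    moreover have "2 / L + 2 / L = 4 / L" by simp
    ultimately show ?thesis
      using integral_energy_cut(2)[OF L x(1), of N] N by linarith
  qed
  ultimately show "(\<integral>\<mu>. indicator {0..} \<mu> * (energy x \<mu> * ?J \<mu>) \<partial>M) \<le>
      4 / L + fejer_rate L N * (2 * response_mass (R + L) + 2 * (1 + L) * neg_weight R L)"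
    by (simp add: algebra_simps)
qed

text \<open>The quantity in \<open>cut_nonpos_bound\<close> for t = 1/2, the limit of the primitive
  of the Dirichlet kernel.\<close>

definition dirichlet_rate :: "real \<Rightarrow> real \<Rightarrow> real" where
  "dirichlet_rate L N = \<bar>antiderivative (dirichlet_kernel N L) L - 1 / 2\<bar> +
    (\<integral>y. indicator {0..L} y * \<bar>antiderivative (dirichlet_kernel N L) y - 1 / 2\<bar> \<partial>lborel)"

text \<open>On \<mu> < 0 the sharp cutoff is 1 and the smooth one is close to it. On \<mu> \<ge> 0
  the pointwise domination \<open>cut_dirichlet_fejer\<close> may be integrated because the measure
  is positive. The term 8/L collects 4/L from each of the two Fejer kernels.\<close>

lemma sharp_smooth_bound:
  assumes L: "0 < L" and x: "0 \<le> x" "x \<le> R" and N: "0 < N"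
  shows "\<bar>(\<integral>\<mu>. indicator {..N\<^sup>2} \<mu> * energy x \<mu> \<partial>M) - (\<integral>\<mu>. energy x \<mu> * cut (dirichlet_kernel N L) \<mu> \<partial>M)\<bar> \<le>
    2 * dirichlet_rate L N * neg_weight R L +
    3 * pi\<^sup>2 * (8 / L + (fejer_rate L N + fejer_rate L (N + pi / L)) * (2 * response_mass (R + L) + 2 * (1 + L) * neg_weight R L))"
proof -
  interpret cutoff "dirichlet_kernel N L" "antiderivative (dirichlet_kernel N L)" L by (rule cutoff_dirichlet[OF L])
  let ?D = "cut (dirichlet_kernel N L)" and ?J = "cut (fejer_kernel N L)" and ?J' = "cut (fejer_kernel (N + pi / L) L)"
  have N': "0 < N + pi / L" using N L pi_gt_zero by (intro add_pos_pos divide_pos_pos) auto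
  have r0: "0 \<le> dirichlet_rate L N" unfolding dirichlet_rate_def by (intro add_nonneg_nonneg integral_nonneg_AE) auto
  have neg: "\<bar>?D \<mu> - 1\<bar> \<le> (2 * dirichlet_rate L N) * cos_sqrt (L + 1) \<mu>" if "\<mu> < 0" for \<mu>
    using cut_nonpos_bound[of \<mu> "1/2"] that unfolding dirichlet_rate_def by simp
  have m: "(\<lambda>\<mu>. ?D \<mu> - 1) \<in> borel_measurable borel" by measurable
  have c0: "0 \<le> 2 * dirichlet_rate L N" using r0 by simp
  note ni = neg_energy_integral[OF L x m neg c0]
  note pJ = fejer_positive_part_bound[OF L x N] and pJ' = fejer_positive_part_bound[OF L x N']
  have iS: "integrable M (\<lambda>\<mu>. indicator {..N\<^sup>2} \<mu> * energy x \<mu>)" by (rule integrable_energy_atMost[OF x(1)])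
  have iD: "integrable M (\<lambda>\<mu>. energy x \<mu> * ?D \<mu>)" by (rule integrable_energy_cut(1)[OF L x(1) N])
  let ?dom = "\<lambda>\<mu>. \<bar>indicator {..<0} \<mu> * (energy x \<mu> * (?D \<mu> - 1))\<bar> +
      3 * pi\<^sup>2 * (indicator {0..} \<mu> * (energy x \<mu> * ?J \<mu>) + indicator {0..} \<mu> * (energy x \<mu> * ?J' \<mu>))"
  have iN: "integrable M (\<lambda>\<mu>. \<bar>indicator {..<0} \<mu> * (energy x \<mu> * (?D \<mu> - 1))\<bar>)" by (rule integrable_abs[OF ni(1)])
  have iP: "integrable M (\<lambda>\<mu>. indicator {0..} \<mu> * (energy x \<mu> * ?J \<mu>) + indicator {0..} \<mu> * (energy x \<mu> * ?J' \<mu>))"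
    by (rule Bochner_Integration.integrable_add[OF pJ(1) pJ'(1)])
  have "\<bar>(\<integral>\<mu>. indicator {..N\<^sup>2} \<mu> * energy x \<mu> \<partial>M) - (\<integral>\<mu>. energy x \<mu> * ?D \<mu> \<partial>M)\<bar> =
    \<bar>\<integral>\<mu>. indicator {..N\<^sup>2} \<mu> * energy x \<mu> - energy x \<mu> * ?D \<mu> \<partial>M\<bar>"
    by (subst Bochner_Integration.integral_diff[OF iS iD]) simp
  also have "\<dots> \<le> (\<integral>\<mu>. ?dom \<mu> \<partial>M)"
  proof (rule order_trans[OF integral_abs_bound], rule Bochner_Integration.integral_mono)
    show "integrable M (\<lambda>\<mu>. \<bar>indicator {..N\<^sup>2} \<mu> * energy x \<mu> - energy x \<mu> * ?D \<mu>\<bar>)" using iS iD by auto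
    show "integrable M ?dom" by (intro Bochner_Integration.integrable_add iN integrable_mult_right pJ(1) pJ'(1))
    fix \<mu>
    show "\<bar>indicator {..N\<^sup>2} \<mu> * energy x \<mu> - energy x \<mu> * ?D \<mu>\<bar> \<le> ?dom \<mu>"
    proof (cases "\<mu> < 0")
      case True
      then have "\<mu> \<le> N\<^sup>2" using zero_le_power2[of N] by linarith
      then have "\<bar>indicator {..N\<^sup>2} \<mu> * energy x \<mu> - energy x \<mu> * ?D \<mu>\<bar> = \<bar>energy x \<mu> * (?D \<mu> - 1)\<bar>"
        by (simp add: right_diff_distrib abs_minus_commute)
      then show ?thesis using True by simp
    next
      case False
      have "\<bar>indicator {..N\<^sup>2} \<mu> * energy x \<mu> - energy x \<mu> * ?D \<mu>\<bar> = energy x \<mu> * \<bar>indicator {..N\<^sup>2} \<mu> - ?D \<mu>\<bar>"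
      proof -
        have "indicator {..N\<^sup>2} \<mu> * energy x \<mu> - energy x \<mu> * ?D \<mu> = energy x \<mu> * (indicator {..N\<^sup>2} \<mu> - ?D \<mu>)"
          by (simp add: right_diff_distrib mult.commute)
        then show ?thesis using energy_nonneg[of x \<mu>] by (simp add: abs_mult)
      qed
      also have "\<dots> \<le> energy x \<mu> * (3 * pi\<^sup>2 * (?J \<mu> + ?J' \<mu>))"
        using False by (intro mult_left_mono energy_nonneg cut_dirichlet_fejer[OF L N]) auto
      also have "\<dots> = 3 * pi\<^sup>2 * (energy x \<mu> * ?J \<mu> + energy x \<mu> * ?J' \<mu>)" by (simp add: algebra_simps)
      finally show ?thesis using False by simp
    qed
  qed
  also have "(\<integral>\<mu>. ?dom \<mu> \<partial>M) = (\<integral>\<mu>. \<bar>indicator {..<0} \<mu> * (energy x \<mu> * (?D \<mu> - 1))\<bar> \<partial>M) +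
    3 * pi\<^sup>2 * ((\<integral>\<mu>. indicator {0..} \<mu> * (energy x \<mu> * ?J \<mu>) \<partial>M) + (\<integral>\<mu>. indicator {0..} \<mu> * (energy x \<mu> * ?J' \<mu>) \<partial>M))"
    unfolding Bochner_Integration.integral_add[OF iN integrable_mult_right[OF iP]]
      integral_mult_right_zero Bochner_Integration.integral_add[OF pJ(1) pJ'(1)] ..
  also have "\<dots> \<le> 2 * dirichlet_rate L N * neg_weight R L + 3 * pi\<^sup>2 *
    ((4 / L + fejer_rate L N * (2 * response_mass (R + L) + 2 * (1 + L) * neg_weight R L)) +
     (4 / L + fejer_rate L (N + pi / L) * (2 * response_mass (R + L) + 2 * (1 + L) * neg_weight R L)))"
    by (intro add_mono mult_left_mono ni(2) pJ(2) pJ'(2)) auto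
  also have "\<dots> = 2 * dirichlet_rate L N * neg_weight R L +
    3 * pi\<^sup>2 * (8 / L + (fejer_rate L N + fejer_rate L (N + pi / L)) * (2 * response_mass (R + L) + 2 * (1 + L) * neg_weight R L))"
  proof -
    have "(4 / L + a * c) + (4 / L + b * c) = 8 / L + (a + b) * c" for a b c by (simp add: distrib_right)
    then show ?thesis by simp
  qed
  finally show ?thesis .
qed

end

section \<open>Limits as N tends to infinity\<close>

context spectral_data
begin

lemma fejer_rate_tendsto:
  assumes "0 < L"
  shows "(fejer_rate L \<longlongrightarrow> 0) at_top" and "((\<lambda>N. fejer_rate L (N + pi / L)) \<longlongrightarrow> 0) at_top"
proof -
  show 1: "(fejer_rate L \<longlongrightarrow> 0) at_top"
    unfolding fejer_rate_def[abs_def] using assms by real_asymp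
  have "filterlim (\<lambda>N. N + pi / L) at_top at_top"
    using assms by real_asymp
  from filterlim_compose[OF 1 this] show "((\<lambda>N. fejer_rate L (N + pi / L)) \<longlongrightarrow> 0) at_top" .
qed

text \<open>The layer [0, \<delta>] is paid for by the uniform bound C, the rest by uniform
  convergence away from 0.\<close>

lemma dirichlet_rate_tendsto:
  assumes L: "0 < L"
  shows "(dirichlet_rate L \<longlongrightarrow> 0) at_top"
proof (rule tendstoI)
  fix e :: real assume e: "0 < e"
  obtain C where C: "0 < C" "\<And>N z. 1 \<le> N \<Longrightarrow> 0 \<le> z \<Longrightarrow> \<bar>antiderivative (dirichlet_kernel N L) z - 1 / 2\<bar> \<le> C"
    by (rule dirichlet_antiderivative_bounded[OF L]) blast
  define \<delta> where "\<delta> = min L (e / (4 * C))"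
  \<comment> \<open>Makes (1 + L) \<eta> equal to e/4: one \<eta> for the value at L and L \<eta>
    for the integral.\<close>
  define \<eta> where "\<eta> = e / (4 * (1 + L))"
  have \<delta>: "0 < \<delta>" "\<delta> \<le> L" "C * \<delta> \<le> e / 4"
  proof -
    show "0 < \<delta>" "\<delta> \<le> L" using L e C by (auto simp: \<delta>_def)
    have "C * \<delta> \<le> C * (e / (4 * C))" using C by (intro mult_left_mono) (auto simp: \<delta>_def)
    then show "C * \<delta> \<le> e / 4" using C by simp
  qed
  have "m * (e / (4 * m)) = e / 4" if "0 < m" for m using that by simp
  from this[of "1 + L"] have \<eta>: "0 < \<eta>" "(1 + L) * \<eta> = e / 4" using e L unfolding \<eta>_def by simp_all
  show "eventually (\<lambda>N. dist (dirichlet_rate L N) 0 < e) at_top"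
    using dirichlet_antiderivative_eventually[OF L \<delta>(1) \<eta>(1)] eventually_ge_at_top[of 1]
  proof eventually_elim
    case (elim N)
    interpret cutoff "dirichlet_kernel N L" "antiderivative (dirichlet_kernel N L)" L by (rule cutoff_dirichlet[OF L])
    let ?K = "antiderivative (dirichlet_kernel N L)"
    have "(\<integral>y. indicator {0..L} y * \<bar>?K y - 1 / 2\<bar> \<partial>lborel) \<le> (\<integral>y. indicator {0..\<delta>} y * C + indicator {0..L} y * \<eta> \<partial>lborel)"
    proof (rule Bochner_Integration.integral_mono)
      show "integrable lborel (\<lambda>y. indicator {0..L} y * \<bar>?K y - 1 / 2\<bar>)"
        by (intro integrable_continuous_indicator continuous_intros K_continuous)
      show "integrable lborel (\<lambda>y. indicator {0..\<delta>} y * C + indicator {0..L} y * \<eta>)"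
        by (intro Bochner_Integration.integrable_add integrable_indicator_interval)
      show "indicator {0..L} y * \<bar>?K y - 1 / 2\<bar> \<le> indicator {0..\<delta>} y * C + indicator {0..L} y * \<eta>" for y
        using elim C(1) C(2)[of N y] \<eta>(1) by (cases "y \<le> \<delta>") (auto simp: indicator_def)
    qed
    also have "\<dots> = \<delta> * C + L * \<eta>"
      using \<delta> L by (subst Bochner_Integration.integral_add) auto
    finally have "(\<integral>y. indicator {0..L} y * \<bar>?K y - 1 / 2\<bar> \<partial>lborel) \<le> \<delta> * C + L * \<eta>" .
    moreover have "\<bar>?K L - 1 / 2\<bar> \<le> \<eta>" using elim \<delta> by simp
    ultimately have "dirichlet_rate L N \<le> C * \<delta> + (1 + L) * \<eta>"
      unfolding dirichlet_rate_def by (simp add: algebra_simps)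
    moreover have "0 \<le> dirichlet_rate L N" unfolding dirichlet_rate_def by (intro add_nonneg_nonneg integral_nonneg_AE) auto
    ultimately show ?case using \<delta>(3) \<eta>(2) e by (simp add: dist_real_def)
  qed
qed

text \<open>The primitive of the Dirichlet kernel tends to sign/2, so the profile tends to half the
  indicator of [0, x]. Uniform convergence fails only near b = 0 and b = x, and the response
  function has little mass on short intervals wherever they lie; this makes the limit uniform
  although the point b = x moves.\<close>

lemma profile_response_eventually:
  assumes L: "0 < L" and R: "0 \<le> R" and e: "0 < e"
  shows "eventually (\<lambda>N. \<forall>x\<in>{0..R}.
    \<bar>(\<integral>b. indicator {0..x + L} b * (cutoff.profile (antiderivative (dirichlet_kernel N L)) x b * response b) \<partial>lborel)
      - (1/2) * (\<integral>b. indicator {0..x} b * response b \<partial>lborel)\<bar> \<le> e) at_top"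
proof -
  obtain C where C: "0 < C" "\<And>N z. 1 \<le> N \<Longrightarrow> 0 \<le> z \<Longrightarrow> \<bar>antiderivative (dirichlet_kernel N L) z - 1 / 2\<bar> \<le> C"
    by (rule dirichlet_antiderivative_bounded[OF L]) blast
  let ?\<rho> = "\<lambda>b. indicator {0..R + L} b * response b"
  obtain d where d: "0 < d" "\<And>a b. \<bar>b - a\<bar> \<le> d \<Longrightarrow> (\<integral>x. indicator {a..b} x * \<bar>?\<rho> x\<bar> \<partial>lborel) \<le> e / (8 * C)"
    by (rule integral_small_interval[OF response_integrable[of "R + L"], of "e / (8 * C)"]) (use e C in auto)
  \<comment> \<open>The interval of radius \<delta> about x has length d.\<close>
  define \<delta> where "\<delta> = d / 2"
  \<comment> \<open>The summand 1 keeps the denominator positive when the response mass is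
    0.\<close>
  define \<eta> where "\<eta> = e / (4 * (response_mass (R + L) + 1))"
  have m0: "0 < response_mass (R + L) + 1" using response_mass_nonneg[of "R + L"] by linarith
  have \<eta>: "0 < \<eta>" "2 * \<eta> * response_mass (R + L) \<le> e / 2"
  proof -
    show "0 < \<eta>" using e m0 by (simp add: \<eta>_def)
    then have "2 * \<eta> * response_mass (R + L) \<le> 2 * \<eta> * (response_mass (R + L) + 1)" by (intro mult_left_mono) auto
    also have "\<dots> = e / 2"
    proof -
      have "2 * (e / (4 * m)) * m = e / 2" if "0 < m" for m using that by simp
      from this[OF m0] show ?thesis unfolding \<eta>_def .
    qed
    finally show "2 * \<eta> * response_mass (R + L) \<le> e / 2" .
  qed
  have \<delta>: "0 < \<delta>" using d by (simp add: \<delta>_def)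
  show ?thesis
    using dirichlet_antiderivative_eventually[OF L \<delta> \<eta>(1)] eventually_ge_at_top[of 1]
  proof eventually_elim
    case (elim N)
    interpret cutoff "dirichlet_kernel N L" "antiderivative (dirichlet_kernel N L)" L by (rule cutoff_dirichlet[OF L])
    let ?K = "antiderivative (dirichlet_kernel N L)"
    note [measurable] = borel_measurable_continuous_onI[OF profile_continuous]
    have Kfar: "\<bar>?K z - 1 / 2\<bar> \<le> \<eta>" if "\<delta> \<le> z" for z using elim(1) that by auto
    have Kall: "\<bar>?K z - 1 / 2\<bar> \<le> C" if "0 \<le> z" for z using C(2) elim(2) that by auto
    show ?case
    proof
      fix x assume x: "x \<in> {0..R}"
      let ?p = "\<lambda>b. profile x b - (1/2) * indicator {..x} b"
      \<comment> \<open>The constant is distributed so that every value of K is taken at a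
        nonnegative argument and compared with 1/2; for b > x the oddness of K flips the middle
        term.\<close>
      have eqp: "?p b = (?K b - 1/2) + (?K (x - b) - 1/2) / 2 - (?K (x + b) - 1/2) / 2" if "b \<le> x" for b
        using that by (simp add: profile_def field_simps)
      have eqp': "?p b = (?K b - 1/2) - (?K (b - x) - 1/2) / 2 - (?K (x + b) - 1/2) / 2" if "x < b" for b
        using that K_odd[of "b - x"] by (simp add: profile_def field_simps)
      have lin: "\<bar>a + b / 2 - c / 2\<bar> \<le> 2 * k" "\<bar>a - b / 2 - c / 2\<bar> \<le> 2 * k"
        if "\<bar>a\<bar> \<le> k" "\<bar>b\<bar> \<le> k" "\<bar>c\<bar> \<le> k" for a b c k :: real
        using that by linarith+
      have pall: "\<bar>?p b\<bar> \<le> 2 * C" if "0 \<le> b" for b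
      proof (cases "b \<le> x")
        case True
        show ?thesis unfolding eqp[OF True] using that x True by (intro lin(1) Kall) auto
      next
        case False
        then have "x < b" by simp
        show ?thesis unfolding eqp'[OF \<open>x < b\<close>] using that x False by (intro lin(2) Kall) auto
      qed
      have pfar: "\<bar>?p b\<bar> \<le> 2 * \<eta>" if "\<delta> \<le> b" "\<delta> \<le> \<bar>x - b\<bar>" for b
      proof (cases "b \<le> x")
        case True
        show ?thesis unfolding eqp[OF True] using that x True by (intro lin(1) Kfar) auto
      next
        case False
        then have "x < b" by simp
        show ?thesis unfolding eqp'[OF \<open>x < b\<close>] using that x False by (intro lin(2) Kfar) auto
      qed
      have pi': "integrable lborel (\<lambda>b. indicator {0..x + L} b * (profile x b * response b))"
      proof -
        obtain k where "\<And>z. \<bar>?K z\<bar> \<le> k" using K_bounded by blast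
        then have "integrable lborel (\<lambda>b. indicator {0..x + L} b * (response b * profile x b))"
          using profile_bound[of k x] by (intro integrable_indicator_mult_bounded[OF response_integrable]) auto
        then show ?thesis by (simp add: mult.commute)
      qed
      have ri: "integrable lborel (\<lambda>b. indicator {0..x} b * response b)" by (rule response_integrable)
      have "(\<integral>b. indicator {0..x + L} b * (profile x b * response b) \<partial>lborel) - (1/2) * (\<integral>b. indicator {0..x} b * response b \<partial>lborel)
        = (\<integral>b. 1 * (indicator {0..x + L} b * (profile x b * response b)) - (1/2) * (indicator {0..x} b * response b) \<partial>lborel)"
        unfolding integral_diff_scaled[OF pi' ri] by simp
      also have "\<dots> = (\<integral>b. indicator {0..x + L} b * (?p b * response b) \<partial>lborel)"
        using L by (intro Bochner_Integration.integral_cong) (auto simp: indicator_def algebra_simps)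
      finally have eq: "(\<integral>b. indicator {0..x + L} b * (profile x b * response b) \<partial>lborel) - (1/2) * (\<integral>b. indicator {0..x} b * response b \<partial>lborel)
        = (\<integral>b. indicator {0..x + L} b * (?p b * response b) \<partial>lborel)" .
      let ?a = "\<lambda>b. \<bar>?\<rho> b\<bar>"
      have ai: "integrable lborel ?a" by (intro integrable_abs response_integrable)
      have aj: "integrable lborel (\<lambda>b. indicator {s..t} b * ?a b)" for s t
        by (rule Bochner_Integration.integrable_bound[OF ai]) (auto simp: indicator_def)
      have "\<bar>\<integral>b. indicator {0..x + L} b * (?p b * response b) \<partial>lborel\<bar> \<le>
        (\<integral>b. 2 * \<eta> * ?a b + 2 * C * (indicator {0..\<delta>} b * ?a b + indicator {x - \<delta>..x + \<delta>} b * ?a b) \<partial>lborel)"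
      proof (rule order_trans[OF integral_abs_bound], rule integral_mono')
        show "integrable lborel (\<lambda>b. 2 * \<eta> * ?a b + 2 * C * (indicator {0..\<delta>} b * ?a b + indicator {x - \<delta>..x + \<delta>} b * ?a b))"
          by (intro Bochner_Integration.integrable_add integrable_mult_right ai aj)
        fix b
        have nn: "0 \<le> 2 * \<eta> * ?a b" "0 \<le> 2 * C * (indicator {0..\<delta>} b * ?a b + indicator {x - \<delta>..x + \<delta>} b * ?a b)"
          using \<eta>(1) C(1) by (auto intro!: mult_nonneg_nonneg add_nonneg_nonneg)
        then show "0 \<le> 2 * \<eta> * ?a b + 2 * C * (indicator {0..\<delta>} b * ?a b + indicator {x - \<delta>..x + \<delta>} b * ?a b)" by linarith
        show "\<bar>indicator {0..x + L} b * (?p b * response b)\<bar> \<le>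
          2 * \<eta> * ?a b + 2 * C * (indicator {0..\<delta>} b * ?a b + indicator {x - \<delta>..x + \<delta>} b * ?a b)"
        proof (cases "b \<in> {0..x + L}")
          case True
          then have a: "?a b = \<bar>response b\<bar>" using x by simp
          show ?thesis
          proof (cases "\<delta> \<le> b \<and> \<delta> \<le> \<bar>x - b\<bar>")
            case far: True
            have "\<bar>?p b\<bar> * \<bar>response b\<bar> \<le> 2 * \<eta> * \<bar>response b\<bar>"
              using pfar[of b] far by (intro mult_right_mono) auto
            moreover have "\<bar>indicator {0..x + L} b * (?p b * response b)\<bar> = \<bar>?p b\<bar> * \<bar>response b\<bar>"
              using True by (simp only: indicator_simps abs_mult mult_1_left abs_one)
            ultimately show ?thesis using nn(2) unfolding a by linarith
          next
            case False
            then have "b \<in> {0..\<delta>} \<or> b \<in> {x - \<delta>..x + \<delta>}" using True by (auto simp: abs_if split: if_splits)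
            then have "1 \<le> indicator {0..\<delta>} b + (indicator {x - \<delta>..x + \<delta>} b :: real)" by (auto simp: indicator_def)
            then have "2 * C * \<bar>response b\<bar> * 1 \<le> 2 * C * \<bar>response b\<bar> * (indicator {0..\<delta>} b + indicator {x - \<delta>..x + \<delta>} b)"
              using C by (intro mult_left_mono) auto
            moreover have "\<bar>?p b\<bar> * \<bar>response b\<bar> \<le> 2 * C * \<bar>response b\<bar>"
              using pall[of b] True by (intro mult_right_mono) auto
            moreover have "\<bar>indicator {0..x + L} b * (?p b * response b)\<bar> = \<bar>?p b\<bar> * \<bar>response b\<bar>"
              using True by (simp only: indicator_simps abs_mult mult_1_left abs_one)
            moreover have "2 * C * \<bar>response b\<bar> * (indicator {0..\<delta>} b + indicator {x - \<delta>..x + \<delta>} b) =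
              2 * C * (indicator {0..\<delta>} b * ?a b + indicator {x - \<delta>..x + \<delta>} b * ?a b)"
              unfolding a by (simp only: algebra_simps)
            ultimately show ?thesis using nn(1) by linarith
          qed
        next
          case False
          then have "indicator {0..x + L} b * (?p b * response b) = 0" by simp
          then show ?thesis using nn by (simp only: abs_zero)
        qed
      qed
      also have "\<dots> = 2 * \<eta> * (\<integral>b. ?a b \<partial>lborel) + 2 * C * ((\<integral>b. indicator {0..\<delta>} b * ?a b \<partial>lborel) + (\<integral>b. indicator {x - \<delta>..x + \<delta>} b * ?a b \<partial>lborel))"
        unfolding Bochner_Integration.integral_add[OF integrable_mult_right[OF ai] integrable_mult_right[OF Bochner_Integration.integrable_add[OF aj aj]]]
          integral_mult_right_zero Bochner_Integration.integral_add[OF aj aj] ..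
      \<comment> \<open>The far part gives e/2, each of the two short intervals e/4.\<close>
      also have "\<dots> \<le> e / 2 + 2 * C * (e / (8 * C) + e / (8 * C))"
      proof (intro add_mono mult_left_mono d(2))
        show "2 * \<eta> * (\<integral>b. ?a b \<partial>lborel) \<le> e / 2" using \<eta>(2) by (simp add: response_mass_def abs_mult)
        show "\<bar>\<delta> - 0\<bar> \<le> d" "\<bar>x + \<delta> - (x - \<delta>)\<bar> \<le> d" using d(1) by (auto simp: \<delta>_def)
      qed (use C in auto)
      also have "\<dots> = e" using C by simp
      finally show "\<bar>(\<integral>b. indicator {0..x + L} b * (profile x b * response b) \<partial>lborel)
        - (1/2) * (\<integral>b. indicator {0..x} b * response b \<partial>lborel)\<bar> \<le> e" unfolding eq .
    qed
  qed
qed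

text \<open>The subtracted term is the boundary term of the Dirichlet kernel without its window; by
  \<open>integral_free_energy\<close> it equals the corresponding integral for the free
  operator.\<close>

theorem sharp_cutoff_asymptotics:
  assumes R: "0 \<le> R" and e: "0 < e"
  shows "eventually (\<lambda>N. \<forall>x\<in>{0..R}. \<bar>(\<integral>\<mu>. indicator {..N\<^sup>2} \<mu> * energy x \<mu> \<partial>M) - N / pi * (1 - sinc (N * x))
    - (1/2) * (\<integral>b. indicator {0..x} b * response b \<partial>lborel)\<bar> \<le> e) at_top"
proof -
  \<comment> \<open>Keeps the two errors that do not decrease with N, 24 pi^2/L from the Fejer
    kernels and R/L^2 from the window, below e/4 together. L > R keeps x inside the window.\<close>
  define L where "L = max (R + 1) ((24 * pi\<^sup>2 + R) * 4 / e)"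
  have L: "1 \<le> L" "R < L" "0 < L" using R unfolding L_def by auto
  have Le: "3 * pi\<^sup>2 * (8 / L) + R / L\<^sup>2 \<le> e / 4"
  proof -
    have "(24 * pi\<^sup>2 + R) * 4 / e \<le> L" unfolding L_def by simp
    then have "(24 * pi\<^sup>2 + R) * 4 \<le> L * e" using e by (simp add: pos_divide_le_eq)
    then have *: "(24 * pi\<^sup>2 + R) / L \<le> e / 4" using L by (simp add: pos_divide_le_eq mult.commute)
    have "R / L\<^sup>2 \<le> R / L" using L R by (intro divide_left_mono) (auto simp: power2_eq_square)
    moreover have "3 * pi\<^sup>2 * (8 / L) = 24 * pi\<^sup>2 / L" by simp
    ultimately show ?thesis using * unfolding add_divide_distrib by linarith
  qed
  have e4: "0 < e / 4" using e by simp
  define w where "w = neg_weight R L"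
  define m where "m = 2 * response_mass (R + L) + 2 * (1 + L) * neg_weight R L"
  have "((\<lambda>N. 2 * dirichlet_rate L N * w + 3 * pi\<^sup>2 * ((fejer_rate L N + fejer_rate L (N + pi / L)) * m)) \<longlongrightarrow>
    2 * 0 * w + 3 * pi\<^sup>2 * ((0 + 0) * m)) at_top"
    by (intro tendsto_intros dirichlet_rate_tendsto fejer_rate_tendsto L)
  then have ev: "eventually (\<lambda>N. 2 * dirichlet_rate L N * w + 3 * pi\<^sup>2 * ((fejer_rate L N + fejer_rate L (N + pi / L)) * m) < e / 4) at_top"
    using e by (intro order_tendstoD(2)) auto
  show ?thesis
    using ev profile_response_eventually[OF L(3) R e4] eventually_gt_at_top[of 0]
  proof eventually_elim
    case (elim N)
    have "\<forall>x\<in>{0..R}. \<bar>(\<integral>b. indicator {0..x + L} b * (cutoff.profile (antiderivative (dirichlet_kernel N L)) x b * response b) \<partial>lborel)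
      - (1/2) * (\<integral>b. indicator {0..x} b * response b \<partial>lborel)\<bar> \<le> e / 4"
      using elim(2) e by simp
    show ?case
    proof
      fix x assume "x \<in> {0..R}"
      then have x: "0 \<le> x" "x \<le> R" by auto
      let ?S = "\<integral>\<mu>. indicator {..N\<^sup>2} \<mu> * energy x \<mu> \<partial>M"
      let ?D = "\<integral>\<mu>. energy x \<mu> * cut (dirichlet_kernel N L) \<mu> \<partial>M"
      let ?P = "\<integral>b. indicator {0..x + L} b * (cutoff.profile (antiderivative (dirichlet_kernel N L)) x b * response b) \<partial>lborel"
      let ?H = "(1/2) * (\<integral>b. indicator {0..x} b * response b \<partial>lborel)"
      have 1: "\<bar>?S - ?D\<bar> \<le> e / 4 + 3 * pi\<^sup>2 * (8 / L)"
      proof -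
        have "\<bar>?S - ?D\<bar> \<le> 2 * dirichlet_rate L N * w + 3 * pi\<^sup>2 * (8 / L + (fejer_rate L N + fejer_rate L (N + pi / L)) * m)"
          unfolding w_def m_def by (rule sharp_smooth_bound[OF L(3) x elim(3)])
        also have "\<dots> = 3 * pi\<^sup>2 * (8 / L) + (2 * dirichlet_rate L N * w + 3 * pi\<^sup>2 * ((fejer_rate L N + fejer_rate L (N + pi / L)) * m))"
          by (simp only: distrib_left add_ac)
        finally show ?thesis using elim(1) by linarith
      qed
      have 2: "?D = dirichlet_kernel N L 0 - dirichlet_kernel N L x + ?P"
        by (rule integral_energy_cut(1)[OF L(3) x(1) elim(3)])
      \<comment> \<open>Removing the window from the boundary term costs sin(N x) x / (pi L^2): the
        factor N cancels against the one in sinc.\<close>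
      have 3: "\<bar>(dirichlet_kernel N L 0 - dirichlet_kernel N L x) - N / pi * (1 - sinc (N * x))\<bar> \<le> R / L\<^sup>2"
      proof -
        have "(x / L)\<^sup>2 \<le> 1" using x L by (intro power_le_one) auto
        then have "dirichlet_kernel N L x = N / pi * sinc (N * x) * (1 - (x / L)\<^sup>2)" by (simp add: dirichlet_kernel_def)
        moreover have "dirichlet_kernel N L 0 = N / pi" by (simp add: dirichlet_kernel_def)
        moreover have "a - a * s * (1 - t) - a * (1 - s) = a * s * t" for a s t :: real by (simp add: algebra_simps)
        ultimately have "(dirichlet_kernel N L 0 - dirichlet_kernel N L x) - N / pi * (1 - sinc (N * x)) = N / pi * sinc (N * x) * (x / L)\<^sup>2"
          by (simp only:)
        also have "\<dots> = sin (N * x) * x / L\<^sup>2 / pi" using elim(3) by (simp add: power2_eq_square)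
        finally have eq: "(dirichlet_kernel N L 0 - dirichlet_kernel N L x) - N / pi * (1 - sinc (N * x)) = sin (N * x) * x / L\<^sup>2 / pi" .
        have "\<bar>sin (N * x) * x\<bar> \<le> 1 * R" unfolding abs_mult using x by (intro mult_mono) auto
        then have "\<bar>sin (N * x) * x\<bar> / L\<^sup>2 \<le> R / L\<^sup>2" using divide_right_mono[of "\<bar>sin (N * x) * x\<bar>" R "L\<^sup>2"] by simp
        then have "\<bar>sin (N * x) * x / L\<^sup>2\<bar> / \<bar>pi\<bar> \<le> (R / L\<^sup>2) / 1"
          using R pi_gt3 by (intro frac_le) auto
        then show ?thesis unfolding eq abs_divide by simp
      qed
      have 4: "\<bar>?P - ?H\<bar> \<le> e / 4"
        using elim(2) x e by auto
      show "\<bar>?S - N / pi * (1 - sinc (N * x)) - ?H\<bar> \<le> e"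
        using 1 2 3 4 Le e by linarith
    qed
  qed
qed

end

section \<open>From the hypotheses to the locale\<close>

text \<open>Bridge from the gauge integrals of the definitions to Lebesgue integrals; exceptions on
  a null set are allowed because q agrees with its Borel representative only almost
  everywhere.\<close>

lemma henstock_eq_lebesgue:
  fixes f g :: "real \<Rightarrow> real"
  assumes f: "integrable lborel (\<lambda>x. indicator {a..b} x * f x)"
    and AE: "AE x in lborel. x \<in> {a..b} \<longrightarrow> g x = f x"
  shows "g integrable_on {a..b}" "integral {a..b} g = (\<integral>x. indicator {a..b} x * f x \<partial>lborel)"
proof -
  have "set_integrable lborel {a..b} f" using f by (simp add: set_integrable_def)
  from set_borel_integral_eq_integral[OF this]
  have f': "(f has_integral (\<integral>x. indicator {a..b} x * f x \<partial>lborel)) {a..b}"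
    by (simp add: set_lebesgue_integral_def has_integral_integrable_integral)
  have "(g has_integral (\<integral>x. indicator {a..b} x * f x \<partial>lborel)) {a..b}"
    using has_integral_AE[OF AE] f' by blast
  then show "g integrable_on {a..b}" "integral {a..b} g = (\<integral>x. indicator {a..b} x * f x \<partial>lborel)"
    by (auto simp: has_integral_integrable_integral)
qed

lemma AE_lborel_half_shift:
  assumes "AE x in lborel. P (x::real)"
  shows "AE x in lborel. P ((x - a) / 2)" and "AE x in lborel. P ((a - x) / 2)"
proof -
  obtain N where N: "N \<in> null_sets lborel" "{x. \<not> P x} \<subseteq> N"
    using assms unfolding eventually_ae_filter by auto
  then have [measurable]: "N \<in> sets borel" by auto
  have "AE x in lborel. x \<notin> N" using N(1) by (rule AE_not_in)
  then have *: "AE x in lborel. - a / 2 + (1/2) * x \<notin> N" "AE x in lborel. a / 2 + (- (1/2)) * x \<notin> N"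
    by (intro AE_borel_affine; simp)+
  show "AE x in lborel. P ((x - a) / 2)"
    using *(1) by eventually_elim (use N(2) in \<open>auto simp: diff_divide_distrib\<close>)
  show "AE x in lborel. P ((a - x) / 2)"
    using *(2) by eventually_elim (use N(2) in \<open>auto simp: diff_divide_distrib\<close>)
qed

text \<open>A Borel representative makes the integrands jointly measurable. It is 0 on the negative
  axis so that integrals over any [a, b] reduce to [0, b].\<close>

lemma L1_loc_borel_version:
  assumes q: "L1_loc q"
  obtains q' where "q' \<in> borel_measurable borel" "\<And>x. x < 0 \<Longrightarrow> q' x = 0"
    "\<And>t. integrable lborel (\<lambda>x. indicator {0..t} x * q' x)"
    "AE x in lborel. 0 \<le> x \<longrightarrow> q x = q' x"
proof -
  have qi: "integrable lebesgue (\<lambda>x. indicator {0..t} x * q x)" for t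
  proof (cases "0 < t")
    case True
    then show ?thesis using q by (simp add: L1_loc_def set_integrable_def)
  next
    case False
    have "integrable lebesgue (\<lambda>x. indicator {0..1} x * q x)" using q by (simp add: L1_loc_def set_integrable_def)
    then have "set_integrable lebesgue {0..1} q" by (simp add: set_integrable_def)
    then have "set_integrable lebesgue {0..t} q" by (rule set_integrable_subset) (use False in auto)
    then show ?thesis by (simp add: set_integrable_def)
  qed
  \<comment> \<open>A pointwise limit of the truncations to [0, n], hence measurable although q need
    not be integrable on the half-line.\<close>
  let ?f = "\<lambda>x. indicator {0..} x * q x"
  have "?f \<in> borel_measurable lebesgue"
  proof (rule borel_measurable_LIMSEQ_real)
    show "(\<lambda>x. indicator {0..real n} x * q x) \<in> borel_measurable lebesgue" for n
      using borel_measurable_integrable[OF qi] .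
    fix x
    obtain n0 :: nat where n0: "x \<le> real n0" using real_arch_simple by blast
    have "eventually (\<lambda>n. indicator {0..real n} x * q x = ?f x) sequentially"
      using eventually_ge_at_top[of n0]
    proof eventually_elim
      case (elim n)
      then show ?case using n0 by (auto simp: indicator_def)
    qed
    then show "(\<lambda>n. indicator {0..real n} x * q x) \<longlonglongrightarrow> ?f x" by (rule tendsto_eventually)
  qed
  from completion_ex_borel_measurable_real[OF this]
  obtain g where g: "g \<in> borel_measurable lborel" "AE x in lborel. ?f x = g x" by auto
  define q' where "q' x = indicator {0..} x * g x" for x
  have [measurable]: "g \<in> borel_measurable borel" using g(1) by simp
  have m: "q' \<in> borel_measurable borel" unfolding q'_def by measurable
  note [measurable] = m
  have ae: "AE x in lborel. 0 \<le> x \<longrightarrow> q x = q' x"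
    using g(2) by eventually_elim (auto simp: q'_def indicator_def)
  have "integrable lborel (\<lambda>x. indicator {0..t} x * q' x)" for t
  proof -
    have "integrable lebesgue (\<lambda>x. indicator {0..t} x * q' x)"
    proof (rule integrable_cong_AE_imp[OF qi[of t]])
      show "(\<lambda>x. indicator {0..t} x * q' x) \<in> borel_measurable lebesgue"
        by (rule measurable_completion) measurable
      show "AE x in lebesgue. indicator {0..t} x * q x = indicator {0..t} x * q' x"
        using AE_completion[OF ae] by eventually_elim (auto simp: indicator_def)
    qed
    then show ?thesis by (subst (asm) integrable_completion) auto
  qed
  then show ?thesis using that[of q'] m ae by (auto simp: q'_def)
qed

text \<open>v in the coordinates of \<open>goursat_kernel\<close>; the arguments are clamped at 0
  because the locale asks for continuity on the whole plane.\<close>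

definition quadrant_kernel :: "(real \<Rightarrow> real \<Rightarrow> real) \<Rightarrow> real \<Rightarrow> real \<Rightarrow> real" where
  "quadrant_kernel v \<xi> y = v (max 0 \<xi>) (max 0 \<xi> + 2 * max 0 y)"

text \<open>The inner integral of the Goursat equation is rewritten with \<eta>1 = \<alpha> +
  2\<beta>, whose Jacobian 2 turns the factor 1/4 into 1/2. Replacing q by its representative at the
  arguments (t - \<alpha>)/2 is harmless because affine maps preserve null sets.\<close>

lemma
  assumes gs: "goursat_solution q v"
    and q'm [measurable]: "q' \<in> borel_measurable borel"
    and q'0: "\<And>x. x < 0 \<Longrightarrow> q' x = 0"
    and q'i: "\<And>t. integrable lborel (\<lambda>x. indicator {0..t} x * q' x)"
    and ae: "AE x in lborel. 0 \<le> x \<longrightarrow> q x = q' x"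
  shows goursat_kernel_quadrant: "goursat_kernel q' (quadrant_kernel v)"
    and response_primitive_eq: "0 \<le> z \<Longrightarrow> response_primitive q v z =
      (1/2) * (\<integral>t. indicator {0..z} t * goursat_kernel.response q' (quadrant_kernel v) t \<partial>lborel)"
proof -
  let ?u = "quadrant_kernel v"
  have cont: "continuous_on UNIV (\<lambda>p. ?u (fst p) (snd p))"
  proof -
    have c: "continuous_on {(\<xi>, \<eta>). 0 \<le> \<xi> \<and> \<xi> \<le> \<eta>} (\<lambda>(\<xi>, \<eta>). v \<xi> \<eta>)"
      using gs by (simp add: goursat_solution_def)
    have "continuous_on UNIV (\<lambda>p. (\<lambda>(\<xi>, \<eta>). v \<xi> \<eta>) (max 0 (fst p), max 0 (fst p) + 2 * max 0 (snd p)))"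
      by (rule continuous_on_compose2[OF c]) (auto intro!: continuous_intros)
    then show ?thesis by (simp add: quadrant_kernel_def)
  qed
  have [measurable]: "(\<lambda>x. ?u (f x) (g x)) \<in> borel_measurable M"
    if "f \<in> borel_measurable M" "g \<in> borel_measurable M" for f g and M :: "'z measure"
  proof -
    have "(\<lambda>p. ?u (fst p) (snd p)) \<in> borel_measurable (borel \<Otimes>\<^sub>M borel)"
      using borel_measurable_continuous_onI[OF cont] by (simp add: borel_prod)
    from measurable_compose[OF measurable_Pair[OF that] this] show ?thesis by simp
  qed
  have ubd: "\<exists>C\<ge>0. \<forall>\<alpha>\<in>{0..s}. \<forall>\<beta>\<in>{0..s}. \<bar>?u \<alpha> \<beta>\<bar> \<le> C" for s
  proof -
    have "compact ((\<lambda>p. ?u (fst p) (snd p)) ` ({0..s} \<times> {0..s}))"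
      by (intro compact_continuous_image compact_Times continuous_on_subset[OF cont]) auto
    then obtain C where "\<forall>x\<in>(\<lambda>p. ?u (fst p) (snd p)) ` ({0..s} \<times> {0..s}). norm x \<le> C"
      using compact_imp_bounded bounded_iff by metis
    then have "\<forall>\<alpha>\<in>{0..s}. \<forall>\<beta>\<in>{0..s}. \<bar>?u \<alpha> \<beta>\<bar> \<le> C" by fastforce
    then show ?thesis by (intro exI[of _ "max 0 C"]) (auto intro: max.coboundedI2)
  qed
  have q'ab: "integrable lborel (\<lambda>x. indicator {a..b} x * q' x)" for a b
  proof (rule Bochner_Integration.integrable_bound[OF q'i[of b]])
    show "AE x in lborel. norm (indicator {a..b} x * q' x) \<le> norm (indicator {0..b} x * q' x)"
      using q'0 by (intro AE_I2) (auto simp: indicator_def not_le)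
  qed measurable
  have half: "(\<integral>\<beta>. f \<beta> \<partial>lborel) = (1/2) * (\<integral>t. f ((t - \<alpha>) / 2) \<partial>lborel)" for f :: "real \<Rightarrow> real" and \<alpha>
    using lborel_integral_real_affine[of "1/2" f "- \<alpha> / 2"] by (simp add: diff_divide_distrib)
  have half_int: "integrable lborel (\<lambda>t. f ((t - \<alpha>) / 2))" if "integrable lborel f" for f :: "real \<Rightarrow> real" and \<alpha>
    using lborel_integrable_real_affine[OF that, of "1/2" "- \<alpha> / 2"] by (simp add: diff_divide_distrib)
  have qu_int: "integrable lborel (\<lambda>\<beta>. indicator {a..b} \<beta> * (q' \<beta> * ?u \<alpha> \<beta>))" for a b \<alpha>
  proof -
    have c: "continuous_on UNIV (\<lambda>x. (\<lambda>p. ?u (fst p) (snd p)) (\<alpha>, x))"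
      by (rule continuous_on_compose2[OF cont]) (auto intro!: continuous_intros)
    from compact_Icc_bound[OF continuous_on_subset[OF c subset_UNIV], of a b]
    obtain C where "\<And>x. x \<in> {a..b} \<Longrightarrow> \<bar>?u \<alpha> x\<bar> \<le> C" by auto
    then show ?thesis by (intro integrable_indicator_mult_bounded[OF q'ab]) auto
  qed
  have inner: "integral {\<xi>..\<eta>} (\<lambda>\<eta>1. q ((\<eta>1 - \<alpha>) / 2) * v \<alpha> \<eta>1) =
      2 * (\<integral>\<beta>. indicator {\<xi> - \<alpha>..\<eta> - \<alpha>} (2 * \<beta>) * (q' \<beta> * ?u \<alpha> \<beta>) \<partial>lborel)"
    if \<alpha>: "0 \<le> \<alpha>" "\<alpha> \<le> \<xi>" for \<xi> \<eta> \<alpha>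
  proof -
    let ?g = "\<lambda>\<beta>. indicator {(\<xi> - \<alpha>) / 2..(\<eta> - \<alpha>) / 2} \<beta> * (q' \<beta> * ?u \<alpha> \<beta>)"
    have e: "?g ((t - \<alpha>) / 2) = indicator {\<xi>..\<eta>} t * (q' ((t - \<alpha>) / 2) * ?u \<alpha> ((t - \<alpha>) / 2))" for t
      by (auto simp: indicator_def divide_right_mono)
    have i: "integrable lborel (\<lambda>t. indicator {\<xi>..\<eta>} t * (q' ((t - \<alpha>) / 2) * ?u \<alpha> ((t - \<alpha>) / 2)))"
      using half_int[OF qu_int[of "(\<xi> - \<alpha>) / 2" "(\<eta> - \<alpha>) / 2" \<alpha>], of \<alpha>] unfolding e .
    have "integral {\<xi>..\<eta>} (\<lambda>\<eta>1. q ((\<eta>1 - \<alpha>) / 2) * v \<alpha> \<eta>1) =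
      (\<integral>t. indicator {\<xi>..\<eta>} t * (q' ((t - \<alpha>) / 2) * ?u \<alpha> ((t - \<alpha>) / 2)) \<partial>lborel)"
    proof (rule henstock_eq_lebesgue(2)[OF i])
      show "AE t in lborel. t \<in> {\<xi>..\<eta>} \<longrightarrow> q ((t - \<alpha>) / 2) * v \<alpha> t = q' ((t - \<alpha>) / 2) * ?u \<alpha> ((t - \<alpha>) / 2)"
        using AE_lborel_half_shift(1)[OF ae, of \<alpha>]
      proof eventually_elim
        case (elim t)
        show ?case
        proof
          assume t: "t \<in> {\<xi>..\<eta>}"
          then have "max 0 \<alpha> = \<alpha>" "max 0 ((t - \<alpha>) / 2) = (t - \<alpha>) / 2" "2 * ((t - \<alpha>) / 2) = t - \<alpha>" "\<alpha> + (t - \<alpha>) = t" using \<alpha> by auto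
          then have "?u \<alpha> ((t - \<alpha>) / 2) = v \<alpha> t" unfolding quadrant_kernel_def by (simp only:)
          then show "q ((t - \<alpha>) / 2) * v \<alpha> t = q' ((t - \<alpha>) / 2) * ?u \<alpha> ((t - \<alpha>) / 2)" using elim t \<alpha> by simp
        qed
      qed
    qed
    also have "\<dots> = 2 * (\<integral>\<beta>. ?g \<beta> \<partial>lborel)" unfolding half[of ?g \<alpha>] e by simp
    also have "(\<integral>\<beta>. ?g \<beta> \<partial>lborel) = (\<integral>\<beta>. indicator {\<xi> - \<alpha>..\<eta> - \<alpha>} (2 * \<beta>) * (q' \<beta> * ?u \<alpha> \<beta>) \<partial>lborel)"
      by (intro Bochner_Integration.integral_cong) (auto simp: indicator_def)
    finally show ?thesis .
  qed
  show gk: "goursat_kernel q' ?u"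
  proof
    fix \<xi> y :: real assume \<xi>: "0 \<le> \<xi>" and y: "0 \<le> y"
    let ?\<eta> = "\<xi> + 2 * y"
    let ?P = "\<lambda>\<alpha>. \<integral>\<beta>. indicator {\<xi> - \<alpha>..\<xi> - \<alpha> + 2 * y} (2 * \<beta>) * (q' \<beta> * ?u \<alpha> \<beta>) \<partial>lborel"
    have "?u \<xi> y = v \<xi> ?\<eta>" using \<xi> y by (simp add: quadrant_kernel_def)
    also have "\<dots> = - (1/2) * integral {\<xi>/2..?\<eta>/2} q
         - (1/4) * integral {0..\<xi>} (\<lambda>\<xi>1. integral {\<xi>..?\<eta>} (\<lambda>\<eta>1. q ((\<eta>1 - \<xi>1) / 2) * v \<xi>1 \<eta>1))"
      using gs \<xi> y unfolding goursat_solution_def by (elim conjE allE[of _ \<xi>] allE[of _ ?\<eta>]) simp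
    also have "integral {\<xi>/2..?\<eta>/2} q = (\<integral>\<beta>. indicator {\<xi>..?\<eta>} (2 * \<beta>) * q' \<beta> \<partial>lborel)"
    proof -
      have "integral {\<xi>/2..?\<eta>/2} q = (\<integral>\<beta>. indicator {\<xi>/2..?\<eta>/2} \<beta> * q' \<beta> \<partial>lborel)"
      proof (rule henstock_eq_lebesgue(2)[OF q'ab])
        show "AE x in lborel. x \<in> {\<xi>/2..?\<eta>/2} \<longrightarrow> q x = q' x"
          using ae by eventually_elim (use \<xi> in auto)
      qed
      also have "\<dots> = (\<integral>\<beta>. indicator {\<xi>..?\<eta>} (2 * \<beta>) * q' \<beta> \<partial>lborel)"
        by (intro Bochner_Integration.integral_cong) (auto simp: indicator_def)
      finally show ?thesis .
    qed
    also have "integral {0..\<xi>} (\<lambda>\<xi>1. integral {\<xi>..?\<eta>} (\<lambda>\<eta>1. q ((\<eta>1 - \<xi>1) / 2) * v \<xi>1 \<eta>1)) =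
      (\<integral>\<alpha>. indicator {0..\<xi>} \<alpha> * (2 * ?P \<alpha>) \<partial>lborel)"
    proof (rule henstock_eq_lebesgue(2))
      obtain C where C: "0 \<le> C" "\<And>\<alpha> \<beta>. \<alpha> \<in> {0..?\<eta>} \<Longrightarrow> \<beta> \<in> {0..?\<eta>} \<Longrightarrow> \<bar>?u \<alpha> \<beta>\<bar> \<le> C" using ubd[of ?\<eta>] by blast
      show "integrable lborel (\<lambda>\<alpha>. indicator {0..\<xi>} \<alpha> * (2 * ?P \<alpha>))"
      proof (rule integrable_indicator_bounded)
        show "\<bar>2 * ?P \<alpha>\<bar> \<le> 2 * (\<integral>\<beta>. \<bar>indicator {0..?\<eta>} \<beta> * q' \<beta>\<bar> * C \<partial>lborel)" if \<alpha>: "\<alpha> \<in> {0..\<xi>}" for \<alpha>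
        proof -
          have "\<bar>?P \<alpha>\<bar> \<le> (\<integral>\<beta>. \<bar>indicator {0..?\<eta>} \<beta> * q' \<beta>\<bar> * C \<partial>lborel)"
          proof (rule order_trans[OF integral_abs_bound], rule integral_mono')
            show "integrable lborel (\<lambda>\<beta>. \<bar>indicator {0..?\<eta>} \<beta> * q' \<beta>\<bar> * C)"
              by (intro integrable_mult_left integrable_abs q'i)
            show "\<bar>indicator {\<xi> - \<alpha>..\<xi> - \<alpha> + 2 * y} (2 * \<beta>) * (q' \<beta> * ?u \<alpha> \<beta>)\<bar> \<le> \<bar>indicator {0..?\<eta>} \<beta> * q' \<beta>\<bar> * C" for \<beta>
              using \<alpha> y C by (auto simp: indicator_def abs_mult intro!: mult_left_mono)
          qed (use C in simp)
          then show ?thesis by (simp add: abs_mult)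
        qed
      qed measurable
      show "AE \<alpha> in lborel. \<alpha> \<in> {0..\<xi>} \<longrightarrow> integral {\<xi>..?\<eta>} (\<lambda>\<eta>1. q ((\<eta>1 - \<alpha>) / 2) * v \<alpha> \<eta>1) = 2 * ?P \<alpha>"
      proof (intro AE_I2 impI)
        fix \<alpha> assume \<alpha>: "\<alpha> \<in> {0..\<xi>}"
        have "?\<eta> - \<alpha> = \<xi> - \<alpha> + 2 * y" by simp
        with inner[of \<alpha> \<xi> ?\<eta>] \<alpha> show "integral {\<xi>..?\<eta>} (\<lambda>\<eta>1. q ((\<eta>1 - \<alpha>) / 2) * v \<alpha> \<eta>1) = 2 * ?P \<alpha>" by simp
      qed
    qed
    also have "(\<integral>\<alpha>. indicator {0..\<xi>} \<alpha> * (2 * ?P \<alpha>) \<partial>lborel) = 2 * (\<integral>\<alpha>. indicator {0..\<xi>} \<alpha> * ?P \<alpha> \<partial>lborel)"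
      unfolding mult.left_commute[of _ 2] by simp
    finally show "?u \<xi> y = - (1/2) * (\<integral>\<beta>. indicator {\<xi>..\<xi> + 2 * y} (2 * \<beta>) * q' \<beta> \<partial>lborel)
      - (1/2) * (\<integral>\<alpha>. indicator {0..\<xi>} \<alpha> * ?P \<alpha> \<partial>lborel)" by simp
  qed (use q'i cont in auto)
  interpret goursat_kernel q' ?u by (rule gk)
  assume z: "0 \<le> z"
  have resp: "AE t in lborel. t \<in> {0..z} \<longrightarrow> response_function q v t = response t"
    using AE_lborel_half_shift(1)[OF ae, of 0]
  proof eventually_elim
    case (elim t)
    show ?case
    proof
      assume t: "t \<in> {0..z}"
      have "integral {0..t} (\<lambda>\<zeta>. q ((t - \<zeta>) / 2) * v \<zeta> t) =
        (\<integral>\<zeta>. indicator {0..t} \<zeta> * (q' ((t - \<zeta>) / 2) * ?u \<zeta> ((t - \<zeta>) / 2)) \<partial>lborel)"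
      proof (rule henstock_eq_lebesgue(2))
        obtain C where C: "0 \<le> C" "\<And>\<alpha> \<beta>. \<alpha> \<in> {0..t} \<Longrightarrow> \<beta> \<in> {0..t} \<Longrightarrow> \<bar>?u \<alpha> \<beta>\<bar> \<le> C" using ubd[of t] by blast
        have e: "t / 2 + - (1/2) * \<zeta> = (t - \<zeta>) / 2" for \<zeta> by (simp add: diff_divide_distrib)
        have "integrable lborel (\<lambda>\<zeta>. indicator {0..t} ((t - \<zeta>) / 2) * q' ((t - \<zeta>) / 2))"
          using lborel_integrable_real_affine[OF q'i[of t], of "- (1/2)" "t/2"] unfolding e by simp
        also have "(\<lambda>\<zeta>. indicator {0..t} ((t - \<zeta>) / 2) * q' ((t - \<zeta>) / 2)) = (\<lambda>\<zeta>. indicator {-t..t} \<zeta> * q' ((t - \<zeta>) / 2))"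
          by (auto simp: fun_eq_iff indicator_def)
        finally have "integrable lborel (\<lambda>\<zeta>. indicator {0..t} \<zeta> * q' ((t - \<zeta>) / 2))"
          by (rule integrable_indicator_subset) (use t in auto)
        then show "integrable lborel (\<lambda>\<zeta>. indicator {0..t} \<zeta> * (q' ((t - \<zeta>) / 2) * ?u \<zeta> ((t - \<zeta>) / 2)))"
          by (rule integrable_indicator_mult_bounded[where C=C]) (use C in auto)
        show "AE \<zeta> in lborel. \<zeta> \<in> {0..t} \<longrightarrow> q ((t - \<zeta>) / 2) * v \<zeta> t = q' ((t - \<zeta>) / 2) * ?u \<zeta> ((t - \<zeta>) / 2)"
          using AE_lborel_half_shift(2)[OF ae, of t]
        proof eventually_elim
          case (elim \<zeta>)
          show ?case
          proof
            assume \<zeta>: "\<zeta> \<in> {0..t}"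
            then have "max 0 \<zeta> = \<zeta>" "max 0 ((t - \<zeta>) / 2) = (t - \<zeta>) / 2" "2 * ((t - \<zeta>) / 2) = t - \<zeta>" "\<zeta> + (t - \<zeta>) = t" by auto
            then have "?u \<zeta> ((t - \<zeta>) / 2) = v \<zeta> t" unfolding quadrant_kernel_def by (simp only:)
            then show "q ((t - \<zeta>) / 2) * v \<zeta> t = q' ((t - \<zeta>) / 2) * ?u \<zeta> ((t - \<zeta>) / 2)" using elim \<zeta> by simp
          qed
        qed
      qed
      moreover have "q (t / 2) = q' (t / 2)" using elim t by simp
      ultimately show "response_function q v t = response t" by (simp add: response_function_def response_def)
    qed
  qed
  have "response_primitive q v z = (1/2) * integral {0..z} (response_function q v)"
    using z by (simp add: response_primitive_def)
  also have "integral {0..z} (response_function q v) = (\<integral>t. indicator {0..z} t * response t \<partial>lborel)"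
    by (rule henstock_eq_lebesgue(2)[OF response_integrable resp])
  finally show "response_primitive q v z = (1/2) * (\<integral>t. indicator {0..z} t * response t \<partial>lborel)" .
qed

text \<open>At 0 the difference quotient of the odd extension is even, so the one-sided derivative
  becomes two-sided.\<close>

lemma DERIV_odd_extension:
  fixes f f' :: "real \<Rightarrow> real"
  assumes d: "\<And>x. 0 \<le> x \<Longrightarrow> (f has_real_derivative f' x) (at x within {0..})" and f0: "f 0 = 0"
  shows "((\<lambda>z. if 0 \<le> z then f z else - f (- z)) has_real_derivative f' \<bar>z\<bar>) (at z)"
proof -
  let ?F = "\<lambda>z. if 0 \<le> z then f z else - f (- z)"
  have pos: "(f has_real_derivative f' x) (at x)" if "0 < x" for x
    using d[of x] that at_within_interior[of x "{0..}"] by (simp add: interior_real_atLeast)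
  consider "0 < z" | "z < 0" | "z = 0" by linarith
  then show ?thesis
  proof cases
    case 1
    have "(?F has_real_derivative f' z) (at z)"
    proof (rule has_field_derivative_transform_within_open[OF pos[OF 1], of "{0<..}"])
      show "f x = ?F x" if "x \<in> {0<..}" for x using that by simp
    qed (use 1 in auto)
    then show ?thesis using 1 by simp
  next
    case 2
    have "((\<lambda>z. - f (- z)) has_real_derivative - (f' (- z) * (- 1))) (at z)"
      by (rule DERIV_minus[OF DERIV_chain2[OF pos]]) (use 2 in \<open>auto intro!: derivative_eq_intros\<close>)
    then have n: "((\<lambda>z. - f (- z)) has_real_derivative f' (- z)) (at z)" by simp
    have "(?F has_real_derivative f' (- z)) (at z)"
    proof (rule has_field_derivative_transform_within_open[OF n, of "{..<0}"])
      show "- f (- x) = ?F x" if "x \<in> {..<0}" for x using that by simp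
    qed (use 2 in auto)
    then show ?thesis using 2 by simp
  next
    case 3
    have "((\<lambda>x. (f x - f 0) / (x - 0)) \<longlongrightarrow> f' 0) (at_right 0)"
      using d[of 0] by (simp add: has_field_derivative_iff at_within_Ici_at_right)
    then have r: "((\<lambda>x. f x / x) \<longlongrightarrow> f' 0) (at_right 0)" using f0 by simp
    have "((\<lambda>x. ?F x / x) \<longlongrightarrow> f' 0) (at_right 0)"
      by (rule Lim_transform_eventually[OF r]) (auto simp: eventually_at_right_field intro!: exI[of _ 1])
    moreover have "((\<lambda>x. ?F x / x) \<longlongrightarrow> f' 0) (at_left 0)"
    proof -
      have "((\<lambda>x. ?F (- x) / (- x)) \<longlongrightarrow> f' 0) (at_right 0)"
        by (rule Lim_transform_eventually[OF r]) (auto simp: eventually_at_right_field intro!: exI[of _ 1])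
      then show ?thesis by (simp add: filterlim_at_left_to_right)
    qed
    ultimately have "((\<lambda>x. (?F x - ?F 0) / (x - 0)) \<longlongrightarrow> f' 0) (at 0)"
      using f0 by (simp add: filterlim_at_split)
    then show ?thesis using 3 by (simp add: has_field_derivative_iff)
  qed
qed

text \<open>Gives the continuity of \<phi>'(|z|), since \<phi>' is an indefinite integral.\<close>

lemma continuous_integral_abs:
  fixes h :: "real \<Rightarrow> real"
  assumes "\<And>b. h integrable_on {0..b}"
  shows "continuous_on UNIV (\<lambda>z. integral {0..\<bar>z\<bar>} h)"
proof -
  have "isCont (\<lambda>z. integral {0..\<bar>z\<bar>} h) z" for z
  proof -
    let ?b = "\<bar>z\<bar> + 1"
    have "continuous_on {- ?b<..<?b} (\<lambda>z. integral {0..\<bar>z\<bar>} h)"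
      by (rule continuous_on_compose2[OF indefinite_integral_continuous_1[OF assms[of ?b]]])
        (auto intro!: continuous_intros)
    moreover have "z \<in> {- ?b<..<?b}" by auto
    ultimately show ?thesis using continuous_on_eq_continuous_at[OF open_greaterThanLessThan] by blast
  qed
  then show ?thesis by (simp add: continuous_on_eq_continuous_at)
qed

text \<open>For a bounded function on [0, A] the integrals over [0, a] are the same for all a \<ge>
  A, so their mean-square limit agrees almost everywhere with the plain integral H. Hence H is
  itself a transform, and the Parseval identity of \<open>spectral_function\<close> applies to
  it.\<close>

lemma spectral_data_intro:
  assumes gk: "goursat_kernel q' u"
    and q'm [measurable]: "q' \<in> borel_measurable borel"
    and q'i: "\<And>t. integrable lborel (\<lambda>x. indicator {0..t} x * q' x)"
    and ae: "AE x in lborel. 0 \<le> x \<longrightarrow> q x = q' x"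
    and sol: "dirichlet_solution q \<phi>" and spec: "spectral_function \<phi> \<rho>"
  shows "spectral_data q' u (\<lambda>x \<mu>. if 0 \<le> x then \<phi> x \<mu> else - \<phi> (- x) \<mu>) (interval_measure \<rho>)"
proof -
  let ?\<Phi> = "\<lambda>x \<mu>. if 0 \<le> x then \<phi> x \<mu> else - \<phi> (- x) \<mu>"
  let ?M = "interval_measure \<rho>"
  interpret goursat_kernel q' u by (rule gk)
  have sol': "\<exists>d. (\<forall>z. ((\<lambda>x. ?\<Phi> x \<mu>) has_real_derivative d z) (at z)) \<and> continuous_on UNIV d \<and>
    (\<forall>z. d (- z) = d z) \<and> d 0 = 1 \<and> (\<forall>z\<ge>0. d z = d 0 + primitive (\<lambda>x. (q' x - \<mu>) * ?\<Phi> x \<mu>) z)" for \<mu>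
  proof -
    obtain \<phi>' where \<phi>': "\<phi>' 0 = 1" "\<And>x. 0 \<le> x \<Longrightarrow> ((\<lambda>x. \<phi> x \<mu>) has_real_derivative \<phi>' x) (at x within {0..})"
      "\<And>x. 0 \<le> x \<Longrightarrow> \<phi>' x = \<phi>' 0 + integral {0..x} (\<lambda>y. (q y - \<mu>) * \<phi> y \<mu>)"
      and \<phi>0: "\<phi> 0 \<mu> = 0"
      using sol unfolding dirichlet_solution_def by metis
    have d: "((\<lambda>x. ?\<Phi> x \<mu>) has_real_derivative \<phi>' \<bar>z\<bar>) (at z)" for z
      by (rule DERIV_odd_extension[OF \<phi>'(2) \<phi>0])
    have c: "continuous_on UNIV (\<lambda>x. ?\<Phi> x \<mu>)" using d by (meson DERIV_isCont continuous_at_imp_continuous_on)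
    note [measurable] = borel_measurable_continuous_onI[OF c]
    have i: "integrable lborel (\<lambda>x. indicator {0..b} x * ((q' x - \<mu>) * ?\<Phi> x \<mu>))" for b
    proof -
      obtain C where "\<And>x. x \<in> {0..b} \<Longrightarrow> \<bar>?\<Phi> x \<mu>\<bar> \<le> C"
        using compact_Icc_bound[OF continuous_on_subset[OF c subset_UNIV]] by blast
      moreover have "integrable lborel (\<lambda>x. indicator {0..b} x * (q' x - \<mu>))"
        using Bochner_Integration.integrable_diff[OF q'i[of b] integrable_indicator_interval[of 0 b \<mu>]]
        by (simp add: right_diff_distrib)
      ultimately show ?thesis by (intro integrable_indicator_mult_bounded) auto
    qed
    have ae': "AE x in lborel. x \<in> {0..b} \<longrightarrow> (q x - \<mu>) * \<phi> x \<mu> = (q' x - \<mu>) * ?\<Phi> x \<mu>" for b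
      using ae by eventually_elim auto
    note hk = henstock_eq_lebesgue[OF i ae']
    have d_eq: "\<phi>' \<bar>z\<bar> = 1 + integral {0..\<bar>z\<bar>} (\<lambda>y. (q y - \<mu>) * \<phi> y \<mu>)" for z
      using \<phi>'(3)[of "\<bar>z\<bar>"] \<phi>'(1) by simp
    have "continuous_on UNIV (\<lambda>z. \<phi>' \<bar>z\<bar>)"
      unfolding d_eq by (intro continuous_intros continuous_integral_abs hk(1))
    moreover have "\<phi>' \<bar>z\<bar> = \<phi>' \<bar>0\<bar> + primitive (\<lambda>x. (q' x - \<mu>) * ?\<Phi> x \<mu>) z" if "0 \<le> z" for z
      using d_eq[of z] hk(2)[of z] that \<phi>'(1) by (simp add: primitive_def)
    ultimately show ?thesis using d \<phi>'(1) by (intro exI[of _ "\<lambda>z. \<phi>' \<bar>z\<bar>"]) auto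
  qed
  have cont: "continuous_on UNIV (\<lambda>x. ?\<Phi> x \<mu>)" for \<mu>
    using sol'[of \<mu>] by (meson DERIV_isCont continuous_at_imp_continuous_on)
  show ?thesis
  proof
    show "sets ?M = sets borel" by simp
    show "continuous_on UNIV (\<lambda>x. ?\<Phi> x \<mu>)" for \<mu> by (rule cont)
    show "sin_sqrt s \<mu> = ?\<Phi> s \<mu> + transmute (\<lambda>x. ?\<Phi> x \<mu>) s" if s: "0 \<le> s" for s \<mu>
    proof -
      obtain d where d: "\<And>z. ((\<lambda>x. ?\<Phi> x \<mu>) has_real_derivative d z) (at z)" "continuous_on UNIV d"
        "\<And>z. d (- z) = d z" "d 0 = 1" "\<And>z. 0 \<le> z \<Longrightarrow> d z = d 0 + primitive (\<lambda>x. (q' x - \<mu>) * ?\<Phi> x \<mu>) z"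
        using sol'[of \<mu>] by blast
      have "\<phi> 0 \<mu> = 0" using sol by (simp add: dirichlet_solution_def)
      then show ?thesis
        by (intro sin_sqrt_eq_transmute[OF d(1,2) _ d(3,4,5) s]) auto
    qed
    fix A C :: real and f g F G :: "real \<Rightarrow> real"
    assume A: "0 < A" and fm [measurable]: "f \<in> borel_measurable borel" and gm [measurable]: "g \<in> borel_measurable borel"
      and fC: "\<And>x. \<bar>f x\<bar> \<le> C" and gC: "\<And>x. \<bar>g x\<bar> \<le> C"
      and Fm: "F \<in> borel_measurable borel" and Gm: "G \<in> borel_measurable borel"
      and F: "\<And>\<mu>. F \<mu> = (\<integral>x. indicator {0..A} x * (f x * ?\<Phi> x \<mu>) \<partial>lborel)"
      and G: "\<And>\<mu>. G \<mu> = (\<integral>x. indicator {0..A} x * (g x * ?\<Phi> x \<mu>) \<partial>lborel)"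
    have L2: "(\<lambda>x. indicator {0..A} x * k x) \<in> L2_half_line"
      if [measurable]: "k \<in> borel_measurable borel" and k: "\<And>x. \<bar>k x\<bar> \<le> C" for k
    proof -
      have m: "(\<lambda>x. indicator {0..A} x * k x) \<in> borel_measurable lebesgue"
        by (rule measurable_completion) measurable
      have "integrable lborel (\<lambda>x. indicator {0..A} x * (k x)\<^sup>2)"
      proof (rule integrable_indicator_bounded)
        show "\<bar>(k x)\<^sup>2\<bar> \<le> C\<^sup>2" for x using k[of x] by (simp add: abs_le_square_iff[symmetric])
      qed measurable
      then have "integrable lebesgue (\<lambda>x. indicator {0..A} x * (k x)\<^sup>2)"
        by (subst integrable_completion) auto
      also have "(\<lambda>x. indicator {0..A} x * (k x)\<^sup>2) = (\<lambda>x. indicator {0..} x *\<^sub>R (indicator {0..A} x * k x)\<^sup>2)"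
        by (auto simp: fun_eq_iff indicator_def)
      finally have "integrable (lebesgue_on {0..}) (\<lambda>x. (indicator {0..A} x * k x)\<^sup>2)"
        by (subst integrable_restrict_space) auto
      then show ?thesis unfolding L2_half_line_def using measurable_restrict_space1[OF m] by simp
    qed
    have trans: "has_transform \<phi> ?M (\<lambda>x. indicator {0..A} x * k x) H"
      if km [measurable]: "k \<in> borel_measurable borel" and k: "\<And>x. \<bar>k x\<bar> \<le> C" and Hm [measurable]: "H \<in> borel_measurable borel"
        and H: "\<And>\<mu>. H \<mu> = (\<integral>x. indicator {0..A} x * (k x * ?\<Phi> x \<mu>) \<partial>lborel)" for k H
    proof -
      let ?k = "\<lambda>x. indicator {0..A} x * k x"
      have int_eq: "integral {0..a} (\<lambda>x. ?k x * \<phi> x \<mu>) = H \<mu>" if a: "A \<le> a" for a \<mu>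
      proof -
        obtain D where D: "\<And>x. x \<in> {0..A} \<Longrightarrow> \<bar>?\<Phi> x \<mu>\<bar> \<le> D"
          using compact_Icc_bound[OF continuous_on_subset[OF cont subset_UNIV]] by blast
        note [measurable] = borel_measurable_continuous_onI[OF cont]
        have "integrable lborel (\<lambda>x. indicator {0..A} x * (k x * ?\<Phi> x \<mu>))"
        proof (rule integrable_indicator_mult_bounded[OF integrable_indicator_bounded[OF km k] _ D])
        qed auto
        also have "(\<lambda>x. indicator {0..A} x * (k x * ?\<Phi> x \<mu>)) = (\<lambda>x. indicator {0..a} x * (?k x * ?\<Phi> x \<mu>))"
          using a by (auto simp: fun_eq_iff indicator_def)
        finally have i: "integrable lborel (\<lambda>x. indicator {0..a} x * (?k x * ?\<Phi> x \<mu>))" .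
        have "integral {0..a} (\<lambda>x. ?k x * \<phi> x \<mu>) = (\<integral>x. indicator {0..a} x * (?k x * ?\<Phi> x \<mu>) \<partial>lborel)"
          by (rule henstock_eq_lebesgue(2)[OF i]) auto
        also have "\<dots> = H \<mu>"
          unfolding H using a by (intro Bochner_Integration.integral_cong) (auto simp: indicator_def)
        finally show ?thesis .
      qed
      \<comment> \<open>The existence of some transform h is what makes H square integrable.\<close>
      obtain h where h: "has_transform \<phi> ?M ?k h"
        using spec L2[OF km k] unfolding spectral_function_def by blast
      then have hm: "h \<in> borel_measurable ?M" by (simp add: has_transform_def)
      note [measurable] = hm
      have "((\<lambda>a. \<integral>\<^sup>+\<mu>. ennreal ((integral {0..a} (\<lambda>x. ?k x * \<phi> x \<mu>) - h \<mu>)\<^sup>2) \<partial>?M) \<longlongrightarrow> 0) at_top"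
        using h by (simp add: has_transform_def)
      moreover have "eventually (\<lambda>a. (\<integral>\<^sup>+\<mu>. ennreal ((integral {0..a} (\<lambda>x. ?k x * \<phi> x \<mu>) - h \<mu>)\<^sup>2) \<partial>?M) =
        (\<integral>\<^sup>+\<mu>. ennreal ((H \<mu> - h \<mu>)\<^sup>2) \<partial>?M)) at_top"
        using eventually_ge_at_top[of A] by eventually_elim (simp add: int_eq)
      ultimately have "((\<lambda>a::real. \<integral>\<^sup>+\<mu>. ennreal ((H \<mu> - h \<mu>)\<^sup>2) \<partial>?M) \<longlongrightarrow> 0) at_top"
        by (rule Lim_transform_eventually)
      then have "(\<integral>\<^sup>+\<mu>. ennreal ((H \<mu> - h \<mu>)\<^sup>2) \<partial>?M) = 0"
        by (simp add: tendsto_const_iff)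
      then have "AE \<mu> in ?M. ennreal ((H \<mu> - h \<mu>)\<^sup>2) = 0"
        by (subst (asm) nn_integral_0_iff_AE) auto
      then have Hh: "AE \<mu> in ?M. (h \<mu>)\<^sup>2 = (H \<mu>)\<^sup>2" by eventually_elim auto
      have "integrable ?M (\<lambda>\<mu>. (h \<mu>)\<^sup>2)" using h by (simp add: has_transform_def)
      then have "integrable ?M (\<lambda>\<mu>. (H \<mu>)\<^sup>2)"
        by (rule integrable_cong_AE_imp) (use Hh in auto)
      moreover have "((\<lambda>a. \<integral>\<^sup>+\<mu>. ennreal ((integral {0..a} (\<lambda>x. ?k x * \<phi> x \<mu>) - H \<mu>)\<^sup>2) \<partial>?M) \<longlongrightarrow> 0) at_top"
      proof (rule tendsto_eventually)
        show "eventually (\<lambda>a. (\<integral>\<^sup>+\<mu>. ennreal ((integral {0..a} (\<lambda>x. ?k x * \<phi> x \<mu>) - H \<mu>)\<^sup>2) \<partial>?M) = 0) at_top"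
          using eventually_ge_at_top[of A] by eventually_elim (simp add: int_eq)
      qed
      ultimately show ?thesis unfolding has_transform_def using Hm by simp
    qed
    note tf = trans[OF fm fC Fm F] and tg = trans[OF gm gC Gm G]
    have "(LINT x|lebesgue_on {0..}. (indicator {0..A} x * f x) * (indicator {0..A} x * g x)) = (LINT \<mu>|?M. F \<mu> * G \<mu>)"
      using spec L2[OF fm fC] L2[OF gm gC] tf tg unfolding spectral_function_def by blast
    moreover have "(LINT x|lebesgue_on {0..}. (indicator {0..A} x * f x) * (indicator {0..A} x * g x)) =
      (\<integral>x. indicator {0..A} x * (f x * g x) \<partial>lborel)"
    proof -
      have "(LINT x|lebesgue_on {0..}. (indicator {0..A} x * f x) * (indicator {0..A} x * g x)) =
        (\<integral>x. indicator {0..} x *\<^sub>R ((indicator {0..A} x * f x) * (indicator {0..A} x * g x)) \<partial>lebesgue)"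
        by (rule integral_restrict_space) simp
      also have "\<dots> = (\<integral>x. indicator {0..A} x * (f x * g x) \<partial>lebesgue)"
        by (intro Bochner_Integration.integral_cong) (auto simp: indicator_def)
      also have "\<dots> = (\<integral>x. indicator {0..A} x * (f x * g x) \<partial>lborel)"
        by (rule integral_completion) measurable
      finally show ?thesis .
    qed
    moreover have "integrable ?M (\<lambda>\<mu>. F \<mu> * G \<mu>)"
    proof (rule Bochner_Integration.integrable_bound)
      show "integrable ?M (\<lambda>\<mu>. (F \<mu>)\<^sup>2 + (G \<mu>)\<^sup>2)" using tf tg by (simp add: has_transform_def)
      show "(\<lambda>\<mu>. F \<mu> * G \<mu>) \<in> borel_measurable ?M" using Fm Gm by simp
      have "\<bar>a * b\<bar> \<le> a\<^sup>2 + b\<^sup>2" for a b :: real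
      proof -
        have "2 * (\<bar>a\<bar> * \<bar>b\<bar>) \<le> a\<^sup>2 + b\<^sup>2" using sum_squares_bound[of "\<bar>a\<bar>" "\<bar>b\<bar>"] by simp
        moreover have "0 \<le> \<bar>a\<bar> * \<bar>b\<bar>" by simp
        ultimately show ?thesis unfolding abs_mult by linarith
      qed
      then show "AE \<mu> in ?M. norm (F \<mu> * G \<mu>) \<le> norm ((F \<mu>)\<^sup>2 + (G \<mu>)\<^sup>2)"
        by (intro AE_I2) auto
    qed
    ultimately show "integrable ?M (\<lambda>\<mu>. F \<mu> * G \<mu>) \<and> (\<integral>\<mu>. F \<mu> * G \<mu> \<partial>?M) = (\<integral>x. indicator {0..A} x * (f x * g x) \<partial>lborel)"
      by simp
  qed
qed

section \<open>The free operator\<close>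

text \<open>The spectral function of the case q = 0, written with \<open>max 0\<close> to be one
  continuous formula on the whole line.\<close>

definition free_spectral_function :: "real \<Rightarrow> real" where
  "free_spectral_function \<mu> = 2 / (3 * pi) * (max 0 \<mu> * sqrt (max 0 \<mu>))"

lemma regularized_spectral_function_eq:
  "regularized_spectral_function \<rho> \<mu> = \<rho> \<mu> - free_spectral_function \<mu>"
proof (cases "0 < \<mu>")
  case True
  have "\<mu> powr (3/2) = \<mu> powr 1 * \<mu> powr (1/2)" using True by (subst powr_add[symmetric]) simp
  also have "\<dots> = \<mu> * sqrt \<mu>" using True by (simp add: powr_half_sqrt)
  finally show ?thesis using True by (simp add: regularized_spectral_function_def free_spectral_function_def)
qed (auto simp: regularized_spectral_function_def free_spectral_function_def max_def)

lemma distribution_function_free: "distribution_function free_spectral_function"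
proof -
  have "mono free_spectral_function"
  proof (rule monoI)
    fix x y :: real assume "x \<le> y"
    then have "max 0 x * sqrt (max 0 x) \<le> max 0 y * sqrt (max 0 y)" by (intro mult_mono) auto
    then show "free_spectral_function x \<le> free_spectral_function y"
      unfolding free_spectral_function_def by (intro mult_left_mono) auto
  qed
  moreover have "continuous_on UNIV free_spectral_function"
    unfolding free_spectral_function_def[abs_def] by (intro continuous_intros)
  then have "continuous (at_right a) free_spectral_function" for a
    by (meson continuous_at_imp_continuous_at_within continuous_on_eq_continuous_at open_UNIV UNIV_I)
  ultimately show ?thesis by (simp add: distribution_function_def)
qed

definition free_density :: "real \<Rightarrow> real" where
  "free_density \<mu> = sqrt (max 0 \<mu>) / pi"

lemma free_density_measurable [measurable]: "free_density \<in> borel_measurable borel"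
  unfolding free_density_def[abs_def] by measurable

lemma free_density_nonneg [simp]: "0 \<le> free_density \<mu>" by (simp add: free_density_def)

lemma has_integral_indicator_mult:
  fixes f :: "'a::euclidean_space \<Rightarrow> real"
  assumes "(f has_integral I) A"
  shows "((\<lambda>x. indicator A x * f x) has_integral I) UNIV"
proof -
  have "(\<lambda>x. indicator A x * f x) = (\<lambda>x. if x \<in> A then f x else 0)" by (auto simp: fun_eq_iff indicator_def)
  then show ?thesis using assms has_integral_restrict_UNIV[of A f I] by simp
qed

text \<open>The fundamental theorem of calculus on each interval, with the point 0 as an exception;
  the half-open intervals then determine the measure.\<close>

lemma interval_measure_free: "interval_measure free_spectral_function = density lborel (\<lambda>\<mu>. ennreal (free_density \<mu>))"
proof -
  let ?F = free_spectral_function and ?N = "density lborel (\<lambda>\<mu>. ennreal (free_density \<mu>))"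
  have mF: "\<And>x y. x \<le> y \<Longrightarrow> ?F x \<le> ?F y" and cF: "\<And>a. continuous (at_right a) ?F"
    using distribution_function_free by (auto simp: distribution_function_def mono_def)
  have c: "continuous_on UNIV ?F"
    unfolding free_spectral_function_def[abs_def] by (intro continuous_intros)
  have eq: "emeasure (interval_measure ?F) {a<..b} = emeasure ?N {a<..b}" for a b
  proof (cases "a \<le> b")
    case True
    have "(free_density has_integral ?F b - ?F a) {a..b}"
    proof (rule fundamental_theorem_of_calculus_interior_strong[of "{0}"])
      fix x assume x: "x \<in> {a<..<b} - {0}"
      show "(?F has_vector_derivative free_density x) (at x)"
        unfolding has_real_derivative_iff_has_vector_derivative[symmetric]
      proof (cases "0 < x")
        case True
        have "((\<lambda>x. 2 / (3 * pi) * (x * sqrt x)) has_real_derivative 2 / (3 * pi) * (1 * sqrt x + inverse (sqrt x) / 2 * x)) (at x)"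
          using True by (intro DERIV_cmult DERIV_mult DERIV_ident DERIV_real_sqrt)
        also have "2 / (3 * pi) * (1 * sqrt x + inverse (sqrt x) / 2 * x) = free_density x"
        proof -
          have "inverse (sqrt x) * x = sqrt x" using True by (simp add: field_simps)
          then have "1 * sqrt x + inverse (sqrt x) / 2 * x = 3 / 2 * sqrt x" by simp
          then show ?thesis using True by (simp add: free_density_def)
        qed
        finally have d: "((\<lambda>x. 2 / (3 * pi) * (x * sqrt x)) has_real_derivative free_density x) (at x)" .
        show "(?F has_real_derivative free_density x) (at x)"
          by (rule has_field_derivative_transform_within_open[OF d, of "{0<..}"])
            (use True in \<open>auto simp: free_spectral_function_def\<close>)
      next
        case False
        then have x0: "x < 0" using x by auto
        have d: "((\<lambda>x. 0) has_real_derivative free_density x) (at x)"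
          using x0 by (simp add: free_density_def)
        show "(?F has_real_derivative free_density x) (at x)"
          by (rule has_field_derivative_transform_within_open[OF d, of "{..<0}"])
            (use x0 in \<open>auto simp: free_spectral_function_def\<close>)
      qed
    qed (use True in \<open>auto intro: continuous_on_subset[OF c]\<close>)
    then have "((\<lambda>x. indicator {a..b} x * free_density x) has_integral ?F b - ?F a) UNIV"
      by (rule has_integral_indicator_mult)
    then have "(\<integral>\<^sup>+x. ennreal (indicator {a..b} x * free_density x) \<partial>lborel) = ennreal (?F b - ?F a)"
      by (intro nn_integral_has_integral_lborel) auto
    moreover have "emeasure ?N {a<..b} = (\<integral>\<^sup>+x. ennreal (indicator {a..b} x * free_density x) \<partial>lborel)"
    proof -
      have "emeasure ?N {a<..b} = (\<integral>\<^sup>+x. ennreal (free_density x) * indicator {a<..b} x \<partial>lborel)"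
        by (rule emeasure_density) auto
      also have "\<dots> = (\<integral>\<^sup>+x. ennreal (indicator {a..b} x * free_density x) \<partial>lborel)"
      proof (rule nn_integral_cong_AE)
        show "AE x in lborel. ennreal (free_density x) * indicator {a<..b} x = ennreal (indicator {a..b} x * free_density x)"
          using AE_lborel_singleton[of a] by eventually_elim (auto simp: indicator_def)
      qed
      finally show ?thesis .
    qed
    ultimately show ?thesis using True by (simp add: emeasure_interval_measure_Ioc_eq[OF mF cF])
  qed simp
  show ?thesis
  proof (rule measure_eqI_generator_eq)
    let ?E = "range (\<lambda>(a, b). {a<..b::real})"
    show "Int_stable ?E" by (auto simp: Int_stable_def)
    show "?E \<subseteq> Pow UNIV" by simp
    show "emeasure (interval_measure ?F) X = emeasure ?N X" if "X \<in> ?E" for X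
      using that eq by auto
    show "sets (interval_measure ?F) = sigma_sets UNIV ?E" "sets ?N = sigma_sets UNIV ?E"
      by (simp_all add: borel_sigma_sets_Ioc image_def split: prod.split)
    show "range (\<lambda>i::nat. {- real i<..real i}) \<subseteq> ?E" by auto
    show "(\<Union>i::nat. {- real i<..real i}) = UNIV"
    proof -
      have "\<exists>i::nat. - real i < x \<and> x \<le> real i" for x :: real
      proof -
        obtain n :: nat where "\<bar>x\<bar> < real n" using reals_Archimedean2 by blast
        then show ?thesis by (intro exI[of _ n]) auto
      qed
      then show ?thesis by auto
    qed
    show "emeasure (interval_measure ?F) {- real i<..real i} \<noteq> \<infinity>" for i :: nat
      by (simp add: emeasure_interval_measure_Ioc_eq[OF mF cF])
  qed
qed

text \<open>The density sqrt(\<mu>)/pi turns S(x/2)^2 into sin(sqrt(\<mu>) x/2)^2 / (pi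
  sqrt(\<mu>)), which is elementary in sqrt(\<mu>). With N = sqrt n the value is the term subtracted
  in \<open>sharp_cutoff_asymptotics\<close>, so the parts of order N cancel in the integral against
  d\<sigma>.\<close>

lemma
  fixes n x :: real
  defines "E \<equiv> \<lambda>\<mu>. (sin_sqrt (x / 2) \<mu>)\<^sup>2"
  assumes x: "0 \<le> x"
  shows integrable_free_energy: "integrable (interval_measure free_spectral_function) (\<lambda>\<mu>. indicator {..n} \<mu> * E \<mu>)"
    and integral_free_energy: "0 \<le> n \<Longrightarrow> (\<integral>\<mu>. indicator {..n} \<mu> * E \<mu> \<partial>interval_measure free_spectral_function) =
      sqrt n / pi * (1 - sinc (sqrt n * x))"
proof -
  have [measurable]: "E \<in> borel_measurable borel" unfolding E_def by measurable
  have E0: "0 \<le> E \<mu>" for \<mu> by (simp add: E_def)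
  let ?H = "\<lambda>\<mu>. sqrt \<mu> / pi * (1 - sinc (sqrt \<mu> * x))"
  have nn: "(\<integral>\<^sup>+\<mu>. ennreal (indicator {0..n} \<mu> * (E \<mu> * free_density \<mu>)) \<partial>lborel) = ennreal (?H n)" if n: "0 \<le> n" for n
  proof -
    have "((\<lambda>\<mu>. E \<mu> * free_density \<mu>) has_integral ?H n - ?H 0) {0..n}"
    proof (rule fundamental_theorem_of_calculus_interior_strong[of "{}"])
      show "continuous_on {0..n} ?H" by (intro continuous_intros) auto
      fix \<mu> assume "\<mu> \<in> {0<..<n} - {}"
      then have \<mu>: "0 < \<mu>" by simp
      show "(?H has_vector_derivative E \<mu> * free_density \<mu>) (at \<mu>)"
        unfolding has_real_derivative_iff_has_vector_derivative[symmetric]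
      \<comment> \<open>The elementary antiderivative divides by x; for x = 0 both sides
        vanish.\<close>
      proof (cases "x = 0")
        case True
        then have "?H = (\<lambda>_. 0)" "E \<mu> = 0" by (auto simp: E_def)
        then show "(?H has_real_derivative E \<mu> * free_density \<mu>) (at \<mu>)" by simp
      next
        case False
        have s: "(sqrt has_real_derivative inverse (sqrt \<mu>) / 2) (at \<mu>)" using \<mu> by (rule DERIV_real_sqrt)
        have "((\<lambda>\<mu>. (sqrt \<mu> - sin (sqrt \<mu> * x) / x) / pi) has_real_derivative
          (inverse (sqrt \<mu>) / 2 - cos (sqrt \<mu> * x) * (inverse (sqrt \<mu>) / 2 * x) / x) / pi) (at \<mu>)"
          by (intro DERIV_cdivide DERIV_diff DERIV_chain2[OF DERIV_sin] DERIV_cmult_right s)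
        also have "(inverse (sqrt \<mu>) / 2 - cos (sqrt \<mu> * x) * (inverse (sqrt \<mu>) / 2 * x) / x) / pi = E \<mu> * free_density \<mu>"
        proof -
          have "cos (sqrt \<mu> * x) = 1 - 2 * (sin (sqrt \<mu> * (x / 2)))\<^sup>2"
            using cos_double_sin[of "sqrt \<mu> * (x / 2)"] by simp
          moreover have "E \<mu> * free_density \<mu> = (sin (sqrt \<mu> * (x / 2)))\<^sup>2 / sqrt \<mu> / pi"
            using \<mu> by (simp add: E_def sin_sqrt_def free_density_def power_divide real_div_sqrt field_simps)
          ultimately show ?thesis using False \<mu> by (simp add: field_simps)
        qed
        finally have d: "((\<lambda>\<mu>. (sqrt \<mu> - sin (sqrt \<mu> * x) / x) / pi) has_real_derivative E \<mu> * free_density \<mu>) (at \<mu>)" .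
        show "(?H has_real_derivative E \<mu> * free_density \<mu>) (at \<mu>)"
          by (rule has_field_derivative_transform_within_open[OF d, of "{0<..}"])
            (use \<mu> False in \<open>auto simp: field_simps\<close>)
      qed
    qed (use n in auto)
    then have "((\<lambda>\<mu>. E \<mu> * free_density \<mu>) has_integral ?H n) {0..n}" by simp
    then have "((\<lambda>\<mu>. indicator {0..n} \<mu> * (E \<mu> * free_density \<mu>)) has_integral ?H n) UNIV"
      by (rule has_integral_indicator_mult)
    then show ?thesis using E0 by (intro nn_integral_has_integral_lborel) auto
  qed
  \<comment> \<open>\<open>max 0 n\<close> also covers negative n, where the remaining interval is a
    single point.\<close>
  have cut: "free_density \<mu> * (indicator {..n} \<mu> * E \<mu>) = indicator {0..max 0 n} \<mu> * (E \<mu> * free_density \<mu>)" if "\<mu> \<noteq> 0" for \<mu>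
    using that by (auto simp: indicator_def free_density_def max_def)
  have Hpos: "0 \<le> ?H (max 0 n)"
  proof -
    have "sinc y \<le> 1" for y
      using abs_sin_x_le_abs_x[of y] sin_x_le_x[of y] sin_x_ge_neg_x[of "- y"] by (auto simp: divide_simps)
    then show ?thesis by (intro mult_nonneg_nonneg divide_nonneg_pos pi_gt_zero) (simp_all only: diff_ge_0_iff_ge real_sqrt_ge_zero max.cobounded1)
  qed
  have nn': "(\<integral>\<^sup>+\<mu>. ennreal (free_density \<mu> * (indicator {..n} \<mu> * E \<mu>)) \<partial>lborel) = ennreal (?H (max 0 n))"
  proof -
    have "(\<integral>\<^sup>+\<mu>. ennreal (free_density \<mu> * (indicator {..n} \<mu> * E \<mu>)) \<partial>lborel) =
      (\<integral>\<^sup>+\<mu>. ennreal (indicator {0..max 0 n} \<mu> * (E \<mu> * free_density \<mu>)) \<partial>lborel)"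
    proof (rule nn_integral_cong_AE)
      show "AE \<mu> in lborel. ennreal (free_density \<mu> * (indicator {..n} \<mu> * E \<mu>)) =
        ennreal (indicator {0..max 0 n} \<mu> * (E \<mu> * free_density \<mu>))"
        using AE_lborel_singleton[of 0] by eventually_elim (simp only: cut not_False_eq_True)
    qed
    then show ?thesis using nn[of "max 0 n"] by simp
  qed
  have hb: "has_bochner_integral lborel (\<lambda>\<mu>. free_density \<mu> * (indicator {..n} \<mu> * E \<mu>)) (?H (max 0 n))"
    using nn' E0 Hpos by (intro has_bochner_integral_nn_integral) auto
  show "integrable (interval_measure free_spectral_function) (\<lambda>\<mu>. indicator {..n} \<mu> * E \<mu>)"
    unfolding interval_measure_free using hb
    by (subst integrable_density) (auto simp: has_bochner_integral_iff)
  assume "0 \<le> n"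
  then show "(\<integral>\<mu>. indicator {..n} \<mu> * E \<mu> \<partial>interval_measure free_spectral_function) = ?H n"
    unfolding interval_measure_free using hb
    by (subst integral_density) (auto simp: has_bochner_integral_iff max_def)
qed

lemma cos_sin_sqrt_squares: "(cos_sqrt b \<mu>)\<^sup>2 + \<mu> * (sin_sqrt b \<mu>)\<^sup>2 = 1"
proof (cases \<mu> "0::real" rule: linorder_cases)
  case less
  then show ?thesis using cosh_square_eq[of "sqrt (- \<mu>) * b"]
    by (simp add: cos_sqrt_def sin_sqrt_def power_divide)
next
  case greater
  then show ?thesis by (simp add: cos_sqrt_def sin_sqrt_def power_divide)
qed (simp add: cos_sqrt_def)

lemma sin_sqrt_mult: "sin_sqrt a \<mu> * sin_sqrt b \<mu> = (sin_sqrt ((a + b) / 2) \<mu>)\<^sup>2 - (sin_sqrt (\<bar>a - b\<bar> / 2) \<mu>)\<^sup>2"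
proof -
  define p r where "p = (a + b) / 2" and "r = (a - b) / 2"
  have ab: "a = p + r" "b = p - r" by (auto simp: p_def r_def field_simps)
  have r: "(sin_sqrt (\<bar>a - b\<bar> / 2) \<mu>)\<^sup>2 = (sin_sqrt r \<mu>)\<^sup>2"
  proof (cases "a < b")
    case True
    then have "\<bar>a - b\<bar> / 2 = - r" by (simp add: r_def field_simps)
    then show ?thesis using sin_sqrt_minus[of r \<mu>] by simp
  qed (simp add: r_def)
  have c: "(cos_sqrt z \<mu>)\<^sup>2 = 1 - \<mu> * (sin_sqrt z \<mu>)\<^sup>2" for z using cos_sin_sqrt_squares[of z \<mu>] by simp
  have "sin_sqrt (p + r) \<mu> * sin_sqrt (p - r) \<mu> = (sin_sqrt p \<mu>)\<^sup>2 * (cos_sqrt r \<mu>)\<^sup>2 - (cos_sqrt p \<mu>)\<^sup>2 * (sin_sqrt r \<mu>)\<^sup>2"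
  proof -
    have "sin_sqrt (p - r) \<mu> = sin_sqrt p \<mu> * cos_sqrt r \<mu> - cos_sqrt p \<mu> * sin_sqrt r \<mu>"
      using sin_sqrt_add[of p "- r" \<mu>] by (simp add: algebra_simps)
    then show ?thesis unfolding sin_sqrt_add[of p r] by (simp only:) (simp add: power2_eq_square algebra_simps)
  qed
  also have "\<dots> = (sin_sqrt p \<mu>)\<^sup>2 - (sin_sqrt r \<mu>)\<^sup>2" unfolding c by (simp add: algebra_simps)
  finally show ?thesis unfolding r p_def[symmetric] using ab by simp
qed

theorem theorem1:
  fixes q \<rho> :: "real \<Rightarrow> real" and \<phi> v :: "real \<Rightarrow> real \<Rightarrow> real" and T :: real
  assumes "L1_loc q"
    and "T > 0"
    and "dirichlet_solution q \<phi>"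
    and "spectral_function \<phi> \<rho>"
    and "goursat_solution q v"
  shows "(\<forall>s\<in>{0..T}. \<forall>t\<in>{0..T}. \<forall>n::real.
            LS_integrable (regularized_spectral_function \<rho>) {..n}
              (\<lambda>\<mu>. sin_sqrt (T - t) \<mu> * sin_sqrt (T - s) \<mu>)) \<and>
         uniform_limit ({0..T} \<times> {0..T})
           (\<lambda>(n::real) (s, t). LS_integral (regularized_spectral_function \<rho>) {..n}
              (\<lambda>\<mu>. sin_sqrt (T - t) \<mu> * sin_sqrt (T - s) \<mu>))
           (\<lambda>(s, t). connecting_kernel q v T s t)
           at_top"
proof -
  obtain q' where q': "q' \<in> borel_measurable borel" "\<And>x. x < 0 \<Longrightarrow> q' x = 0"
    "\<And>t. integrable lborel (\<lambda>x. indicator {0..t} x * q' x)" "AE x in lborel. 0 \<le> x \<longrightarrow> q x = q' x"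
    using L1_loc_borel_version[OF assms(1)] by blast
  let ?u = "quadrant_kernel v" and ?M = "interval_measure \<rho>" and ?N = "interval_measure free_spectral_function"
  have gk: "goursat_kernel q' ?u" by (rule goursat_kernel_quadrant[OF assms(5) q'])
  interpret spectral_data q' ?u "\<lambda>x \<mu>. if 0 \<le> x then \<phi> x \<mu> else - \<phi> (- x) \<mu>" ?M
    by (rule spectral_data_intro[OF gk q'(1,3,4) assms(3,4)])
  have resp: "response_primitive q v z = (1/2) * (\<integral>t. indicator {0..z} t * response t \<partial>lborel)" if "0 \<le> z" for z
    by (rule response_primitive_eq[OF assms(5) q' that])
  have \<rho>: "distribution_function \<rho>" using assms(4) by (simp add: spectral_function_def)
  define \<Lambda> where "\<Lambda> n x = (\<integral>\<mu>. indicator {..n} \<mu> * energy x \<mu> \<partial>?M) - (\<integral>\<mu>. indicator {..n} \<mu> * energy x \<mu> \<partial>?N)" for n x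
  have iM: "integrable ?M (\<lambda>\<mu>. indicator {..n} \<mu> * energy x \<mu>)" if "0 \<le> x" for n x
    by (rule integrable_energy_atMost[OF that])
  have iN: "integrable ?N (\<lambda>\<mu>. indicator {..n} \<mu> * energy x \<mu>)" if "0 \<le> x" for n x
    unfolding energy_def by (rule integrable_free_energy[OF that])
  have LS: "has_LS_integral (regularized_spectral_function \<rho>) {..n} (\<lambda>\<mu>. sin_sqrt (T - t) \<mu> * sin_sqrt (T - s) \<mu>)
      (\<Lambda> n (2 * T - s - t) - \<Lambda> n \<bar>s - t\<bar>)" if st: "s \<in> {0..T}" "t \<in> {0..T}" for s t n
  proof -
    have x: "0 \<le> 2 * T - s - t" "0 \<le> \<bar>s - t\<bar>" using st by auto
    have e: "indicator {..n} \<mu> *\<^sub>R (sin_sqrt (T - t) \<mu> * sin_sqrt (T - s) \<mu>) =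
      indicator {..n} \<mu> * energy (2 * T - s - t) \<mu> - indicator {..n} \<mu> * energy \<bar>s - t\<bar> \<mu>" for \<mu>
    proof -
      have p: "T - t + (T - s) = 2 * T - s - t" "T - t - (T - s) = s - t" by auto
      show ?thesis unfolding sin_sqrt_mult p energy_def by (simp add: right_diff_distrib)
    qed
    have "set_integrable ?M {..n} (\<lambda>\<mu>. sin_sqrt (T - t) \<mu> * sin_sqrt (T - s) \<mu>)"
      "set_integrable ?N {..n} (\<lambda>\<mu>. sin_sqrt (T - t) \<mu> * sin_sqrt (T - s) \<mu>)"
      unfolding set_integrable_def e
      by (intro Bochner_Integration.integrable_diff iM iN x)+
    moreover have "(LINT \<mu>:{..n}|?M. sin_sqrt (T - t) \<mu> * sin_sqrt (T - s) \<mu>) -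
      (LINT \<mu>:{..n}|?N. sin_sqrt (T - t) \<mu> * sin_sqrt (T - s) \<mu>) = \<Lambda> n (2 * T - s - t) - \<Lambda> n \<bar>s - t\<bar>"
      unfolding set_lebesgue_integral_def e \<Lambda>_def
        Bochner_Integration.integral_diff[OF iM[OF x(1)] iM[OF x(2)]]
        Bochner_Integration.integral_diff[OF iN[OF x(1)] iN[OF x(2)]] by simp
    ultimately have "distribution_function \<rho> \<and> distribution_function free_spectral_function \<and>
      (\<forall>x. regularized_spectral_function \<rho> x = \<rho> x - free_spectral_function x) \<and>
      set_integrable ?M {..n} (\<lambda>\<mu>. sin_sqrt (T - t) \<mu> * sin_sqrt (T - s) \<mu>) \<and>
      set_integrable ?N {..n} (\<lambda>\<mu>. sin_sqrt (T - t) \<mu> * sin_sqrt (T - s) \<mu>) \<and>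
      \<Lambda> n (2 * T - s - t) - \<Lambda> n \<bar>s - t\<bar> = (LINT \<mu>:{..n}|?M. sin_sqrt (T - t) \<mu> * sin_sqrt (T - s) \<mu>) -
      (LINT \<mu>:{..n}|?N. sin_sqrt (T - t) \<mu> * sin_sqrt (T - s) \<mu>)"
      by (simp add: \<rho> distribution_function_free regularized_spectral_function_eq)
    then show ?thesis unfolding has_LS_integral_def by (intro exI)
  qed
  have lim: "eventually (\<lambda>n. \<forall>x\<in>{0..2 * T}. \<bar>\<Lambda> n x - response_primitive q v x\<bar> \<le> e) at_top" if e: "0 < e" for e
  proof -
    have "eventually (\<lambda>N. \<forall>x\<in>{0..2 * T}. \<bar>(\<integral>\<mu>. indicator {..N\<^sup>2} \<mu> * energy x \<mu> \<partial>?M) - N / pi * (1 - sinc (N * x))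
      - (1/2) * (\<integral>b. indicator {0..x} b * response b \<partial>lborel)\<bar> \<le> e) at_top"
      by (rule sharp_cutoff_asymptotics) (use assms(2) e in auto)
    then have "eventually (\<lambda>n. \<forall>x\<in>{0..2 * T}. \<bar>(\<integral>\<mu>. indicator {..(sqrt n)\<^sup>2} \<mu> * energy x \<mu> \<partial>?M) - sqrt n / pi * (1 - sinc (sqrt n * x))
      - (1/2) * (\<integral>b. indicator {0..x} b * response b \<partial>lborel)\<bar> \<le> e) at_top"
      by (rule eventually_compose_filterlim[OF _ sqrt_at_top])
    then show ?thesis using eventually_ge_at_top[of 0]
    proof eventually_elim
      case (elim n)
      show ?case
      proof
        fix x assume x: "x \<in> {0..2 * T}"
        have "(\<integral>\<mu>. indicator {..n} \<mu> * energy x \<mu> \<partial>?N) = sqrt n / pi * (1 - sinc (sqrt n * x))"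
          unfolding energy_def by (rule integral_free_energy) (use x elim in auto)
        moreover have "(sqrt n)\<^sup>2 = n" using elim by simp
        ultimately show "\<bar>\<Lambda> n x - response_primitive q v x\<bar> \<le> e"
          using bspec[OF elim(1) x] resp[of x] x unfolding \<Lambda>_def by simp
      qed
    qed
  qed
  have "uniform_limit ({0..T} \<times> {0..T})
           (\<lambda>(n::real) (s, t). LS_integral (regularized_spectral_function \<rho>) {..n}
              (\<lambda>\<mu>. sin_sqrt (T - t) \<mu> * sin_sqrt (T - s) \<mu>))
           (\<lambda>(s, t). connecting_kernel q v T s t) at_top"
  proof (rule uniform_limitI)
    fix e :: real assume e: "0 < e"
    then have "eventually (\<lambda>n. \<forall>x\<in>{0..2 * T}. \<bar>\<Lambda> n x - response_primitive q v x\<bar> \<le> e / 3) at_top"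
      by (intro lim) simp
    then show "\<forall>\<^sub>F n in at_top. \<forall>x\<in>{0..T} \<times> {0..T}.
      dist ((\<lambda>(s, t). LS_integral (regularized_spectral_function \<rho>) {..n} (\<lambda>\<mu>. sin_sqrt (T - t) \<mu> * sin_sqrt (T - s) \<mu>)) x)
        ((\<lambda>(s, t). connecting_kernel q v T s t) x) < e"
    proof eventually_elim
      case (elim n)
      show ?case
      proof
        fix x assume "x \<in> {0..T} \<times> {0..T}"
        then obtain s t where x: "x = (s, t)" and st: "s \<in> {0..T}" "t \<in> {0..T}" by auto
        have "2 * T - s - t \<in> {0..2 * T}" "\<bar>s - t\<bar> \<in> {0..2 * T}" using st by auto
        then have "\<bar>\<Lambda> n (2 * T - s - t) - response_primitive q v (2 * T - s - t)\<bar> \<le> e / 3"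
          "\<bar>\<Lambda> n \<bar>s - t\<bar> - response_primitive q v \<bar>s - t\<bar>\<bar> \<le> e / 3" using elim by auto
        moreover have "response_primitive q v \<bar>s - t\<bar> = response_primitive q v (s - t)"
          by (simp add: response_primitive_def)
        ultimately have "\<bar>(\<Lambda> n (2 * T - s - t) - \<Lambda> n \<bar>s - t\<bar>) -
            (response_primitive q v (2 * T - s - t) - response_primitive q v (s - t))\<bar> < e"
          using e by arith
        then show "dist ((\<lambda>(s, t). LS_integral (regularized_spectral_function \<rho>) {..n} (\<lambda>\<mu>. sin_sqrt (T - t) \<mu> * sin_sqrt (T - s) \<mu>)) x)
          ((\<lambda>(s, t). connecting_kernel q v T s t) x) < e"
          by (simp add: LS_integral_eqI[OF LS[OF st]] x dist_real_def connecting_kernel_def)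
      qed
    qed
  qed
  then show ?thesis using LS unfolding LS_integrable_def by blast
qed

end
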